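(* Let $d\ge5$. Assume that the offspring law $\{p_k\}_{k\ge 0}$ satisfies $p_1<1$, $\sum_{k\ge0}kp_k=1$ and $\sigma^2:=\sum_{k\ge0}(k-1)^2p_k\in(0,\infty)$, and that the jump law $\mu$ on $\mathbb{Z}^d$ (with zero mean, positive definite covariance matrix, and not supported on a strict subgroup of $\mathbb{Z}^d$) is such that there exists a constant $C>0$ with $$\mu(\{x\in\mathbb{Z}^d:\|x\|>r\})<C\, r^{-d}\qquad\text{for all } r\ge1.$$ Let $K\subset\mathbb{Z}^d$ be nonempty and compact (i.e. finite). Then there is a non-degenerate random vector $(Y_{d,K},Z_{d,K})$, whose law depends on $d$ and $K$ (and on the offspring and jump laws), such that under $\mathbf{P}_x(\,\cdot\mid Z_{\mathbb{T}}(K)\ge1)$, as $\|x\|\to\infty$, the following joint convergence in law holds: $$(L_K,Z_{\mathbb{T}}(K))\xrightarrow{(d)}(Y_{d,K},Z_{d,K}).$$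
   Context: Critical branching random walk (CBRW) on $\mathbb{Z}^d$: under $\mathbf{P}_x$, one ancestor $\rho$ is located at $S_\rho=x\in\mathbb{Z}^d$ at time $0$. Each individual $v$ of generation $n$ dies at time $n+1$ and gives birth to a random number of children with law $\{p_k\}$; each child immediately makes a jump from the position of $v$ distributed as $\mu$; all offspring numbers and jumps are independent. The genealogical tree is $\mathbb{T}$, and $S_u\in\mathbb{Z}^d$ is the position of $u\in\mathbb{T}$. Write $v\le u$ if $v$ is an ancestor of $u$ or $v=u$, and $v<u$ if moreover $v\ne u$. Occupation time: $Z_{\mathbb{T}}(B):=\sum_{u\in\mathbb{T}}\mathbf{1}_{\{S_u\in B\}}$ for $B\subset\mathbb{Z}^d$. Pioneers: $\mathcal{L}_K:=\{u\in\mathbb{T}: S_u\in K \text{ and } S_v\notin K \text{ for all } \rho\le v<u\}$, and $L_K:=|\mathcal{L}_K|$. $\|\cdot\|$ is the Euclidean norm. A random vector is called non-degenerate if it is not almost surely constant. *)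

theory Defs
  imports "HOL-Probability.Probability" "HOL-Library.Sublist"
begin

section \<open>Laws on the integer lattice\<close>

definition vec_of_int :: "int ^ 'd::finite \<Rightarrow> real ^ 'd" where
  "vec_of_int x = (\<chi> i. real_of_int (x $ i))"

definition mean_vec :: "(int ^ 'd::finite) pmf \<Rightarrow> real ^ 'd" where
  "mean_vec \<mu> = measure_pmf.expectation \<mu> vec_of_int"

text \<open>The entries are genuine only if the law has finite second moments. The tail bound
  assumed in the theorem guarantees this in dimension at least five.\<close>

definition covariance_matrix :: "(int ^ 'd::finite) pmf \<Rightarrow> real ^ 'd ^ 'd" where
  "covariance_matrix \<mu> = (\<chi> i j. measure_pmf.expectation \<mu>
     (\<lambda>x. (vec_of_int x $ i - mean_vec \<mu> $ i) * (vec_of_int x $ j - mean_vec \<mu> $ j)))"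

definition positive_definite :: "real ^ 'd ^ 'd::finite \<Rightarrow> bool" where
  "positive_definite A \<longleftrightarrow> transpose A = A \<and> (\<forall>v. v \<noteq> 0 \<longrightarrow> v \<bullet> (A *v v) > 0)"

definition add_subgroup :: "'a::ab_group_add set \<Rightarrow> bool" where
  "add_subgroup H \<longleftrightarrow> 0 \<in> H \<and> (\<forall>x\<in>H. \<forall>y\<in>H. x + y \<in> H) \<and> (\<forall>x\<in>H. - x \<in> H)"

section \<open>Branching random walk\<close>

text \<open>Individuals carry Ulam--Harris labels: the root is \<open>[]\<close>, and child number \<open>i\<close> of
  \<open>v\<close> is \<open>v @ [i]\<close>, so that (strict) ancestry is the (strict) prefix order. An outcome
  \<open>\<omega>\<close> attaches to every label \<open>u\<close> the pair consisting of the number of children of \<open>u\<close> and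
  the jump made from the parent of \<open>u\<close> to \<open>u\<close>; the jump attached to the root is never used.
  All these variables are independent. The starting point enters only through the
  positions, hence one probability space serves for all starting points.\<close>

type_synonym 'd outcome = "nat list \<Rightarrow> nat \<times> (int ^ 'd)"

definition brw_space :: "nat pmf \<Rightarrow> (int ^ 'd::finite) pmf \<Rightarrow> 'd outcome measure" where
  "brw_space p \<mu> = PiM UNIV (\<lambda>_. measure_pmf (pair_pmf p \<mu>))"

definition offspring :: "'d::finite outcome \<Rightarrow> nat list \<Rightarrow> nat" where
  "offspring \<omega> u = fst (\<omega> u)"

definition jump :: "'d::finite outcome \<Rightarrow> nat list \<Rightarrow> int ^ 'd" where
  "jump \<omega> u = snd (\<omega> u)"

inductive_set tree :: "'d::finite outcome \<Rightarrow> nat list set" for \<omega> where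
  root: "[] \<in> tree \<omega>"
| child: "v \<in> tree \<omega> \<Longrightarrow> i < offspring \<omega> v \<Longrightarrow> v @ [i] \<in> tree \<omega>"

definition position :: "int ^ 'd::finite \<Rightarrow> 'd outcome \<Rightarrow> nat list \<Rightarrow> int ^ 'd" where
  "position x \<omega> u = x + (\<Sum>v | v \<noteq> [] \<and> prefix v u. jump \<omega> v)"

text \<open>Counts are extended nonnegative reals, since the tree may be infinite on a null set.\<close>

definition occupation_time ::
    "int ^ 'd::finite \<Rightarrow> (int ^ 'd) set \<Rightarrow> 'd outcome \<Rightarrow> ennreal" where
  "occupation_time x B \<omega> =
     (\<integral>\<^sup>+ u. indicator B (position x \<omega> u) \<partial>count_space (tree \<omega>))"

definition pioneers ::
    "int ^ 'd::finite \<Rightarrow> (int ^ 'd) set \<Rightarrow> 'd outcome \<Rightarrow> nat list set" where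
  "pioneers x K \<omega> = {u \<in> tree \<omega>. position x \<omega> u \<in> K \<and>
     (\<forall>v. strict_prefix v u \<longrightarrow> position x \<omega> v \<notin> K)}"

definition num_pioneers ::
    "int ^ 'd::finite \<Rightarrow> (int ^ 'd) set \<Rightarrow> 'd outcome \<Rightarrow> ennreal" where
  "num_pioneers x K \<omega> = emeasure (count_space UNIV) (pioneers x K \<omega>)"

text \<open>The law of the walk started at \<open>x\<close>, conditioned on visiting \<open>K\<close>.\<close>

definition brw_conditioned ::
    "nat pmf \<Rightarrow> (int ^ 'd::finite) pmf \<Rightarrow> int ^ 'd \<Rightarrow> (int ^ 'd) set \<Rightarrow> 'd outcome measure" where
  "brw_conditioned p \<mu> x K = uniform_measure (brw_space p \<mu>)
     {\<omega> \<in> space (brw_space p \<mu>). occupation_time x K \<omega> \<ge> 1}"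

section \<open>Random vectors and convergence in law\<close>

definition nondegenerate :: "'a measure \<Rightarrow> ('a \<Rightarrow> 'b) \<Rightarrow> bool" where
  "nondegenerate M X \<longleftrightarrow> \<not> (\<exists>c. AE \<omega> in M. X \<omega> = c)"

text \<open>Convergence in law, along a filter, of random variables that may live on different
  probability spaces.\<close>

definition converges_in_law ::
    "('i \<Rightarrow> 'a measure) \<Rightarrow> ('i \<Rightarrow> 'a \<Rightarrow> 'c::topological_space) \<Rightarrow> 'i filter \<Rightarrow>
     'b measure \<Rightarrow> ('b \<Rightarrow> 'c) \<Rightarrow> bool" where
  "converges_in_law M X F N Y \<longleftrightarrow>
     (\<forall>f :: 'c \<Rightarrow> real. continuous_on UNIV f \<and> bounded (range f) \<longrightarrow>
        ((\<lambda>i. \<integral>\<omega>. f (X i \<omega>) \<partial>M i) \<longlongrightarrow> (\<integral>\<omega>. f (Y \<omega>) \<partial>N)) F)"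

end

theory Submission
  imports Defs
begin

text \<open>
  Let \<open>F\<close> be a bounded function of the pair (number of pioneers, occupation time) with
  \<open>F 0 = 0\<close>, let \<open>v F x\<close> be its mean for the walk started at \<open>x\<close>, and let \<open>q x\<close> be the
  probability of visiting \<open>K\<close>. It suffices that \<open>v F x / q x\<close> converges as \<open>x\<close> tends to
  infinity, for every such \<open>F\<close>, and that the limits are the means of \<open>F\<close> under a
  non-degenerate law.

  From a point outside \<open>K\<close> both counts are sums over the subtrees of the children of the
  root. The value of \<open>F\<close> at a sum and the sum of the values of \<open>F\<close> differ only if two
  children have descendants in \<open>K\<close>, and the mean number of children is one. So \<open>v F\<close>
  differs from its average \<open>P (v F)\<close> over one jump by at most a multiple of the square of
  \<open>P q\<close> (\<open>v_one_step\<close>). Moreover \<open>q\<close> is at most the mean occupation time, which is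
  at most half the Green function \<open>G\<close> of the lazy walk, summed over \<open>K\<close>
  (\<open>mean_occupation_le\<close>). Hence \<open>v F\<close> is the potential of a charge dominated by squares
  of \<open>G\<close>. In dimension at least five these squares are summable
  (\<open>G_square_summable\<close>). Together with the 3G-inequality (\<open>G_three\<close>) and the fact that a
  translation changes \<open>G\<close> by a factor tending to one (\<open>G_ratio\<close>) this shows that the
  potential is asymptotic to \<open>G (- x)\<close> times the total charge
  (\<open>potential_asymptotics\<close>). The same applies to \<open>q\<close>, which is \<open>v F\<close> for the indicator
  \<open>F\<close> of the nonzero pairs, so that \<open>v F x / q x\<close> converges to a quotient of total charges
  once the charge of \<open>q\<close> is positive (\<open>charge_q_pos\<close>). For this, \<open>q\<close> is compared with
  \<open>v F\<close> for \<open>F = 1 - exp (- s z)\<close>, \<open>z\<close> being the occupation time: its charge is at least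
  a positive multiple of \<open>s\<close> minus an error of order \<open>s\<^sup>2\<close>.

  No mass escapes in the limit, because the mean occupation time given a visit
  stays bounded (\<open>cond_limit_tight\<close>). The limit is not constant, because for every
  \<open>j\<close> the conditional probability of at least \<open>2 ^ j\<close> visits is bounded away from zero
  (\<open>large_ge_q\<close>). Indeed this holds from the finitely many points of \<open>K\<close>, and it extends to
  all starting points by a comparison of the recursions for the two probabilities, which
  rests on the convexity of the offspring generating function.

  The estimates of \<open>G\<close> come from the transition probabilities \<open>h n x\<close> of the lazy walk,
  laziness serving to remove periodicity. Fourier inversion on the torus gives the
  bounds of order \<open>n\<close> to the power \<open>- d / 2\<close>, their analogue for differences, and a
  lower bound at points within distance of order \<open>sqrt n\<close> from the origin. The tail
  assumption on the jumps yields \<open>h n x = O (1 / norm x ^ d)\<close> uniformly in \<open>n\<close>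
  (\<open>heat_kernel_decay\<close>): one half of a path of length \<open>n\<close> to \<open>x\<close> has to make up half of the
  distance, and the cheapest way to do so is by one big jump.
\<close>

section \<open>Convolution powers and one big jump\<close>

primrec conv_pow :: "'a::ab_group_add pmf \<Rightarrow> nat \<Rightarrow> 'a pmf" where
  "conv_pow \<nu> 0 = return_pmf 0"
| "conv_pow \<nu> (Suc n) = bind_pmf \<nu> (\<lambda>z. map_pmf ((+) z) (conv_pow \<nu> n))"

lemma conv_pow_add:
  "conv_pow \<nu> (m + n) = bind_pmf (conv_pow \<nu> m) (\<lambda>z. map_pmf ((+) z) (conv_pow \<nu> n))"
proof (induction m)
  case 0
  have "(+) (0::'a) = id" by auto
  then show ?case by (simp add: bind_return_pmf)
next
  case (Suc m)
  have "(\<lambda>y. z + (x + y)) = (+) (z + x)" for z x :: 'a by (auto simp: add.assoc)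
  then show ?case
    using Suc by (simp add: bind_assoc_pmf map_bind_pmf bind_map_pmf pmf.map_comp comp_def)
qed

lemma pmf_map_plus: "pmf (map_pmf ((+) z) M) (x::'a::ab_group_add) = pmf M (x - z)"
proof -
  have "pmf (map_pmf ((+) z) M) (z + (x - z)) = pmf M (x - z)"
    by (rule pmf_map_inj') (auto simp: inj_def)
  then show ?thesis by simp
qed

lemma pmf_conv_pow_add:
  "ennreal (pmf (conv_pow \<nu> (m + n)) x) =
     (\<integral>\<^sup>+z. ennreal (pmf (conv_pow \<nu> m) z) * ennreal (pmf (conv_pow \<nu> n) (x - z)) \<partial>count_space UNIV)"
  unfolding conv_pow_add ennreal_pmf_bind pmf_map_plus nn_integral_measure_pmf ..

text \<open>As \<open>l\<close> is additive, one of the two parts of a path to \<open>x\<close> contributes at least half of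
  \<open>l x\<close>; the other part is then determined by it and is estimated by the largest atom. A
  pointwise bound is thereby reduced to a tail bound.\<close>

lemma conv_pow_half_split:
  fixes l :: "'a::ab_group_add \<Rightarrow> real"
  assumes l: "\<And>x y. l (x + y) = l x + l y"
    and s: "\<And>y. pmf (conv_pow \<nu> m) y \<le> s" and s': "\<And>y. pmf (conv_pow \<nu> n) y \<le> s'"
  shows "pmf (conv_pow \<nu> (m + n)) x \<le>
    s' * measure_pmf.prob (conv_pow \<nu> m) {z. l z \<ge> l x / 2} +
    s * measure_pmf.prob (conv_pow \<nu> n) {z. l z \<ge> l x / 2}"
proof -
  let ?A = "{z. l z \<ge> l x / 2}"
  have s0: "0 \<le> s" "0 \<le> s'" using order_trans[OF pmf_nonneg s[of 0]] order_trans[OF pmf_nonneg s'[of 0]] by auto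
  have lx: "l x = l z + l (x - z)" for z using l[of z "x - z"] by simp
  have pt: "ennreal (pmf (conv_pow \<nu> m) z) * ennreal (pmf (conv_pow \<nu> n) (x - z)) \<le>
     ennreal s' * (ennreal (pmf (conv_pow \<nu> m) z) * indicator ?A z) +
     ennreal s * (ennreal (pmf (conv_pow \<nu> n) (x - z)) * indicator ?A (x - z))" for z
  proof -
    have "z \<in> ?A \<or> x - z \<in> ?A" using lx[of z] by auto
    then show ?thesis
    proof
      assume a: "z \<in> ?A"
      have "ennreal (pmf (conv_pow \<nu> m) z) * ennreal (pmf (conv_pow \<nu> n) (x - z))
         \<le> ennreal s' * (ennreal (pmf (conv_pow \<nu> m) z))"
        using s'[of "x - z"] by (subst mult.commute) (intro mult_right_mono ennreal_leI, auto)
      then show ?thesis using a by (intro order_trans[OF _ add_increasing2]) auto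
    next
      assume a: "x - z \<in> ?A"
      have "ennreal (pmf (conv_pow \<nu> m) z) * ennreal (pmf (conv_pow \<nu> n) (x - z))
         \<le> ennreal s * (ennreal (pmf (conv_pow \<nu> n) (x - z)))"
        using s[of z] by (intro mult_right_mono ennreal_leI, auto)
      then show ?thesis using a by (intro order_trans[OF _ add_increasing]) auto
    qed
  qed
  have "ennreal (pmf (conv_pow \<nu> (m + n)) x) \<le>
    (\<integral>\<^sup>+z. ennreal s' * (ennreal (pmf (conv_pow \<nu> m) z) * indicator ?A z) +
     ennreal s * (ennreal (pmf (conv_pow \<nu> n) (x - z)) * indicator ?A (x - z)) \<partial>count_space UNIV)"
    unfolding pmf_conv_pow_add by (intro nn_integral_mono pt)
  also have "\<dots> = ennreal s' * (\<integral>\<^sup>+z. ennreal (pmf (conv_pow \<nu> m) z) * indicator ?A z \<partial>count_space UNIV) +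
     ennreal s * (\<integral>\<^sup>+z. ennreal (pmf (conv_pow \<nu> n) (x - z)) * indicator ?A (x - z) \<partial>count_space UNIV)"
    by (simp add: nn_integral_add nn_integral_cmult)
  also have "(\<integral>\<^sup>+z. ennreal (pmf (conv_pow \<nu> n) (x - z)) * indicator ?A (x - z) \<partial>count_space UNIV) =
     (\<integral>\<^sup>+z. ennreal (pmf (conv_pow \<nu> n) z) * indicator ?A z \<partial>count_space UNIV)"
    by (rule nn_integral_bij_count_space[of "\<lambda>z. x - z"])
       (auto intro!: bij_betw_byWitness[where f'="\<lambda>z. x - z"])
  also have "(\<integral>\<^sup>+z. ennreal (pmf (conv_pow \<nu> n) z) * indicator ?A z \<partial>count_space UNIV) =
     emeasure (conv_pow \<nu> n) ?A"
    unfolding nn_integral_measure_pmf[symmetric] by simp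
  also have "(\<integral>\<^sup>+z. ennreal (pmf (conv_pow \<nu> m) z) * indicator ?A z \<partial>count_space UNIV) =
     emeasure (conv_pow \<nu> m) ?A"
    unfolding nn_integral_measure_pmf[symmetric] by simp
  finally show ?thesis
    using s0 by (simp add: measure_pmf.emeasure_eq_measure flip: ennreal_mult ennreal_plus)
qed

text \<open>Either some step exceeds the level \<open>M\<close>, or the exponential Chebyshev inequality applies to
  the truncated steps, whose exponential moment is at most \<open>A\<close>. Conditioning on the first
  step proves this by induction, without a space that carries the independent steps.\<close>

lemma conv_pow_tail:
  fixes l :: "'a::ab_group_add \<Rightarrow> real"
  assumes l: "\<And>x y. l (x + y) = l x + l y" and lam0: "lam \<ge> 0"
    and A: "(\<integral>\<^sup>+z. ennreal (exp (lam * l z)) * indicator {z. l z \<le> M} z \<partial>measure_pmf \<nu>) \<le> ennreal A"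
    and A0: "A \<ge> 0"
  shows "measure_pmf.prob (conv_pow \<nu> m) {z. l z \<ge> \<rho>} \<le>
    real m * measure_pmf.prob \<nu> {z. l z > M} + exp (- lam * \<rho>) * A ^ m"
proof (induction m arbitrary: \<rho>)
  case 0
  have "l 0 = 0" using l[of 0 0] by simp
  then show ?case using lam0
    by (auto simp: measure_return_pmf indicator_def mult_nonneg_nonpos)
next
  case (Suc m)
  let ?p = "measure_pmf.prob \<nu> {z. l z > M}"
  let ?h = "\<lambda>m \<rho>. measure_pmf.prob (conv_pow \<nu> m) {z. l z \<ge> \<rho>}"
  have eq: "emeasure (map_pmf ((+) z) (conv_pow \<nu> m)) {z. l z \<ge> \<rho>} = ennreal (?h m (\<rho> - l z))" for z
    by (simp add: measure_pmf.emeasure_eq_measure vimage_def l algebra_simps)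
  have pt: "ennreal (?h m (\<rho> - l z)) \<le> indicator {z. l z > M} z +
     (ennreal (m * ?p) + ennreal (exp (- lam * \<rho>) * A ^ m) * (ennreal (exp (lam * l z)) * indicator {z. l z \<le> M} z))" for z
  proof (cases "l z > M")
    case True
    have "ennreal (?h m (\<rho> - l z)) \<le> 1" by simp
    then show ?thesis using True by (intro order_trans[OF _ add_increasing2]) auto
  next
    case False
    have "?h m (\<rho> - l z) \<le> m * ?p + exp (- lam * (\<rho> - l z)) * A ^ m" by (rule Suc.IH)
    also have "exp (- lam * (\<rho> - l z)) = exp (- lam * \<rho>) * exp (lam * l z)"
      by (simp add: exp_add[symmetric] algebra_simps)
    finally show ?thesis using False A0
      by (auto simp: mult_ac simp flip: ennreal_mult ennreal_plus intro!: ennreal_leI)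
  qed
  have "ennreal (?h (Suc m) \<rho>) = (\<integral>\<^sup>+z. ennreal (?h m (\<rho> - l z)) \<partial>measure_pmf \<nu>)"
    unfolding measure_pmf.emeasure_eq_measure[symmetric] conv_pow.simps emeasure_bind_pmf eq ..
  also have "\<dots> \<le> (\<integral>\<^sup>+z. indicator {z. l z > M} z +
     (ennreal (m * ?p) + ennreal (exp (- lam * \<rho>) * A ^ m) * (ennreal (exp (lam * l z)) * indicator {z. l z \<le> M} z)) \<partial>measure_pmf \<nu>)"
    by (intro nn_integral_mono pt)
  also have "\<dots> = ennreal ?p + (ennreal (m * ?p) + ennreal (exp (- lam * \<rho>) * A ^ m) *
      (\<integral>\<^sup>+z. ennreal (exp (lam * l z)) * indicator {z. l z \<le> M} z \<partial>measure_pmf \<nu>))"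
    by (simp add: nn_integral_add nn_integral_cmult measure_pmf.emeasure_eq_measure)
  also have "\<dots> \<le> ennreal ?p + (ennreal (m * ?p) + ennreal (exp (- lam * \<rho>) * A ^ m) * ennreal A)"
    by (intro add_left_mono mult_left_mono A) auto
  also have "\<dots> = ennreal (?p + (m * ?p + exp (- lam * \<rho>) * A ^ m * A))"
    using A0 by (simp flip: ennreal_mult ennreal_plus)
  finally show ?case using A0
    by (subst (asm) ennreal_le_iff) (auto simp: algebra_simps)
qed

lemma exp_le_quadratic:
  fixes y b :: real assumes "y \<le> b" "0 \<le> b"
  shows "exp y \<le> 1 + y + y\<^sup>2 / 2 * exp b"
proof -
  obtain t where t: "\<bar>t\<bar> \<le> \<bar>y\<bar>" "exp y = (\<Sum>m<2. y ^ m / fact m) + exp t / fact 2 * y ^ 2"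
    using Maclaurin_exp_le[of y 2] by blast
  have "t \<le> b \<or> y < 0" using t assms by (auto simp: abs_if split: if_splits)
  show ?thesis
  proof (cases "y < 0")
    case True
    have "(\<lambda>t. 1 + t + t\<^sup>2/2 - exp t) 0 \<le> (\<lambda>t. 1 + t + t\<^sup>2/2 - exp t) y"
    proof (rule DERIV_nonpos_imp_nonincreasing[of y 0])
      fix x assume "y \<le> x" "x \<le> 0"
      show "\<exists>d. ((\<lambda>t. 1 + t + t\<^sup>2/2 - exp t) has_real_derivative d) (at x) \<and> d \<le> 0"
        by (rule exI[of _ "1 + x - exp x"]) (auto intro!: derivative_eq_intros)
    qed (use True in auto)
    then have "exp y \<le> 1 + y + y\<^sup>2/2" by simp
    also have "\<dots> \<le> 1 + y + y\<^sup>2 / 2 * exp b"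
      using assms(2) mult_left_mono[of 1 "exp b" "y\<^sup>2/2"] by simp
    finally show ?thesis .
  next
    case False
    then have "exp t \<le> exp b" using t assms by auto
    then have "exp t / 2 * y\<^sup>2 \<le> exp b / 2 * y\<^sup>2" by (intro mult_right_mono) auto
    then show ?thesis using t by (simp add: numeral_2_eq_2 mult_ac)
  qed
qed

text \<open>The linear term of the exponential has mean zero, and truncation makes the quadratic
  remainder a multiple of the second moment.\<close>

lemma truncated_exp_moment:
  fixes l :: "'a::countable \<Rightarrow> real"
  assumes int: "integrable (measure_pmf \<nu>) l" "measure_pmf.expectation \<nu> l = 0"
    "integrable (measure_pmf \<nu>) (\<lambda>z. (l z)\<^sup>2)" "measure_pmf.expectation \<nu> (\<lambda>z. (l z)\<^sup>2) \<le> s"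
    and pos: "lam \<ge> 0" "M \<ge> 0"
  shows "(\<integral>\<^sup>+z. ennreal (exp (lam * l z)) * indicator {z. l z \<le> M} z \<partial>measure_pmf \<nu>)
    \<le> ennreal (exp (s * lam\<^sup>2 / 2 * exp (lam * M)))"
proof -
  let ?e = "exp (lam * M)"
  let ?g = "\<lambda>z. 1 + lam * l z + lam\<^sup>2 / 2 * ?e * (l z)\<^sup>2"
  have g0: "exp (lam * l z) \<le> ?g z" if "l z \<le> M" for z
  proof -
    have "lam * l z \<le> lam * M" using that pos by (intro mult_left_mono)
    from exp_le_quadratic[OF this] pos show ?thesis
      by (simp add: power_mult_distrib mult_ac)
  qed
  have "(\<integral>\<^sup>+z. ennreal (exp (lam * l z)) * indicator {z. l z \<le> M} z \<partial>measure_pmf \<nu>)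
    \<le> (\<integral>\<^sup>+z. ennreal (?g z) \<partial>measure_pmf \<nu>)"
    using g0 by (intro nn_integral_mono) (auto simp: indicator_def intro!: ennreal_leI)
  also have "\<dots> = ennreal (measure_pmf.expectation \<nu> ?g)"
  proof (rule nn_integral_eq_integral)
    show "integrable (measure_pmf \<nu>) ?g"
      using int by (intro Bochner_Integration.integrable_add integrable_mult_right) auto
    have "0 \<le> ?g z" for z
    proof (cases "l z \<le> M")
      case True then show ?thesis using g0[OF True] exp_ge_zero order_trans by blast
    next
      case False then show ?thesis using pos by (intro add_nonneg_nonneg) auto
    qed
    then show "AE z in measure_pmf \<nu>. 0 \<le> ?g z" by simp
  qed
  also have "measure_pmf.expectation \<nu> ?g = 1 + lam\<^sup>2 / 2 * ?e * measure_pmf.expectation \<nu> (\<lambda>z. (l z)\<^sup>2)"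
    using int by simp
  also have "\<dots> \<le> 1 + s * lam\<^sup>2 / 2 * ?e"
    using int(4) mult_left_mono[OF int(4), of "lam\<^sup>2 / 2 * ?e"] by (simp add: mult_ac)
  also have "\<dots> \<le> exp (s * lam\<^sup>2 / 2 * ?e)" by (rule exp_ge_add_one_self)
  finally show ?thesis by (simp add: ennreal_leI)
qed

text \<open>The bound does not depend on \<open>n\<close>. If \<open>l x\<close> is at most \<open>sqrt (n + 1)\<close>, it follows from the
  uniform bound. Otherwise let \<open>y = l x / sqrt (n + 1)\<close> and combine \<open>conv_pow_tail\<close> with
  \<open>truncated_exp_moment\<close> at the level \<open>M = l x / (2 d)\<close> with the tilt \<open>ln y / M\<close>. The Chebyshev term is then a multiple
  of \<open>y\<close> to the power \<open>- d\<close>, because \<open>(ln y)\<^sup>2 \<le> 4 y\<close> keeps the exponential moments bounded;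
  the big jump costs \<open>n C / M ^ d\<close>, which is of no larger order. Splitting the path into
  halves supplies the missing power of \<open>sqrt (n + 1)\<close>.\<close>

lemma conv_pow_pointwise_decay:
  fixes l :: "'a::{ab_group_add,countable} \<Rightarrow> real" and d :: nat
  assumes l: "\<And>x y. l (x + y) = l x + l y"
    and int: "integrable (measure_pmf \<nu>) l" "measure_pmf.expectation \<nu> l = 0"
    "integrable (measure_pmf \<nu>) (\<lambda>z. (l z)\<^sup>2)" "measure_pmf.expectation \<nu> (\<lambda>z. (l z)\<^sup>2) \<le> s"
    and tail: "\<And>M. M \<ge> 1 \<Longrightarrow> measure_pmf.prob \<nu> {z. l z > M} \<le> C / M ^ d"
    and S1: "\<And>n y. pmf (conv_pow \<nu> n) y \<le> C1 / sqrt (real n + 1) ^ d"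
    and d: "d \<ge> 2" and lx: "l x > 0" and C0: "C \<ge> 0" "C1 \<ge> 0"
  shows "pmf (conv_pow \<nu> n) x \<le>
    ((2 * real d) ^ d + C1 + 2 * C1 * sqrt 2 ^ d * (C * (2 * real d) ^ d + exp (8 * s * (real d)\<^sup>2))) / l x ^ d"
proof -
  let ?B1 = "(2 * real d) ^ d"
  let ?B3 = "2 * C1 * sqrt 2 ^ d * (C * (2 * real d) ^ d + exp (8 * s * (real d)\<^sup>2))"
  define r where "r = l x"
  define N where "N = real n + 1"
  have r: "r > 0" and N: "N \<ge> 1" using lx by (auto simp: r_def N_def)
  have B: "?B1 \<ge> 0" "?B3 \<ge> 0" using C0 by auto
  have mono: "a / r ^ d \<le> (?B1 + C1 + ?B3) / r ^ d" if "a \<le> ?B1 + C1 + ?B3" for a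
    using that r by (intro divide_right_mono) auto
  have s0: "s \<ge> 0"
    using int(4) by (rule order_trans[rotated]) (simp add: integral_nonneg_AE)
  \<comment> \<open>If \<open>r < 2 * d\<close>, then \<open>M\<close> would be below one, where
    the tail bound says nothing; the trivial bound by one suffices there.\<close>
  consider "r < 2 * real d" | "N > r\<^sup>2" | "r \<ge> 2 * real d" "N \<le> r\<^sup>2" by linarith
  then show ?thesis
  proof cases
    case 1
    have "pmf (conv_pow \<nu> n) x \<le> 1" by (rule pmf_le_1)
    also have "1 \<le> ?B1 / r ^ d" using 1 r power_mono[of r "2 * real d" d] by (simp add: field_simps)
    also have "\<dots> \<le> (?B1 + C1 + ?B3) / r ^ d" using B C0 by (intro mono) auto
    finally show ?thesis by (simp add: r_def)
  next
    case 2
    have "pmf (conv_pow \<nu> n) x \<le> C1 / sqrt N ^ d" using S1 by (simp add: N_def)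
    also have "r \<le> sqrt N" using 2 r by (simp add: real_le_rsqrt)
    then have "C1 / sqrt N ^ d \<le> C1 / r ^ d"
      using r C0 N by (intro divide_left_mono power_mono mult_pos_pos zero_less_power) auto
    also have "\<dots> \<le> (?B1 + C1 + ?B3) / r ^ d" using B C0 by (intro mono) auto
    finally show ?thesis by (simp add: r_def)
  next
    case 3
    \<comment> \<open>The tilt satisfies \<open>exp (lam * M) = y\<close> and \<open>exp (lam * r /
      2) = y ^ d\<close>.\<close>
    define y where "y = r / sqrt N"
    define M where "M = r / (2 * real d)"
    define lam where "lam = ln y / M"
    have sN: "sqrt N > 0" "sqrt N * sqrt N = N" using N by auto
    have y1: "y \<ge> 1" using 3(2) sN r real_sqrt_le_mono[OF 3(2)] by (simp add: y_def)
    have M1: "M \<ge> 1" using 3(1) d by (simp add: M_def)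
    have lam0: "lam \<ge> 0" using y1 M1 by (simp add: lam_def)
    have lnM: "lam * M = ln y" using M1 by (simp add: lam_def)
    have lnr: "lam * (r / 2) = real d * ln y" using lnM d by (simp add: M_def field_simps)
    define A where "A = exp (s * lam\<^sup>2 / 2 * exp (lam * M))"
    have ln2: "(ln y)\<^sup>2 \<le> 4 * y"
    proof -
      have "ln y = 2 * ln (sqrt y)" using y1 by (simp add: ln_sqrt)
      also have "\<dots> \<le> 2 * sqrt y" using ln_le_minus_one[of "sqrt y"] y1 by simp
      finally have "(ln y)\<^sup>2 \<le> (2 * sqrt y)\<^sup>2" using y1 by (intro power_mono) auto
      then show ?thesis using y1 by (simp add: power_mult_distrib)
    qed
    have Am: "A ^ m \<le> exp (8 * s * (real d)\<^sup>2)" if m: "real m \<le> N" for m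
    proof -
      have "real m * (s * lam\<^sup>2 / 2 * exp (lam * M)) \<le> N * (s * lam\<^sup>2 / 2 * exp (lam * M))"
        using m s0 by (intro mult_right_mono) auto
      also have "\<dots> = 2 * s * (real d)\<^sup>2 * ((ln y)\<^sup>2 / y)"
      proof -
        have "N * y * y = r\<^sup>2" using sN N by (simp add: y_def power2_eq_square field_simps)
        moreover have "lam\<^sup>2 * r\<^sup>2 = 4 * (real d)\<^sup>2 * (ln y)\<^sup>2"
        proof -
          have "lam * r = 2 * real d * ln y" using lnr by simp
          then have "(lam * r)\<^sup>2 = (2 * real d * ln y)\<^sup>2" by simp
          then show ?thesis by (simp add: power_mult_distrib)
        qed
        ultimately have e: "lam\<^sup>2 * (N * y * y) = 4 * (real d)\<^sup>2 * (ln y)\<^sup>2" by simp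
        have "N * (s * lam\<^sup>2 / 2 * exp (lam * M)) = s / 2 * (lam\<^sup>2 * (N * y * y)) / y"
          using y1 by (simp add: lnM)
        then show ?thesis unfolding e by simp
      qed
      also have "\<dots> \<le> 2 * s * (real d)\<^sup>2 * 4"
        using ln2 y1 s0 by (intro mult_left_mono) (auto simp: field_simps)
      finally show ?thesis by (simp add: A_def exp_of_nat_mult[symmetric])
    qed
    have tl: "measure_pmf.prob (conv_pow \<nu> m) {z. l z \<ge> l x / 2} \<le>
       (C * (2 * real d) ^ d + exp (8 * s * (real d)\<^sup>2)) * sqrt N ^ d / r ^ d" if m: "real m \<le> N" for m
    proof -
      have "measure_pmf.prob (conv_pow \<nu> m) {z. l z \<ge> l x / 2} \<le>
         real m * measure_pmf.prob \<nu> {z. l z > M} + exp (- lam * (l x / 2)) * A ^ m"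
        unfolding A_def using lam0 M1 int
        by (intro conv_pow_tail[OF l] truncated_exp_moment) auto
      also have "\<dots> \<le> N * (C / M ^ d) + exp (- lam * (l x / 2)) * exp (8 * s * (real d)\<^sup>2)"
        using m tail[OF M1] Am[OF m] N by (intro add_mono mult_mono) (auto simp: A_def)
      also have "exp (- lam * (l x / 2)) = sqrt N ^ d / r ^ d"
      proof -
        have "exp (- lam * (l x / 2)) = inverse (exp (real d * ln y))"
          using lnr by (simp add: r_def exp_minus)
        also have "exp (real d * ln y) = y ^ d" using y1 by (simp add: exp_of_nat_mult)
        finally show ?thesis by (simp add: y_def power_divide)
      qed
      also have "C / M ^ d = C * (2 * real d) ^ d / r ^ d" by (simp add: M_def power_divide)
      also have "N * (C * (2 * real d) ^ d / r ^ d) \<le> sqrt N ^ d * (C * (2 * real d) ^ d / r ^ d)"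
      proof (rule mult_right_mono)
        have "N = sqrt N ^ 2" using N by simp
        also have "\<dots> \<le> sqrt N ^ d" using d N by (intro power_increasing) auto
        finally show "N \<le> sqrt N ^ d" .
      qed (use C0 r in auto)
      finally show ?thesis by (simp add: field_simps add_divide_distrib)
    qed
    have sm: "pmf (conv_pow \<nu> m) z \<le> C1 * sqrt 2 ^ d / sqrt N ^ d" if m: "N \<le> 2 * (real m + 1)" for m z
    proof -
      have "sqrt N \<le> sqrt 2 * sqrt (real m + 1)"
        using m by (metis real_sqrt_le_mono real_sqrt_mult)
      then have "sqrt N ^ d \<le> (sqrt 2 * sqrt (real m + 1)) ^ d" using N by (intro power_mono) auto
      then have "C1 / sqrt (real m + 1) ^ d \<le> C1 * sqrt 2 ^ d / sqrt N ^ d"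
        using N C0 mult_left_mono[OF _ C0(2), of "sqrt N ^ d" "(sqrt 2 * sqrt (real m + 1)) ^ d"]
        by (simp add: field_simps)
      then show ?thesis using S1[of m z] by simp
    qed
    \<comment> \<open>Both halves of \<open>n\<close> are comparable to \<open>N = n + 1\<close>,
      also for \<open>n = 0\<close>.\<close>
    define m where "m = n div 2"
    have nm: "n = m + (n - m)" "N \<le> 2 * (real m + 1)" "N \<le> 2 * (real (n - m) + 1)"
      "real m \<le> N" "real (n - m) \<le> N"
      by (auto simp: m_def N_def)
    let ?S = "C1 * sqrt 2 ^ d / sqrt N ^ d"
    let ?T = "(C * (2 * real d) ^ d + exp (8 * s * (real d)\<^sup>2)) * sqrt N ^ d / r ^ d"
    have S0: "?S \<ge> 0" using C0 N by auto
    have "pmf (conv_pow \<nu> n) x = pmf (conv_pow \<nu> (m + (n - m))) x" using nm(1) by simp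
    also have "\<dots> \<le> ?S * measure_pmf.prob (conv_pow \<nu> m) {z. l z \<ge> l x / 2} +
       ?S * measure_pmf.prob (conv_pow \<nu> (n - m)) {z. l z \<ge> l x / 2}"
      using nm by (intro conv_pow_half_split l sm) auto
    also have "\<dots> \<le> ?S * ?T + ?S * ?T"
      using S0 nm by (intro add_mono mult_left_mono tl) auto
    also have "?S * ?T + ?S * ?T = ?B3 / r ^ d" using sN by simp
    also have "\<dots> \<le> (?B1 + C1 + ?B3) / r ^ d" using B C0 by (intro mono) auto
    finally show ?thesis by (simp add: r_def)
  qed
qed

section \<open>Fourier inversion on the lattice\<close>

text \<open>Normalised to mass one, so that finite products are probability measures.\<close>

definition circle :: "real measure" where
  "circle = density lborel (\<lambda>t. ennreal (indicator {-pi..pi} t / (2 * pi)))"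

text \<open>Points are functions, since product measures live on function spaces; \<open>vec_lambda\<close> turns
  them into vectors.\<close>

definition torus :: "('d::finite \<Rightarrow> real) measure" where
  "torus = PiM UNIV (\<lambda>_. circle)"

lemma sets_circle [measurable_cong]: "sets circle = sets borel"
  by (simp add: circle_def)

lemma space_circle [simp]: "space circle = UNIV"
  by (simp add: circle_def)

lemma integral_circle:
  fixes f :: "real \<Rightarrow> 'b::{banach, second_countable_topology}"
  assumes "f \<in> borel_measurable borel"
  shows "integral\<^sup>L circle f = (\<integral>t. (indicator {-pi..pi} t / (2 * pi)) *\<^sub>R f t \<partial>lborel)"
  unfolding circle_def using assms by (subst integral_density) auto

lemma prob_space_circle: "prob_space circle"
proof
  have "emeasure circle (space circle) =
    (\<integral>\<^sup>+t. ennreal (1 / (2 * pi)) * indicator {-pi..pi} t \<partial>lborel)"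
    unfolding circle_def by (subst emeasure_density)
       (auto intro!: nn_integral_cong simp: indicator_def)
  also have "\<dots> = ennreal (1 / (2 * pi)) * ennreal (2 * pi)"
    by (subst nn_integral_cmult_indicator) auto
  also have "\<dots> = 1" by (simp flip: ennreal_mult)
  finally show "emeasure circle (space circle) = 1" .
qed

lemma AE_circle: "AE t in circle. t \<in> {-pi..pi}"
  unfolding circle_def by (subst AE_density) (auto simp: indicator_def)

lemma prob_space_torus: "prob_space torus"
  unfolding torus_def by (intro prob_space_PiM prob_space_circle)

lemma AE_torus: "AE \<theta> in torus. \<forall>i. \<theta> i \<in> {-pi..pi}"
proof -
  have "AE \<theta> in torus. \<forall>i\<in>UNIV. \<theta> i \<in> {-pi..pi}"
    unfolding torus_def
    by (intro AE_finite_allI AE_PiM_component prob_space_circle AE_circle) auto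
  then show ?thesis by simp
qed

lemma integral_torus_prod:
  fixes f :: "'d::finite \<Rightarrow> real \<Rightarrow> 'b::{real_normed_field,banach,second_countable_topology}"
  assumes "\<And>i. integrable circle (f i)"
  shows "(\<integral>\<theta>. (\<Prod>i\<in>UNIV. f i (\<theta> i)) \<partial>torus) = (\<Prod>i\<in>UNIV. integral\<^sup>L circle (f i))"
proof -
  interpret prob_space circle by (rule prob_space_circle)
  interpret product_sigma_finite "\<lambda>_::'d. circle" by unfold_locales
  show ?thesis unfolding torus_def by (rule product_integral_prod) (use assms in auto)
qed

lemma integrable_circle_bounded:
  fixes f :: "real \<Rightarrow> 'b::{banach, second_countable_topology}"
  assumes "f \<in> borel_measurable borel" "\<And>t. norm (f t) \<le> B"
  shows "integrable circle f"
proof -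
  interpret prob_space circle by (rule prob_space_circle)
  show ?thesis using assms by (intro integrable_const_bound[of _ B]) auto
qed

lemma integrable_torus_bounded:
  fixes f :: "('d::finite \<Rightarrow> real) \<Rightarrow> 'b::{banach, second_countable_topology}"
  assumes "f \<in> borel_measurable torus" "\<And>t. norm (f t) \<le> B"
  shows "integrable torus f"
proof -
  interpret prob_space torus by (rule prob_space_torus)
  show ?thesis using assms by (intro integrable_const_bound[of _ B]) auto
qed

lemma circle_orthogonality:
  fixes k :: int
  shows "(\<integral>t. iexp (t * k) \<partial>circle) = (if k = 0 then 1 else 0)"
proof (cases "k = 0")
  case True
  interpret prob_space circle by (rule prob_space_circle)
  show ?thesis using True by (simp add: prob_space[simplified])
next
  case False
  let ?F = "\<lambda>t::real. iexp (t * k) / (\<i> * k)"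
  have "(\<integral>t. indicator {-pi..pi} t *\<^sub>R iexp (t * k) \<partial>lborel) = ?F pi - ?F (- pi)"
  proof (rule integral_FTC_atLeastAtMost)
    fix x :: real
    show "(?F has_vector_derivative iexp (x * k)) (at x within {-pi..pi})"
      using False
      by (auto intro!: derivative_eq_intros has_vector_derivative_real_field simp: field_simps)
  qed (auto intro!: continuous_intros)
  also have "\<dots> = 0"
  proof -
    have "iexp (pi * k) = iexp (- pi * k)"
      by (auto simp: complex_eq_iff Re_exp Im_exp sin_int_times_real)
    then show ?thesis by (simp add: diff_divide_distrib[symmetric])
  qed
  finally have 0: "(\<integral>t. indicator {-pi..pi} t *\<^sub>R iexp (t * k) \<partial>lborel) = 0" .
  have "(\<integral>t. iexp (t * k) \<partial>circle) =
    (\<integral>t. (1 / (2 * pi)) *\<^sub>R (indicator {-pi..pi} t *\<^sub>R iexp (t * k)) \<partial>lborel)"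
    by (subst integral_circle) (auto intro!: Bochner_Integration.integral_cong)
  also have "\<dots> = (1 / (2 * pi)) *\<^sub>R 0" unfolding integral_scaleR_right 0 ..
  finally show ?thesis using False by simp
qed

subsection \<open>Characteristic functions\<close>

definition char_pmf :: "(int ^ 'd::finite) pmf \<Rightarrow> real ^ 'd \<Rightarrow> complex" where
  "char_pmf \<nu> t = (\<integral>z. iexp (t \<bullet> vec_of_int z) \<partial>measure_pmf \<nu>)"

lemma vec_of_int_add: "vec_of_int (x + y) = vec_of_int x + vec_of_int y"
  by (simp add: vec_of_int_def vec_eq_iff)

lemma vec_of_int_diff: "vec_of_int (x - y) = vec_of_int x - vec_of_int y"
  by (simp add: vec_of_int_def vec_eq_iff)

lemma vec_of_int_minus: "vec_of_int (- y) = - vec_of_int y"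
  by (simp add: vec_of_int_def vec_eq_iff)

lemma vec_of_int_0 [simp]: "vec_of_int 0 = 0"
  by (simp add: vec_of_int_def vec_eq_iff)

lemma vec_of_int_nth [simp]: "vec_of_int x $ i = real_of_int (x $ i)"
  by (simp add: vec_of_int_def)

lemma integrable_iexp_pmf [simp]: "integrable (measure_pmf \<nu>) (\<lambda>z. iexp (f z))"
  by (rule measure_pmf.integrable_const_bound[of _ 1]) auto

lemma norm_char_pmf_le: "cmod (char_pmf \<nu> t) \<le> 1"
proof -
  have "cmod (char_pmf \<nu> t) \<le> (\<integral>z. cmod (iexp (t \<bullet> vec_of_int z)) \<partial>measure_pmf \<nu>)"
    unfolding char_pmf_def by (rule integral_norm_bound)
  then show ?thesis by simp
qed

lemma integral_bind_pmf_bounded: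
  fixes f :: "'b \<Rightarrow> real"
  assumes "\<And>x. \<bar>f x\<bar> \<le> B"
  shows "measure_pmf.expectation (bind_pmf M N) f =
    (\<integral>x. measure_pmf.expectation (N x) f \<partial>measure_pmf M)"
  unfolding measure_pmf_bind
  by (rule integral_bind[where K="count_space UNIV" and B=B and B'=1])
     (use assms in \<open>auto simp: measure_pmf_in_subprob_algebra measure_pmf.emeasure_space_1
        intro!: measure_pmf.finite_measure\<close>)

lemma integral_bind_pmf_complex:
  fixes f :: "'b \<Rightarrow> complex"
  assumes B: "\<And>x. cmod (f x) \<le> B"
  shows "measure_pmf.expectation (bind_pmf M N) f =
    (\<integral>x. measure_pmf.expectation (N x) f \<partial>measure_pmf M)"
proof -
  have i1: "integrable (measure_pmf Q) f" for Q
    using B by (intro measure_pmf.integrable_const_bound[of _ B]) auto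
  have i2: "integrable (measure_pmf M) (\<lambda>x. measure_pmf.expectation (N x) f)"
  proof (intro measure_pmf.integrable_const_bound[of _ B])
    show "AE x in measure_pmf M. cmod (measure_pmf.expectation (N x) f) \<le> B"
    proof (rule AE_I2)
      fix x
      have "cmod (measure_pmf.expectation (N x) f) \<le> (\<integral>y. cmod (f y) \<partial>measure_pmf (N x))"
        by (rule integral_norm_bound)
      also have "\<dots> \<le> B" using B i1 by (intro measure_pmf.integral_le_const integrable_norm) auto
      finally show "cmod (measure_pmf.expectation (N x) f) \<le> B" .
    qed
  qed auto
  have R: "\<bar>Re (f x)\<bar> \<le> B" "\<bar>Im (f x)\<bar> \<le> B" for x
    using B[of x] abs_Re_le_cmod[of "f x"] abs_Im_le_cmod[of "f x"] by linarith+
  show ?thesis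
    using i1 i2
    by (auto simp: complex_eq_iff simp flip: integral_Re integral_Im
        intro!: integral_bind_pmf_bounded[of _ B] R)
qed

lemma char_pmf_conv_pow: "char_pmf (conv_pow \<nu> n) t = char_pmf \<nu> t ^ n"
proof (induction n)
  case 0
  then show ?case by (simp add: char_pmf_def)
next
  case (Suc n)
  have "char_pmf (conv_pow \<nu> (Suc n)) t =
    (\<integral>z. (\<integral>y. iexp (t \<bullet> vec_of_int (z + y)) \<partial>measure_pmf (conv_pow \<nu> n)) \<partial>measure_pmf \<nu>)"
    unfolding char_pmf_def conv_pow.simps
    by (subst integral_bind_pmf_complex[of _ 1]) auto
  also have "\<dots> = (\<integral>z. iexp (t \<bullet> vec_of_int z) * char_pmf (conv_pow \<nu> n) t \<partial>measure_pmf \<nu>)"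
    unfolding char_pmf_def
    by (simp add: vec_of_int_add inner_add_right distrib_left exp_add)
  also have "\<dots> = char_pmf \<nu> t * char_pmf (conv_pow \<nu> n) t"
    by (simp add: char_pmf_def)
  finally show ?case using Suc by simp
qed

lemma inner_vec_lambda: "vec_lambda \<theta> \<bullet> vec_of_int z = (\<Sum>i\<in>UNIV. \<theta> i * real_of_int (z $ i))"
  by (simp add: inner_vec_def)

lemma torus_component_measurable [measurable]: "(\<lambda>\<theta>. \<theta> i) \<in> torus \<rightarrow>\<^sub>M borel"
proof -
  have "(\<lambda>\<theta>. \<theta> i) \<in> torus \<rightarrow>\<^sub>M circle"
    unfolding torus_def by (rule measurable_component_singleton) auto
  then show ?thesis by (simp add: measurable_def circle_def)
qed

lemma torus_orthogonality:
  fixes x :: "int ^ 'd::finite"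
  shows "(\<integral>\<theta>. iexp (vec_lambda \<theta> \<bullet> vec_of_int x) \<partial>torus) = (if x = 0 then 1 else 0)"
proof -
  have "(\<integral>\<theta>. iexp (vec_lambda \<theta> \<bullet> vec_of_int x) \<partial>torus) =
    (\<integral>\<theta>. (\<Prod>i\<in>UNIV. iexp (\<theta> i * real_of_int (x $ i))) \<partial>torus)"
    by (simp add: inner_vec_lambda exp_sum sum_distrib_left)
  also have "\<dots> = (\<Prod>i\<in>UNIV. \<integral>t. iexp (t * real_of_int (x $ i)) \<partial>circle)"
    by (rule integral_torus_prod) (auto intro!: integrable_circle_bounded[of _ 1])
  also have "\<dots> = (\<Prod>i\<in>UNIV. if x $ i = 0 then 1 else 0)"
    by (simp only: circle_orthogonality)
  also have "\<dots> = (if x = 0 then 1 else 0)"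
    by (auto simp: vec_eq_iff)
  finally show ?thesis .
qed

lemma iexp_pair_measurable:
  "(\<lambda>(\<theta>, z). iexp (vec_lambda \<theta> \<bullet> vec_of_int (z - x))) \<in> borel_measurable (torus \<Otimes>\<^sub>M measure_pmf \<nu>)"
proof -
  have [measurable]: "(\<lambda>p. real_of_int ((snd p - x) $ i)) \<in> borel_measurable (torus \<Otimes>\<^sub>M measure_pmf \<nu>)" for i
    by (rule measurable_compose[OF measurable_snd]) auto
  have "(\<lambda>p. \<Sum>i\<in>UNIV. fst p i * real_of_int ((snd p - x) $ i)) \<in> borel_measurable (torus \<Otimes>\<^sub>M measure_pmf \<nu>)"
    by measurable
  then have "(\<lambda>p. iexp (\<Sum>i\<in>UNIV. fst p i * real_of_int ((snd p - x) $ i))) \<in> borel_measurable (torus \<Otimes>\<^sub>M measure_pmf \<nu>)"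
    by (intro measurable_compose[where f="\<lambda>p. \<Sum>i\<in>UNIV. fst p i * real_of_int ((snd p - x) $ i)" and g=iexp]) auto
  then show ?thesis by (simp only: inner_vec_lambda case_prod_beta')
qed

lemma char_pmf_measurable [measurable]:
  "(\<lambda>\<theta>. char_pmf \<nu> (vec_lambda \<theta>)) \<in> borel_measurable torus"
  unfolding char_pmf_def
  by (rule measure_pmf.borel_measurable_lebesgue_integral) (use iexp_pair_measurable[of 0 \<nu>] in simp)

lemma iexp_inner_measurable [measurable]:
  "(\<lambda>\<theta>. iexp (vec_lambda \<theta> \<bullet> vec_of_int x)) \<in> borel_measurable torus"
  using char_pmf_measurable[of "return_pmf x"] by (simp add: char_pmf_def)

lemma iexp_neg_inner_measurable [measurable]:
  "(\<lambda>\<theta>. iexp (- (vec_lambda \<theta> \<bullet> vec_of_int x))) \<in> borel_measurable torus"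
  using iexp_inner_measurable[of "- x"] by (simp add: vec_of_int_minus)

text \<open>Exchanging the integral over the torus with the one that defines the characteristic
  function leaves the orthogonality relations.\<close>

lemma fourier_inversion:
  fixes \<nu> :: "(int ^ 'd::finite) pmf"
  shows "complex_of_real (pmf \<nu> x) =
    (\<integral>\<theta>. char_pmf \<nu> (vec_lambda \<theta>) * iexp (- (vec_lambda \<theta> \<bullet> vec_of_int x)) \<partial>torus)"
proof -
  interpret T: prob_space "torus :: ('d \<Rightarrow> real) measure" by (rule prob_space_torus)
  interpret pair_prob_space "torus :: ('d \<Rightarrow> real) measure" "measure_pmf \<nu>"
    by unfold_locales
  let ?f = "\<lambda>\<theta> z. iexp (vec_lambda \<theta> \<bullet> vec_of_int (z - x))"
  have "(\<integral>\<theta>. char_pmf \<nu> (vec_lambda \<theta>) * iexp (- (vec_lambda \<theta> \<bullet> vec_of_int x)) \<partial>torus) =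
    (\<integral>\<theta>. (\<integral>z. ?f \<theta> z \<partial>measure_pmf \<nu>) \<partial>torus)"
  proof (rule Bochner_Integration.integral_cong[OF refl])
    fix \<theta> :: "'d \<Rightarrow> real"
    have "?f \<theta> z = iexp (vec_lambda \<theta> \<bullet> vec_of_int z) * iexp (- (vec_lambda \<theta> \<bullet> vec_of_int x))" for z
      by (simp add: vec_of_int_diff inner_diff_right exp_add[symmetric] algebra_simps)
    then show "char_pmf \<nu> (vec_lambda \<theta>) * iexp (- (vec_lambda \<theta> \<bullet> vec_of_int x)) =
      (\<integral>z. ?f \<theta> z \<partial>measure_pmf \<nu>)"
      by (simp add: char_pmf_def)
  qed
  also have "\<dots> = (\<integral>z. (\<integral>\<theta>. ?f \<theta> z \<partial>torus) \<partial>measure_pmf \<nu>)"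
  proof (rule Fubini_integral[symmetric])
    show "integrable (torus \<Otimes>\<^sub>M measure_pmf \<nu>) (\<lambda>(\<theta>, z). ?f \<theta> z)"
      using iexp_pair_measurable[of x \<nu>]
      by (intro P.integrable_const_bound[of _ 1]) auto
  qed
  also have "\<dots> = (\<integral>z. complex_of_real (indicator {x} z) \<partial>measure_pmf \<nu>)"
    by (intro Bochner_Integration.integral_cong) (auto simp: torus_orthogonality)
  also have "\<dots> = complex_of_real (pmf \<nu> x)"
    by (simp add: measure_pmf_single)
  finally show ?thesis ..
qed

subsection \<open>Gaussian integrals\<close>

text \<open>The integral over the whole line is an upper bound.\<close>

lemma circle_gaussian_upper:
  assumes a: "a > 0"
  shows "(\<integral>t. exp (- a * t\<^sup>2) \<partial>circle) \<le> 1 / sqrt a"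
proof -
  define s where "s = 1 / sqrt (2 * a)"
  have s: "s > 0" "2 * s\<^sup>2 = 1 / a" using a by (auto simp: s_def power_divide)
  have e: "exp (- a * t\<^sup>2) = sqrt (pi / a) * normal_density 0 s t" for t
  proof -
    have "2 * pi * s\<^sup>2 = pi / a" using s(2) by (simp add: field_simps)
    moreover have "t\<^sup>2 / (2 * s\<^sup>2) = a * t\<^sup>2" using s(2) by simp
    ultimately show ?thesis using a by (simp add: normal_density_def)
  qed
  have int: "integrable lborel (\<lambda>t. exp (- a * t\<^sup>2))"
    unfolding e using s by (intro integrable_mult_right integrable_normal_density) 
  have "(\<integral>t. exp (- a * t\<^sup>2) \<partial>circle) =
    (\<integral>t. (indicator {-pi..pi} t / (2 * pi)) * exp (- a * t\<^sup>2) \<partial>lborel)"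
    by (subst integral_circle) auto
  also have "\<dots> \<le> (\<integral>t. (1 / (2 * pi)) * exp (- a * t\<^sup>2) \<partial>lborel)"
  proof (rule integral_mono)
    show "integrable lborel (\<lambda>t. (1 / (2 * pi)) * exp (- a * t\<^sup>2))"
      using int by (rule integrable_mult_right)
    show "integrable lborel (\<lambda>t. (indicator {-pi..pi} t / (2 * pi)) * exp (- a * t\<^sup>2))"
      by (rule Bochner_Integration.integrable_bound[OF \<open>integrable lborel (\<lambda>t. (1 / (2 * pi)) * exp (- a * t\<^sup>2))\<close>])
         (auto simp: indicator_def)
  qed (auto simp: indicator_def)
  also have "\<dots> = (1 / (2 * pi)) * sqrt (pi / a)"
    unfolding e using s by (simp add: integral_normal_density)
  also have "\<dots> \<le> 1 / sqrt a"
  proof -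
    have "sqrt pi \<le> 2 * pi"
      using pi_ge_two by (intro real_le_lsqrt) (auto simp: power2_eq_square)
    then show ?thesis using a by (simp add: real_sqrt_divide field_simps)
  qed
  finally show ?thesis .
qed

text \<open>The integrand is at least \<open>exp (- 1)\<close> on the interval of radius \<open>1 / sqrt a\<close>.\<close>

lemma circle_gaussian_lower:
  assumes a: "a \<ge> 1"
  shows "exp (-1) / (pi * sqrt a) \<le> (\<integral>t. exp (- a * t\<^sup>2) \<partial>circle)"
proof -
  let ?r = "1 / sqrt a"
  have "?r \<le> 1" using a by simp
  then have r: "0 < ?r" "?r \<le> pi" using a pi_ge_two by (simp, linarith)
  have "exp (-1) / (pi * sqrt a) = (\<integral>t. indicator {- ?r .. ?r} t * (exp (-1) / (2 * pi)) \<partial>lborel)"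
    using r by simp
  also have "\<dots> \<le> (\<integral>t. (indicator {-pi..pi} t / (2 * pi)) * exp (- a * t\<^sup>2) \<partial>lborel)"
  proof (rule integral_mono)
    show "integrable lborel (\<lambda>t. indicator {- ?r .. ?r} t * (exp (-1) / (2 * pi)))"
      by (intro integrable_mult_left integrable_real_indicator) (auto simp: emeasure_lborel_Icc_eq)
    show "integrable lborel (\<lambda>t. (indicator {-pi..pi} t / (2 * pi)) * exp (- a * t\<^sup>2))"
    proof (rule Bochner_Integration.integrable_bound[of _ "\<lambda>t. indicator {-pi..pi} t / (2 * pi)"])
      show "integrable lborel (\<lambda>t. indicator {-pi..pi} t / (2 * pi) :: real)"
        by (intro integrable_divide integrable_real_indicator) (auto simp: emeasure_lborel_Icc_eq)
      have "exp (- a * t\<^sup>2) \<le> 1" for t using a by (simp only: exp_le_one_iff) auto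
      then show "AE t in lborel. norm ((indicator {-pi..pi} t / (2 * pi)) * exp (- a * t\<^sup>2))
        \<le> norm (indicator {-pi..pi} t / (2 * pi) :: real)"
        by (intro AE_I2) (auto simp: indicator_def intro!: divide_right_mono)
    qed simp
    fix t :: real
    show "indicator {- ?r .. ?r} t * (exp (-1) / (2 * pi)) \<le> (indicator {-pi..pi} t / (2 * pi)) * exp (- a * t\<^sup>2)"
    proof (cases "t \<in> {- ?r .. ?r}")
      case True
      then have "\<bar>t\<bar> \<le> ?r" by auto
      then have "\<bar>t\<bar>\<^sup>2 \<le> ?r\<^sup>2" by (intro power_mono) auto
      then have "a * t\<^sup>2 \<le> 1" using a by (simp add: power_divide field_simps)
      moreover have "t \<in> {-pi..pi}" using True r by auto
      ultimately show ?thesis using True by (auto intro!: divide_right_mono)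
    qed (auto simp: indicator_def)
  qed
  also have "\<dots> = (\<integral>t. exp (- a * t\<^sup>2) \<partial>circle)"
    by (subst integral_circle) auto
  finally show ?thesis .
qed

lemma norm_vec_lambda_power2: "(norm (vec_lambda \<theta> :: real ^ 'd::finite))\<^sup>2 = (\<Sum>i\<in>UNIV. (\<theta> i)\<^sup>2)"
  unfolding power2_norm_eq_inner by (simp add: inner_vec_def power2_eq_square)

lemma norm_vec_lambda_measurable [measurable]:
  "(\<lambda>\<theta>. norm (vec_lambda \<theta> :: real ^ 'd::finite)) \<in> borel_measurable torus"
proof -
  have "norm (vec_lambda \<theta> :: real ^ 'd) = sqrt (\<Sum>i\<in>UNIV. (\<theta> i)\<^sup>2)" for \<theta>
    by (simp flip: norm_vec_lambda_power2)
  then show ?thesis by simp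
qed

lemma torus_gaussian:
  fixes a :: real assumes "a \<ge> 0"
  shows torus_gaussian_eq: "(\<integral>\<theta>. exp (- a * (norm (vec_lambda \<theta> :: real ^ 'd::finite))\<^sup>2) \<partial>torus) =
    (\<integral>t. exp (- a * t\<^sup>2) \<partial>circle) ^ CARD('d)"
  and integrable_torus_gaussian: "integrable torus (\<lambda>\<theta>. exp (- a * (norm (vec_lambda \<theta> :: real ^ 'd))\<^sup>2))"
proof -
  have "(\<integral>\<theta>. exp (- a * (norm (vec_lambda \<theta> :: real ^ 'd))\<^sup>2) \<partial>torus) =
    (\<integral>\<theta>. (\<Prod>i\<in>(UNIV::'d set). exp (- a * (\<theta> i)\<^sup>2)) \<partial>torus)"
    by (simp add: norm_vec_lambda_power2 exp_sum[symmetric] sum_distrib_left sum_negf)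
  also have "\<dots> = (\<integral>t. exp (- a * t\<^sup>2) \<partial>circle) ^ CARD('d)"
    by (subst integral_torus_prod) (use assms in \<open>auto intro!: integrable_circle_bounded[of _ 1]\<close>)
  finally show "(\<integral>\<theta>. exp (- a * (norm (vec_lambda \<theta> :: real ^ 'd))\<^sup>2) \<partial>torus) =
    (\<integral>t. exp (- a * t\<^sup>2) \<partial>circle) ^ CARD('d)" .
  show "integrable torus (\<lambda>\<theta>. exp (- a * (norm (vec_lambda \<theta> :: real ^ 'd))\<^sup>2))"
    by (rule integrable_torus_bounded[of _ 1]) (use assms in auto)
qed

lemma torus_gaussian_upper:
  assumes "a > 0"
  shows "(\<integral>\<theta>. exp (- a * (norm (vec_lambda \<theta> :: real ^ 'd::finite))\<^sup>2) \<partial>torus) \<le> 1 / sqrt a ^ CARD('d)"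
proof -
  have "(\<integral>t. exp (- a * t\<^sup>2) \<partial>circle) ^ CARD('d) \<le> (1 / sqrt a) ^ CARD('d)"
    using assms by (intro power_mono circle_gaussian_upper integral_nonneg_AE) auto
  then show ?thesis using assms by (simp only: torus_gaussian_eq[OF less_imp_le] power_divide power_one)
qed

lemma torus_gaussian_lower:
  assumes "a \<ge> 1"
  shows "(exp (-1) / (pi * sqrt a)) ^ CARD('d) \<le> (\<integral>\<theta>. exp (- a * (norm (vec_lambda \<theta> :: real ^ 'd::finite))\<^sup>2) \<partial>torus)"
proof -
  have "(exp (-1) / (pi * sqrt a)) ^ CARD('d) \<le> (\<integral>t. exp (- a * t\<^sup>2) \<partial>circle) ^ CARD('d)"
    using assms by (intro power_mono circle_gaussian_lower) auto
  then show ?thesis using assms by (simp only: torus_gaussian_eq)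
qed

lemma norm_integral_le_AE:
  fixes f :: "'a \<Rightarrow> 'b::{banach, second_countable_topology}"
  assumes "f \<in> borel_measurable M" "integrable M g" "AE x in M. norm (f x) \<le> g x"
  shows "norm (integral\<^sup>L M f) \<le> integral\<^sup>L M g"
proof -
  have "integrable M (\<lambda>x. norm (f x))"
  proof (rule Bochner_Integration.integrable_bound[OF assms(2)])
    show "AE x in M. norm (norm (f x)) \<le> norm (g x)" using assms(3) by eventually_elim auto
  qed (use assms in simp)
  then have "(\<integral>x. norm (f x) \<partial>M) \<le> integral\<^sup>L M g"
    using assms by (intro integral_mono_AE) auto
  then show ?thesis using integral_norm_bound[of M f] by linarith
qed

lemma norm_iexp_diff_le: "cmod (iexp x - 1) \<le> \<bar>x\<bar>"
  using iexp_approx1[of x 0] by simp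

lemma norm_power_diff_le:
  fixes z w :: complex
  assumes "norm z \<le> m" "norm w \<le> m"
  shows "norm (z ^ n - w ^ n) \<le> real n * norm (z - w) * m ^ (n - 1)"
proof (induction n)
  case 0 then show ?case by simp
next
  case (Suc n)
  have m0: "0 \<le> m" using assms(1) norm_ge_zero order_trans by blast
  have "z ^ Suc n - w ^ Suc n = z * (z ^ n - w ^ n) + (z - w) * w ^ n"
    by (simp add: algebra_simps)
  then have "norm (z ^ Suc n - w ^ Suc n) \<le> norm z * norm (z ^ n - w ^ n) + norm (z - w) * norm w ^ n"
    by (metis norm_triangle_ineq norm_mult norm_power)
  also have "\<dots> \<le> m * (real n * norm (z - w) * m ^ (n - 1)) + norm (z - w) * m ^ n"
    using Suc assms m0 by (intro add_mono mult_mono power_mono) auto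
  also have "\<dots> = real (Suc n) * norm (z - w) * m ^ n"
    by (cases n) (auto simp: algebra_simps)
  finally show ?case by simp
qed

text \<open>This bound and the next one absorb powers of \<open>sqrt n * norm t\<close> into one half of the
  Gaussian decay of the characteristic function.\<close>

lemma le_exp_half_square: "(s::real) \<le> exp (s\<^sup>2 / 2)"
proof -
  have "0 \<le> (s - 1)\<^sup>2" by simp
  then have "s \<le> 1 + s\<^sup>2 / 2" by (simp add: power2_eq_square algebra_simps)
  then show ?thesis using exp_ge_add_one_self[of "s\<^sup>2 / 2"] by linarith
qed

lemma cube_le_exp_half_square: assumes "(s::real) \<ge> 0" shows "s ^ 3 \<le> 27 * exp (s\<^sup>2 / 2)"
proof -
  have "0 \<le> (s - 1)\<^sup>2" by simp
  then have "s \<le> 3 * (1 + s\<^sup>2 / 6)" unfolding distrib_left by (simp add: power2_eq_square algebra_simps)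
  also have "\<dots> \<le> 3 * exp (s\<^sup>2 / 6)" by (intro mult_left_mono exp_ge_add_one_self) auto
  finally have "s \<le> 3 * exp (s\<^sup>2 / 6)" .
  then have "s ^ 3 \<le> (3 * exp (s\<^sup>2 / 6)) ^ 3" using assms by (intro power_mono) auto
  then show ?thesis by (simp add: power_mult_distrib exp_of_nat_mult[symmetric])
qed

text \<open>Gaussian decay on the whole torus combines non-degeneracy, which matters near the origin,
  with aperiodicity, which matters away from it.\<close>

locale fourier_decay =
  fixes \<nu> :: "(int ^ 'd::finite) pmf" and c :: real
  assumes c: "c > 0"
    and decay: "\<And>t. (\<And>i. t $ i \<in> {-pi..pi}) \<Longrightarrow> cmod (char_pmf \<nu> t) \<le> exp (- c * (norm t)\<^sup>2)"
begin

abbreviation sqn :: "('d \<Rightarrow> real) \<Rightarrow> real" where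
  "sqn \<theta> \<equiv> (norm (vec_lambda \<theta> :: real ^ 'd))\<^sup>2"

lemma AE_decay: "AE \<theta> in torus. cmod (char_pmf \<nu> (vec_lambda \<theta>) ^ n) \<le> exp (- (c * real n) * sqn \<theta>)"
  using AE_torus
proof (rule AE_mp, intro AE_I2 impI)
  fix \<theta> :: "'d \<Rightarrow> real" assume "\<forall>i. \<theta> i \<in> {-pi..pi}"
  then have "cmod (char_pmf \<nu> (vec_lambda \<theta>)) ^ n \<le> exp (- c * sqn \<theta>) ^ n"
    by (intro power_mono decay) auto
  also have "\<dots> = exp (- (c * real n) * sqn \<theta>)"
    by (simp add: exp_of_nat_mult[symmetric] mult_ac)
  finally show "cmod (char_pmf \<nu> (vec_lambda \<theta>) ^ n) \<le> exp (- (c * real n) * sqn \<theta>)"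
    by (simp add: norm_power)
qed

lemma heat_upper:
  assumes n: "n \<ge> 1"
  shows "pmf (conv_pow \<nu> n) x \<le> 1 / sqrt (c * real n) ^ CARD('d)"
proof -
  have "pmf (conv_pow \<nu> n) x = cmod (complex_of_real (pmf (conv_pow \<nu> n) x))" by simp
  also have "\<dots> \<le> (\<integral>\<theta>. exp (- (c * real n) * sqn \<theta>) \<partial>torus)"
    unfolding fourier_inversion char_pmf_conv_pow
  proof (rule norm_integral_le_AE)
    show "integrable torus (\<lambda>\<theta>. exp (- (c * real n) * sqn \<theta>))"
      using c by (intro integrable_torus_gaussian) auto
    show "AE \<theta> in torus. cmod (char_pmf \<nu> (vec_lambda \<theta>) ^ n * iexp (- (vec_lambda \<theta> \<bullet> vec_of_int x))) \<le> exp (- (c * real n) * sqn \<theta>)"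
      using AE_decay[of n] by (simp add: norm_mult)
  qed measurable
  also have "\<dots> \<le> 1 / sqrt (c * real n) ^ CARD('d)"
    using c n by (intro torus_gaussian_upper) auto
  finally show ?thesis .
qed

text \<open>A shift by \<open>y\<close> multiplies the integrand by a number that differs from one by at most
  \<open>norm t * norm y\<close>, and a factor \<open>norm t\<close> in a Gaussian integral of variance \<open>1 / n\<close> gains
  \<open>1 / sqrt n\<close>.\<close>

lemma heat_gradient:
  assumes n: "n \<ge> 1"
  shows "\<bar>pmf (conv_pow \<nu> n) (x + y) - pmf (conv_pow \<nu> n) x\<bar> \<le>
    norm (vec_of_int y) * (1 / sqrt (c * real n) * (1 / sqrt (c * real n / 2) ^ CARD('d)))"
proof -
  let ?a = "c * real n"
  let ?g = "\<lambda>\<theta>. norm (vec_of_int y) / sqrt ?a * exp (- (?a / 2) * sqn \<theta>)"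
  have a: "?a > 0" using c n by auto
  have I: "integrable torus (\<lambda>\<theta>. char_pmf \<nu> (vec_lambda \<theta>) ^ n * iexp (- (vec_lambda \<theta> \<bullet> vec_of_int x)))" for x
  proof (rule integrable_torus_bounded[of _ 1])
    show "(\<lambda>\<theta>. char_pmf \<nu> (vec_lambda \<theta>) ^ n * iexp (- (vec_lambda \<theta> \<bullet> vec_of_int x))) \<in> borel_measurable torus"
      by measurable
  qed (simp add: norm_mult norm_power power_le_one norm_char_pmf_le)
  have "\<bar>pmf (conv_pow \<nu> n) (x + y) - pmf (conv_pow \<nu> n) x\<bar> =
     cmod (complex_of_real (pmf (conv_pow \<nu> n) (x + y)) - complex_of_real (pmf (conv_pow \<nu> n) x))"
    by (simp flip: of_real_diff)
  also have "\<dots> = cmod (\<integral>\<theta>. char_pmf \<nu> (vec_lambda \<theta>) ^ n * iexp (- (vec_lambda \<theta> \<bullet> vec_of_int (x + y)))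
     - char_pmf \<nu> (vec_lambda \<theta>) ^ n * iexp (- (vec_lambda \<theta> \<bullet> vec_of_int x)) \<partial>torus)"
    unfolding fourier_inversion char_pmf_conv_pow
    by (subst Bochner_Integration.integral_diff[OF I I]) simp
  also have "\<dots> \<le> (\<integral>\<theta>. ?g \<theta> \<partial>torus)"
  proof (rule norm_integral_le_AE)
    show "integrable torus ?g"
      using a by (intro integrable_mult_right integrable_torus_gaussian) auto
    show "AE \<theta> in torus. cmod (char_pmf \<nu> (vec_lambda \<theta>) ^ n * iexp (- (vec_lambda \<theta> \<bullet> vec_of_int (x + y)))
     - char_pmf \<nu> (vec_lambda \<theta>) ^ n * iexp (- (vec_lambda \<theta> \<bullet> vec_of_int x))) \<le> ?g \<theta>"
      using AE_decay[of n]
    proof (rule AE_mp, intro AE_I2 impI)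
      fix \<theta> :: "'d \<Rightarrow> real"
      assume d: "cmod (char_pmf \<nu> (vec_lambda \<theta>) ^ n) \<le> exp (- (c * real n) * sqn \<theta>)"
      let ?t = "vec_lambda \<theta> :: real ^ 'd"
      let ?s = "sqrt ?a * norm ?t"
      have s2: "?s\<^sup>2 = ?a * sqn \<theta>" using a by (simp add: power_mult_distrib)
      have "char_pmf \<nu> ?t ^ n * iexp (- (?t \<bullet> vec_of_int (x + y))) - char_pmf \<nu> ?t ^ n * iexp (- (?t \<bullet> vec_of_int x))
        = char_pmf \<nu> ?t ^ n * iexp (- (?t \<bullet> vec_of_int x)) * (iexp (- (?t \<bullet> vec_of_int y)) - 1)"
        by (simp add: vec_of_int_add inner_add_right exp_add algebra_simps exp_diff divide_simps exp_minus)
      then have "cmod (char_pmf \<nu> ?t ^ n * iexp (- (?t \<bullet> vec_of_int (x + y))) - char_pmf \<nu> ?t ^ n * iexp (- (?t \<bullet> vec_of_int x)))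
        = cmod (char_pmf \<nu> ?t ^ n) * cmod (iexp (- (?t \<bullet> vec_of_int y)) - 1)"
        by (simp add: norm_mult)
      also have "\<dots> \<le> exp (- ?a * sqn \<theta>) * (norm ?t * norm (vec_of_int y))"
        using norm_iexp_diff_le[of "- (?t \<bullet> vec_of_int y)"] Cauchy_Schwarz_ineq2[of ?t "vec_of_int y"]
        by (intro mult_mono d) auto
      also have "\<dots> = norm (vec_of_int y) / sqrt ?a * (?s * exp (- ?a * sqn \<theta>))"
        using c n by simp
      also have "\<dots> \<le> norm (vec_of_int y) / sqrt ?a * (exp (?s\<^sup>2 / 2) * exp (- ?a * sqn \<theta>))"
        using a by (intro mult_left_mono mult_right_mono le_exp_half_square) auto
      also have "exp (?s\<^sup>2 / 2) * exp (- ?a * sqn \<theta>) = exp (- (?a / 2) * sqn \<theta>)"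
        unfolding s2 by (simp add: exp_add[symmetric])
      finally show "cmod (char_pmf \<nu> ?t ^ n * iexp (- (?t \<bullet> vec_of_int (x + y))) - char_pmf \<nu> ?t ^ n * iexp (- (?t \<bullet> vec_of_int x))) \<le> ?g \<theta>" .
    qed
  qed measurable
  also have "(\<integral>\<theta>. ?g \<theta> \<partial>torus) = norm (vec_of_int y) / sqrt ?a * (\<integral>\<theta>. exp (- (?a / 2) * sqn \<theta>) \<partial>torus)"
    by (rule integral_mult_right_zero)
  also have "\<dots> \<le> norm (vec_of_int y) / sqrt ?a * (1 / sqrt (?a / 2) ^ CARD('d))"
    using a by (intro mult_left_mono torus_gaussian_upper) auto
  finally show ?thesis by simp
qed

text \<open>The \<open>n\<close>-th power of the characteristic function is compared with \<open>exp (- n * Q t)\<close>. The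
  difference is at most of the order of \<open>n * norm t ^ 3\<close> times a Gaussian and integrates to a
  term that is smaller than the main one by the factor \<open>sqrt n\<close>.\<close>

lemma heat_at_origin:
  fixes Q :: "real ^ 'd \<Rightarrow> real"
  assumes B: "B \<ge> 1" and Qm: "(\<lambda>\<theta>. Q (vec_lambda \<theta>)) \<in> borel_measurable torus"
    and Q: "\<And>t. c * (norm t)\<^sup>2 \<le> Q t" "\<And>t. Q t \<le> B * (norm t)\<^sup>2"
    and approx: "\<And>t. cmod (char_pmf \<nu> t - (1 - Q t)) \<le> B * norm t ^ 3"
  obtains a b where "a > 0" "b \<ge> 0"
    "\<And>n. n \<ge> 1 \<Longrightarrow> a / sqrt (real n) ^ CARD('d) - b / sqrt (real n) ^ (CARD('d) + 1) \<le> pmf (conv_pow \<nu> n) 0"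
proof -
  \<comment> \<open>\<open>R\<close> bounds the norm on the torus, so that \<open>(norm t) ^ 4
    \<le> R * norm t ^ 3\<close> there.\<close>
  define R where "R = sqrt (real CARD('d)) * pi"
  define B' where "B' = (B + B\<^sup>2 * R) * exp (c * R\<^sup>2)"
  have R0: "R \<ge> 0" by (simp add: R_def)
  have B'0: "B' \<ge> 0" using B R0 by (simp add: B'_def)
  define a where "a = (exp (-1) / (pi * sqrt B)) ^ CARD('d)"
  define b where "b = B' * 27 / sqrt c ^ 3 / sqrt (c / 2) ^ CARD('d)"
  have a0: "a > 0" using B by (simp add: a_def)
  have b0: "b \<ge> 0" using B'0 c by (simp add: b_def)
  have main: "a / sqrt (real n) ^ CARD('d) - b / sqrt (real n) ^ (CARD('d) + 1) \<le> pmf (conv_pow \<nu> n) 0"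
    if n: "n \<ge> 1" for n
  proof -
    let ?E = "\<lambda>\<theta>. exp (- real n * Q (vec_lambda \<theta>))"
    let ?g = "\<lambda>\<theta>. B' * real n * 27 / sqrt (c * real n) ^ 3 * exp (- (c * real n / 2) * sqn \<theta>)"
    have Q0: "Q t \<ge> 0" for t using Q(1)[of t] c by (meson mult_nonneg_nonneg less_imp_le order_trans zero_le_power2)
    have intE: "integrable torus ?E"
      using Qm Q0 by (intro integrable_torus_bounded[of _ 1]) auto
    have cn: "c * real n > 0" using c n by simp
    have AEd: "AE \<theta> in torus. cmod (char_pmf \<nu> (vec_lambda \<theta>) ^ n - complex_of_real (?E \<theta>)) \<le> ?g \<theta>"
      using AE_torus
    proof (rule AE_mp, intro AE_I2 impI)
      fix \<theta> :: "'d \<Rightarrow> real" assume th: "\<forall>i. \<theta> i \<in> {-pi..pi}"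
      let ?t = "vec_lambda \<theta> :: real ^ 'd"
      let ?s = "sqrt (c * real n) * norm ?t"
      have "(\<theta> i)\<^sup>2 \<le> pi\<^sup>2" for i
        using th[rule_format, of i] by (intro abs_le_square_iff[THEN iffD1]) (auto simp: abs_if)
      then have "sqn \<theta> \<le> (\<Sum>i\<in>(UNIV::'d set). pi\<^sup>2)"
        unfolding norm_vec_lambda_power2 by (intro sum_mono) auto
      then have R2: "sqn \<theta> \<le> R\<^sup>2" by (simp add: R_def power_mult_distrib)
      then have nR: "norm ?t \<le> R" using R0 by (rule power2_le_imp_le)
      let ?w = "complex_of_real (exp (- Q ?t))"
      have 1: "cmod (char_pmf \<nu> ?t) \<le> exp (- c * sqn \<theta>)" using th by (intro decay) auto
      have 2: "cmod ?w \<le> exp (- c * sqn \<theta>)" using Q(1)[of ?t] by simp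
      have e2: "\<bar>exp (- q) - (1 - q)\<bar> \<le> q\<^sup>2" if "q \<ge> 0" for q :: real
      proof -
        have "exp (- q) \<le> 1 + (- q) + (- q)\<^sup>2 / 2 * exp 0" using that by (intro exp_le_quadratic) auto
        moreover have "1 + (- q) \<le> exp (- q)" by (rule exp_ge_add_one_self)
        ultimately show ?thesis by (auto simp: abs_if)
      qed
      have "(Q ?t)\<^sup>2 \<le> (B * (norm ?t)\<^sup>2)\<^sup>2" using Q0 Q(2) by (intro power_mono) auto
      also have "\<dots> = B\<^sup>2 * norm ?t * norm ?t ^ 3" by (simp add: power_mult_distrib eval_nat_numeral)
      also have "\<dots> \<le> B\<^sup>2 * R * norm ?t ^ 3" using nR by (intro mult_right_mono mult_left_mono) auto
      finally have Q2: "(Q ?t)\<^sup>2 \<le> B\<^sup>2 * R * norm ?t ^ 3" .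
      have "cmod (char_pmf \<nu> ?t - ?w) \<le> cmod (char_pmf \<nu> ?t - (1 - Q ?t)) + cmod ((1 - Q ?t) - ?w)"
        using norm_triangle_ineq[of "char_pmf \<nu> ?t - (1 - Q ?t)" "(1 - Q ?t) - ?w"] by simp
      also have "cmod ((1 - Q ?t) - ?w) = \<bar>exp (- Q ?t) - (1 - Q ?t)\<bar>"
        by (subst norm_of_real[symmetric]) (simp only: of_real_diff of_real_1 norm_minus_commute)
      finally have 3: "cmod (char_pmf \<nu> ?t - ?w) \<le> (B + B\<^sup>2 * R) * norm ?t ^ 3"
        using approx[of ?t] e2[OF Q0, of ?t] Q2 unfolding distrib_right by linarith
      have "exp (- c * sqn \<theta>) ^ (n - 1) = exp (c * sqn \<theta>) * exp (- (c * real n) * sqn \<theta>)"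
        using n by (simp add: exp_of_nat_mult[symmetric] exp_add[symmetric] of_nat_diff algebra_simps)
      also have "\<dots> \<le> exp (c * R\<^sup>2) * exp (- (c * real n) * sqn \<theta>)"
        using R2 c by (intro mult_right_mono) auto
      finally have 4: "exp (- c * sqn \<theta>) ^ (n - 1) \<le> exp (c * R\<^sup>2) * exp (- (c * real n) * sqn \<theta>)" .
      have "complex_of_real (?E \<theta>) = ?w ^ n" by (simp add: exp_of_nat_mult[symmetric] flip: of_real_power)
      then have "cmod (char_pmf \<nu> ?t ^ n - complex_of_real (?E \<theta>)) \<le>
        real n * cmod (char_pmf \<nu> ?t - ?w) * exp (- c * sqn \<theta>) ^ (n - 1)"
        using norm_power_diff_le[OF 1 2] by simp
      also have "\<dots> \<le> real n * ((B + B\<^sup>2 * R) * norm ?t ^ 3) * (exp (c * R\<^sup>2) * exp (- (c * real n) * sqn \<theta>))"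
        using 3 4 B R0 by (intro mult_mono mult_left_mono) auto
      also have "\<dots> = B' * real n * norm ?t ^ 3 * exp (- (c * real n) * sqn \<theta>)"
        by (simp add: B'_def)
      also have "\<dots> = B' * real n / sqrt (c * real n) ^ 3 * (?s ^ 3 * exp (- (c * real n) * sqn \<theta>))"
        using c n by (simp add: power_mult_distrib)
      also have "\<dots> \<le> B' * real n / sqrt (c * real n) ^ 3 * ((27 * exp (?s\<^sup>2 / 2)) * exp (- (c * real n) * sqn \<theta>))"
        using B'0 cn by (intro mult_left_mono mult_right_mono cube_le_exp_half_square) auto
      also have "?s\<^sup>2 = c * real n * sqn \<theta>" using cn by (simp add: power_mult_distrib)
      also have "B' * real n / sqrt (c * real n) ^ 3 * ((27 * exp (c * real n * sqn \<theta> / 2)) * exp (- (c * real n) * sqn \<theta>)) = ?g \<theta>"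
        by (simp add: exp_add[symmetric])
      finally show "cmod (char_pmf \<nu> ?t ^ n - complex_of_real (?E \<theta>)) \<le> ?g \<theta>" .
    qed
    have "complex_of_real (pmf (conv_pow \<nu> n) 0) - complex_of_real (\<integral>\<theta>. ?E \<theta> \<partial>torus) =
       (\<integral>\<theta>. char_pmf \<nu> (vec_lambda \<theta>) ^ n - complex_of_real (?E \<theta>) \<partial>torus)"
    proof -
      have "complex_of_real (pmf (conv_pow \<nu> n) 0) = (\<integral>\<theta>. char_pmf \<nu> (vec_lambda \<theta>) ^ n \<partial>torus)"
        unfolding fourier_inversion char_pmf_conv_pow by simp
      moreover have "complex_of_real (\<integral>\<theta>. ?E \<theta> \<partial>torus) = (\<integral>\<theta>. complex_of_real (?E \<theta>) \<partial>torus)"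
        by (rule integral_complex_of_real[symmetric])
      moreover have "integrable torus (\<lambda>\<theta>. char_pmf \<nu> (vec_lambda \<theta>) ^ n)"
        by (auto intro!: integrable_torus_bounded[of _ 1] simp: norm_power power_le_one norm_char_pmf_le)
      moreover have "integrable torus (\<lambda>\<theta>. complex_of_real (?E \<theta>))"
        using intE by (rule integrable_of_real)
      ultimately show ?thesis by (simp only: Bochner_Integration.integral_diff)
    qed
    then have "cmod (complex_of_real (pmf (conv_pow \<nu> n) 0) - complex_of_real (\<integral>\<theta>. ?E \<theta> \<partial>torus)) \<le>
       (\<integral>\<theta>. ?g \<theta> \<partial>torus)"
      using AEd cn Qm by (simp only:) (intro norm_integral_le_AE integrable_mult_right integrable_torus_gaussian, auto)
    then have "(\<integral>\<theta>. ?E \<theta> \<partial>torus) - (\<integral>\<theta>. ?g \<theta> \<partial>torus) \<le> pmf (conv_pow \<nu> n) 0"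
      unfolding of_real_diff[symmetric] norm_of_real by (simp only: abs_le_iff) linarith
    moreover have "(\<integral>\<theta>. ?g \<theta> \<partial>torus) \<le> b / sqrt (real n) ^ (CARD('d) + 1)"
    proof -
      have "(\<integral>\<theta>. ?g \<theta> \<partial>torus) = B' * real n * 27 / sqrt (c * real n) ^ 3 * (\<integral>\<theta>. exp (- (c * real n / 2) * sqn \<theta>) \<partial>torus)"
        by (rule integral_mult_right_zero)
      also have "\<dots> \<le> B' * real n * 27 / sqrt (c * real n) ^ 3 * (1 / sqrt (c * real n / 2) ^ CARD('d))"
        using cn B'0 by (intro mult_left_mono torus_gaussian_upper) auto
      also have "\<dots> = b / sqrt (real n) ^ (CARD('d) + 1)"
      proof -
        have e: "sqrt (c * real n / 2) = sqrt (c / 2) * sqrt (real n)" "sqrt (c * real n) = sqrt c * sqrt (real n)"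
          by (simp_all add: real_sqrt_mult real_sqrt_divide)
        have e3: "real n = sqrt (real n) ^ 2" by simp
        show ?thesis unfolding e b_def power_mult_distrib
          using n c by (subst (1) e3) (simp add: eval_nat_numeral divide_simps)
      qed
      finally show ?thesis .
    qed
    moreover have "a / sqrt (real n) ^ CARD('d) \<le> (\<integral>\<theta>. ?E \<theta> \<partial>torus)"
    proof -
      have "a / sqrt (real n) ^ CARD('d) = (exp (-1) / (pi * sqrt (B * real n))) ^ CARD('d)"
        by (simp add: a_def real_sqrt_mult power_mult_distrib power_divide)
      also have "\<dots> \<le> (\<integral>\<theta>. exp (- (B * real n) * sqn \<theta>) \<partial>torus)"
        using B n mult_mono[of 1 B 1 "real n"] by (intro torus_gaussian_lower) auto
      also have "\<dots> \<le> (\<integral>\<theta>. ?E \<theta> \<partial>torus)"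
      proof (rule integral_mono[OF integrable_torus_gaussian intE])
        fix \<theta> :: "'d \<Rightarrow> real"
        have "real n * Q (vec_lambda \<theta>) \<le> real n * (B * sqn \<theta>)" using Q(2) by (intro mult_left_mono) auto
        then show "exp (- (B * real n) * sqn \<theta>) \<le> ?E \<theta>" by (simp add: mult_ac)
      qed (use B in auto)
      finally show ?thesis .
    qed
    ultimately show ?thesis by linarith
  qed
  show thesis by (rule that[OF a0 b0 main])
qed

end

section \<open>The lazy walk\<close>

text \<open>The layer between \<open>2 ^ j\<close> and \<open>2 ^ (j + 1)\<close> contributes at most a multiple of
  \<open>8 ^ j / 2 ^ (5 * j)\<close>.\<close>

lemma nn_integral_cube_finite:
  fixes X :: "'a \<Rightarrow> real"
  assumes tail: "\<And>r. r \<ge> 1 \<Longrightarrow> measure_pmf.prob \<mu> {x. X x > r} \<le> C / r ^ d" and d: "d \<ge> 5"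
    and X: "\<And>x. X x \<ge> 0" and C: "C \<ge> 0"
  shows "(\<integral>\<^sup>+x. ennreal (X x ^ 3) \<partial>measure_pmf \<mu>) < \<infinity>"
proof -
  let ?f = "\<lambda>j x. ennreal (8 ^ (j + 1)) * indicator {x. X x > 2 ^ j} x"
  have pt: "ennreal (X x ^ 3) \<le> 1 + (\<Sum>j. ?f j x)" for x
  proof (cases "X x \<le> 1")
    case True
    then have "X x ^ 3 \<le> 1" using X by (intro power_le_one) auto
    then have "ennreal (X x ^ 3) \<le> 1" by simp
    then show ?thesis by (rule order_trans) simp
  next
    case False
    define j where "j = (LEAST j. X x \<le> 2 ^ (j + 1))"
    obtain n where "X x < 2 ^ n" using real_arch_pow[of 2 "X x"] by auto
    then have "X x \<le> 2 ^ (n + 1)" using order_trans[of "X x" "2 ^ n" "2 ^ (n + 1)"] by simp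
    then have j1: "X x \<le> 2 ^ (j + 1)" unfolding j_def by (rule LeastI)
    have j2: "X x > 2 ^ j"
    proof (cases j)
      case 0 then show ?thesis using False by simp
    next
      case (Suc i)
      then have "\<not> X x \<le> 2 ^ (i + 1)" unfolding j_def by (intro not_less_Least) simp
      then show ?thesis using Suc by simp
    qed
    have "X x ^ 3 \<le> (2 ^ (j + 1)) ^ 3" using j1 X by (intro power_mono) auto
    also have "(2 ^ (j + 1)) ^ 3 = ((2::real) ^ 3) ^ (j + 1)" by (simp only: power_mult[symmetric] mult.commute)
    also have "\<dots> = 8 ^ (j + 1)" by simp
    finally have "ennreal (X x ^ 3) \<le> ?f j x" using j2 by (simp add: ennreal_leI del: power_Suc)
    also have "\<dots> = (\<Sum>i\<in>{j}. ?f i x)" by (simp only: sum.insert sum.empty finite.emptyI empty_iff not_False_eq_True add_0_right)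
    also have "\<dots> \<le> (\<Sum>j. ?f j x)" by (rule sum_le_suminf) auto
    finally show ?thesis by (rule order_trans) simp
  qed
  have summand: "(\<integral>\<^sup>+x. ?f j x \<partial>measure_pmf \<mu>) \<le> ennreal (8 * C * (1 / 4) ^ j)" for j
  proof -
    have "(\<integral>\<^sup>+x. ?f j x \<partial>measure_pmf \<mu>) = ennreal (8 ^ (j + 1)) * emeasure (measure_pmf \<mu>) {x. X x > 2 ^ j}"
      by (subst nn_integral_cmult_indicator) auto
    also have "\<dots> = ennreal (8 ^ (j + 1) * measure_pmf.prob \<mu> {x. X x > 2 ^ j})"
      by (simp add: measure_pmf.emeasure_eq_measure ennreal_mult del: power_Suc)
    also have "\<dots> \<le> ennreal (8 ^ (j + 1) * (C / (2 ^ j) ^ d))"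
      by (intro ennreal_leI mult_left_mono tail) auto
    also have "\<dots> \<le> ennreal (8 ^ (j + 1) * (C / (2 ^ j) ^ 5))"
      using d C by (intro ennreal_leI mult_left_mono divide_left_mono power_increasing) auto
    also have "8 ^ (j + 1) * (C / (2 ^ j) ^ 5) = 8 * C * (1 / 4) ^ j"
    proof -
      have "((2::real) ^ j) ^ 5 = 8 ^ j * 4 ^ j"
        by (simp add: power_mult[symmetric] mult.commute[of j] flip: power_mult_distrib) (simp add: power_mult)
      then show ?thesis by (simp add: power_divide)
    qed
    finally show ?thesis .
  qed
  have "(\<integral>\<^sup>+x. ennreal (X x ^ 3) \<partial>measure_pmf \<mu>) \<le> (\<integral>\<^sup>+x. 1 + (\<Sum>j. ?f j x) \<partial>measure_pmf \<mu>)"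
    by (intro nn_integral_mono pt)
  also have "\<dots> = 1 + (\<Sum>j. \<integral>\<^sup>+x. ?f j x \<partial>measure_pmf \<mu>)"
    by (simp add: nn_integral_add nn_integral_suminf del: power_Suc)
  also have "\<dots> \<le> 1 + (\<Sum>j. ennreal (8 * C * (1 / 4) ^ j))"
    by (intro add_left_mono suminf_le summand) auto
  also have "(\<Sum>j. ennreal (8 * C * (1 / 4) ^ j)) = ennreal (\<Sum>j. 8 * C * (1 / 4) ^ j)"
    using C by (intro suminf_ennreal2 summable_mult summable_geometric) auto
  also have "1 + \<dots> < \<infinity>" by simp
  finally show ?thesis .
qed

text \<open>Staying put with probability one half makes the walk aperiodic: its characteristic function
  is \<open>(1 + char_pmf \<mu> t) / 2\<close>, which has modulus one only where \<open>char_pmf \<mu> t = 1\<close>.\<close>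

definition lazy :: "(int ^ 'd::finite) pmf \<Rightarrow> (int ^ 'd) pmf" where
  "lazy \<mu> = bind_pmf (bernoulli_pmf (1/2)) (\<lambda>b. if b then return_pmf 0 else \<mu>)"

lemma nn_integral_lazy:
  "(\<integral>\<^sup>+z. f z \<partial>measure_pmf (lazy \<mu>)) = f 0 / 2 + (\<integral>\<^sup>+z. f z \<partial>measure_pmf \<mu>) / 2"
  by (simp add: lazy_def divide_ennreal_def)

lemma integrable_lazy:
  fixes f :: "int ^ 'd::finite \<Rightarrow> 'b::{banach, second_countable_topology}"
  assumes "integrable (measure_pmf \<mu>) f" shows "integrable (measure_pmf (lazy \<mu>)) f"
  using assms unfolding integrable_iff_bounded
  by (auto simp: nn_integral_lazy less_top[symmetric] ennreal_divide_eq_top_iff)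

lemma integral_lazy_nonneg:
  fixes f :: "int ^ 'd::finite \<Rightarrow> real"
  assumes "integrable (measure_pmf \<mu>) f" "\<And>z. f z \<ge> 0"
  shows "measure_pmf.expectation (lazy \<mu>) f = (f 0 + measure_pmf.expectation \<mu> f) / 2"
proof -
  have "ennreal (measure_pmf.expectation (lazy \<mu>) f) = (\<integral>\<^sup>+z. ennreal (f z) \<partial>measure_pmf (lazy \<mu>))"
    using assms by (intro nn_integral_eq_integral[symmetric] integrable_lazy) auto
  also have "\<dots> = ennreal (f 0) / ennreal 2 + ennreal (measure_pmf.expectation \<mu> f) / ennreal 2"
    unfolding nn_integral_lazy ennreal_numeral using assms by (subst nn_integral_eq_integral) auto
  also have "\<dots> = ennreal ((f 0 + measure_pmf.expectation \<mu> f) / 2)"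
    using assms by (simp add: integral_nonneg_AE add_divide_distrib divide_ennreal del: ennreal_numeral flip: ennreal_plus)
  finally show ?thesis
    using assms by (subst (asm) ennreal_inj) (auto intro!: integral_nonneg_AE add_nonneg_nonneg divide_nonneg_pos)
qed

lemma integral_lazy:
  fixes f :: "int ^ 'd::finite \<Rightarrow> real"
  assumes f: "integrable (measure_pmf \<mu>) f"
  shows "measure_pmf.expectation (lazy \<mu>) f = (f 0 + measure_pmf.expectation \<mu> f) / 2"
proof -
  let ?p = "\<lambda>z. max 0 (f z)" and ?n = "\<lambda>z. max 0 (- f z)"
  have e: "f = (\<lambda>z. ?p z - ?n z)" by (auto simp: max_def)
  have i: "integrable (measure_pmf \<mu>) ?p" "integrable (measure_pmf \<mu>) ?n" using f by auto
  have "measure_pmf.expectation (lazy \<mu>) (\<lambda>z. ?p z - ?n z) = (?p 0 + measure_pmf.expectation \<mu> ?p) / 2 - (?n 0 + measure_pmf.expectation \<mu> ?n) / 2"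
    using i by (subst Bochner_Integration.integral_diff) (auto intro!: integrable_lazy simp: integral_lazy_nonneg)
  also have "\<dots> = ((?p 0 - ?n 0) + (measure_pmf.expectation \<mu> ?p - measure_pmf.expectation \<mu> ?n)) / 2"
    by (simp add: field_simps)
  also have "measure_pmf.expectation \<mu> ?p - measure_pmf.expectation \<mu> ?n = measure_pmf.expectation \<mu> (\<lambda>z. ?p z - ?n z)"
    using i by simp
  finally show ?thesis using e by simp
qed

lemma char_pmf_lazy: "char_pmf (lazy \<mu>) t = (1 + char_pmf \<mu> t) / 2"
proof -
  have i: "integrable (measure_pmf N) (\<lambda>z. iexp (t \<bullet> vec_of_int z))" for N by simp
  have R: "measure_pmf.expectation (lazy \<mu>) (\<lambda>z. Re (iexp (t \<bullet> vec_of_int z))) = (Re (iexp (t \<bullet> vec_of_int 0)) + measure_pmf.expectation \<mu> (\<lambda>z. Re (iexp (t \<bullet> vec_of_int z)))) / 2"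
    by (rule integral_lazy) (intro integrable_Re i)
  have I: "measure_pmf.expectation (lazy \<mu>) (\<lambda>z. Im (iexp (t \<bullet> vec_of_int z))) = (Im (iexp (t \<bullet> vec_of_int 0)) + measure_pmf.expectation \<mu> (\<lambda>z. Im (iexp (t \<bullet> vec_of_int z)))) / 2"
    by (rule integral_lazy) (intro integrable_Im i)
  show ?thesis unfolding complex_eq_iff char_pmf_def
    using R I by (simp only: integral_Re[OF i] integral_Im[OF i]) simp
qed

locale centred_walk =
  fixes \<mu> :: "(int ^ 'd::finite) pmf" and C :: real
  assumes dim: "CARD('d) \<ge> 5"
    and mean: "integrable (measure_pmf \<mu>) vec_of_int" "mean_vec \<mu> = 0"
    and cov: "positive_definite (covariance_matrix \<mu>)"
    and aperiodic: "\<And>H. add_subgroup H \<Longrightarrow> set_pmf \<mu> \<subseteq> H \<Longrightarrow> H = UNIV"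
    and C: "C > 0"
    and tail: "\<And>r::real. r \<ge> 1 \<Longrightarrow>
      measure_pmf.prob \<mu> {x. norm (vec_of_int x) > r} < C / r ^ CARD('d)"
begin

abbreviation "E f \<equiv> measure_pmf.expectation \<mu> f"

lemma integrable_norm3: "integrable (measure_pmf \<mu>) (\<lambda>z. norm (vec_of_int z) ^ 3)"
  unfolding integrable_iff_bounded
  using nn_integral_cube_finite[of \<mu> "\<lambda>z. norm (vec_of_int z)" C "CARD('d)"] tail dim C
  by (auto simp: less_imp_le)

lemma integrable_norm2: "integrable (measure_pmf \<mu>) (\<lambda>z. norm (vec_of_int z) ^ 2)"
proof (rule Bochner_Integration.integrable_bound[of _ "\<lambda>z. 1 + norm (vec_of_int z) ^ 3"])
  show "integrable (measure_pmf \<mu>) (\<lambda>z. 1 + norm (vec_of_int z) ^ 3)"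
    using integrable_norm3 by simp
  have "a\<^sup>2 \<le> 1 + a ^ 3" if "a \<ge> 0" for a :: real
  proof (cases "a \<le> 1")
    case True then have "a\<^sup>2 \<le> 1" using that by (intro power_le_one) auto
    then show ?thesis using that by (simp add: add_increasing2)
  next
    case False then have "a\<^sup>2 \<le> a ^ 3" by (intro power_increasing) auto
    then show ?thesis by simp
  qed
  then show "AE z in measure_pmf \<mu>. norm ((norm (vec_of_int z))\<^sup>2) \<le> norm (1 + norm (vec_of_int z) ^ 3)"
    by (intro AE_I2) (simp add: add_nonneg_nonneg)
qed simp

definition m2 where "m2 = E (\<lambda>z. norm (vec_of_int z) ^ 2)"
definition m3 where "m3 = E (\<lambda>z. norm (vec_of_int z) ^ 3)"

lemma m2_nonneg: "m2 \<ge> 0" and m3_nonneg: "m3 \<ge> 0"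
  unfolding m2_def m3_def by (intro integral_nonneg_AE; simp)+

lemma integrable_inner: "integrable (measure_pmf \<mu>) (\<lambda>z. t \<bullet> vec_of_int z)"
  using mean(1) by (rule integrable_inner_right) 

lemma integral_inner_zero: "E (\<lambda>z. t \<bullet> vec_of_int z) = 0"
  using mean by (simp add: mean_vec_def)

lemma inner_sq_le: "(t \<bullet> vec_of_int z)\<^sup>2 \<le> (norm t)\<^sup>2 * norm (vec_of_int z) ^ 2"
  using Cauchy_Schwarz_ineq[of t "vec_of_int z"] by (simp add: power2_norm_eq_inner)

lemma integrable_inner2: "integrable (measure_pmf \<mu>) (\<lambda>z. (t \<bullet> vec_of_int z)\<^sup>2)"
proof (rule Bochner_Integration.integrable_bound[of _ "\<lambda>z. (norm t)\<^sup>2 * norm (vec_of_int z) ^ 2"])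
  show "integrable (measure_pmf \<mu>) (\<lambda>z. (norm t)\<^sup>2 * norm (vec_of_int z) ^ 2)"
    using integrable_norm2 by (rule integrable_mult_right)
qed (auto simp: inner_sq_le)

definition proj_var :: "real ^ 'd \<Rightarrow> real" where "proj_var t = E (\<lambda>z. (t \<bullet> vec_of_int z)\<^sup>2)"

lemma proj_var_le: "proj_var t \<le> m2 * (norm t)\<^sup>2"
proof -
  have "proj_var t \<le> E (\<lambda>z. (norm t)\<^sup>2 * norm (vec_of_int z) ^ 2)"
    unfolding proj_var_def using integrable_norm2
    by (intro integral_mono integrable_inner2 integrable_mult_right inner_sq_le)
  then show ?thesis by (simp add: m2_def mult.commute)
qed

lemma proj_var_eq: "proj_var t = t \<bullet> (covariance_matrix \<mu> *v t)"
proof -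
  have int: "integrable (measure_pmf \<mu>) (\<lambda>z. vec_of_int z $ i * vec_of_int z $ j)" for i j
  proof (rule Bochner_Integration.integrable_bound[OF integrable_norm2])
    show "AE z in measure_pmf \<mu>. norm (vec_of_int z $ i * vec_of_int z $ j) \<le> norm ((norm (vec_of_int z))\<^sup>2)"
    proof (intro AE_I2)
      fix z :: "int ^ 'd"
      have "norm (vec_of_int z $ i * vec_of_int z $ j) = norm (vec_of_int z $ i) * norm (vec_of_int z $ j)" by (rule norm_mult)
      also have "\<dots> \<le> norm (vec_of_int z) * norm (vec_of_int z)"
        by (intro mult_mono) (simp_all only: real_norm_def component_le_norm_cart norm_ge_zero abs_ge_zero)
      finally show "norm (vec_of_int z $ i * vec_of_int z $ j) \<le> norm ((norm (vec_of_int z))\<^sup>2)"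
        by (simp add: power2_eq_square)
    qed
  qed simp
  have "proj_var t = E (\<lambda>z. \<Sum>i\<in>UNIV. \<Sum>j\<in>UNIV. t $ i * t $ j * (vec_of_int z $ i * vec_of_int z $ j))"
    unfolding proj_var_def
    by (intro Bochner_Integration.integral_cong refl)
       (simp add: inner_vec_def power2_eq_square sum_product mult_ac)
  also have "\<dots> = (\<Sum>i\<in>UNIV. \<Sum>j\<in>UNIV. t $ i * t $ j * E (\<lambda>z. vec_of_int z $ i * vec_of_int z $ j))"
    using int by (simp add: Bochner_Integration.integral_sum integrable_sum integrable_mult_right del: vec_of_int_nth)
  also have "\<dots> = t \<bullet> (covariance_matrix \<mu> *v t)"
    by (simp add: covariance_matrix_def mean matrix_vector_mult_def inner_vec_def sum_distrib_left mult_ac)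
  finally show ?thesis .
qed

text \<open>Positive definiteness is uniform on the unit sphere by compactness, and \<open>proj_var\<close> is
  homogeneous of degree two.\<close>

lemma proj_var_lower: "\<exists>lam>0. \<forall>t. lam * (norm t)\<^sup>2 \<le> proj_var t"
proof -
  have cont: "continuous_on UNIV proj_var"
    unfolding proj_var_eq[abs_def] matrix_vector_mult_def inner_vec_def by (intro continuous_intros)
  have "compact (sphere (0::real^'d) 1)" "sphere (0::real^'d) 1 \<noteq> {}"
    by auto
  then obtain u where u: "u \<in> sphere 0 1" "\<And>v. v \<in> sphere 0 1 \<Longrightarrow> proj_var u \<le> proj_var v"
    using continuous_attains_inf[of "sphere 0 1" proj_var] continuous_on_subset[OF cont] by blast
  have "u \<noteq> 0" using u by auto
  then have pos: "proj_var u > 0" using cov by (auto simp: proj_var_eq positive_definite_def)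
  have "proj_var u * (norm t)\<^sup>2 \<le> proj_var t" for t
  proof (cases "t = 0")
    case False
    have "proj_var u \<le> proj_var ((1 / norm t) *\<^sub>R t)" using False by (intro u) auto
    also have "\<dots> = (1 / norm t)\<^sup>2 * proj_var t"
      by (simp add: proj_var_def power_mult_distrib power_divide)
    finally show ?thesis using False by (simp add: power_divide field_simps)
  qed (simp add: proj_var_def)
  with pos show ?thesis by blast
qed

text \<open>Taylor expansion; the linear term vanishes since the walk is centred.\<close>

lemma char_approx: "cmod (char_pmf \<mu> t - (1 - proj_var t / 2)) \<le> m3 * norm t ^ 3 / 6"
proof -
  let ?x = "\<lambda>z. t \<bullet> vec_of_int z"
  let ?f = "\<lambda>z. iexp (?x z) - (1 + \<i> * ?x z - (?x z)\<^sup>2 / 2)"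
  have i: "integrable (measure_pmf \<mu>) (\<lambda>z. complex_of_real (?x z))"
    "integrable (measure_pmf \<mu>) (\<lambda>z. complex_of_real ((?x z)\<^sup>2))"
    by (rule integrable_of_real, rule integrable_inner) (rule integrable_of_real, rule integrable_inner2)
  have "(\<integral>z. ?f z \<partial>measure_pmf \<mu>) = char_pmf \<mu> t - (1 + \<i> * complex_of_real (E ?x) - complex_of_real (E (\<lambda>z. (?x z)\<^sup>2)) / 2)"
    unfolding char_pmf_def using i
    by (simp flip: integral_complex_of_real del: of_real_power)
  also have "\<dots> = char_pmf \<mu> t - (1 - proj_var t / 2)"
    by (simp add: integral_inner_zero proj_var_def)
  finally have e: "char_pmf \<mu> t - (1 - proj_var t / 2) = (\<integral>z. ?f z \<partial>measure_pmf \<mu>)" ..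
  show ?thesis unfolding e
  proof (rule order_trans[OF norm_integral_le_AE])
    show "integrable (measure_pmf \<mu>) (\<lambda>z. norm t ^ 3 / 6 * norm (vec_of_int z) ^ 3)"
      using integrable_norm3 by (rule integrable_mult_right)
    show "AE z in measure_pmf \<mu>. cmod (?f z) \<le> norm t ^ 3 / 6 * norm (vec_of_int z) ^ 3"
    proof (rule AE_I2)
      fix z
      have "(\<Sum>k\<le>2. (\<i> * complex_of_real (?x z)) ^ k / fact k) = 1 + \<i> * ?x z - (?x z)\<^sup>2 / 2"
        by (simp add: eval_nat_numeral power2_eq_square algebra_simps)
      then have "cmod (?f z) \<le> \<bar>?x z\<bar> ^ 3 / fact 3"
        using iexp_approx1[of "?x z" 2] by (simp add: eval_nat_numeral)
      also have "\<dots> \<le> (norm t * norm (vec_of_int z)) ^ 3 / fact 3"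
        by (intro divide_right_mono power_mono Cauchy_Schwarz_ineq2) auto
      finally show "cmod (?f z) \<le> norm t ^ 3 / 6 * norm (vec_of_int z) ^ 3"
        by (simp add: power_mult_distrib fact_numeral)
    qed
  qed (simp_all add: m3_def)
qed

lemma Re_char: "Re (char_pmf \<mu> t) = E (\<lambda>z. cos (t \<bullet> vec_of_int z))"
  unfolding char_pmf_def by (subst integral_Re[symmetric]) (auto simp: Re_exp)

text \<open>Equality would make \<open>t \<bullet> z\<close> a multiple of \<open>2 * pi\<close> for all possible jumps \<open>z\<close>, hence on
  the subgroup that they generate, which is the whole lattice. The unit vectors then give
  \<open>t = 0\<close>.\<close>

lemma Re_char_less_1:
  assumes t: "\<And>i. t $ i \<in> {-pi..pi}" and "t \<noteq> 0"
  shows "Re (char_pmf \<mu> t) < 1"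
proof (rule ccontr)
  assume "\<not> Re (char_pmf \<mu> t) < 1"
  then have "E (\<lambda>z. 1 - cos (t \<bullet> vec_of_int z)) \<le> 0"
    by (subst Bochner_Integration.integral_diff)
       (auto simp: Re_char intro!: measure_pmf.integrable_const_bound[of _ 1])
  moreover have "E (\<lambda>z. 1 - cos (t \<bullet> vec_of_int z)) \<ge> 0" by (intro integral_nonneg_AE) simp
  ultimately have "E (\<lambda>z. 1 - cos (t \<bullet> vec_of_int z)) = 0" by simp
  then have "AE z in measure_pmf \<mu>. 1 - cos (t \<bullet> vec_of_int z) = 0"
    by (subst (asm) integral_nonneg_eq_0_iff_AE)
       (auto intro!: measure_pmf.integrable_const_bound[of _ 2] abs_leI simp: add_increasing2)
  then have sub: "set_pmf \<mu> \<subseteq> {z. cos (t \<bullet> vec_of_int z) = 1}"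
    by (auto simp: AE_measure_pmf_iff)
  have "add_subgroup {z. cos (t \<bullet> vec_of_int z) = 1}"
    unfolding add_subgroup_def
    by (auto simp: vec_of_int_add vec_of_int_minus inner_add_right cos_add dest!: cos_one_sin_zero)
  from aperiodic[OF this sub] have all: "cos (t \<bullet> vec_of_int z) = 1" for z by auto
  have "t $ i = 0" for i
  proof -
    have "t \<bullet> vec_of_int (axis i 1) = t $ i"
      by (simp add: inner_vec_def axis_def if_distrib cong: if_cong)
    then have c1: "cos \<bar>t $ i\<bar> = 1" using all[of "axis i 1"] by simp
    have "\<bar>t $ i\<bar> \<le> pi" using t[of i] by auto
    then show ?thesis using c1 cos_monotone_0_pi[of 0 "\<bar>t $ i\<bar>"] by (cases "t $ i = 0") auto
  qed
  then show False using \<open>t \<noteq> 0\<close> by (simp add: vec_eq_iff)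
qed

text \<open>Near the origin the expansion of the characteristic function applies; on the rest of the
  torus the real part is bounded away from one by compactness.\<close>

lemma Re_char_upper:
  "\<exists>c0>0. \<forall>t. (\<forall>i. t $ i \<in> {-pi..pi}) \<longrightarrow> Re (char_pmf \<mu> t) \<le> 1 - c0 * (norm t)\<^sup>2"
proof -
  obtain lam where lam: "lam > 0" "\<And>t. lam * (norm t)\<^sup>2 \<le> proj_var t" using proj_var_lower by blast
  define \<delta> where "\<delta> = lam / (m3 + 1)"
  have d: "\<delta> > 0" using lam m3_nonneg by (simp add: \<delta>_def)
  have near: "Re (char_pmf \<mu> t) \<le> 1 - lam / 4 * (norm t)\<^sup>2" if t: "norm t \<le> \<delta>" for t
  proof -
    have "Re (char_pmf \<mu> t) - (1 - proj_var t / 2) \<le> m3 * norm t ^ 3 / 6"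
      using complex_Re_le_cmod[of "char_pmf \<mu> t - (1 - proj_var t / 2)"] char_approx[of t] by simp
    also have "m3 * norm t ^ 3 / 6 \<le> (lam / 4) * (norm t)\<^sup>2"
    proof -
      have "m3 * norm t \<le> (m3 + 1) * \<delta>" using t m3_nonneg d by (intro mult_mono) auto
      also have "\<dots> = lam" using m3_nonneg by (simp add: \<delta>_def)
      finally have "m3 * norm t * (norm t)\<^sup>2 \<le> lam * (norm t)\<^sup>2" by (intro mult_right_mono) auto
      moreover have "m3 * norm t ^ 3 = m3 * norm t * (norm t)\<^sup>2"
        by (simp add: power2_eq_square power3_eq_cube)
      moreover have "0 \<le> lam * (norm t)\<^sup>2" using lam by simp
      ultimately show ?thesis by linarith
    qed
    finally show ?thesis using lam(2)[of t] by simp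
  qed
  define S where "S = {t::real^'d. \<forall>i. t $ i \<in> {-pi..pi}} - ball 0 \<delta>"
  have Sc: "{t::real^'d. \<forall>i. t $ i \<in> {-pi..pi}} = cbox (\<chi> i. -pi) (\<chi> i. pi)"
    by (auto simp: mem_box_cart)
  have compS: "compact S" unfolding S_def Sc by (intro compact_diff) auto
  have cont: "continuous_on UNIV (\<lambda>t. Re (char_pmf \<mu> t))"
  proof -
    have "\<bar>Re (char_pmf \<mu> t) - Re (char_pmf \<mu> s)\<bar> \<le> E (\<lambda>z. norm (vec_of_int z)) * norm (t - s)" for t s
    proof -
      have "Re (char_pmf \<mu> t) - Re (char_pmf \<mu> s) = E (\<lambda>z. cos (t \<bullet> vec_of_int z) - cos (s \<bullet> vec_of_int z))"
        unfolding Re_char by (subst Bochner_Integration.integral_diff) (auto intro!: measure_pmf.integrable_const_bound[of _ 1])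
      also have "norm \<dots> \<le> E (\<lambda>z. norm (t - s) * norm (vec_of_int z))"
      proof (rule norm_integral_le_AE)
        show "integrable (measure_pmf \<mu>) (\<lambda>z. norm (t - s) * norm (vec_of_int z))"
          using mean(1) by (intro integrable_mult_right integrable_norm)
        have "\<bar>cos a - cos b\<bar> \<le> \<bar>a - b\<bar>" for a b :: real
        proof -
          have "\<bar>cos a - cos b\<bar> = 2 * \<bar>sin ((a + b) / 2)\<bar> * \<bar>sin ((b - a) / 2)\<bar>"
            by (simp add: cos_diff_cos abs_mult)
          also have "\<dots> \<le> 2 * 1 * \<bar>(b - a) / 2\<bar>"
            by (intro mult_mono abs_sin_x_le_abs_x) auto
          finally show ?thesis by (simp add: abs_minus_commute)
        qed
        from this[of "t \<bullet> vec_of_int z" "s \<bullet> vec_of_int z" for z]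
        show "AE z in measure_pmf \<mu>. norm (cos (t \<bullet> vec_of_int z) - cos (s \<bullet> vec_of_int z)) \<le> norm (t - s) * norm (vec_of_int z)"
          using Cauchy_Schwarz_ineq2[of "t - s"]
          by (intro AE_I2) (auto simp: inner_diff_left intro: order_trans)
      qed simp
      finally show ?thesis by (simp add: mult.commute)
    qed
    then have "(E (\<lambda>z. norm (vec_of_int z)))-lipschitz_on UNIV (\<lambda>t. Re (char_pmf \<mu> t))"
      by (intro lipschitz_onI) (auto simp: dist_norm intro!: integral_nonneg_AE)
    then show ?thesis by (rule lipschitz_on_continuous_on)
  qed
  obtain k where k: "k > 0" "\<And>t. t \<in> S \<Longrightarrow> Re (char_pmf \<mu> t) \<le> 1 - k"
  proof (cases "S = {}")
    case True then show thesis using that[of 1] by auto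
  next
    case False
    then obtain u where u: "u \<in> S" "\<And>v. v \<in> S \<Longrightarrow> Re (char_pmf \<mu> v) \<le> Re (char_pmf \<mu> u)"
      using continuous_attains_sup[OF compS False continuous_on_subset[OF cont]] by blast
    have "Re (char_pmf \<mu> u) < 1" using u(1) d by (intro Re_char_less_1) (auto simp: S_def)
    then show thesis using that[of "1 - Re (char_pmf \<mu> u)"] u by auto
  qed
  define R where "R = real CARD('d) * pi\<^sup>2"
  have R: "R > 0" by (simp add: R_def)
  have nR: "(norm t)\<^sup>2 \<le> R" if "\<And>i. t $ i \<in> {-pi..pi}" for t :: "real ^ 'd"
  proof -
    have "(t $ i)\<^sup>2 \<le> pi\<^sup>2" for i using that[of i] by (intro abs_le_square_iff[THEN iffD1]) (auto simp: abs_if)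
    then have "(\<Sum>i\<in>UNIV. (t $ i)\<^sup>2) \<le> (\<Sum>i\<in>(UNIV::'d set). pi\<^sup>2)" by (intro sum_mono) auto
    then show ?thesis unfolding power2_norm_eq_inner by (simp add: inner_vec_def power2_eq_square R_def)
  qed
  show ?thesis
  proof (intro exI[of _ "min (lam / 4) (k / R)"] conjI allI impI)
    show "min (lam / 4) (k / R) > 0" using lam k R by simp
    fix t :: "real ^ 'd" assume t': "\<forall>i. t $ i \<in> {-pi..pi}"
    then have t: "\<And>i. t $ i \<in> {-pi..pi}" by blast
    show "Re (char_pmf \<mu> t) \<le> 1 - min (lam / 4) (k / R) * (norm t)\<^sup>2"
    proof (cases "norm t \<le> \<delta>")
      case True
      have "min (lam / 4) (k / R) * (norm t)\<^sup>2 \<le> lam / 4 * (norm t)\<^sup>2" by (intro mult_right_mono min.cobounded1) simp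
      then show ?thesis using near[OF True] by linarith
    next
      case False
      have "min (lam / 4) (k / R) * (norm t)\<^sup>2 \<le> k / R * R"
        using nR[OF t] k R by (intro mult_mono) auto
      moreover have "Re (char_pmf \<mu> t) \<le> 1 - k" using False t by (intro k) (auto simp: S_def)
      ultimately show ?thesis using R by simp
    qed
  qed
qed

text \<open>If \<open>z\<close> has modulus at most one, then \<open>(1 + z) / 2\<close> has squared modulus at most
  \<open>(1 + Re z) / 2\<close>.\<close>

lemma lazy_decay:
  assumes "Re (char_pmf \<mu> t) \<le> 1 - a"
  shows "cmod (char_pmf (lazy \<mu>) t) \<le> exp (- (a / 4))"
proof -
  let ?z = "char_pmf \<mu> t"
  have "(Re ?z)\<^sup>2 + (Im ?z)\<^sup>2 \<le> 1"
    using norm_char_pmf_le[of \<mu> t] power_le_one[of "cmod ?z" 2] by (simp add: cmod_power2)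
  then have "(1 + Re ?z)\<^sup>2 + (Im ?z)\<^sup>2 \<le> 4 * (1 - a / 2)"
    using assms by (simp add: power2_eq_square algebra_simps)
  then have "(cmod (char_pmf (lazy \<mu>) t))\<^sup>2 \<le> 1 - a / 2"
    by (simp add: char_pmf_lazy cmod_power2 power_divide norm_divide)
  also have "\<dots> \<le> exp (- (a / 2))" using exp_ge_add_one_self[of "- (a / 2)"] by simp
  also have "\<dots> = (exp (- (a / 4)))\<^sup>2" by (simp add: exp_of_nat_mult[symmetric])
  finally show ?thesis by (rule power2_le_imp_le) simp
qed

subsection \<open>Heat kernel of the lazy walk\<close>

abbreviation h :: "nat \<Rightarrow> int ^ 'd \<Rightarrow> real" where "h n x \<equiv> pmf (conv_pow (lazy \<mu>) n) x"

text \<open>The second conjunct allows the same constant for the quadratic form \<open>proj_var t / 4\<close> that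
  approximates the characteristic function of the lazy walk, as \<open>heat_at_origin\<close> requires.\<close>

lemma ex_fourier_decay:
  "\<exists>c>0. fourier_decay (lazy \<mu>) c \<and> (\<forall>t. c * (norm t)\<^sup>2 \<le> proj_var t / 4)"
proof -
  obtain lam where lam: "lam > 0" "\<And>t. lam * (norm t)\<^sup>2 \<le> proj_var t" using proj_var_lower by blast
  obtain c0 where c0: "c0 > 0" "\<And>t. (\<forall>i. t $ i \<in> {-pi..pi}) \<Longrightarrow> Re (char_pmf \<mu> t) \<le> 1 - c0 * (norm t)\<^sup>2"
    using Re_char_upper by blast
  define c where "c = min c0 lam / 4"
  have c: "c > 0" "c \<le> c0 / 4" "c \<le> lam / 4" using lam c0 by (auto simp: c_def)
  have "fourier_decay (lazy \<mu>) c"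
  proof
    show "c > 0" by (rule c)
    fix t :: "real ^ 'd" assume "\<And>i. t $ i \<in> {-pi..pi}"
    then have "cmod (char_pmf (lazy \<mu>) t) \<le> exp (- (c0 * (norm t)\<^sup>2 / 4))"
      by (intro lazy_decay c0) auto
    also have "c * (norm t)\<^sup>2 \<le> c0 / 4 * (norm t)\<^sup>2" using c by (intro mult_right_mono) auto
    then have "exp (- (c0 * (norm t)\<^sup>2 / 4)) \<le> exp (- c * (norm t)\<^sup>2)" by simp
    finally show "cmod (char_pmf (lazy \<mu>) t) \<le> exp (- c * (norm t)\<^sup>2)" .
  qed
  moreover have "c * (norm t)\<^sup>2 \<le> proj_var t / 4" for t
    using mult_right_mono[OF c(3), of "(norm t)\<^sup>2"] lam(2)[of t] by simp
  ultimately show ?thesis using c by blast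
qed

lemma inverse_sqrt_power_shift:
  assumes "c > 0" "n \<ge> 1"
  shows "1 / sqrt (c * real n) ^ k \<le> (sqrt 2 / sqrt c) ^ k / sqrt (real n + 1) ^ k"
proof -
  have "sqrt (real n + 1) \<le> sqrt (2 * real n)" using assms by simp
  then have "sqrt (real n + 1) ^ k \<le> (sqrt 2 * sqrt (real n)) ^ k"
    by (intro power_mono) (auto simp: real_sqrt_mult)
  then show ?thesis using assms
    by (simp add: real_sqrt_mult power_mult_distrib power_divide field_simps)
qed

lemma int_vec_norm_ge_1:
  fixes y :: "int ^ 'n::finite" assumes "y \<noteq> 0" shows "norm (vec_of_int y) \<ge> 1"
proof -
  obtain i where "y $ i \<noteq> 0" using assms by (auto simp: vec_eq_iff)
  then have "1 \<le> \<bar>vec_of_int y $ i\<bar>" by simp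
  also have "\<dots> \<le> norm (vec_of_int y)" by (rule component_le_norm_cart)
  finally show ?thesis .
qed

lemma heat_kernel_sup: "\<exists>C1\<ge>0. \<forall>n x. h n x \<le> C1 / sqrt (real n + 1) ^ CARD('d)"
proof -
  obtain c where c: "c > 0" "fourier_decay (lazy \<mu>) c" using ex_fourier_decay by blast
  interpret fourier_decay "lazy \<mu>" c by (rule c)
  let ?C = "max 1 ((sqrt 2 / sqrt c) ^ CARD('d))"
  have "h n x \<le> ?C / sqrt (real n + 1) ^ CARD('d)" for n x
  proof (cases "n = 0")
    case True
    have "h n x \<le> 1" by (rule pmf_le_1)
    then show ?thesis using True by (simp del: conv_pow.simps)
  next
    case False
    have "h n x \<le> 1 / sqrt (c * real n) ^ CARD('d)" using False by (intro heat_upper) auto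
    also have "\<dots> \<le> (sqrt 2 / sqrt c) ^ CARD('d) / sqrt (real n + 1) ^ CARD('d)"
      using False c by (intro inverse_sqrt_power_shift) auto
    also have "\<dots> \<le> ?C / sqrt (real n + 1) ^ CARD('d)" by (intro divide_right_mono) auto
    finally show ?thesis .
  qed
  then show ?thesis by (intro exI[of _ ?C]) auto
qed

lemma heat_kernel_gradient:
  "\<exists>C3\<ge>0. \<forall>n x y. \<bar>h n (x + y) - h n x\<bar> \<le> C3 * norm (vec_of_int y) / sqrt (real n + 1) ^ (CARD('d) + 1)"
proof -
  obtain c where c: "c > 0" "fourier_decay (lazy \<mu>) c" using ex_fourier_decay by blast
  interpret fourier_decay "lazy \<mu>" c by (rule c)
  let ?K = "(sqrt 2 / sqrt c) * (sqrt 2 / sqrt (c / 2)) ^ CARD('d)"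
  let ?C = "max 1 ?K"
  have "\<bar>h n (x + y) - h n x\<bar> \<le> ?C * norm (vec_of_int y) / sqrt (real n + 1) ^ (CARD('d) + 1)" for n x y
  proof (cases "n = 0")
    case True
    show ?thesis
    proof (cases "y = 0")
      case False
      have "0 \<le> h n (x + y)" "h n (x + y) \<le> 1" "0 \<le> h n x" "h n x \<le> 1" by (rule pmf_nonneg pmf_le_1)+
      then have "\<bar>h n (x + y) - h n x\<bar> \<le> 1 * 1" by linarith
      also have "\<dots> \<le> ?C * norm (vec_of_int y)" using int_vec_norm_ge_1[OF False] by (intro mult_mono) auto
      finally show ?thesis using True by (simp del: conv_pow.simps)
    qed simp
  next
    case False
    have "\<bar>h n (x + y) - h n x\<bar> \<le> norm (vec_of_int y) * (1 / sqrt (c * real n) ^ 1 * (1 / sqrt (c / 2 * real n) ^ CARD('d)))"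
      using heat_gradient[of n x y] False by simp
    also have "\<dots> \<le> norm (vec_of_int y) * (((sqrt 2 / sqrt c) ^ 1 / sqrt (real n + 1) ^ 1) * ((sqrt 2 / sqrt (c / 2)) ^ CARD('d) / sqrt (real n + 1) ^ CARD('d)))"
      using False c by (intro mult_left_mono mult_mono inverse_sqrt_power_shift) auto
    also have "\<dots> = ?K * norm (vec_of_int y) / sqrt (real n + 1) ^ (CARD('d) + 1)" by (simp add: mult_ac)
    also have "\<dots> \<le> ?C * norm (vec_of_int y) / sqrt (real n + 1) ^ (CARD('d) + 1)"
      by (intro divide_right_mono mult_right_mono) auto
    finally show ?thesis .
  qed
  then show ?thesis by (intro exI[of _ ?C]) auto
qed

text \<open>The values at \<open>x\<close> and at the origin differ by at most the gradient bound, which is at most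
  half of the lower bound at the origin as soon as \<open>n\<close> is a large multiple of the squared
  distance.\<close>

lemma heat_kernel_lower:
  "\<exists>a>0. \<exists>A\<ge>1. \<forall>n x. real n \<ge> A * (1 + norm (vec_of_int x))\<^sup>2 \<longrightarrow> a / sqrt (real n + 1) ^ CARD('d) \<le> h n x"
proof -
  obtain c where fd: "fourier_decay (lazy \<mu>) c" "\<And>t. c * (norm t)\<^sup>2 \<le> proj_var t / 4"
    using ex_fourier_decay by blast
  interpret fourier_decay "lazy \<mu>" c by (rule fd)
  obtain C3 where C3: "C3 \<ge> 0" "\<And>n x y. \<bar>h n (x + y) - h n x\<bar> \<le> C3 * norm (vec_of_int y) / sqrt (real n + 1) ^ (CARD('d) + 1)"
    using heat_kernel_gradient by blast
  define B where "B = 1 + m2 + m3"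
  have B: "B \<ge> 1" "m2 / 4 \<le> B" "m3 / 12 \<le> B" using m2_nonneg m3_nonneg by (auto simp: B_def)
  have meas: "(\<lambda>\<theta>. proj_var (vec_lambda \<theta>) / 4) \<in> borel_measurable torus"
    unfolding proj_var_eq matrix_vector_mult_def inner_vec_def by simp
  have up: "proj_var t / 4 \<le> B * (norm t)\<^sup>2" for t
    using proj_var_le[of t] mult_right_mono[OF B(2), of "(norm t)\<^sup>2"] by simp
  have ap: "cmod (char_pmf (lazy \<mu>) t - (1 - proj_var t / 4)) \<le> B * norm t ^ 3" for t
  proof -
    have e: "char_pmf (lazy \<mu>) t - (1 - proj_var t / 4) = (char_pmf \<mu> t - (1 - proj_var t / 2)) / 2"
      by (simp add: char_pmf_lazy field_simps)
    have "cmod (char_pmf (lazy \<mu>) t - (1 - proj_var t / 4)) = cmod (char_pmf \<mu> t - (1 - proj_var t / 2)) / 2"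
      by (simp only: e norm_divide norm_numeral)
    then have "cmod (char_pmf (lazy \<mu>) t - (1 - proj_var t / 4)) \<le> m3 / 12 * norm t ^ 3"
      using char_approx[of t] by linarith
    also have "\<dots> \<le> B * norm t ^ 3" by (intro mult_right_mono B) auto
    finally show ?thesis .
  qed
  obtain a b where ab: "a > 0" "b \<ge> 0"
    "\<And>n. n \<ge> 1 \<Longrightarrow> a / sqrt (real n) ^ CARD('d) - b / sqrt (real n) ^ (CARD('d) + 1) \<le> h n 0"
    using heat_at_origin[OF B(1) meas fd(2) up ap] by metis
  define q where "q = 2 * (b + C3) / a"
  define A where "A = max 1 (q\<^sup>2)"
  have q: "q \<ge> 0" using ab C3 by (simp add: q_def)
  have "(a / 2) / sqrt (real n + 1) ^ CARD('d) \<le> h n x" if n: "real n \<ge> A * (1 + norm (vec_of_int x))\<^sup>2" for n x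
  proof -
    let ?N = "1 + norm (vec_of_int x)"
    have N: "?N \<ge> 1" by simp
    have "1 * 1 \<le> A * ?N\<^sup>2" using N by (intro mult_mono) (auto simp: A_def)
    then have n1: "n \<ge> 1" using n by simp
    have "q\<^sup>2 * ?N\<^sup>2 \<le> A * ?N\<^sup>2" by (intro mult_right_mono) (auto simp: A_def)
    then have "(q * ?N)\<^sup>2 \<le> real n" using n by (simp add: power_mult_distrib)
    then have sn: "q * ?N \<le> sqrt (real n)" by (rule real_le_rsqrt)
    have "2 * (b + C3 * norm (vec_of_int x)) \<le> 2 * (b + C3) * ?N"
      using ab C3 by (simp add: algebra_simps add_increasing2)
    also have "\<dots> = a * (q * ?N)" using ab by (simp add: q_def)
    also have "\<dots> \<le> a * sqrt (real n)" using sn ab by (intro mult_left_mono) auto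
    finally have k: "b + C3 * norm (vec_of_int x) \<le> a / 2 * sqrt (real n)" by simp
    have "\<bar>h n (0 + x) - h n 0\<bar> \<le> C3 * norm (vec_of_int x) / sqrt (real n + 1) ^ (CARD('d) + 1)"
      by (rule C3)
    also have "\<dots> \<le> C3 * norm (vec_of_int x) / sqrt (real n) ^ (CARD('d) + 1)"
      using C3 n1 by (intro divide_left_mono power_mono mult_pos_pos zero_less_power) auto
    finally have "h n x \<ge> h n 0 - C3 * norm (vec_of_int x) / sqrt (real n) ^ (CARD('d) + 1)" by simp
    then have "h n x \<ge> a / sqrt (real n) ^ CARD('d) - (b + C3 * norm (vec_of_int x)) / sqrt (real n) ^ (CARD('d) + 1)"
      using ab(3)[OF n1] by (simp add: add_divide_distrib)
    moreover have "(b + C3 * norm (vec_of_int x)) / sqrt (real n) ^ (CARD('d) + 1) \<le> (a / 2 * sqrt (real n)) / sqrt (real n) ^ (CARD('d) + 1)"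
      using k by (intro divide_right_mono) auto
    moreover have "(a / 2 * sqrt (real n)) / sqrt (real n) ^ (CARD('d) + 1) = a / 2 / sqrt (real n) ^ CARD('d)"
      using n1 by simp
    ultimately have "h n x \<ge> a / 2 / sqrt (real n) ^ CARD('d)" by (simp add: field_simps)
    moreover have "a / 2 / sqrt (real n + 1) ^ CARD('d) \<le> a / 2 / sqrt (real n) ^ CARD('d)"
      using ab n1 by (intro divide_left_mono power_mono mult_pos_pos zero_less_power) auto
    ultimately show ?thesis by linarith
  qed
  moreover have "A \<ge> 1" by (simp add: A_def)
  ultimately show ?thesis using ab(1) by (intro exI[of _ "a / 2"] conjI exI[of _ A]) auto
qed

text \<open>Some coordinate of \<open>x\<close>, up to its sign, is at least \<open>norm x / d\<close>, and
  \<open>conv_pow_pointwise_decay\<close> applies to that signed coordinate.\<close>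

lemma heat_kernel_decay:
  "\<exists>C2\<ge>0. \<forall>n x. h n x \<le> C2 / (1 + norm (vec_of_int x)) ^ CARD('d)"
proof -
  let ?d = "CARD('d)"
  obtain C1 where C1: "C1 \<ge> 0" "\<And>n x. h n x \<le> C1 / sqrt (real n + 1) ^ CARD('d)"
    using heat_kernel_sup by blast
  define B where "B = (2 * real ?d) ^ ?d + C1 + 2 * C1 * sqrt 2 ^ ?d * (C * (2 * real ?d) ^ ?d + exp (8 * m2 * (real ?d)\<^sup>2))"
  have B: "B \<ge> 0" using C1 C by (simp add: B_def)
  have key: "h n x \<le> B / (s * real_of_int (x $ i)) ^ ?d"
    if s: "s = 1 \<or> s = -1" and pos: "s * real_of_int (x $ i) > 0" for n x i and s :: real
  proof -
    let ?l = "\<lambda>z::int^'d. s * real_of_int (z $ i)"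
    have lt: "?l z = (s *\<^sub>R axis i 1) \<bullet> vec_of_int z" for z
      by (simp add: inner_axis' )
    have lle: "\<bar>?l z\<bar> \<le> norm (vec_of_int z)" for z
      using component_le_norm_cart[of "vec_of_int z" i] s by (auto simp: abs_mult)
    have s2: "s * s = 1" using s by auto
    have i1: "integrable (measure_pmf \<mu>) ?l" unfolding lt by (rule integrable_inner)
    have i2: "integrable (measure_pmf \<mu>) (\<lambda>z. (?l z)\<^sup>2)" unfolding lt by (rule integrable_inner2)
    have e1: "E ?l = 0" unfolding lt by (rule integral_inner_zero)
    have e2: "E (\<lambda>z. (?l z)\<^sup>2) \<le> m2"
      unfolding m2_def using i2 integrable_norm2 lle by (intro integral_mono) (auto simp: abs_le_square_iff[symmetric])
    have e2n: "E (\<lambda>z. (?l z)\<^sup>2) \<ge> 0" by (intro integral_nonneg_AE) auto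
    have "h n x \<le> ((2 * real ?d) ^ ?d + C1 + 2 * C1 * sqrt 2 ^ ?d * (C * (2 * real ?d) ^ ?d + exp (8 * m2 * (real ?d)\<^sup>2))) / (?l x) ^ ?d"
    proof (rule conv_pow_pointwise_decay)
      show "integrable (measure_pmf (lazy \<mu>)) ?l" "integrable (measure_pmf (lazy \<mu>)) (\<lambda>z. (?l z)\<^sup>2)"
        using i1 i2 by (auto intro: integrable_lazy)
      show "measure_pmf.expectation (lazy \<mu>) ?l = 0" unfolding integral_lazy[OF i1] e1 by simp
      show "measure_pmf.expectation (lazy \<mu>) (\<lambda>z. (?l z)\<^sup>2) \<le> m2" unfolding integral_lazy[OF i2] using e2 e2n m2_nonneg by simp
      fix M :: real assume M: "M \<ge> 1"
      have "measure_pmf.prob (lazy \<mu>) {z. ?l z > M} = (indicator {z. ?l z > M} 0 + measure_pmf.prob \<mu> {z. ?l z > M}) / 2"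
      proof -
        have "integrable (measure_pmf \<mu>) (indicator {z. ?l z > M} :: _ \<Rightarrow> real)"
          by (rule measure_pmf.integrable_const_bound[of _ 1]) auto
        from integral_lazy[OF this] show ?thesis by simp
      qed
      also have "\<dots> \<le> measure_pmf.prob \<mu> {z. ?l z > M}" using M by (simp add: indicator_def)
      also have "\<dots> \<le> measure_pmf.prob \<mu> {z. norm (vec_of_int z) > M}"
        using lle by (intro measure_pmf.finite_measure_mono) (auto intro: less_le_trans[OF _ order_trans[OF abs_ge_self]])
      also have "\<dots> \<le> C / M ^ ?d" using tail[OF M] by simp
      finally show "measure_pmf.prob (lazy \<mu>) {z. ?l z > M} \<le> C / M ^ ?d" .
    qed (use C1 C dim pos in \<open>auto simp: distrib_left\<close>)
    then show ?thesis by (simp add: B_def)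
  qed
  have "h n x \<le> max 1 (B * (2 * real ?d) ^ ?d) / (1 + norm (vec_of_int x)) ^ ?d" for n x
  proof (cases "x = 0")
    case True
    then show ?thesis using pmf_le_1[of "conv_pow (lazy \<mu>) n" x] by simp
  next
    case False
    obtain i where i: "\<And>j. \<bar>x $ j\<bar> \<le> \<bar>x $ i\<bar>"
    proof -
      have "Max (range (\<lambda>j. \<bar>x $ j\<bar>)) \<in> range (\<lambda>j. \<bar>x $ j\<bar>)" by (intro Max_in) auto
      then obtain i where "Max (range (\<lambda>j. \<bar>x $ j\<bar>)) = \<bar>x $ i\<bar>" by (rule rangeE)
      then have "\<bar>x $ j\<bar> \<le> \<bar>x $ i\<bar>" for j using Max_ge[of "range (\<lambda>j. \<bar>x $ j\<bar>)" "\<bar>x $ j\<bar>"] by simp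
      then show thesis by (rule that)
    qed
    define r where "r = real_of_int \<bar>x $ i\<bar>"
    have "x $ i \<noteq> 0"
    proof
      assume "x $ i = 0"
      then have "x $ j = 0" for j using i[of j] by simp
      then show False using False by (simp add: vec_eq_iff)
    qed
    then have r: "r > 0" by (simp add: r_def)
    have "norm (vec_of_int x) \<le> (\<Sum>j\<in>UNIV. \<bar>vec_of_int x $ j\<bar>)" by (rule norm_le_l1_cart)
    also have "\<dots> \<le> (\<Sum>j\<in>(UNIV::'d set). r)"
      using i by (intro sum_mono) (auto simp: r_def simp flip: of_int_abs)
    finally have "norm (vec_of_int x) \<le> real ?d * r" by simp
    then have "1 + norm (vec_of_int x) \<le> 2 * real ?d * r" using int_vec_norm_ge_1[OF False] by linarith
    then have "(1 + norm (vec_of_int x)) ^ ?d \<le> (2 * real ?d * r) ^ ?d" by (intro power_mono) auto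
    then have "B * (1 + norm (vec_of_int x)) ^ ?d \<le> B * (2 * real ?d * r) ^ ?d" using B by (rule mult_left_mono)
    then have le: "B / r ^ ?d \<le> B * (2 * real ?d) ^ ?d / (1 + norm (vec_of_int x)) ^ ?d"
      using r by (simp add: power_mult_distrib divide_simps add_pos_nonneg mult_ac)
    have "h n x \<le> B / r ^ ?d"
    proof (cases "x $ i > 0")
      case True then show ?thesis using key[of 1 x i n] by (simp add: r_def)
    next
      case False then show ?thesis using key[of "-1" x i n] \<open>x $ i \<noteq> 0\<close> by (simp add: r_def)
    qed
    also note le
    also have "B * (2 * real ?d) ^ ?d / (1 + norm (vec_of_int x)) ^ ?d \<le> max 1 (B * (2 * real ?d) ^ ?d) / (1 + norm (vec_of_int x)) ^ ?d"
      by (intro divide_right_mono) auto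
    finally show ?thesis .
  qed
  then show ?thesis by (intro exI[of _ "max 1 (B * (2 * real ?d) ^ ?d)"]) auto
qed

end

section \<open>The Green function\<close>

text \<open>Four of the \<open>k\<close> square roots are compared with the telescoping terms \<open>1 / (n * (n + 1))\<close>,
  and the others with their value at the beginning.\<close>

lemma sum_inverse_sqrt_power_tail:
  fixes M k :: nat
  assumes k: "k \<ge> 4" and M: "M \<ge> 1"
  shows "summable (\<lambda>i. 1 / sqrt (real (M + i) + 1) ^ k)"
    and "(\<Sum>i. 1 / sqrt (real (M + i) + 1) ^ k) \<le> 1 / sqrt (real M) ^ (k - 2)"
proof -
  let ?g = "\<lambda>i. 1 / real (M + i) - 1 / real (M + Suc i)"
  have "(\<lambda>i. 1 / real (M + i)) \<longlonglongrightarrow> 0" 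
    using LIMSEQ_ignore_initial_segment[OF lim_1_over_n, of M] by (simp add: add.commute)
  from telescope_sums'[OF this] have g: "?g sums (1 / real M)" by simp
  let ?a = "1 / sqrt (real M) ^ (k - 4)"
  have le: "1 / sqrt (real (M + i) + 1) ^ k \<le> ?a * ?g i" for i
  proof -
    let ?n = "real (M + i)"
    have n: "?n \<ge> 1" using M by simp
    have "sqrt (?n + 1) ^ k = sqrt (?n + 1) ^ (k - 4) * sqrt (?n + 1) ^ 4"
      using k by (simp flip: power_add)
    also have "sqrt (?n + 1) ^ 4 = (?n + 1)\<^sup>2"
      by (metis (no_types) add_increasing n numeral_Bit0 power_add power2_eq_square real_sqrt_pow2 order_trans zero_le_one)
    finally have e: "1 / sqrt (?n + 1) ^ k = (1 / sqrt (?n + 1) ^ (k - 4)) * (1 / (?n + 1)\<^sup>2)" by simp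
    have "1 / (?n + 1)\<^sup>2 \<le> 1 / (?n * (?n + 1))"
      using n by (intro divide_left_mono) (auto simp: power2_eq_square)
    also have "\<dots> = ?g i" using n by (simp add: field_simps)
    finally have "1 / (?n + 1)\<^sup>2 \<le> ?g i" .
    moreover have "1 / sqrt (?n + 1) ^ (k - 4) \<le> ?a"
      using M by (intro divide_left_mono power_mono mult_pos_pos zero_less_power) auto
    ultimately show ?thesis unfolding e using M by (intro mult_mono) auto
  qed
  have s: "summable (\<lambda>i. ?a * ?g i)" using g by (intro summable_mult) (rule sums_summable)
  show sm: "summable (\<lambda>i. 1 / sqrt (real (M + i) + 1) ^ k)"
    by (rule summable_comparison_test'[OF s, of 0]) (use le in simp)
  have "(\<Sum>i. 1 / sqrt (real (M + i) + 1) ^ k) \<le> (\<Sum>i. ?a * ?g i)" by (intro suminf_le le sm s)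
  also have "\<dots> = ?a * (1 / real M)" using g by (subst suminf_mult) (auto simp: sums_iff)
  also have "\<dots> = 1 / sqrt (real M) ^ (k - 2)"
  proof -
    have "k - 2 = (k - 4) + 2" using k by simp
    then show ?thesis using M by (simp only: power_add) simp
  qed
  finally show "(\<Sum>i. 1 / sqrt (real (M + i) + 1) ^ k) \<le> 1 / sqrt (real M) ^ (k - 2)" .
qed

context centred_walk begin

definition G :: "int ^ 'd \<Rightarrow> real" where "G x = (\<Sum>n. h n x)"

abbreviation N :: "int ^ 'd \<Rightarrow> real" where "N x \<equiv> 1 + norm (vec_of_int x)"

lemma N_ge_1: "N x \<ge> 1" by simp

lemma N_add_le: "N (x + y) \<le> N x * N y"
proof -
  have "norm (vec_of_int (x + y)) \<le> norm (vec_of_int x) + norm (vec_of_int y)"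
    by (simp add: vec_of_int_add norm_triangle_ineq)
  moreover have "0 \<le> norm (vec_of_int x) * norm (vec_of_int y)" by simp
  moreover have "N x * N y = 1 + norm (vec_of_int x) + norm (vec_of_int y) + norm (vec_of_int x) * norm (vec_of_int y)"
    by (simp add: algebra_simps)
  ultimately show ?thesis by linarith
qed

lemma power_card_split: "a ^ CARD('d) = (a::real)\<^sup>2 * a ^ (CARD('d) - 2)"
proof -
  have "CARD('d) = 2 + (CARD('d) - 2)" using dim by simp
  then show ?thesis by (metis power_add)
qed

lemma N_minus [simp]: "N (- x) = N x" by (simp add: vec_of_int_minus)

lemma summable_h: "summable (\<lambda>n. h n x)"
proof -
  obtain C1 where C1: "C1 \<ge> 0" "\<And>n x. h n x \<le> C1 / sqrt (real n + 1) ^ CARD('d)"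
    using heat_kernel_sup by blast
  have "summable (\<lambda>i. C1 * (1 / sqrt (real (1 + i) + 1) ^ CARD('d)))"
    using dim by (intro summable_mult sum_inverse_sqrt_power_tail) auto
  then have "summable (\<lambda>i. h (i + 1) x)"
    by (rule summable_comparison_test'[of _ 0]) (use C1(2)[of "_ + 1" x] in \<open>simp add: pmf_nonneg add_ac\<close>)
  then show ?thesis by (subst (asm) summable_iff_shift)
qed

lemma G_nonneg: "G x \<ge> 0"
  unfolding G_def by (intro suminf_nonneg summable_h pmf_nonneg)

lemma ennreal_G: "ennreal (G x) = (\<Sum>n. ennreal (h n x))"
  unfolding G_def by (intro suminf_ennreal2[symmetric] summable_h pmf_nonneg)

lemma G_split: "G x = (\<Sum>n<M. h n x) + (\<Sum>i. h (M + i) x)"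
  unfolding G_def using suminf_split_initial_segment[OF summable_h, of x M] by (simp add: add_ac)

lemma summable_h_shift: "summable (\<lambda>i. h (M + i) x)"
  using summable_h[of x] by (subst add.commute) (rule summable_ignore_initial_segment)

text \<open>The terms with \<open>n \<le> (N x)\<^sup>2\<close> are bounded by the decay in \<open>x\<close>, the others by the decay in
  \<open>n\<close>.\<close>

lemma G_upper: "\<exists>K\<ge>0. \<forall>x. G x \<le> K / N x ^ (CARD('d) - 2)"
proof -
  let ?d = "CARD('d)"
  obtain C1 where C1: "C1 \<ge> 0" "\<And>n x. h n x \<le> C1 / sqrt (real n + 1) ^ ?d"
    using heat_kernel_sup by blast
  obtain C2 where C2: "C2 \<ge> 0" "\<And>n x. h n x \<le> C2 / N x ^ ?d"
    using heat_kernel_decay by blast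
  have "G x \<le> (2 * C2 + C1) / N x ^ (?d - 2)" for x
  proof -
    define M where "M = nat \<lceil>(N x)\<^sup>2\<rceil>"
    have N2: "(N x)\<^sup>2 \<ge> 1" using N_ge_1[of x] by (intro one_le_power)
    have M: "real M \<ge> (N x)\<^sup>2" "real M \<le> (N x)\<^sup>2 + 1" "M \<ge> 1"
      using N2 unfolding M_def by linarith+
    have Nd: "N x ^ ?d = (N x)\<^sup>2 * N x ^ (?d - 2)" by (rule power_card_split)
    have Np: "N x > 0" using N_ge_1[of x] by linarith
    have "(\<Sum>n<M. h n x) \<le> (\<Sum>n<M. C2 / N x ^ ?d)" by (intro sum_mono C2)
    also have "\<dots> = real M * (C2 / N x ^ ?d)" by simp
    also have "real M \<le> 2 * (N x)\<^sup>2" using M N2 by linarith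
    then have "real M * (C2 / N x ^ ?d) \<le> (2 * (N x)\<^sup>2) * (C2 / N x ^ ?d)"
      using C2 Np by (intro mult_right_mono) auto
    also have "\<dots> = 2 * C2 / N x ^ (?d - 2)" unfolding Nd using Np by simp
    finally have 1: "(\<Sum>n<M. h n x) \<le> 2 * C2 / N x ^ (?d - 2)" .
    have "(\<Sum>i. h (M + i) x) \<le> (\<Sum>i. C1 * (1 / sqrt (real (M + i) + 1) ^ ?d))"
      using C1(2)[of "M + _" x] dim M by (intro suminf_le summable_h_shift summable_mult sum_inverse_sqrt_power_tail) auto
    also have "\<dots> \<le> C1 * (1 / sqrt (real M) ^ (?d - 2))"
    proof -
      have T: "summable (\<lambda>i. 1 / sqrt (real (M + i) + 1) ^ ?d)"
        "(\<Sum>i. 1 / sqrt (real (M + i) + 1) ^ ?d) \<le> 1 / sqrt (real M) ^ (?d - 2)"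
        using dim M by (intro sum_inverse_sqrt_power_tail; simp)+
      show ?thesis by (simp only: suminf_mult[OF T(1)]) (intro mult_left_mono T C1)
    qed
    also have "\<dots> \<le> C1 * (1 / N x ^ (?d - 2))"
      using M Np C1 by (intro mult_left_mono divide_left_mono power_mono mult_pos_pos zero_less_power real_le_rsqrt) auto
    finally show ?thesis using 1 by (subst G_split[of x M]) (simp add: add_divide_distrib)
  qed
  then show ?thesis using C1 C2 by (intro exI[of _ "2 * C2 + C1"]) auto
qed

text \<open>The times between \<open>A * (N x)\<^sup>2\<close> and twice that number, with \<open>A\<close> as in \<open>heat_kernel_lower\<close>,
  already contribute the claimed order.\<close>

lemma G_lower: "\<exists>k>0. \<forall>x. k / N x ^ (CARD('d) - 2) \<le> G x"
proof -
  let ?d = "CARD('d)"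
  obtain a A where a: "a > 0" "A \<ge> 1"
    "\<And>n x. real n \<ge> A * (N x)\<^sup>2 \<Longrightarrow> a / sqrt (real n + 1) ^ ?d \<le> h n x"
    using heat_kernel_lower by blast
  define q where "q = sqrt (2 * A)"
  have q: "q > 0" using a by (simp add: q_def)
  have "a / (sqrt 2 ^ ?d * q ^ (?d - 2)) / N x ^ (?d - 2) \<le> G x" for x
  proof -
    define M where "M = nat \<lceil>A * (N x)\<^sup>2\<rceil>"
    have N2: "A * (N x)\<^sup>2 \<ge> 1 * 1" using N_ge_1[of x] a by (intro mult_mono one_le_power) auto
    have M: "real M \<ge> A * (N x)\<^sup>2" "real M \<le> A * (N x)\<^sup>2 + 1" "M \<ge> 1"
      using N2 unfolding M_def by linarith+
    have Np: "N x > 0" using N_ge_1[of x] by linarith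
    have "real M \<le> (q * N x)\<^sup>2" using M N2 a by (simp add: q_def power_mult_distrib)
    then have sM: "sqrt (real M) \<le> q * N x" using q Np by (intro real_le_lsqrt) auto
    have dM: "sqrt (2 * real M) ^ ?d = sqrt 2 ^ ?d * (real M * sqrt (real M) ^ (?d - 2))"
    proof -
      have "sqrt (real M) ^ ?d = sqrt (real M) ^ 2 * sqrt (real M) ^ (?d - 2)" by (rule power_card_split)
      then show ?thesis by (simp add: real_sqrt_mult power_mult_distrib)
    qed
    have "a / (sqrt 2 ^ ?d * q ^ (?d - 2)) / N x ^ (?d - 2) = a / (sqrt 2 ^ ?d * (q * N x) ^ (?d - 2))"
      by (simp add: power_mult_distrib)
    also have "\<dots> \<le> a / (sqrt 2 ^ ?d * sqrt (real M) ^ (?d - 2))"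
      using sM a M q Np by (intro divide_left_mono mult_left_mono power_mono mult_pos_pos zero_less_power) auto
    also have "\<dots> = (\<Sum>n\<in>{M..<2*M}. a / sqrt (2 * real M) ^ ?d)"
      unfolding dM using M(3) by simp
    also have "\<dots> \<le> (\<Sum>n\<in>{M..<2*M}. h n x)"
    proof (rule sum_mono)
      fix n assume n: "n \<in> {M..<2*M}"
      have "a / sqrt (2 * real M) ^ ?d \<le> a / sqrt (real n + 1) ^ ?d"
        using n a by (intro divide_left_mono power_mono mult_pos_pos zero_less_power) auto
      also have "\<dots> \<le> h n x" using n M by (intro a) auto
      finally show "a / sqrt (2 * real M) ^ ?d \<le> h n x" .
    qed
    also have "\<dots> \<le> G x" unfolding G_def by (intro sum_le_suminf summable_h) (auto simp: pmf_nonneg)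
    finally show ?thesis .
  qed
  then show ?thesis using a q by (intro exI[of _ "a / (sqrt 2 ^ ?d * q ^ (?d - 2))"]) auto
qed

lemma G_pos: "G x > 0"
proof -
  obtain k where "k > 0" "k / N x ^ (CARD('d) - 2) \<le> G x" using G_lower by blast
  moreover have "k / N x ^ (CARD('d) - 2) > 0" using \<open>k > 0\<close> N_ge_1[of x] by (intro divide_pos_pos zero_less_power) linarith+
  ultimately show ?thesis by linarith
qed

text \<open>The 3G-inequality. The one of \<open>x\<close> and \<open>y\<close> that is farther out has at least half the size of
  \<open>x + y\<close>, so that \<open>G\<close> at this point is at most a multiple of \<open>G (x + y)\<close>.\<close>

lemma G_three:
  "\<exists>K>0. \<forall>x y. G x * G y \<le> K * G (x + y) * (G x + G y)"
proof -
  let ?e = "CARD('d) - 2"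
  obtain K where K: "K \<ge> 0" "\<And>x. G x \<le> K / N x ^ ?e" using G_upper by blast
  obtain k where k: "k > 0" "\<And>x. k / N x ^ ?e \<le> G x" using G_lower by blast
  have far: "G x \<le> (K * 2 ^ ?e / k) * G (x + y)" if "N x \<ge> N y" for x y
  proof -
    have "N (x + y) \<le> 2 * N x" using that norm_triangle_ineq[of "vec_of_int x" "vec_of_int y"] by (simp add: vec_of_int_add)
    then have "N (x + y) ^ ?e \<le> (2 * N x) ^ ?e" using N_ge_1[of "x + y"] by (intro power_mono) auto
    then have p: "N (x + y) ^ ?e \<le> 2 ^ ?e * N x ^ ?e" by (simp only: power_mult_distrib)
    have pos: "N x ^ ?e > 0" "N (x + y) ^ ?e > 0" using N_ge_1[of x] N_ge_1[of "x + y"] by (intro zero_less_power; linarith)+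
    have "G x \<le> K / N x ^ ?e" by (rule K)
    also have "\<dots> \<le> K * 2 ^ ?e / N (x + y) ^ ?e"
      using mult_left_mono[OF p K(1)] pos 
      by (simp only: pos_divide_le_eq[OF pos(1)] times_divide_eq_left pos_le_divide_eq[OF pos(2)] mult.assoc)
    also have "\<dots> = (K * 2 ^ ?e / k) * (k / N (x + y) ^ ?e)" using k by simp
    also have "\<dots> \<le> (K * 2 ^ ?e / k) * G (x + y)" using K k by (intro mult_left_mono) auto
    finally show ?thesis .
  qed
  define L where "L = K * 2 ^ ?e / k"
  have L0: "L \<ge> 0" using K k by (simp add: L_def)
  have "G x * G y \<le> (L + 1) * G (x + y) * (G x + G y)" for x y
  proof -
    have pn: "G x \<ge> 0" "G y \<ge> 0" "G (x + y) \<ge> 0" by (rule G_nonneg)+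
    have "G x * G y \<le> L * G (x + y) * (G x + G y)"
    proof (cases "N x \<ge> N y")
      case True
      have "G x * G y \<le> L * G (x + y) * G y" using far[OF True] pn by (intro mult_right_mono) (auto simp: L_def)
      then show ?thesis using mult_nonneg_nonneg[OF mult_nonneg_nonneg[OF L0 pn(3)] pn(1)]
        unfolding distrib_left by linarith
    next
      case False
      have "G y * G x \<le> L * G (y + x) * G x" using far[of x y] far[of y x] False pn by (intro mult_right_mono) (auto simp: L_def)
      then show ?thesis using mult_nonneg_nonneg[OF mult_nonneg_nonneg[OF L0 pn(3)] pn(2)]
        unfolding distrib_left add.commute[of y x] mult.commute[of "G y" "G x"] by linarith
    qed
    also have "\<dots> \<le> (L + 1) * G (x + y) * (G x + G y)" using pn by (intro mult_right_mono) auto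
    finally show ?thesis .
  qed
  then show ?thesis using L0 by (intro exI[of _ "L + 1"]) auto
qed

lemma nn_integral_h: "(\<integral>\<^sup>+x. ennreal (h n x) \<partial>count_space UNIV) = 1"
  by (rule nn_integral_pmf_eq_1)

text \<open>The square is a double series over times \<open>m\<close> and \<open>n\<close>. The factor belonging to the larger
  time, say \<open>n\<close>, is bounded uniformly in space by a multiple of the power \<open>- 5 / 2\<close> of
  \<open>n + 1\<close>, hence by the product of the powers \<open>- 5 / 4\<close> of \<open>n + 1\<close> and \<open>m + 1\<close>; the
  other factor is a probability distribution. In dimension four the double series would diverge
  logarithmically.\<close>

lemma G_square_summable: "(\<integral>\<^sup>+x. ennreal (G x ^ 2) \<partial>count_space UNIV) < \<infinity>"
proof -
  obtain C1 where C1: "C1 \<ge> 0" "\<And>n x. h n x \<le> C1 / sqrt (real n + 1) ^ CARD('d)"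
    using heat_kernel_sup by blast
  let ?w = "\<lambda>n. (real n + 1) powr (- 5 / 4)"
  have w: "summable ?w"
  proof -
    have "summable (\<lambda>n. real (Suc n) powr (- 5 / 4))"
      by (subst summable_Suc_iff[of "\<lambda>n. real n powr (- 5 / 4)"]) (simp add: summable_real_powr_iff)
    then show ?thesis by (simp add: add_ac)
  qed
  have term': "(\<integral>\<^sup>+x. ennreal (h n x) * ennreal (h m x) \<partial>count_space UNIV) \<le> ennreal (C1 * ?w n * ?w m)"
    if nm: "m \<le> n" for n m
  proof -
    have "1 / sqrt (real n + 1) ^ CARD('d) \<le> 1 / sqrt (real n + 1) ^ 5"
      using dim by (intro divide_left_mono power_increasing) auto
    also have "sqrt (real n + 1) ^ 5 = (real n + 1) powr (5 / 2)"
      by (simp add: powr_half_sqrt[symmetric] powr_powr flip: powr_realpow)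
    also have "1 / (real n + 1) powr (5 / 2) = ?w n * ?w n"
      by (simp add: powr_minus_divide flip: powr_add)
    also have "\<dots> \<le> ?w n * ?w m"
      using nm by (intro mult_left_mono powr_mono2') auto
    finally have "C1 * (1 / sqrt (real n + 1) ^ CARD('d)) \<le> C1 * (?w n * ?w m)" using C1 by (intro mult_left_mono)
    then have "h n x \<le> C1 * ?w n * ?w m" for x using C1(2)[of n x] by (simp add: mult.assoc)
    then have "(\<integral>\<^sup>+x. ennreal (h n x) * ennreal (h m x) \<partial>count_space UNIV) \<le> (\<integral>\<^sup>+x. ennreal (C1 * ?w n * ?w m) * ennreal (h m x) \<partial>count_space UNIV)"
      by (intro nn_integral_mono mult_right_mono ennreal_leI) auto
    also have "\<dots> = ennreal (C1 * ?w n * ?w m)" by (simp add: nn_integral_cmult nn_integral_h)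
    finally show ?thesis .
  qed
  have summand: "(\<integral>\<^sup>+x. ennreal (h n x) * ennreal (h m x) \<partial>count_space UNIV) \<le> ennreal (C1 * ?w n * ?w m)" for n m
  proof (cases "m \<le> n")
    case True then show ?thesis by (rule term')
  next
    case False then show ?thesis using term'[of n m] by (simp add: mult.commute mult.left_commute)
  qed
  have "(\<integral>\<^sup>+x. ennreal (G x ^ 2) \<partial>count_space UNIV) =
    (\<integral>\<^sup>+x. (\<Sum>n. \<Sum>m. ennreal (h n x) * ennreal (h m x)) \<partial>count_space UNIV)"
  proof (intro nn_integral_cong)
    fix x
    have "ennreal (G x ^ 2) = ennreal (G x) * ennreal (G x)"
      unfolding power2_eq_square by (intro ennreal_mult G_nonneg)
    also have "\<dots> = (\<Sum>n. \<Sum>m. ennreal (h n x) * ennreal (h m x))"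
      unfolding ennreal_suminf_cmult ennreal_suminf_multc ennreal_G ..
    finally show "ennreal (G x ^ 2) = (\<Sum>n. \<Sum>m. ennreal (h n x) * ennreal (h m x))" .
  qed
  also have "\<dots> = (\<Sum>n. \<Sum>m. \<integral>\<^sup>+x. ennreal (h n x) * ennreal (h m x) \<partial>count_space UNIV)"
    by (simp add: nn_integral_suminf del: ennreal_suminf_cmult ennreal_suminf_multc)
  also have "\<dots> \<le> (\<Sum>n. \<Sum>m. ennreal (C1 * ?w n * ?w m))"
    by (intro suminf_le summand allI) auto
  also have "\<dots> = (\<Sum>n. ennreal (C1 * ?w n * suminf ?w))"
    using C1 w by (subst suminf_ennreal2) (auto intro!: summable_mult simp: suminf_mult)
  also have "\<dots> = ennreal (C1 * suminf ?w * suminf ?w)"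
  proof -
    have "(\<Sum>n. ennreal (C1 * ?w n * suminf ?w)) = (\<Sum>n. ennreal (C1 * suminf ?w * ?w n))"
      by (simp add: mult_ac)
    also have "\<dots> = ennreal (\<Sum>n. C1 * suminf ?w * ?w n)"
      using C1 w by (intro suminf_ennreal2 summable_mult mult_nonneg_nonneg suminf_nonneg) auto
    also have "(\<Sum>n. C1 * suminf ?w * ?w n) = C1 * suminf ?w * suminf ?w" by (rule suminf_mult[OF w])
    finally show ?thesis .
  qed
  also have "\<dots> < \<infinity>" by simp
  finally show ?thesis .
qed

definition at_inf :: "(int ^ 'd) filter" where
  "at_inf = filtercomap (\<lambda>x. norm (vec_of_int x)) at_top"

lemma filterlim_N: "filterlim N at_top at_inf"
proof -
  have "filterlim (\<lambda>x. norm (vec_of_int x)) at_top at_inf"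
    unfolding at_inf_def by (rule filterlim_filtercomap)
  then show ?thesis by (intro filterlim_tendsto_add_at_top[OF tendsto_const])
qed

lemma at_inf_neq_bot: "at_inf \<noteq> bot"
proof -
  have "\<exists>x :: int ^ 'd. norm (vec_of_int x) \<ge> b" for b :: real
  proof -
    let ?x = "axis undefined \<lceil>\<bar>b\<bar>\<rceil> :: int ^ 'd"
    have "b \<le> \<bar>vec_of_int ?x $ undefined\<bar>" by (simp add: axis_def) linarith
    also have "\<dots> \<le> norm (vec_of_int ?x)" by (rule component_le_norm_cart)
    finally show ?thesis by blast
  qed
  then show ?thesis unfolding at_inf_def
    by (intro filtercomap_neq_bot) (metis eventually_at_top_linorder)
qed

text \<open>Relative to \<open>G x\<close>, the terms with \<open>n \<le> \<epsilon> * (N x)\<^sup>2\<close> contribute a multiple of \<open>\<epsilon>\<close> to the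
  difference, up to a vanishing term, by the decay in \<open>x\<close>. For the later terms the gradient
  bound gains a factor \<open>1 / N x\<close>.\<close>

lemma G_ratio: "((\<lambda>x. G (x + y) / G x) \<longlongrightarrow> 1) at_inf"
proof (rule tendstoI)
  fix e :: real assume e: "e > 0"
  let ?d = "CARD('d)"
  obtain C2 where C2: "C2 \<ge> 0" "\<And>n x. h n x \<le> C2 / N x ^ ?d"
    using heat_kernel_decay by blast
  obtain C3 where C3: "C3 \<ge> 0" "\<And>n x y. \<bar>h n (x + y) - h n x\<bar> \<le> C3 * norm (vec_of_int y) / sqrt (real n + 1) ^ (?d + 1)"
    using heat_kernel_gradient by blast
  obtain k where k: "k > 0" "\<And>x. k / N x ^ (?d - 2) \<le> G x" using G_lower by blast
  define Y where "Y = C3 * norm (vec_of_int y)"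
  define K where "K = C2 * (1 + N y ^ ?d)"
  have Y0: "Y \<ge> 0" using C3 by (simp add: Y_def)
  have K0: "K \<ge> 0" using C2 by (simp add: K_def)
  \<comment> \<open>The threshold makes \<open>K * \<epsilon> / k\<close>, the contribution of the
    early terms, smaller than \<open>e\<close>.\<close>
  define \<epsilon> where "\<epsilon> = (e * k / 4) / (K + 1)"
  have eps: "\<epsilon> > 0" using e k K0 by (simp add: \<epsilon>_def)
  have bound: "\<bar>G (x + y) / G x - 1\<bar> \<le> (K * \<epsilon> + K / (N x)\<^sup>2 + Y / (sqrt \<epsilon> ^ (?d - 1) * N x)) / k" for x
  proof -
    define M where "M = nat \<lceil>\<epsilon> * (N x)\<^sup>2\<rceil>"
    have Np: "N x > 0" using N_ge_1[of x] by linarith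
    have "\<epsilon> * (N x)\<^sup>2 > 0" using eps Np by simp
    then have M: "real M \<ge> \<epsilon> * (N x)\<^sup>2" "real M \<le> \<epsilon> * (N x)\<^sup>2 + 1" "M \<ge> 1"
      unfolding M_def by linarith+
    have sM: "sqrt \<epsilon> * N x \<le> sqrt (real M)"
      using real_sqrt_le_mono[OF M(1)] Np by (simp add: real_sqrt_mult)
    have Nd: "N x ^ ?d = (N x)\<^sup>2 * N x ^ (?d - 2)" by (rule power_card_split)
    have hs: "h n (x + y) + h n x \<le> K / N x ^ ?d" for n
    proof -
      have "N x \<le> N (x + y) * N (- y)" using N_add_le[of "x + y" "- y"] by simp
      then have "N x ^ ?d \<le> (N (x + y) * N y) ^ ?d" using Np by (intro power_mono) auto
      then have "N x ^ ?d \<le> N (x + y) ^ ?d * N y ^ ?d" by (simp add: power_mult_distrib)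
      from mult_left_mono[OF this C2(1)] have "C2 * N x ^ ?d \<le> C2 * (N (x + y) ^ ?d * N y ^ ?d)" .
      have "C2 / N (x + y) ^ ?d \<le> C2 * N y ^ ?d / N x ^ ?d"
      proof -
        have pos: "N (x + y) ^ ?d > 0" "N x ^ ?d > 0"
          using Np N_ge_1[of "x + y"] by (intro zero_less_power; linarith)+
        show ?thesis using \<open>C2 * N x ^ ?d \<le> C2 * (N (x + y) ^ ?d * N y ^ ?d)\<close>
          by (simp only: pos_divide_le_eq[OF pos(1)] times_divide_eq_left pos_le_divide_eq[OF pos(2)])
             (simp only: mult_ac)
      qed
      then show ?thesis using C2(2)[of n x] C2(2)[of n "x + y"]
        unfolding K_def by (simp add: distrib_left add_divide_distrib)
    qed
    have "\<bar>\<Sum>n<M. h n (x + y) - h n x\<bar> \<le> (\<Sum>n<M. K / N x ^ ?d)"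
    proof (rule order_trans[OF sum_abs sum_mono])
      fix n
      have "0 \<le> h n (x + y)" "0 \<le> h n x" by (rule pmf_nonneg)+
      then show "\<bar>h n (x + y) - h n x\<bar> \<le> K / N x ^ ?d" using hs[of n] by linarith
    qed
    also have "\<dots> = real M * (K / N x ^ ?d)" by simp
    also have "\<dots> \<le> (\<epsilon> * (N x)\<^sup>2 + 1) * (K / N x ^ ?d)" using M K0 Np by (intro mult_right_mono) auto
    also have "\<dots> = (K * \<epsilon> + K / (N x)\<^sup>2) / N x ^ (?d - 2)"
      unfolding Nd using Np by (simp add: field_simps)
    finally have 1: "\<bar>\<Sum>n<M. h n (x + y) - h n x\<bar> \<le> (K * \<epsilon> + K / (N x)\<^sup>2) / N x ^ (?d - 2)" .
    let ?s = "\<lambda>i. Y * (1 / sqrt (real (M + i) + 1) ^ (?d + 1))"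
    have ss: "summable ?s" using dim M by (intro summable_mult sum_inverse_sqrt_power_tail) auto
    have si: "\<bar>h (M + i) (x + y) - h (M + i) x\<bar> \<le> ?s i" for i
      using C3(2)[of "M + i" x y] by (simp add: Y_def)
    have sa: "summable (\<lambda>i. \<bar>h (M + i) (x + y) - h (M + i) x\<bar>)"
      by (rule summable_comparison_test'[OF ss, of 0]) (use si in simp)
    have "\<bar>\<Sum>i. h (M + i) (x + y) - h (M + i) x\<bar> \<le> (\<Sum>i. \<bar>h (M + i) (x + y) - h (M + i) x\<bar>)"
      by (rule summable_rabs[OF sa])
    also have "\<dots> \<le> (\<Sum>i. ?s i)" by (intro suminf_le si sa ss)
    also have "\<dots> \<le> Y * (1 / sqrt (real M) ^ (?d + 1 - 2))"
    proof -
      have T: "summable (\<lambda>i. 1 / sqrt (real (M + i) + 1) ^ (?d + 1))"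
        "(\<Sum>i. 1 / sqrt (real (M + i) + 1) ^ (?d + 1)) \<le> 1 / sqrt (real M) ^ (?d + 1 - 2)"
        using dim M by (intro sum_inverse_sqrt_power_tail; simp)+
      show ?thesis by (simp only: suminf_mult[OF T(1)]) (intro mult_left_mono T Y0)
    qed
    also have "?d + 1 - 2 = ?d - 1" by simp
    also have "Y * (1 / sqrt (real M) ^ (?d - 1)) \<le> Y * (1 / (sqrt \<epsilon> * N x) ^ (?d - 1))"
      using sM Np eps Y0 M by (intro mult_left_mono divide_left_mono power_mono mult_pos_pos zero_less_power) auto
    also have "\<dots> = Y / (sqrt \<epsilon> ^ (?d - 1) * N x) / N x ^ (?d - 2)"
    proof -
      have "?d - 1 = Suc (?d - 2)" using dim by simp
      then show ?thesis by (simp add: power_mult_distrib)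
    qed
    finally have 2: "\<bar>\<Sum>i. h (M + i) (x + y) - h (M + i) x\<bar> \<le> Y / (sqrt \<epsilon> ^ (?d - 1) * N x) / N x ^ (?d - 2)" .
    have "G (x + y) - G x = (\<Sum>n<M. h n (x + y) - h n x) + (\<Sum>i. h (M + i) (x + y) - h (M + i) x)"
      by (subst (1 2) G_split[of _ M]) (simp add: sum_subtractf suminf_diff summable_h_shift)
    then have "\<bar>G (x + y) - G x\<bar> \<le> (K * \<epsilon> + K / (N x)\<^sup>2 + Y / (sqrt \<epsilon> ^ (?d - 1) * N x)) / N x ^ (?d - 2)" (is "_ \<le> ?T / _")
      using 1 2 unfolding add_divide_distrib by linarith
    then have "\<bar>G (x + y) - G x\<bar> / G x \<le> (?T / N x ^ (?d - 2)) / G x"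
      using G_pos[of x] by (intro divide_right_mono) auto
    also have "\<dots> \<le> (?T / N x ^ (?d - 2)) / (k / N x ^ (?d - 2))"
      using k G_pos[of x] Np K0 Y0 eps by (intro divide_left_mono mult_pos_pos divide_nonneg_nonneg add_nonneg_nonneg) auto
    also have "\<dots> = ?T / k" using Np by simp
    finally show ?thesis using G_pos[of x] by (simp add: diff_divide_distrib[symmetric] abs_divide field_simps)
  qed
  have "((\<lambda>x. (K * \<epsilon> + K / (N x)\<^sup>2 + Y / (sqrt \<epsilon> ^ (?d - 1) * N x)) / k) \<longlongrightarrow> (K * \<epsilon> + 0 + 0) / k) at_inf"
    using k eps filterlim_N
    by (intro tendsto_intros tendsto_divide_0[OF tendsto_const] filterlim_at_top_imp_at_infinity
        filterlim_pow_at_top filterlim_tendsto_pos_mult_at_top[OF tendsto_const]) auto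
  moreover have "(K * \<epsilon> + 0 + 0) / k < e"
  proof -
    have "K * \<epsilon> \<le> (K + 1) * \<epsilon>" using eps by simp
    also have "\<dots> = e * k / 4"
    proof -
      have "K + 1 \<noteq> 0" using K0 by linarith
      then show ?thesis unfolding \<epsilon>_def by (subst times_divide_eq_right) (rule nonzero_mult_div_cancel_left)
    qed
    also have "\<dots> < e * k" using e k by simp
    finally show ?thesis using k by (simp add: field_simps)
  qed
  ultimately have "\<forall>\<^sub>F x in at_inf. (K * \<epsilon> + K / (N x)\<^sup>2 + Y / (sqrt \<epsilon> ^ (?d - 1) * N x)) / k < e"
    by (rule order_tendstoD(2))
  then show "\<forall>\<^sub>F x in at_inf. dist (G (x + y) / G x) 1 < e"
    by eventually_elim (use bound in \<open>auto simp: dist_real_def intro: le_less_trans\<close>)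
qed

end

section \<open>Potentials of summable charges\<close>

lemma finite_support_tail:
  fixes H :: "'a::countable \<Rightarrow> real"
  assumes H: "integrable (count_space UNIV) H" "\<And>y. H y \<ge> 0" and e: "e > 0"
  shows "\<exists>S. finite S \<and> (\<integral>y. indicator (- S) y * H y \<partial>count_space UNIV) < e"
proof -
  let ?S = "\<lambda>n. {y :: 'a. to_nat y < n}"
  have fin: "finite (?S n)" for n
    by (rule finite_subset[of _ "to_nat -` {..<n}"]) (auto intro: finite_vimageI)
  have "(\<lambda>n. \<integral>y. indicator (- ?S n) y * H y \<partial>count_space UNIV) \<longlonglongrightarrow> (\<integral>y. 0 \<partial>count_space (UNIV :: 'a set))"
  proof (rule integral_dominated_convergence[OF _ _ H(1)])
    show "AE y in count_space UNIV. (\<lambda>n. indicator (- ?S n) y * H y) \<longlonglongrightarrow> 0"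
    proof (rule AE_I2)
      fix y :: 'a
      have "\<forall>\<^sub>F n in sequentially. indicator (- ?S n) y * H y = 0"
        using eventually_gt_at_top[of "to_nat y"] by eventually_elim simp
      then show "(\<lambda>n. indicator (- ?S n) y * H y) \<longlonglongrightarrow> 0" by (rule tendsto_eventually)
    qed
    show "AE y in count_space UNIV. norm (indicator (- ?S n) y * H y) \<le> H y" for n
      using H(2) by (auto simp: indicator_def)
  qed auto
  then have "\<forall>\<^sub>F n in sequentially. (\<integral>y. indicator (- ?S n) y * H y \<partial>count_space UNIV) < e"
    using e by (intro order_tendstoD(2)[of _ 0]) auto
  then obtain n where "(\<integral>y. indicator (- ?S n) y * H y \<partial>count_space UNIV) < e"
    by (auto simp: eventually_sequentially)
  with fin show ?thesis by blast
qed

context centred_walk begin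

abbreviation A :: "nat \<Rightarrow> (int ^ 'd \<Rightarrow> real) \<Rightarrow> int ^ 'd \<Rightarrow> real" where
  "A n f x \<equiv> measure_pmf.expectation (conv_pow (lazy \<mu>) n) (\<lambda>z. f (x + z))"

lemma integrable_bounded_pmf:
  fixes f :: "'a \<Rightarrow> real" assumes "\<And>x. \<bar>f x\<bar> \<le> B" shows "integrable (measure_pmf M) f"
  using assms by (intro measure_pmf.integrable_const_bound[of _ B]) auto

lemma A_bounded:
  assumes "\<And>x. \<bar>f x\<bar> \<le> B" shows "\<bar>A n f x\<bar> \<le> B"
proof -
  have "norm (A n f x) \<le> measure_pmf.expectation (conv_pow (lazy \<mu>) n) (\<lambda>z. B)"
    by (rule norm_integral_le_AE) (use assms in auto)
  then show ?thesis by simp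
qed

lemma A_Suc:
  assumes "\<And>x. \<bar>f x\<bar> \<le> B"
  shows "A (Suc n) f x = measure_pmf.expectation (lazy \<mu>) (\<lambda>z. A n f (x + z))"
  unfolding conv_pow.simps
  by (subst integral_bind_pmf_bounded[of _ B]) (use assms in \<open>auto simp: add.assoc\<close>)

text \<open>The Poisson equation \<open>u - A 1 u = \<rho>\<close> makes \<open>u\<close> the potential of the charge \<open>\<rho>\<close>, provided
  the last term vanishes as \<open>M\<close> grows; \<open>A_green_sum_vanishes\<close> provides this.\<close>

lemma potential_iterate:
  assumes u: "\<And>x. u x = \<rho> x + measure_pmf.expectation (lazy \<mu>) (\<lambda>z. u (x + z))"
    and B: "\<And>x. \<bar>u x\<bar> \<le> B" "\<And>x. \<bar>\<rho> x\<bar> \<le> B'"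
  shows "u x = (\<Sum>n<M. A n \<rho> x) + A M u x"
proof (induction M arbitrary: x)
  case 0 then show ?case by simp
next
  case (Suc M)
  have "u x = \<rho> x + measure_pmf.expectation (lazy \<mu>) (\<lambda>z. (\<Sum>n<M. A n \<rho> (x + z)) + A M u (x + z))"
    by (subst u, subst Suc) (rule refl)
  also have "measure_pmf.expectation (lazy \<mu>) (\<lambda>z. (\<Sum>n<M. A n \<rho> (x + z)) + A M u (x + z)) =
    (\<Sum>n<M. A (Suc n) \<rho> x) + A (Suc M) u x"
  proof -
    have i: "integrable (measure_pmf (lazy \<mu>)) (\<lambda>z. A n \<rho> (x + z))"
      "integrable (measure_pmf (lazy \<mu>)) (\<lambda>z. A n u (x + z))" for n
      by (rule integrable_bounded_pmf, rule A_bounded, rule B)+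
    have s: "A (Suc n) \<rho> x = measure_pmf.expectation (lazy \<mu>) (\<lambda>z. A n \<rho> (x + z))"
      "A (Suc n) u x = measure_pmf.expectation (lazy \<mu>) (\<lambda>z. A n u (x + z))" for n
      by (rule A_Suc, rule B)+
    show ?thesis unfolding s
      by (simp only: Bochner_Integration.integral_add Bochner_Integration.integral_sum Bochner_Integration.integrable_sum i)
  qed
  also have "\<rho> x + ((\<Sum>n<M. A (Suc n) \<rho> x) + A (Suc M) u x) = (\<Sum>n<Suc M. A n \<rho> x) + A (Suc M) u x"
    by (subst sum.lessThan_Suc_shift) simp
  finally show ?case .
qed

lemma potential_kernel:
  fixes D :: "int ^ 'd \<Rightarrow> ennreal"
  shows "(\<Sum>n. \<integral>\<^sup>+z. D (x + z) \<partial>measure_pmf (conv_pow (lazy \<mu>) n)) =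
    (\<integral>\<^sup>+y. ennreal (G (y - x)) * D y \<partial>count_space UNIV)"
proof -
  have "(\<integral>\<^sup>+z. D (x + z) \<partial>measure_pmf (conv_pow (lazy \<mu>) n)) =
    (\<integral>\<^sup>+y. ennreal (h n (y - x)) * D y \<partial>count_space UNIV)" for n
  proof -
    have "(\<integral>\<^sup>+y. ennreal (h n (y - x)) * D y \<partial>count_space UNIV) =
      (\<integral>\<^sup>+z. ennreal (h n ((x + z) - x)) * D (x + z) \<partial>count_space UNIV)"
      by (rule nn_integral_bij_count_space[symmetric, of "\<lambda>z. x + z"])
         (auto intro!: bij_betw_byWitness[where f'="\<lambda>z. z - x"])
    then show ?thesis by (simp add: nn_integral_measure_pmf)
  qed
  then show ?thesis
    by (simp add: nn_integral_suminf[symmetric] ennreal_G)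
qed

text \<open>Averaging over \<open>M\<close> steps removes the first \<open>M\<close> terms of the Green series.\<close>

lemma potential_tail_vanishes:
  "(\<lambda>M. \<integral>\<^sup>+z. ennreal (G (k - (x + z))) \<partial>measure_pmf (conv_pow (lazy \<mu>) M)) \<longlonglongrightarrow> 0"
proof -
  have e: "(\<integral>\<^sup>+z. ennreal (G (k - (x + z))) \<partial>measure_pmf (conv_pow (lazy \<mu>) M)) = ennreal (G (k - x) - (\<Sum>n<M. h n (k - x)))" for M
  proof -
    have "(\<integral>\<^sup>+z. ennreal (G (k - (x + z))) \<partial>measure_pmf (conv_pow (lazy \<mu>) M)) =
      (\<Sum>n. \<integral>\<^sup>+z. ennreal (h n (k - x - z)) \<partial>measure_pmf (conv_pow (lazy \<mu>) M))"
      by (simp add: ennreal_G nn_integral_suminf diff_diff_eq)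
    also have "\<dots> = (\<Sum>n. ennreal (h (M + n) (k - x)))"
      unfolding conv_pow_add ennreal_pmf_bind pmf_map_plus ..
    also have "\<dots> = ennreal (\<Sum>n. h (M + n) (k - x))"
      by (intro suminf_ennreal2 summable_h_shift pmf_nonneg)
    also have "(\<Sum>n. h (M + n) (k - x)) = G (k - x) - (\<Sum>n<M. h n (k - x))"
      using G_split[of "k - x" M] by simp
    finally show ?thesis .
  qed
  have "(\<lambda>M. G (k - x) - (\<Sum>n<M. h n (k - x))) \<longlonglongrightarrow> G (k - x) - G (k - x)"
    unfolding G_def by (intro tendsto_diff tendsto_const summable_LIMSEQ summable_h)
  then have "(\<lambda>M. ennreal (G (k - x) - (\<Sum>n<M. h n (k - x)))) \<longlonglongrightarrow> ennreal (G (k - x) - G (k - x))"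
    by (rule tendsto_ennrealI)
  then show ?thesis unfolding e by simp
qed

text \<open>The mean number of visits of the lazy walk to \<open>K\<close>, when it starts from \<open>x\<close>.\<close>

definition green_sum :: "(int ^ 'd) set \<Rightarrow> int ^ 'd \<Rightarrow> real" where "green_sum K x = (\<Sum>k\<in>K. G (k - x))"

lemma green_sum_nonneg: "green_sum K x \<ge> 0" unfolding green_sum_def by (intro sum_nonneg G_nonneg)

lemma ennreal_abs_integral_le:
  fixes f :: "'a \<Rightarrow> real"
  shows "ennreal \<bar>measure_pmf.expectation M f\<bar> \<le> (\<integral>\<^sup>+z. ennreal \<bar>f z\<bar> \<partial>measure_pmf M)"
proof (cases "integrable (measure_pmf M) f")
  case True
  then have "ennreal \<bar>measure_pmf.expectation M f\<bar> \<le> ennreal (measure_pmf.expectation M (\<lambda>z. \<bar>f z\<bar>))"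
    by (intro ennreal_leI integral_abs_bound)
  also have "\<dots> = (\<integral>\<^sup>+z. ennreal \<bar>f z\<bar> \<partial>measure_pmf M)"
    using True by (intro nn_integral_eq_integral[symmetric]) auto
  finally show ?thesis .
qed (simp add: not_integrable_integral_eq)

lemma A_green_sum_vanishes:
  assumes K: "finite K" and u: "\<And>x. \<bar>u x\<bar> \<le> B * green_sum K x" and B: "B \<ge> 0"
  shows "(\<lambda>M. A M u x) \<longlonglongrightarrow> 0"
proof -
  have "(\<lambda>M. ennreal B * (\<Sum>k\<in>K. \<integral>\<^sup>+z. ennreal (G (k - (x + z))) \<partial>measure_pmf (conv_pow (lazy \<mu>) M))) \<longlonglongrightarrow> ennreal B * (\<Sum>k\<in>K. 0)"
    by (intro ennreal_tendsto_cmult tendsto_sum potential_tail_vanishes) auto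
  then have lim: "(\<lambda>M. ennreal B * (\<Sum>k\<in>K. \<integral>\<^sup>+z. ennreal (G (k - (x + z))) \<partial>measure_pmf (conv_pow (lazy \<mu>) M))) \<longlonglongrightarrow> 0" by simp
  have le: "ennreal \<bar>A M u x\<bar> \<le> ennreal B * (\<Sum>k\<in>K. \<integral>\<^sup>+z. ennreal (G (k - (x + z))) \<partial>measure_pmf (conv_pow (lazy \<mu>) M))" for M
  proof -
    have "ennreal \<bar>A M u x\<bar> \<le> (\<integral>\<^sup>+z. ennreal \<bar>u (x + z)\<bar> \<partial>measure_pmf (conv_pow (lazy \<mu>) M))"
      by (rule ennreal_abs_integral_le)
    also have "\<dots> \<le> (\<integral>\<^sup>+z. ennreal B * (\<Sum>k\<in>K. ennreal (G (k - (x + z)))) \<partial>measure_pmf (conv_pow (lazy \<mu>) M))"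
      using u B by (intro nn_integral_mono) (simp add: ennreal_mult[symmetric] sum_ennreal G_nonneg sum_nonneg green_sum_def ennreal_leI)
    also have "\<dots> = ennreal B * (\<Sum>k\<in>K. \<integral>\<^sup>+z. ennreal (G (k - (x + z))) \<partial>measure_pmf (conv_pow (lazy \<mu>) M))"
      by (simp add: nn_integral_cmult nn_integral_sum)
    finally show ?thesis .
  qed
  have "(\<lambda>M. ennreal \<bar>A M u x\<bar>) \<longlonglongrightarrow> 0"
    by (rule tendsto_sandwich[OF _ _ tendsto_const lim]) (auto intro: always_eventually le)
  then have "(\<lambda>M. ennreal \<bar>A M u x\<bar>) \<longlonglongrightarrow> ennreal 0" by simp
  then have "(\<lambda>M. \<bar>A M u x\<bar>) \<longlonglongrightarrow> 0" by (rule tendsto_ennrealD) auto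
  then show ?thesis by (rule tendsto_rabs_zero_cancel)
qed

text \<open>Errors that are quadratic in \<open>green_sum\<close> are multiples of this by the Cauchy--Schwarz
  inequality, and unlike the square of \<open>green_sum\<close> it is a sum of translates of \<open>G\<^sup>2\<close>.\<close>

definition green_sq_sum :: "(int ^ 'd) set \<Rightarrow> int ^ 'd \<Rightarrow> real" where "green_sq_sum K y = (\<Sum>k\<in>K. (G (k - y))\<^sup>2)"

lemma green_sq_sum_nonneg: "green_sq_sum K y \<ge> 0" unfolding green_sq_sum_def by (intro sum_nonneg) auto

lemma integrable_G2: "integrable (count_space UNIV) (\<lambda>y. (G y)\<^sup>2)"
  unfolding integrable_iff_bounded using G_square_summable by (simp add: G_nonneg)

lemma integrable_G2_reflect:
  "integrable (count_space UNIV) (\<lambda>y. (G (k - y))\<^sup>2)"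
  and integrable_G2_shift: "integrable (count_space UNIV) (\<lambda>y. (G (y - k))\<^sup>2)"
  and integral_G2_shift: "(\<integral>y. (G (y - k))\<^sup>2 \<partial>count_space UNIV) = (\<integral>y. (G y)\<^sup>2 \<partial>count_space UNIV)"
proof -
  have b: "bij_betw (\<lambda>y. k - y) UNIV (UNIV :: (int ^ 'd) set)"
    by (auto intro!: bij_betw_byWitness[where f'="\<lambda>z. k - z"])
  have b': "bij_betw (\<lambda>y. y - k) UNIV (UNIV :: (int ^ 'd) set)"
    by (auto intro!: bij_betw_byWitness[where f'="\<lambda>z. z + k"])
  show "integrable (count_space UNIV) (\<lambda>y. (G (k - y))\<^sup>2)"
    using integrable_distr_eq[of "\<lambda>y. k - y" "count_space UNIV" "count_space UNIV" "\<lambda>y. (G y)\<^sup>2"] integrable_G2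
    by (simp add: distr_bij_count_space[OF b])
  show "integrable (count_space UNIV) (\<lambda>y. (G (y - k))\<^sup>2)"
    using integrable_distr_eq[of "\<lambda>y. y - k" "count_space UNIV" "count_space UNIV" "\<lambda>y. (G y)\<^sup>2"] integrable_G2
    by (simp add: distr_bij_count_space[OF b'])
  show "(\<integral>y. (G (y - k))\<^sup>2 \<partial>count_space UNIV) = (\<integral>y. (G y)\<^sup>2 \<partial>count_space UNIV)"
    using integral_distr[of "\<lambda>y. y - k" "count_space UNIV" "count_space UNIV" "\<lambda>y. (G y)\<^sup>2"]
    by (simp add: distr_bij_count_space[OF b'])
qed

lemma integrable_green_sq_sum: "integrable (count_space UNIV) (green_sq_sum K)"
  unfolding green_sq_sum_def[abs_def] by (intro Bochner_Integration.integrable_sum integrable_G2_reflect)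

lemma filterlim_uminus_at_inf: "filterlim uminus at_inf at_inf"
  unfolding at_inf_def filterlim_filtercomap_iff
  by (simp add: o_def vec_of_int_minus filterlim_filtercomap)

lemma G_ratio': "((\<lambda>x. G (y - x) / G (- x)) \<longlongrightarrow> 1) at_inf"
  using filterlim_compose[OF G_ratio[of y] filterlim_uminus_at_inf] by (simp add: add.commute)

text \<open>A finite part \<open>S\<close> of the charge has a potential asymptotic to its mass times \<open>G (- x)\<close>. The
  rest has to be small relative to \<open>G (- x)\<close>, uniformly in \<open>x\<close>, although \<open>y\<close> may be close to
  \<open>x\<close>. The 3G-inequality and the inequality \<open>a * b \<le> \<delta> * a\<^sup>2 + b\<^sup>2 / \<delta>\<close> bound
  \<open>G (y - x) * (G (k - y))\<^sup>2\<close> by a multiple of \<open>G (k - x)\<close> times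
  \<open>\<delta> * (G (y - x))\<^sup>2 + (1 / \<delta> + 1) * (G (k - y))\<^sup>2\<close>. The first summand sums to a multiple of
  \<open>\<delta>\<close>, and outside \<open>S\<close> the second one has a small sum.\<close>

lemma potential_asymptotics:
  assumes K: "finite K"
    and u: "\<And>x. u x = \<rho> x + measure_pmf.expectation (lazy \<mu>) (\<lambda>z. u (x + z))"
    and B: "B \<ge> 0" "\<And>x. \<bar>u x\<bar> \<le> B" "\<And>x. \<bar>u x\<bar> \<le> B * green_sum K x"
    and \<rho>: "\<And>y. \<bar>\<rho> y\<bar> \<le> B * green_sq_sum K y"
  shows "((\<lambda>x. u x / G (- x)) \<longlongrightarrow> (\<integral>y. \<rho> y \<partial>count_space UNIV)) at_inf"
proof (rule tendstoI)
  fix e :: real assume e: "e > 0"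
  obtain K3 where K3: "K3 > 0" "\<And>x y. G x * G y \<le> K3 * G (x + y) * (G x + G y)"
    using G_three by blast
  define Q where "Q = (\<integral>y. (G y)\<^sup>2 \<partial>count_space UNIV)"
  have rho_bd: "\<bar>\<rho> x\<bar> \<le> B + B" for x
  proof -
    have "\<bar>measure_pmf.expectation (lazy \<mu>) (\<lambda>z. u (x + z))\<bar> \<le> B"
      using A_bounded[where f=u and B=B and n=1 and x=x, OF B(2)]
        A_Suc[where f=u and B=B and n=0 and x=x, OF B(2)] by simp
    then show ?thesis using u[of x] B(2)[of x] by linarith
  qed
  have int_rho: "integrable (count_space UNIV) \<rho>"
    by (rule Bochner_Integration.integrable_bound[of _ "\<lambda>y. B * green_sq_sum K y"])
       (use \<rho> B green_sq_sum_nonneg integrable_green_sq_sum in \<open>auto intro!: AE_I2 simp: abs_mult\<close>)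
  have key: "\<bar>u x - (\<Sum>y\<in>S. G (y - x) * \<rho> y)\<bar> \<le>
      B * K3 * green_sum K x * (\<delta> * Q + (1 / \<delta> + 1) * (\<integral>y. indicator (- S) y * green_sq_sum K y \<partial>count_space UNIV))"
    if S: "finite S" and d: "\<delta> > 0" for S x \<delta>
  proof -
    let ?\<rho>S = "\<lambda>y. indicator S y * \<rho> y" and ?\<rho>T = "\<lambda>y. indicator (- S) y * \<rho> y"
    define X where "X = (\<lambda>M. (\<Sum>n<M. A n ?\<rho>T x))"
    have bS: "\<bar>?\<rho>S y\<bar> \<le> B + B" "\<bar>?\<rho>T y\<bar> \<le> B + B" for y
      using rho_bd[of y] B(1) by (auto simp: indicator_def)
    have split: "A n \<rho> x = A n ?\<rho>S x + A n ?\<rho>T x" for n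
    proof -
      have "A n \<rho> x = measure_pmf.expectation (conv_pow (lazy \<mu>) n) (\<lambda>z. ?\<rho>S (x + z) + ?\<rho>T (x + z))"
        by (intro Bochner_Integration.integral_cong) (auto simp: indicator_def)
      also have "\<dots> = A n ?\<rho>S x + A n ?\<rho>T x"
        by (rule Bochner_Integration.integral_add; rule integrable_bounded_pmf, rule bS)
      finally show ?thesis .
    qed
    have AS: "A n ?\<rho>S x = (\<Sum>y\<in>S. h n (y - x) * \<rho> y)" for n
    proof -
      have "A n ?\<rho>S x = (\<Sum>z\<in>(\<lambda>y. y - x) ` S. h n z * ?\<rho>S (x + z))"
        by (subst integral_measure_pmf[of "(\<lambda>y. y - x) ` S"])
           (use S in \<open>auto simp: indicator_def image_iff intro!: bexI[of _ "x + _"]\<close>)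
      also have "\<dots> = (\<Sum>y\<in>S. h n (y - x) * ?\<rho>S (x + (y - x)))"
        by (subst sum.reindex) (auto simp: inj_on_def)
      finally show ?thesis by simp
    qed
    have 1: "(\<lambda>M. \<Sum>n<M. A n ?\<rho>S x) \<longlonglongrightarrow> (\<Sum>y\<in>S. G (y - x) * \<rho> y)"
    proof -
      have "(\<lambda>n. h n (y - x) * \<rho> y) sums (G (y - x) * \<rho> y)" for y
        unfolding G_def by (intro sums_mult2 summable_sums summable_h)
      then have "(\<lambda>n. \<Sum>y\<in>S. h n (y - x) * \<rho> y) sums (\<Sum>y\<in>S. G (y - x) * \<rho> y)" by (intro sums_sum)
      then show ?thesis unfolding AS sums_def .
    qed
    have 2: "(\<lambda>M. u x - A M u x - (\<Sum>n<M. A n ?\<rho>S x)) \<longlonglongrightarrow> u x - 0 - (\<Sum>y\<in>S. G (y - x) * \<rho> y)"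
      by (intro tendsto_diff tendsto_const A_green_sum_vanishes[where u=u, OF K B(3) B(1)] 1)
    have "u x - A M u x - (\<Sum>n<M. A n ?\<rho>S x) = X M" for M
      using potential_iterate[where u=u and \<rho>=\<rho> and x=x and M=M, OF u B(2) rho_bd] by (simp add: X_def split sum.distrib)
    then have 3: "X \<longlonglongrightarrow> u x - (\<Sum>y\<in>S. G (y - x) * \<rho> y)" using 2 by simp
    let ?D = "\<lambda>y. ennreal (B * (indicator (- S) y * green_sq_sum K y))"
    have 4: "ennreal \<bar>X M\<bar> \<le> (\<integral>\<^sup>+y. ennreal (G (y - x)) * ?D y \<partial>count_space UNIV)" for M
    proof -
      have "ennreal \<bar>X M\<bar> \<le> ennreal (\<Sum>n<M. \<bar>A n ?\<rho>T x\<bar>)" unfolding X_def by (intro ennreal_leI sum_abs)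
      also have "\<dots> = (\<Sum>n<M. ennreal \<bar>A n ?\<rho>T x\<bar>)" by (simp add: sum_ennreal)
      also have "\<dots> \<le> (\<Sum>n<M. \<integral>\<^sup>+z. ?D (x + z) \<partial>measure_pmf (conv_pow (lazy \<mu>) n))"
      proof (intro sum_mono order_trans[OF ennreal_abs_integral_le] nn_integral_mono ennreal_leI)
        fix z show "\<bar>?\<rho>T (x + z)\<bar> \<le> B * (indicator (- S) (x + z) * green_sq_sum K (x + z))"
          using \<rho>[of "x + z"] by (auto simp: indicator_def)
      qed
      also have "\<dots> \<le> (\<Sum>n. \<integral>\<^sup>+z. ?D (x + z) \<partial>measure_pmf (conv_pow (lazy \<mu>) n))"
        by (rule sum_le_suminf) auto
      finally show ?thesis by (simp only: potential_kernel[of ?D x])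
    qed
    let ?I = "\<lambda>y. \<Sum>k\<in>K. B * K3 * G (k - x) * (\<delta> * (G (y - x))\<^sup>2 + (1 / \<delta> + 1) * (indicator (- S) y * (G (k - y))\<^sup>2))"
    have I0: "?I y \<ge> 0" for y
      using B K3 d by (intro sum_nonneg mult_nonneg_nonneg add_nonneg_nonneg G_nonneg) auto
    have pt: "G (y - x) * (B * (indicator (- S) y * green_sq_sum K y)) \<le> ?I y" for y
    proof (cases "y \<in> S")
      case True then show ?thesis using I0[of y] by simp
    next
      case False
      have "G (y - x) * (G (k - y))\<^sup>2 \<le> K3 * G (k - x) * (\<delta> * (G (y - x))\<^sup>2 + (1 / \<delta> + 1) * (G (k - y))\<^sup>2)" for k
      proof -
        let ?a = "G (y - x)" and ?b = "G (k - y)"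
        have pos: "?a \<ge> 0" "?b \<ge> 0" "G (k - x) \<ge> 0" by (rule G_nonneg)+
        have "?a * ?b\<^sup>2 = (?a * ?b) * ?b" by (simp add: power2_eq_square)
        also have "\<dots> \<le> (K3 * G (y - x + (k - y)) * (?a + ?b)) * ?b" using pos by (intro mult_right_mono K3)
        also have "\<dots> = K3 * G (k - x) * (?a * ?b + ?b\<^sup>2)" by (simp add: power2_eq_square algebra_simps)
        also have "\<dots> \<le> K3 * G (k - x) * (\<delta> * ?a\<^sup>2 + (1 / \<delta> + 1) * ?b\<^sup>2)"
        proof -
          have "0 \<le> (\<delta> * ?a - ?b)\<^sup>2 + (\<delta> * ?a)\<^sup>2 + ?b\<^sup>2" by simp
          then have "?a * ?b * \<delta> \<le> (\<delta> * ?a\<^sup>2 + 1 / \<delta> * ?b\<^sup>2) * \<delta>"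
            using d by (simp add: power2_eq_square algebra_simps)
          then have "?a * ?b \<le> \<delta> * ?a\<^sup>2 + 1 / \<delta> * ?b\<^sup>2" using d by simp
          then have "?a * ?b + ?b\<^sup>2 \<le> \<delta> * ?a\<^sup>2 + (1 / \<delta> + 1) * ?b\<^sup>2" by (simp add: distrib_right)
          then show ?thesis using K3 pos by (intro mult_left_mono) auto
        qed
        finally show ?thesis .
      qed
      then have "B * (G (y - x) * (G (k - y))\<^sup>2) \<le> B * (K3 * G (k - x) * (\<delta> * (G (y - x))\<^sup>2 + (1 / \<delta> + 1) * (G (k - y))\<^sup>2))" for k
        using B by (intro mult_left_mono) auto
      then have "(\<Sum>k\<in>K. B * (G (y - x) * (G (k - y))\<^sup>2)) \<le> (\<Sum>k\<in>K. B * (K3 * G (k - x) * (\<delta> * (G (y - x))\<^sup>2 + (1 / \<delta> + 1) * (G (k - y))\<^sup>2)))"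
        by (intro sum_mono)
      moreover have "G (y - x) * (B * (indicator (- S) y * green_sq_sum K y)) = (\<Sum>k\<in>K. B * (G (y - x) * (G (k - y))\<^sup>2))"
        using False by (simp add: green_sq_sum_def sum_distrib_left mult_ac)
      moreover have "?I y = (\<Sum>k\<in>K. B * (K3 * G (k - x) * (\<delta> * (G (y - x))\<^sup>2 + (1 / \<delta> + 1) * (G (k - y))\<^sup>2)))"
        using False by (intro sum.cong) (auto simp: mult_ac)
      ultimately show ?thesis by simp
    qed
    have int_ind: "integrable (count_space UNIV) (\<lambda>y. indicator (- S) y * (G (k - y))\<^sup>2)" for k
      by (rule Bochner_Integration.integrable_bound[OF integrable_G2_reflect[of k]]) (auto simp: indicator_def)
    have intI: "integrable (count_space UNIV) ?I"
      by (intro Bochner_Integration.integrable_sum integrable_mult_right Bochner_Integration.integrable_add integrable_G2_shift int_ind)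
    have "(\<integral>\<^sup>+y. ennreal (G (y - x)) * ?D y \<partial>count_space UNIV) \<le> (\<integral>\<^sup>+y. ennreal (?I y) \<partial>count_space UNIV)"
    proof (intro nn_integral_mono)
      fix y
      have "ennreal (G (y - x)) * ?D y = ennreal (G (y - x) * (B * (indicator (- S) y * green_sq_sum K y)))"
        using B green_sq_sum_nonneg[of K y] G_nonneg[of "y - x"] by (intro ennreal_mult[symmetric]) (auto simp: indicator_def)
      also have "\<dots> \<le> ennreal (?I y)" by (intro ennreal_leI pt)
      finally show "ennreal (G (y - x)) * ?D y \<le> ennreal (?I y)" .
    qed
    also have "\<dots> = ennreal (\<integral>y. ?I y \<partial>count_space UNIV)"
      using I0 by (intro nn_integral_eq_integral intI) auto
    finally have 5: "ennreal \<bar>X M\<bar> \<le> ennreal (\<integral>y. ?I y \<partial>count_space UNIV)" for M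
      using 4[of M] by (rule order_trans[rotated])
    have intI0: "(\<integral>y. ?I y \<partial>count_space UNIV) \<ge> 0" using I0 by (intro integral_nonneg_AE) auto
    have "\<bar>X M\<bar> \<le> (\<integral>y. ?I y \<partial>count_space UNIV)" for M
      using 5[of M] ennreal_le_iff[OF intI0] by blast
    then have "\<bar>u x - (\<Sum>y\<in>S. G (y - x) * \<rho> y)\<bar> \<le> (\<integral>y. ?I y \<partial>count_space UNIV)"
      using tendsto_rabs[OF 3] by (intro LIMSEQ_le_const2[of "\<lambda>M. \<bar>X M\<bar>"]) auto
    also have "\<dots> = (\<Sum>k\<in>K. B * K3 * G (k - x) * (\<delta> * Q + (1 / \<delta> + 1) * (\<integral>y. indicator (- S) y * (G (k - y))\<^sup>2 \<partial>count_space UNIV)))"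
      by (simp add: Bochner_Integration.integral_sum Bochner_Integration.integral_add integrable_mult_right
          Bochner_Integration.integrable_add integrable_G2_shift int_ind integral_G2_shift Q_def)
    also have "\<dots> \<le> (\<Sum>k\<in>K. B * K3 * G (k - x) * (\<delta> * Q + (1 / \<delta> + 1) * (\<integral>y. indicator (- S) y * green_sq_sum K y \<partial>count_space UNIV)))"
    proof (rule sum_mono)
      fix k assume k: "k \<in> K"
      have "(\<integral>y. indicator (- S) y * (G (k - y))\<^sup>2 \<partial>count_space UNIV) \<le> (\<integral>y. indicator (- S) y * green_sq_sum K y \<partial>count_space UNIV)"
      proof (rule integral_mono[OF int_ind])
        show "integrable (count_space UNIV) (\<lambda>y. indicator (- S) y * green_sq_sum K y)"
          by (rule Bochner_Integration.integrable_bound[OF integrable_green_sq_sum[of K]]) (auto simp: indicator_def)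
        fix y show "indicator (- S) y * (G (k - y))\<^sup>2 \<le> indicator (- S) y * green_sq_sum K y"
          unfolding green_sq_sum_def using member_le_sum[OF k, of "\<lambda>k. (G (k - y))\<^sup>2"] K by (intro mult_left_mono) auto
      qed
      then show "B * K3 * G (k - x) * (\<delta> * Q + (1 / \<delta> + 1) * (\<integral>y. indicator (- S) y * (G (k - y))\<^sup>2 \<partial>count_space UNIV))
        \<le> B * K3 * G (k - x) * (\<delta> * Q + (1 / \<delta> + 1) * (\<integral>y. indicator (- S) y * green_sq_sum K y \<partial>count_space UNIV))"
        using d B K3 G_nonneg[of "k - x"] by (intro mult_left_mono add_left_mono) auto
    qed
    also have "\<dots> = B * K3 * green_sum K x * (\<delta> * Q + (1 / \<delta> + 1) * (\<integral>y. indicator (- S) y * green_sq_sum K y \<partial>count_space UNIV))"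
      by (simp add: green_sum_def sum_distrib_left sum_distrib_right mult_ac)
    finally show ?thesis .
  qed
  \<comment> \<open>Total error if the charge outside \<open>S\<close> has mass at most
    \<open>\<delta>\<^sup>2\<close>, which outweighs the factor \<open>1 /
    \<delta>\<close>.\<close>
  define \<phi> where "\<phi> = (\<lambda>\<delta>::real. B * \<delta>\<^sup>2 + B * K3 * real (card K) * (\<delta> * Q + \<delta> + \<delta>\<^sup>2))"
  have "(\<phi> \<longlongrightarrow> \<phi> 0) (at_right 0)" unfolding \<phi>_def by (intro tendsto_intros)
  then have "\<forall>\<^sub>F \<delta> in at_right 0. \<phi> \<delta> < e" using e by (intro order_tendstoD) (auto simp: \<phi>_def)
  then have "\<forall>\<^sub>F \<delta> in at_right (0::real). \<phi> \<delta> < e \<and> \<delta> > 0"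
    using eventually_at_right_less[of 0] by eventually_elim simp
  then obtain \<delta> where d: "\<phi> \<delta> < e" "\<delta> > 0"
    using eventually_happens[of _ "at_right (0::real)"] trivial_limit_at_right_real by (metis (no_types, lifting))
  obtain S where S: "finite S" "(\<integral>y. indicator (- S) y * green_sq_sum K y \<partial>count_space UNIV) < \<delta>\<^sup>2"
    using finite_support_tail[OF integrable_green_sq_sum green_sq_sum_nonneg, of "\<delta>\<^sup>2" K] d by auto
  define T where "T = (\<integral>y. indicator (- S) y * green_sq_sum K y \<partial>count_space UNIV)"
  have T0: "T \<ge> 0" unfolding T_def using green_sq_sum_nonneg[of K] by (intro integral_nonneg_AE) auto
  have rem: "\<bar>(\<Sum>y\<in>S. \<rho> y) - (\<integral>y. \<rho> y \<partial>count_space UNIV)\<bar> \<le> B * T"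
  proof -
    have i1: "integrable (count_space UNIV) (\<lambda>y. indicator S y * \<rho> y)" "integrable (count_space UNIV) (\<lambda>y. indicator (- S) y * \<rho> y)"
      by (rule Bochner_Integration.integrable_bound[OF int_rho]; auto simp: indicator_def)+
    have "(\<integral>y. \<rho> y \<partial>count_space UNIV) = (\<integral>y. indicator S y * \<rho> y + indicator (- S) y * \<rho> y \<partial>count_space UNIV)"
      by (intro Bochner_Integration.integral_cong) (auto simp: indicator_def)
    also have "\<dots> = (\<integral>y. indicator S y * \<rho> y \<partial>count_space UNIV) + (\<integral>y. indicator (- S) y * \<rho> y \<partial>count_space UNIV)"
      using i1 by (rule Bochner_Integration.integral_add)
    also have "(\<integral>y. indicator S y * \<rho> y \<partial>count_space UNIV) = (\<Sum>y\<in>S. \<rho> y)"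
    proof -
      have f: "finite {y \<in> UNIV. indicator S y * \<rho> y \<noteq> 0}"
        by (rule finite_subset[OF _ S(1)]) (auto simp: indicator_def)
      have "(\<integral>y. indicator S y * \<rho> y \<partial>count_space UNIV) = (\<Sum>y | y \<in> UNIV \<and> indicator S y * \<rho> y \<noteq> 0. indicator S y * \<rho> y)"
        using f by (intro lebesgue_integral_count_space_finite_support) simp
      also have "\<dots> = (\<Sum>y\<in>S. \<rho> y)"
        using S(1) by (intro sum.mono_neutral_cong_left) (auto simp: indicator_def)
      finally show ?thesis .
    qed
    finally have "\<bar>(\<Sum>y\<in>S. \<rho> y) - (\<integral>y. \<rho> y \<partial>count_space UNIV)\<bar> = norm (\<integral>y. indicator (- S) y * \<rho> y \<partial>count_space UNIV)" by simp
    also have "\<dots> \<le> (\<integral>y. B * (indicator (- S) y * green_sq_sum K y) \<partial>count_space UNIV)"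
    proof (rule norm_integral_le_AE)
      show "integrable (count_space UNIV) (\<lambda>y. B * (indicator (- S) y * green_sq_sum K y))"
        by (intro integrable_mult_right Bochner_Integration.integrable_bound[OF integrable_green_sq_sum[of K]]) (auto simp: indicator_def)
    qed (use \<rho> in \<open>auto simp: indicator_def\<close>)
    finally show ?thesis by (simp add: T_def)
  qed
  let ?R = "\<lambda>x. (\<Sum>y\<in>S. \<bar>G (y - x) / G (- x) - 1\<bar> * \<bar>\<rho> y\<bar>) + B * T +
    B * K3 * (\<Sum>k\<in>K. G (k - x) / G (- x)) * (\<delta> * Q + (1 / \<delta> + 1) * T)"
  have bnd: "\<bar>u x / G (- x) - (\<integral>y. \<rho> y \<partial>count_space UNIV)\<bar> \<le> ?R x" for x
  proof -
    have g: "G (- x) > 0" by (rule G_pos)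
    have "\<bar>u x / G (- x) - (\<Sum>y\<in>S. G (y - x) / G (- x) * \<rho> y)\<bar> = \<bar>u x - (\<Sum>y\<in>S. G (y - x) * \<rho> y)\<bar> / G (- x)"
    proof -
      have "(\<Sum>y\<in>S. G (y - x) / G (- x) * \<rho> y) = (\<Sum>y\<in>S. G (y - x) * \<rho> y) / G (- x)"
        by (simp add: sum_divide_distrib)
      then have "u x / G (- x) - (\<Sum>y\<in>S. G (y - x) / G (- x) * \<rho> y) = (u x - (\<Sum>y\<in>S. G (y - x) * \<rho> y)) / G (- x)"
        by (simp only: diff_divide_distrib)
      then show ?thesis using g by (simp only: abs_divide)
    qed
    also have "\<dots> \<le> B * K3 * green_sum K x * (\<delta> * Q + (1 / \<delta> + 1) * T) / G (- x)"
      using key[OF S(1) d(2), of x] g by (intro divide_right_mono) (auto simp: T_def)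
    also have "\<dots> = B * K3 * (\<Sum>k\<in>K. G (k - x) / G (- x)) * (\<delta> * Q + (1 / \<delta> + 1) * T)"
      by (simp add: green_sum_def sum_divide_distrib[symmetric])
    finally have 1: "\<bar>u x / G (- x) - (\<Sum>y\<in>S. G (y - x) / G (- x) * \<rho> y)\<bar> \<le> B * K3 * (\<Sum>k\<in>K. G (k - x) / G (- x)) * (\<delta> * Q + (1 / \<delta> + 1) * T)" .
    have "\<bar>(\<Sum>y\<in>S. G (y - x) / G (- x) * \<rho> y) - (\<Sum>y\<in>S. \<rho> y)\<bar> = \<bar>\<Sum>y\<in>S. (G (y - x) / G (- x) - 1) * \<rho> y\<bar>"
      by (simp add: sum_subtractf[symmetric] algebra_simps)
    also have "\<dots> \<le> (\<Sum>y\<in>S. \<bar>G (y - x) / G (- x) - 1\<bar> * \<bar>\<rho> y\<bar>)"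
      by (rule order_trans[OF sum_abs]) (simp add: abs_mult)
    finally show ?thesis using 1 rem by linarith
  qed
  have "(?R \<longlongrightarrow> (\<Sum>y\<in>S. \<bar>1 - 1\<bar> * \<bar>\<rho> y\<bar>) + B * T + B * K3 * (\<Sum>k\<in>K. 1) * (\<delta> * Q + (1 / \<delta> + 1) * T)) at_inf"
    by (intro tendsto_intros G_ratio')
  moreover have "(\<Sum>y\<in>S. \<bar>1 - 1\<bar> * \<bar>\<rho> y\<bar>) + B * T + B * K3 * (\<Sum>k\<in>K. 1) * (\<delta> * Q + (1 / \<delta> + 1) * T) < e"
  proof -
    have Tl: "T \<le> \<delta>\<^sup>2" using S by (simp add: T_def)
    have "(1 / \<delta> + 1) * T \<le> (1 / \<delta> + 1) * \<delta>\<^sup>2" using Tl d by (intro mult_left_mono) auto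
    also have "\<dots> = \<delta> + \<delta>\<^sup>2" using d by (simp add: power2_eq_square field_simps)
    finally have "B * K3 * real (card K) * (\<delta> * Q + (1 / \<delta> + 1) * T) \<le> B * K3 * real (card K) * (\<delta> * Q + \<delta> + \<delta>\<^sup>2)"
      using B K3 by (intro mult_left_mono) auto
    moreover have "B * T \<le> B * \<delta>\<^sup>2" using Tl B by (intro mult_left_mono)
    ultimately show ?thesis using d(1) by (simp add: \<phi>_def)
  qed
  ultimately have "\<forall>\<^sub>F x in at_inf. ?R x < e" by (rule order_tendstoD(2))
  then show "\<forall>\<^sub>F x in at_inf. dist (u x / G (- x)) (\<integral>y. \<rho> y \<partial>count_space UNIV) < e"
    by eventually_elim (use bnd in \<open>auto simp: dist_real_def intro: le_less_trans\<close>)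
qed

end

section \<open>The tree and the branching property\<close>

text \<open>The jump from the root to its child \<open>i\<close> becomes the jump that is attached to the root of
  \<open>child i \<omega>\<close>. There it does not affect the positions, so the subtree of the child starts from
  \<open>x + jump (child i \<omega>) []\<close>.\<close>

definition child :: "nat \<Rightarrow> 'd::finite outcome \<Rightarrow> 'd outcome" where
  "child i \<omega> = (\<lambda>u. \<omega> (i # u))"

lemma offspring_child: "offspring (child i \<omega>) v = offspring \<omega> (i # v)"
  and jump_child: "jump (child i \<omega>) v = jump \<omega> (i # v)"
  by (simp_all add: child_def offspring_def jump_def)

lemma tree_snoc: "v @ [j] \<in> tree \<omega> \<longleftrightarrow> v \<in> tree \<omega> \<and> j < offspring \<omega> v"
  by (auto intro: tree.child elim: tree.cases)

lemma tree_Cons: "i # v \<in> tree \<omega> \<longleftrightarrow> i < offspring \<omega> [] \<and> v \<in> tree (child i \<omega>)"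
proof (induction v rule: rev_induct)
  case Nil
  then show ?case using tree_snoc[of "[]" i \<omega>] by (auto intro: tree.root)
next
  case (snoc j v)
  then show ?case using tree_snoc[of "i # v" j \<omega>] tree_snoc[of v j "child i \<omega>"]
    by (auto simp: offspring_child)
qed

lemma finite_prefixes: "finite {v. v \<noteq> [] \<and> prefix v u}"
  by (rule finite_subset[of _ "set (prefixes u)"]) auto

lemma position_Nil [simp]: "position x \<omega> [] = x"
proof -
  have "{v. v \<noteq> [] \<and> prefix v ([] :: nat list)} = {}" by auto
  then show ?thesis by (simp add: position_def)
qed

lemma position_Cons: "position x \<omega> (i # v) = position (x + jump (child i \<omega>) []) (child i \<omega>) v"
proof -
  have "{w. w \<noteq> [] \<and> prefix w (i # v)} = insert [i] (Cons i ` {w. w \<noteq> [] \<and> prefix w v})"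
    by (auto simp: prefix_Cons image_iff)
  then have "(\<Sum>w | w \<noteq> [] \<and> prefix w (i # v). jump \<omega> w) =
    jump \<omega> [i] + (\<Sum>w\<in>Cons i ` {w. w \<noteq> [] \<and> prefix w v}. jump \<omega> w)"
    using finite_prefixes[of v] by (simp only:) (subst sum.insert, auto)
  also have "(\<Sum>w\<in>Cons i ` {w. w \<noteq> [] \<and> prefix w v}. jump \<omega> w) = (\<Sum>w | w \<noteq> [] \<and> prefix w v. jump (child i \<omega>) w)"
    by (subst sum.reindex) (auto simp: jump_child)
  finally show ?thesis by (simp add: position_def jump_child add.assoc)
qed

text \<open>The recursions for all counts are instances of this one.\<close>

lemma nn_integral_tree:
  "(\<integral>\<^sup>+u. \<Phi> u \<partial>count_space (tree \<omega>)) =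
    \<Phi> [] + (\<Sum>i<offspring \<omega> []. \<integral>\<^sup>+u. \<Phi> (i # u) \<partial>count_space (tree (child i \<omega>)))"
proof -
  let ?T = "\<lambda>i. Cons i ` tree (child i \<omega>)"
  have pt: "\<Phi> u * indicator (tree \<omega>) u = \<Phi> u * indicator {[]} u + (\<Sum>i<offspring \<omega> []. \<Phi> u * indicator (?T i) u)" for u
  proof (cases u)
    case Nil
    then show ?thesis by (auto simp: tree.root indicator_def intro!: sum.neutral)
  next
    case (Cons j v)
    have "(\<Sum>i<offspring \<omega> []. \<Phi> u * indicator (?T i) u) = (\<Sum>i<offspring \<omega> []. if i = j then \<Phi> u * indicator (?T j) u else 0)"
      using Cons by (intro sum.cong) (auto simp: indicator_def)
    then show ?thesis using Cons by (auto simp: tree_Cons indicator_def)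
  qed
  have "(\<integral>\<^sup>+u. \<Phi> u \<partial>count_space (tree \<omega>)) = (\<integral>\<^sup>+u. \<Phi> u * indicator (tree \<omega>) u \<partial>count_space UNIV)"
    by (subst nn_integral_count_space_indicator) auto
  also have "\<dots> = (\<integral>\<^sup>+u. \<Phi> u * indicator {[]} u \<partial>count_space UNIV) + (\<Sum>i<offspring \<omega> []. \<integral>\<^sup>+u. \<Phi> u * indicator (?T i) u \<partial>count_space UNIV)"
    unfolding pt by (subst nn_integral_add, simp, simp, subst nn_integral_sum, simp, rule refl)
  also have "(\<integral>\<^sup>+u. \<Phi> u * indicator {[]} u \<partial>count_space UNIV) = \<Phi> []"
    by (subst nn_integral_count_space_indicator[symmetric]) (auto simp: nn_integral_count_space_finite)
  also have "(\<Sum>i<offspring \<omega> []. \<integral>\<^sup>+u. \<Phi> u * indicator (?T i) u \<partial>count_space UNIV) =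
    (\<Sum>i<offspring \<omega> []. \<integral>\<^sup>+u. \<Phi> (i # u) \<partial>count_space (tree (child i \<omega>)))"
    by (intro sum.cong refl, subst nn_integral_count_space_indicator[symmetric])
       (auto intro!: nn_integral_bij_count_space[symmetric] simp: bij_betw_def inj_on_def)
  finally show ?thesis .
qed

lemma occupation_time_rec:
  "occupation_time x K \<omega> = indicator K x +
    (\<Sum>i<offspring \<omega> []. occupation_time (x + jump (child i \<omega>) []) K (child i \<omega>))"
  unfolding occupation_time_def by (subst nn_integral_tree) (simp add: position_Cons)

text \<open>The recursion for the occupation time does not determine it, but the count up to generation
  \<open>n\<close> can be treated by induction on \<open>n\<close> and increases to the occupation time.\<close>

definition truncated_occupation ::
    "nat \<Rightarrow> int ^ 'd::finite \<Rightarrow> (int ^ 'd) set \<Rightarrow> 'd outcome \<Rightarrow> ennreal" where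
  "truncated_occupation n x B \<omega> =
     (\<integral>\<^sup>+ u. indicator B (position x \<omega> u) * indicator {u. length u \<le> n} u \<partial>count_space (tree \<omega>))"

lemma truncated_occupation_0: "truncated_occupation 0 x K \<omega> = indicator K x"
  unfolding truncated_occupation_def by (subst nn_integral_tree) simp

lemma truncated_occupation_Suc:
  "truncated_occupation (Suc n) x K \<omega> = indicator K x +
    (\<Sum>i<offspring \<omega> []. truncated_occupation n (x + jump (child i \<omega>) []) K (child i \<omega>))"
  unfolding truncated_occupation_def
  by (subst nn_integral_tree) (simp add: position_Cons indicator_def cong: if_cong)

lemma SUP_truncated_occupation:
  "(SUP n. truncated_occupation n x K \<omega>) = occupation_time x K \<omega>"
proof -
  have "(SUP n. truncated_occupation n x K \<omega>) =
    (\<integral>\<^sup>+ u. (SUP n. indicator K (position x \<omega> u) * indicator {u. length u \<le> n} u) \<partial>count_space (tree \<omega>))"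
    unfolding truncated_occupation_def
    by (intro nn_integral_monotone_convergence_SUP[symmetric])
       (auto simp: incseq_def le_fun_def indicator_def)
  also have "\<dots> = occupation_time x K \<omega>"
    unfolding occupation_time_def
  proof (rule nn_integral_cong)
    fix u
    show "(SUP n. indicator K (position x \<omega> u) * indicator {u. length u \<le> n} u) = (indicator K (position x \<omega> u) :: ennreal)"
      by (rule antisym, rule SUP_least) (auto simp: indicator_def intro!: SUP_upper2[of "length u"])
  qed
  finally show ?thesis .
qed

lemma num_pioneers_eq:
  "num_pioneers x K \<omega> = (\<integral>\<^sup>+u. indicator {u. position x \<omega> u \<in> K \<and> (\<forall>v. strict_prefix v u \<longrightarrow> position x \<omega> v \<notin> K)} u \<partial>count_space (tree \<omega>))"
proof -
  have "num_pioneers x K \<omega> = (\<integral>\<^sup>+u. indicator (pioneers x K \<omega>) u \<partial>count_space UNIV)"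
    by (simp add: num_pioneers_def)
  also have "\<dots> = (\<integral>\<^sup>+u. indicator {u. position x \<omega> u \<in> K \<and> (\<forall>v. strict_prefix v u \<longrightarrow> position x \<omega> v \<notin> K)} u * indicator (tree \<omega>) u \<partial>count_space UNIV)"
    by (intro nn_integral_cong) (auto simp: indicator_def pioneers_def)
  also have "\<dots> = (\<integral>\<^sup>+u. indicator {u. position x \<omega> u \<in> K \<and> (\<forall>v. strict_prefix v u \<longrightarrow> position x \<omega> v \<notin> K)} u \<partial>count_space (tree \<omega>))"
    by (subst nn_integral_count_space_indicator[symmetric]) auto
  finally show ?thesis .
qed

lemma strict_prefix_Cons_iff: "strict_prefix w (i # v) \<longleftrightarrow> w = [] \<or> (\<exists>w'. w = i # w' \<and> strict_prefix w' v)"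
  by (cases w) auto

text \<open>A visit at the root prevents all descendants from being pioneers.\<close>

lemma num_pioneers_rec:
  "num_pioneers x K \<omega> = (if x \<in> K then 1 else
    (\<Sum>i<offspring \<omega> []. num_pioneers (x + jump (child i \<omega>) []) K (child i \<omega>)))"
proof (cases "x \<in> K")
  case True
  have "(\<forall>v. strict_prefix v (i # u) \<longrightarrow> position x \<omega> v \<notin> K) = False" for i u
    using True by (auto simp: strict_prefix_Cons_iff intro!: exI[of _ "[]"])
  then show ?thesis using True unfolding num_pioneers_eq by (subst nn_integral_tree) simp
next
  case False
  have "(\<forall>v. strict_prefix v (i # u) \<longrightarrow> position x \<omega> v \<notin> K) \<longleftrightarrow>
    (\<forall>v. strict_prefix v u \<longrightarrow> position (x + jump (child i \<omega>) []) (child i \<omega>) v \<notin> K)" for i u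
    using False by (auto simp: strict_prefix_Cons_iff position_Cons)
  then show ?thesis using False unfolding num_pioneers_eq
    by (subst nn_integral_tree) (simp add: position_Cons indicator_def[abs_def] cong: if_cong)
qed

lemma num_pioneers_le_occupation: "num_pioneers x K \<omega> \<le> occupation_time x K \<omega>"
  unfolding num_pioneers_eq occupation_time_def
  by (intro nn_integral_mono) (auto simp: indicator_def)

lemma child_update_root [simp]: "child i (fun_upd \<omega> [] a) = child i \<omega>"
  by (simp add: child_def)

lemma offspring_update_root [simp]: "offspring (fun_upd \<omega> [] a) [] = fst a"
  by (simp add: offspring_def)

lemma occupation_time_update_root:
  "occupation_time x K (fun_upd \<omega> [] (n, z)) = occupation_time x K (fun_upd \<omega> [] (n, z'))"
  by (subst (1 2) occupation_time_rec) simp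

lemma num_pioneers_update_root:
  "num_pioneers x K (fun_upd \<omega> [] (n, z)) = num_pioneers x K (fun_upd \<omega> [] (n, z'))"
  by (subst (1 2) num_pioneers_rec) simp

subsection \<open>Measurability\<close>

locale branching =
  fixes p :: "nat pmf" and \<mu> :: "(int ^ 'd::finite) pmf"
begin

abbreviation "M \<equiv> brw_space p \<mu>"

lemma prob_space_M: "prob_space M"
  unfolding brw_space_def by (intro prob_space_PiM prob_space_measure_pmf)

sublocale prob_space M by (rule prob_space_M)

lemma space_M [simp]: "space M = UNIV"
  by (simp add: brw_space_def space_PiM)

lemma measurable_label [measurable]: "(\<lambda>\<omega>. \<omega> u) \<in> M \<rightarrow>\<^sub>M count_space UNIV"
proof -
  have "(\<lambda>\<omega>. \<omega> u) \<in> M \<rightarrow>\<^sub>M measure_pmf (pair_pmf p \<mu>)"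
    unfolding brw_space_def by (rule measurable_component_singleton) auto
  then show ?thesis by (simp add: measurable_def)
qed

lemma measurable_into_M:
  assumes "\<And>u. (\<lambda>x. f x u) \<in> Q \<rightarrow>\<^sub>M count_space UNIV"
  shows "f \<in> Q \<rightarrow>\<^sub>M M"
proof -
  have "(\<lambda>x u. f x u) \<in> Q \<rightarrow>\<^sub>M PiM UNIV (\<lambda>_. measure_pmf (pair_pmf p \<mu>))"
  proof (rule measurable_PiM_single')
    fix u show "(\<lambda>x. f x u) \<in> Q \<rightarrow>\<^sub>M measure_pmf (pair_pmf p \<mu>)"
      using assms[of u] by (simp add: measurable_def)
  qed auto
  then show ?thesis by (simp add: brw_space_def)
qed

lemma measurable_child [measurable]: "child i \<in> M \<rightarrow>\<^sub>M M"
  by (rule measurable_into_M) (simp add: child_def)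

lemma measurable_offspring [measurable]: "(\<lambda>\<omega>. offspring \<omega> u) \<in> M \<rightarrow>\<^sub>M count_space UNIV"
  unfolding offspring_def by (rule measurable_compose[OF measurable_label]) simp

lemma measurable_jump [measurable]: "(\<lambda>\<omega>. jump \<omega> u) \<in> M \<rightarrow>\<^sub>M count_space UNIV"
  unfolding jump_def by (rule measurable_compose[OF measurable_label]) simp

lemma measurable_tree [measurable]: "Measurable.pred M (\<lambda>\<omega>. u \<in> tree \<omega>)"
proof (induction u rule: rev_induct)
  case Nil then show ?case by (simp add: tree.root)
next
  case (snoc j u)
  then show ?case unfolding tree_snoc by measurable
qed

lemma position_snoc: "position x \<omega> (u @ [j]) = position x \<omega> u + jump \<omega> (u @ [j])"
proof -
  have "{v. v \<noteq> [] \<and> prefix v (u @ [j])} = insert (u @ [j]) {v. v \<noteq> [] \<and> prefix v u}"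
    by (auto simp: prefix_snoc)
  moreover have "u @ [j] \<notin> {v. v \<noteq> [] \<and> prefix v u}" by (auto dest: prefix_length_le)
  ultimately show ?thesis using finite_prefixes[of u]
    by (simp add: position_def sum.insert add_ac)
qed

lemma measurable_position [measurable]: "(\<lambda>\<omega>. position x \<omega> u) \<in> M \<rightarrow>\<^sub>M count_space UNIV"
proof (induction u rule: rev_induct)
  case Nil then show ?case by simp
next
  case (snoc j u)
  have "(\<lambda>\<omega>. position x \<omega> u + jump \<omega> (u @ [j])) \<in> M \<rightarrow>\<^sub>M count_space UNIV"
  proof (rule measurable_compose_countable[OF _ snoc])
    fix y show "(\<lambda>\<omega>. y + jump \<omega> (u @ [j])) \<in> M \<rightarrow>\<^sub>M count_space UNIV"
      by (rule measurable_compose[OF measurable_jump]) simp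
  qed
  then show ?case by (simp add: position_snoc)
qed

lemma measurable_tree_integral:
  assumes [measurable]: "\<And>u. (\<lambda>\<omega>. \<Phi> \<omega> u) \<in> borel_measurable M"
  shows "(\<lambda>\<omega>. \<integral>\<^sup>+u. \<Phi> \<omega> u \<partial>count_space (tree \<omega>)) \<in> borel_measurable M"
proof -
  have "(\<integral>\<^sup>+u. \<Phi> \<omega> u \<partial>count_space (tree \<omega>)) = (\<Sum>n. \<Phi> \<omega> (from_nat n) * indicator (tree \<omega>) (from_nat n :: nat list) * indicator (range (to_nat :: nat list \<Rightarrow> nat)) n)" for \<omega>
  proof -
    have "(\<integral>\<^sup>+u. \<Phi> \<omega> u \<partial>count_space (tree \<omega>)) = (\<integral>\<^sup>+u. \<Phi> \<omega> u * indicator (tree \<omega>) u \<partial>count_space UNIV)"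
      by (subst nn_integral_count_space_indicator) auto
    also have "\<dots> = (\<integral>\<^sup>+n. \<Phi> \<omega> (from_nat n) * indicator (tree \<omega>) (from_nat n) \<partial>count_space (range (to_nat :: nat list \<Rightarrow> nat)))"
      by (subst nn_integral_bij_count_space[of to_nat UNIV, symmetric]) (auto simp: bij_betw_def)
    also have "\<dots> = (\<integral>\<^sup>+n. \<Phi> \<omega> (from_nat n) * indicator (tree \<omega>) (from_nat n) * indicator (range (to_nat :: nat list \<Rightarrow> nat)) n \<partial>count_space UNIV)"
      by (subst nn_integral_count_space_indicator) auto
    finally show ?thesis by (simp add: nn_integral_count_space_nat)
  qed
  then show ?thesis by simp
qed

lemma measurable_occupation_time [measurable]: "occupation_time x K \<in> borel_measurable M"
  unfolding occupation_time_def[abs_def]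
  by (intro measurable_tree_integral measurable_compose[OF measurable_position]) simp

lemma measurable_truncated_occupation [measurable]: "truncated_occupation n x K \<in> borel_measurable M"
  unfolding truncated_occupation_def[abs_def]
  by (intro measurable_tree_integral borel_measurable_times_ennreal measurable_compose[OF measurable_position]) auto

lemma measurable_num_pioneers [measurable]: "num_pioneers x K \<in> borel_measurable M"
proof -
  have [measurable]: "Measurable.pred M (\<lambda>\<omega>. position x \<omega> v \<in> K)" for v
    by (rule measurable_compose[OF measurable_position]) simp
  have "Measurable.pred M (\<lambda>\<omega>. position x \<omega> u \<in> K \<and> (\<forall>v. strict_prefix v u \<longrightarrow> position x \<omega> v \<notin> K))" for u
    by measurable
  then have "(\<lambda>\<omega>. indicator {u. position x \<omega> u \<in> K \<and> (\<forall>v. strict_prefix v u \<longrightarrow> position x \<omega> v \<notin> K)} u :: ennreal) \<in> borel_measurable M" for u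
    unfolding indicator_def by simp
  then show ?thesis unfolding num_pioneers_eq[abs_def] by (rule measurable_tree_integral)
qed

subsection \<open>The branching property at the root\<close>

lemma distr_update_root:
  "distr (measure_pmf (pair_pmf p \<mu>) \<Otimes>\<^sub>M M) M (\<lambda>(a, \<omega>). (fun_upd \<omega> [] a)) = M"
  using distr_pair_PiM_eq_PiM[of UNIV "\<lambda>_. measure_pmf (pair_pmf p \<mu>)" "[] :: nat list"]
  by (simp add: brw_space_def prob_space_measure_pmf)

lemma measurable_update_root: "(\<lambda>(a, \<omega>). (fun_upd \<omega> [] a)) \<in> measure_pmf (pair_pmf p \<mu>) \<Otimes>\<^sub>M M \<rightarrow>\<^sub>M M"
proof (rule measurable_into_M)
  fix u show "(\<lambda>x. (case x of (a, \<omega>) \<Rightarrow> (fun_upd \<omega> [] a)) u) \<in> measure_pmf (pair_pmf p \<mu>) \<Otimes>\<^sub>M M \<rightarrow>\<^sub>M count_space UNIV"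
  proof (cases "u = []")
    case True
    have "fst \<in> measure_pmf (pair_pmf p \<mu>) \<Otimes>\<^sub>M M \<rightarrow>\<^sub>M measure_pmf (pair_pmf p \<mu>)" by (rule measurable_fst)
    then have "fst \<in> measure_pmf (pair_pmf p \<mu>) \<Otimes>\<^sub>M M \<rightarrow>\<^sub>M count_space UNIV" by (simp add: measurable_def)
    then show ?thesis using True by (simp add: case_prod_beta')
  next
    case False
    then show ?thesis using measurable_compose[OF measurable_snd measurable_label]
      by (simp add: case_prod_beta')
  qed
qed

lemma nn_integral_update_root:
  assumes [measurable]: "f \<in> borel_measurable M"
  shows "(\<integral>\<^sup>+\<omega>. f \<omega> \<partial>M) = (\<integral>\<^sup>+z. \<integral>\<^sup>+n. \<integral>\<^sup>+\<omega>. f (fun_upd \<omega> [] (n, z)) \<partial>M \<partial>measure_pmf p \<partial>measure_pmf \<mu>)"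
proof -
  have m: "(\<lambda>(a, \<omega>). f (fun_upd \<omega> [] a)) \<in> borel_measurable (measure_pmf (pair_pmf p \<mu>) \<Otimes>\<^sub>M M)"
    using measurable_compose[OF measurable_update_root assms] by (simp add: case_prod_beta')
  have "(\<integral>\<^sup>+\<omega>. f \<omega> \<partial>M) = (\<integral>\<^sup>+x. f (case x of (a, \<omega>) \<Rightarrow> (fun_upd \<omega> [] a)) \<partial>(measure_pmf (pair_pmf p \<mu>) \<Otimes>\<^sub>M M))"
    by (subst distr_update_root[symmetric], subst nn_integral_distr) (auto intro: measurable_update_root)
  also have "\<dots> = (\<integral>\<^sup>+x. (case x of (a, \<omega>) \<Rightarrow> f (fun_upd \<omega> [] a)) \<partial>(measure_pmf (pair_pmf p \<mu>) \<Otimes>\<^sub>M M))"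
    by (simp add: case_prod_beta')
  also have "\<dots> = (\<integral>\<^sup>+a. \<integral>\<^sup>+\<omega>. f (fun_upd \<omega> [] a) \<partial>M \<partial>measure_pmf (pair_pmf p \<mu>))"
    using nn_integral_fst[OF m] by simp
  also have "\<dots> = (\<integral>\<^sup>+a. \<integral>\<^sup>+\<omega>. f (fun_upd \<omega> [] (prod.swap a)) \<partial>M \<partial>measure_pmf (pair_pmf \<mu> p))"
    by (subst pair_commute_pmf) (simp add: case_prod_beta' prod.swap_def)
  also have "\<dots> = (\<integral>\<^sup>+z. \<integral>\<^sup>+n. \<integral>\<^sup>+\<omega>. f (fun_upd \<omega> [] (n, z)) \<partial>M \<partial>measure_pmf p \<partial>measure_pmf \<mu>)"
    by (subst nn_integral_pair_pmf') simp
  finally show ?thesis .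
qed

text \<open>The jump at the root is independent of all other labels. As \<open>H y\<close> does not depend on it, it
  may be averaged separately.\<close>

lemma nn_integral_root_jump:
  fixes H :: "int ^ 'd \<Rightarrow> 'd outcome \<Rightarrow> ennreal"
  assumes [measurable]: "\<And>y. H y \<in> borel_measurable M"
    and upd: "\<And>y \<omega> n z z'. H y (fun_upd \<omega> [] (n, z)) = H y (fun_upd \<omega> [] (n, z'))"
  shows "(\<integral>\<^sup>+\<omega>. H (x + jump \<omega> []) \<omega> \<partial>M) = (\<integral>\<^sup>+z. \<integral>\<^sup>+\<omega>. H (x + z) \<omega> \<partial>M \<partial>measure_pmf \<mu>)"
proof -
  have m: "(\<lambda>\<omega>. H (x + jump \<omega> []) \<omega>) \<in> borel_measurable M"
    by (rule measurable_compose_countable[where f="\<lambda>z \<omega>. H (x + z) \<omega>"]) auto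
  have one: "(\<integral>\<^sup>+\<omega>. H y \<omega> \<partial>M) = (\<integral>\<^sup>+n. \<integral>\<^sup>+\<omega>. H y (fun_upd \<omega> [] (n, z)) \<partial>M \<partial>measure_pmf p)" for y z
  proof -
    have "(\<integral>\<^sup>+\<omega>. H y \<omega> \<partial>M) = (\<integral>\<^sup>+z'. \<integral>\<^sup>+n. \<integral>\<^sup>+\<omega>. H y (fun_upd \<omega> [] (n, z')) \<partial>M \<partial>measure_pmf p \<partial>measure_pmf \<mu>)"
      by (rule nn_integral_update_root) simp
    also have "\<dots> = (\<integral>\<^sup>+z'. \<integral>\<^sup>+n. \<integral>\<^sup>+\<omega>. H y (fun_upd \<omega> [] (n, z)) \<partial>M \<partial>measure_pmf p \<partial>measure_pmf \<mu>)"
      by (intro nn_integral_cong upd)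
    finally show ?thesis by simp
  qed
  show ?thesis
    by (subst nn_integral_update_root[OF m], simp only: jump_def fun_upd_same snd_conv)
       (rule nn_integral_cong, rule one[symmetric])
qed

lemma indep_labels: "indep_vars (\<lambda>_. measure_pmf (pair_pmf p \<mu>)) (\<lambda>u \<omega>. \<omega> u) UNIV"
proof -
  let ?S = "measure_pmf (pair_pmf p \<mu>)"
  have rv: "random_variable ?S (\<lambda>\<omega>. \<omega> u)" for u
    unfolding brw_space_def by (rule measurable_component_singleton) auto
  have "distr M ?S (\<lambda>\<omega>. \<omega> u) = ?S" for u
    unfolding brw_space_def by (rule distr_PiM_component) (auto intro: prob_space_measure_pmf)
  moreover have "distr M (PiM UNIV (\<lambda>_. ?S)) (\<lambda>x. \<lambda>i\<in>UNIV. x i) = PiM UNIV (\<lambda>_. ?S)"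
  proof -
    have "distr M (PiM UNIV (\<lambda>_. ?S)) (\<lambda>x. \<lambda>i\<in>UNIV. x i) = distr M M (\<lambda>x. x)"
      by (rule distr_cong) (auto simp: brw_space_def)
    then show ?thesis by (simp add: distr_id2 brw_space_def)
  qed
  ultimately show ?thesis
    by (subst indep_vars_iff_distr_eq_PiM) (use rv in auto)
qed

lemma distr_child: "distr M M (child i) = M"
proof -
  have "distr (PiM UNIV (\<lambda>_. measure_pmf (pair_pmf p \<mu>))) (PiM UNIV (\<lambda>_. measure_pmf (pair_pmf p \<mu>))) (\<lambda>\<omega>. \<lambda>u\<in>UNIV. \<omega> (i # u)) = PiM UNIV (\<lambda>_. measure_pmf (pair_pmf p \<mu>))"
    by (rule distr_PiM_reindex) (auto intro: prob_space_measure_pmf)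
  then show ?thesis by (simp add: brw_space_def child_def[abs_def] restrict_UNIV)
qed

text \<open>The number of children of the root and the subtrees of the children are functions of
  disjoint sets of labels. All labels carry variables, whether or not they belong to the
  tree, so that \<open>J\<close> need not depend on the number of children.\<close>

lemma branching_product:
  fixes Y :: "nat \<Rightarrow> 'd outcome \<Rightarrow> ennreal" and f :: "nat \<Rightarrow> ennreal"
  assumes J: "finite J" and Y[measurable]: "\<And>i. i \<in> J \<Longrightarrow> Y i \<in> borel_measurable M"
  shows "(\<integral>\<^sup>+\<omega>. f (offspring \<omega> []) * (\<Prod>i\<in>J. Y i (child i \<omega>)) \<partial>M) =
    (\<integral>\<^sup>+n. f n \<partial>measure_pmf p) * (\<Prod>i\<in>J. \<integral>\<^sup>+\<omega>. Y i \<omega> \<partial>M)"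
proof -
  let ?S = "measure_pmf (pair_pmf p \<mu>)"
  \<comment> \<open>The index \<open>None\<close> stands for the label of the root, \<open>Some
    i\<close> for the labels of the subtree of child \<open>i\<close>.\<close>
  define K where "K = (\<lambda>j. case j of None \<Rightarrow> {[] :: nat list} | Some i \<Rightarrow> range (Cons i))"
  define I where "I = insert None (Some ` J)"
  define Q :: "nat option \<Rightarrow> (nat list \<Rightarrow> nat \<times> (int ^ 'd)) \<Rightarrow> ennreal" where
    "Q = (\<lambda>j \<eta>. case j of None \<Rightarrow> f (fst (\<eta> [])) | Some i \<Rightarrow> Y i (\<lambda>u. \<eta> (i # u)))"
  have "indep_vars (\<lambda>j. PiM (K j) (\<lambda>_. ?S)) (\<lambda>j \<omega>. restrict (\<lambda>u. \<omega> u) (K j)) I"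
    by (rule indep_vars_restrict[OF indep_labels])
       (auto simp: disjoint_family_on_def K_def I_def split: option.splits)
  then have ind: "indep_vars (\<lambda>_. borel) (\<lambda>j \<omega>. Q j (restrict (\<lambda>u. \<omega> u) (K j))) I"
  proof (rule indep_vars_compose2)
    fix j assume j: "j \<in> I"
    show "Q j \<in> borel_measurable (PiM (K j) (\<lambda>_. ?S))"
    proof (cases j)
      case None
      have "(\<lambda>\<eta>. \<eta> []) \<in> PiM (K j) (\<lambda>_. ?S) \<rightarrow>\<^sub>M ?S"
        using None by (intro measurable_component_singleton) (simp add: K_def)
      then have "(\<lambda>\<eta>. \<eta> []) \<in> PiM (K j) (\<lambda>_. ?S) \<rightarrow>\<^sub>M count_space UNIV" by (simp add: measurable_def)
      then show ?thesis unfolding Q_def None option.case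
        by (rule measurable_compose) simp
    next
      case (Some i)
      have "(\<lambda>\<eta>. \<eta> (i # u)) \<in> PiM (K j) (\<lambda>_. ?S) \<rightarrow>\<^sub>M ?S" for u
        using Some by (intro measurable_component_singleton) (simp add: K_def)
      then have "(\<lambda>\<eta> u. \<eta> (i # u)) \<in> PiM (K j) (\<lambda>_. ?S) \<rightarrow>\<^sub>M M"
        by (intro measurable_into_M) (simp add: measurable_def)
      moreover have "i \<in> J" using j Some by (auto simp: I_def)
      ultimately show ?thesis unfolding Q_def Some option.case
        using measurable_compose[OF _ Y] by blast
    qed
  qed
  have fI: "finite I" using J by (simp add: I_def)
  have prod_I: "(\<Prod>j\<in>I. g j) = g None * (\<Prod>i\<in>J. g (Some i))" for g :: "nat option \<Rightarrow> ennreal"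
    unfolding I_def using J by (subst prod.insert) (auto simp: prod.reindex)
  have Q1: "Q None (restrict (\<lambda>u. \<omega> u) (K None)) = f (offspring \<omega> [])" for \<omega>
    by (simp add: Q_def K_def offspring_def)
  have Q2: "Q (Some i) (restrict (\<lambda>u. \<omega> u) (K (Some i))) = Y i (child i \<omega>)" for \<omega> i
    by (simp add: Q_def K_def child_def)
  have "(\<integral>\<^sup>+\<omega>. (\<Prod>j\<in>I. Q j (restrict (\<lambda>u. \<omega> u) (K j))) \<partial>M) = (\<Prod>j\<in>I. \<integral>\<^sup>+\<omega>. Q j (restrict (\<lambda>u. \<omega> u) (K j)) \<partial>M)"
    by (rule indep_vars_nn_integral[OF fI ind]) simp
  then have "(\<integral>\<^sup>+\<omega>. f (offspring \<omega> []) * (\<Prod>i\<in>J. Y i (child i \<omega>)) \<partial>M) =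
    (\<integral>\<^sup>+\<omega>. f (offspring \<omega> []) \<partial>M) * (\<Prod>i\<in>J. \<integral>\<^sup>+\<omega>. Y i (child i \<omega>) \<partial>M)"
    unfolding prod_I Q1 Q2 .
  also have "(\<integral>\<^sup>+\<omega>. f (offspring \<omega> []) \<partial>M) = (\<integral>\<^sup>+n. f n \<partial>measure_pmf p)"
  proof -
    have "distr M ?S (\<lambda>\<omega>. \<omega> []) = ?S"
      unfolding brw_space_def by (rule distr_PiM_component) (auto intro: prob_space_measure_pmf)
    then have "(\<integral>\<^sup>+a. f (fst a) \<partial>?S) = (\<integral>\<^sup>+a. f (fst a) \<partial>distr M ?S (\<lambda>\<omega>. \<omega> []))" by simp
    also have "\<dots> = (\<integral>\<^sup>+\<omega>. f (fst (\<omega> [])) \<partial>M)"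
    proof (rule nn_integral_distr)
      show "(\<lambda>\<omega>. \<omega> []) \<in> M \<rightarrow>\<^sub>M ?S"
        unfolding brw_space_def by (rule measurable_component_singleton) simp
    qed simp
    finally show ?thesis by (simp add: offspring_def nn_integral_pair_pmf')
  qed
  also have "(\<Prod>i\<in>J. \<integral>\<^sup>+\<omega>. Y i (child i \<omega>) \<partial>M) = (\<Prod>i\<in>J. \<integral>\<^sup>+\<omega>. Y i \<omega> \<partial>M)"
  proof (rule prod.cong[OF refl])
    fix i assume "i \<in> J"
    then show "(\<integral>\<^sup>+\<omega>. Y i (child i \<omega>) \<partial>M) = (\<integral>\<^sup>+\<omega>. Y i \<omega> \<partial>M)"
      by (subst (2) distr_child[of i, symmetric], subst nn_integral_distr) auto
  qed
  finally show ?thesis .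
qed

lemma sum_lessThan_suminf: "(\<Sum>i<n. a i) = (\<Sum>i. indicator {i. i < n} i * (a i :: ennreal))"
proof -
  have "(\<Sum>i. indicator {i. i < n} i * a i) = (\<Sum>i<n. indicator {i. i < n} i * a i)"
    by (rule suminf_finite) auto
  then show ?thesis by simp
qed

lemma of_nat_eq_suminf: "(of_nat n :: ennreal) = (\<Sum>i. indicator {n. i < n} n)"
  using sum_lessThan_suminf[of "\<lambda>_. 1" n] by (simp add: indicator_def)

text \<open>Wald's identity: writing the sum as a series with the indicators of \<open>i < offspring \<omega> []\<close>
  reduces it to \<open>branching_product\<close>.\<close>

lemma branching_sum:
  assumes Y[measurable]: "Y \<in> borel_measurable M"
  shows "(\<integral>\<^sup>+\<omega>. (\<Sum>i<offspring \<omega> []. Y (child i \<omega>)) \<partial>M) =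
    (\<integral>\<^sup>+n. of_nat n \<partial>measure_pmf p) * (\<integral>\<^sup>+\<omega>. Y \<omega> \<partial>M)"
proof -
  let ?y = "\<integral>\<^sup>+\<omega>. Y \<omega> \<partial>M"
  have m: "(\<lambda>\<omega>. indicator {n. i < n} (offspring \<omega> []) * Y (child i \<omega>)) \<in> borel_measurable M" for i
    by (intro borel_measurable_times_ennreal measurable_compose[OF measurable_offspring] measurable_compose[OF measurable_child]) auto
  have "(\<integral>\<^sup>+\<omega>. (\<Sum>i<offspring \<omega> []. Y (child i \<omega>)) \<partial>M) =
    (\<integral>\<^sup>+\<omega>. (\<Sum>i. indicator {n. i < n} (offspring \<omega> []) * Y (child i \<omega>)) \<partial>M)"
    by (subst sum_lessThan_suminf) (simp add: indicator_def)
  also have "\<dots> = (\<Sum>i. \<integral>\<^sup>+\<omega>. indicator {n. i < n} (offspring \<omega> []) * Y (child i \<omega>) \<partial>M)"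
    by (rule nn_integral_suminf[OF m])
  also have "\<dots> = (\<Sum>i. (\<integral>\<^sup>+n. indicator {n. i < n} n \<partial>measure_pmf p) * ?y)"
    using branching_product[of "{_}" "\<lambda>_. Y"] by simp
  also have "\<dots> = (\<Sum>i. \<integral>\<^sup>+n. indicator {n. i < n} n \<partial>measure_pmf p) * ?y"
    by (rule ennreal_suminf_multc)
  also have "(\<Sum>i. \<integral>\<^sup>+n. indicator {n. i < n} n \<partial>measure_pmf p) = (\<integral>\<^sup>+n. of_nat n \<partial>measure_pmf p)"
    unfolding of_nat_eq_suminf by (rule nn_integral_suminf[symmetric]) simp
  finally show ?thesis .
qed

lemma branching_pairs:
  assumes Y[measurable]: "Y \<in> borel_measurable M"
  shows "(\<integral>\<^sup>+\<omega>. (\<Sum>i<offspring \<omega> []. \<Sum>j<offspring \<omega> []. if i = j then 0 else Y (child i \<omega>) * Y (child j \<omega>)) \<partial>M) =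
    (\<integral>\<^sup>+n. of_nat (n * (n - 1)) \<partial>measure_pmf p) * (\<integral>\<^sup>+\<omega>. Y \<omega> \<partial>M)\<^sup>2"
proof -
  let ?y = "\<integral>\<^sup>+\<omega>. Y \<omega> \<partial>M"
  let ?c = "\<lambda>i j n. if i = j then 0 else indicator {n. i < n \<and> j < n} n :: ennreal"
  have m: "(\<lambda>\<omega>. ?c i j (offspring \<omega> []) * (Y (child i \<omega>) * Y (child j \<omega>))) \<in> borel_measurable M" for i j
    by (intro borel_measurable_times_ennreal measurable_compose[OF measurable_offspring] measurable_compose[OF measurable_child]) auto
  have pt: "(\<Sum>i<n. \<Sum>j<n. if i = j then 0 else a i * a j) = (\<Sum>i. \<Sum>j. ?c i j n * (a i * a j))" for n and a :: "nat \<Rightarrow> ennreal"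
  proof -
    have "(\<Sum>i<n. \<Sum>j<n. if i = j then 0 else a i * a j) = (\<Sum>i. indicator {i. i < n} i * (\<Sum>j. indicator {j. j < n} j * (if i = j then 0 else a i * a j)))"
      unfolding sum_lessThan_suminf ..
    also have "\<dots> = (\<Sum>i. \<Sum>j. indicator {i. i < n} i * (indicator {j. j < n} j * (if i = j then 0 else a i * a j)))"
      by simp
    also have "\<dots> = (\<Sum>i. \<Sum>j. ?c i j n * (a i * a j))"
      by (intro suminf_cong) (auto simp: indicator_def)
    finally show ?thesis .
  qed
  have pt1: "(\<Sum>i<n. \<Sum>j<n. if i = j then 0 else 1 * 1) = (\<Sum>i. \<Sum>j. ?c i j n * (1 * 1))" for n
    by (rule pt)
  have ij: "(\<integral>\<^sup>+\<omega>. ?c i j (offspring \<omega> []) * (Y (child i \<omega>) * Y (child j \<omega>)) \<partial>M) = (\<integral>\<^sup>+n. ?c i j n \<partial>measure_pmf p) * ?y\<^sup>2" for i j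
  proof (cases "i = j")
    case False
    then show ?thesis using branching_product[of "{i, j}" "\<lambda>_. Y" "?c i j"] by (simp add: power2_eq_square)
  qed simp
  have "(\<integral>\<^sup>+\<omega>. (\<Sum>i<offspring \<omega> []. \<Sum>j<offspring \<omega> []. if i = j then 0 else Y (child i \<omega>) * Y (child j \<omega>)) \<partial>M) =
    (\<integral>\<^sup>+\<omega>. (\<Sum>i. \<Sum>j. ?c i j (offspring \<omega> []) * (Y (child i \<omega>) * Y (child j \<omega>))) \<partial>M)"
    by (intro nn_integral_cong pt)
  also have "\<dots> = (\<Sum>i. \<integral>\<^sup>+\<omega>. (\<Sum>j. ?c i j (offspring \<omega> []) * (Y (child i \<omega>) * Y (child j \<omega>))) \<partial>M)"
    using m by (intro nn_integral_suminf) measurable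
  also have "\<dots> = (\<Sum>i. \<Sum>j. \<integral>\<^sup>+\<omega>. ?c i j (offspring \<omega> []) * (Y (child i \<omega>) * Y (child j \<omega>)) \<partial>M)"
    by (intro suminf_cong nn_integral_suminf m)
  also have "\<dots> = (\<Sum>i. \<Sum>j. (\<integral>\<^sup>+n. ?c i j n \<partial>measure_pmf p) * ?y\<^sup>2)"
    unfolding ij ..
  also have "\<dots> = (\<Sum>i. \<Sum>j. \<integral>\<^sup>+n. ?c i j n \<partial>measure_pmf p) * ?y\<^sup>2"
    unfolding ennreal_suminf_multc ..
  also have "(\<Sum>i. \<Sum>j. \<integral>\<^sup>+n. ?c i j n \<partial>measure_pmf p) = (\<integral>\<^sup>+n. (\<Sum>i. \<Sum>j. ?c i j n) \<partial>measure_pmf p)"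
    by (subst nn_integral_suminf, simp, subst nn_integral_suminf, simp, rule refl)
  also have "\<dots> = (\<integral>\<^sup>+n. of_nat (n * (n - 1)) \<partial>measure_pmf p)"
  proof (rule nn_integral_cong)
    fix n :: nat
    have "(\<Sum>i. \<Sum>j. ?c i j n) = (\<Sum>i<n. \<Sum>j<n. if i = j then 0 else 1)"
      using pt1[of n] by (simp only: mult_1_left mult_1_right)
    also have "\<dots> = (\<Sum>i<n. of_nat (n - 1))"
    proof (rule sum.cong[OF refl])
      fix i assume "i \<in> {..<n}"
      then have "(\<Sum>j<n. if i = j then 0 else 1) = (\<Sum>j\<in>{..<n} - {i}. 1 :: ennreal)"
        by (intro sum.mono_neutral_cong_right) auto
      then show "(\<Sum>j<n. if i = j then 0 else 1 :: ennreal) = of_nat (n - 1)"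
        using \<open>i \<in> {..<n}\<close> by simp
    qed
    finally show "(\<Sum>i. \<Sum>j. ?c i j n) = of_nat (n * (n - 1))" by simp
  qed
  finally show ?thesis .
qed

lemma branching_power:
  assumes Y[measurable]: "Y \<in> borel_measurable M"
  shows "(\<integral>\<^sup>+\<omega>. (\<Prod>i<offspring \<omega> []. Y (child i \<omega>)) \<partial>M) =
    (\<integral>\<^sup>+n. (\<integral>\<^sup>+\<omega>. Y \<omega> \<partial>M) ^ n \<partial>measure_pmf p)"
proof -
  let ?y = "\<integral>\<^sup>+\<omega>. Y \<omega> \<partial>M"
  have m: "(\<lambda>\<omega>. indicator {k} (offspring \<omega> []) * (\<Prod>i<k. Y (child i \<omega>))) \<in> borel_measurable M" for k
    by (intro borel_measurable_times_ennreal measurable_compose[OF measurable_offspring]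
        borel_measurable_prod_ennreal measurable_compose[OF measurable_child]) auto
  have pt: "a n = (\<Sum>k. indicator {k} n * (a k :: ennreal))" for a :: "nat \<Rightarrow> ennreal" and n
  proof -
    have "(\<Sum>k. indicator {k} n * a k) = (\<Sum>k\<in>{n}. indicator {k} n * a k)"
      by (rule suminf_finite) auto
    then show ?thesis by simp
  qed
  have "(\<integral>\<^sup>+\<omega>. (\<Prod>i<offspring \<omega> []. Y (child i \<omega>)) \<partial>M) =
    (\<integral>\<^sup>+\<omega>. (\<Sum>k. indicator {k} (offspring \<omega> []) * (\<Prod>i<k. Y (child i \<omega>))) \<partial>M)"
  proof (rule nn_integral_cong)
    fix \<omega>
    show "(\<Prod>i<offspring \<omega> []. Y (child i \<omega>)) = (\<Sum>k. indicator {k} (offspring \<omega> []) * (\<Prod>i<k. Y (child i \<omega>)))"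
      using pt[of "\<lambda>k. \<Prod>i<k. Y (child i \<omega>)" "offspring \<omega> []"] .
  qed
  also have "\<dots> = (\<Sum>k. \<integral>\<^sup>+\<omega>. indicator {k} (offspring \<omega> []) * (\<Prod>i<k. Y (child i \<omega>)) \<partial>M)"
    by (rule nn_integral_suminf[OF m])
  also have "\<dots> = (\<Sum>k. (\<integral>\<^sup>+n. indicator {k} n \<partial>measure_pmf p) * ?y ^ k)"
    by (subst branching_product) auto
  also have "\<dots> = (\<Sum>k. (\<integral>\<^sup>+n. indicator {k} n * ?y ^ k \<partial>measure_pmf p))"
    by (subst nn_integral_multc) auto
  also have "\<dots> = (\<integral>\<^sup>+n. (\<Sum>k. indicator {k} n * ?y ^ k) \<partial>measure_pmf p)"
    by (rule nn_integral_suminf[symmetric]) simp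
  also have "\<dots> = (\<integral>\<^sup>+n. ?y ^ n \<partial>measure_pmf p)"
    by (rule nn_integral_cong) (rule pt[of "\<lambda>k. ?y ^ k", symmetric])
  finally show ?thesis .
qed

end

section \<open>Decomposition at the first generation\<close>

lemma occupation_time_eq_emeasure:
  "occupation_time x B \<omega> = emeasure (count_space UNIV) {u \<in> tree \<omega>. position x \<omega> u \<in> B}"
proof -
  have "occupation_time x B \<omega> = (\<integral>\<^sup>+u. indicator B (position x \<omega> u) * indicator (tree \<omega>) u \<partial>count_space UNIV)"
    unfolding occupation_time_def by (subst nn_integral_count_space_indicator) auto
  also have "\<dots> = (\<integral>\<^sup>+u. indicator {u \<in> tree \<omega>. position x \<omega> u \<in> B} u \<partial>count_space UNIV)"
    by (intro nn_integral_cong) (auto simp: indicator_def)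
  finally show ?thesis by simp
qed

lemma emeasure_count_space_of_nat:
  "emeasure (count_space UNIV) S = of_nat (card S) \<or> emeasure (count_space UNIV) S = \<top>"
  by (cases "finite S") auto

lemma occupation_time_cases:
  obtains n :: nat where "occupation_time x B \<omega> = of_nat n" | "occupation_time x B \<omega> = \<top>"
  unfolding occupation_time_eq_emeasure using emeasure_count_space_of_nat by blast

lemma num_pioneers_cases:
  obtains n :: nat where "num_pioneers x B \<omega> = of_nat n" | "num_pioneers x B \<omega> = \<top>"
  unfolding num_pioneers_def using emeasure_count_space_of_nat by blast

lemma occupation_time_ge_1: "occupation_time x B \<omega> \<ge> 1 \<longleftrightarrow> occupation_time x B \<omega> \<noteq> 0"
  by (rule occupation_time_cases[of x B \<omega>]) (auto simp: of_nat_eq_0_iff Suc_le_eq)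

text \<open>The left side vanishes if at most one term is nonzero. If there are \<open>m \<ge> 2\<close> nonzero terms,
  it is at most \<open>B * (1 + m)\<close>, and the double sum counts \<open>m * (m - 1) \<ge> (1 + m) / 2\<close> ordered
  pairs.\<close>

lemma additive_defect:
  fixes a :: "nat \<Rightarrow> 'a::comm_monoid_add" and F :: "'a \<Rightarrow> real"
  assumes F: "F 0 = 0" "\<And>x. \<bar>F x\<bar> \<le> B"
  shows "\<bar>F (\<Sum>i<n. a i) - (\<Sum>i<n. F (a i))\<bar> \<le>
    2 * B * (\<Sum>i<n. \<Sum>j<n. if i = j then 0 else of_bool (a i \<noteq> 0) * of_bool (a j \<noteq> 0))"
proof -
  define S where "S = {i. i < n \<and> a i \<noteq> 0}"
  have finS: "finite S" by (simp add: S_def)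
  have B0: "B \<ge> 0" using F(2)[of 0] by linarith
  have 1: "(\<Sum>i<n. a i) = (\<Sum>i\<in>S. a i)" "(\<Sum>i<n. F (a i)) = (\<Sum>i\<in>S. F (a i))"
    by (rule sum.mono_neutral_right; auto simp: S_def F(1))+
  have inner: "(\<Sum>j<n. if i = j then 0 else of_bool (a i \<noteq> 0) * of_bool (a j \<noteq> 0)) = (if i \<in> S then real (card S) - 1 else 0)" if "i < n" for i
  proof (cases "i \<in> S")
    case True
    have "(\<Sum>j<n. if i = j then 0 else of_bool (a i \<noteq> 0) * of_bool (a j \<noteq> 0)) = (\<Sum>j\<in>S - {i}. 1 :: real)"
      using True by (intro sum.mono_neutral_cong_right) (auto simp: S_def)
    also have "\<dots> = real (card S) - 1"
    proof -
      have "card S \<noteq> 0" using True finS by auto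
      then have "Suc 0 \<le> card S" by linarith
      then show ?thesis using True finS by (simp add: of_nat_diff)
    qed
    finally show ?thesis using True by simp
  next
    case False then show ?thesis using that by (auto simp: S_def intro!: sum.neutral)
  qed
  have 2: "(\<Sum>i<n. \<Sum>j<n. if i = j then 0 else of_bool (a i \<noteq> 0) * of_bool (a j \<noteq> 0)) = real (card S) * (real (card S) - 1)"
  proof -
    have "(\<Sum>i<n. \<Sum>j<n. if i = j then 0 else of_bool (a i \<noteq> 0) * of_bool (a j \<noteq> 0)) = (\<Sum>i<n. if i \<in> S then real (card S) - 1 else 0)"
      by (intro sum.cong refl inner) simp
    also have "\<dots> = (\<Sum>i\<in>S. real (card S) - 1)"
      by (intro sum.mono_neutral_cong_right) (auto simp: S_def)
    finally show ?thesis by simp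
  qed
  consider "card S = 0" | "card S = 1" | "card S \<ge> 2" by linarith
  then show ?thesis
  proof cases
    case 1
    then have "S = {}" using finS by simp
    then show ?thesis unfolding 2 \<open>(\<Sum>i<n. a i) = _\<close> \<open>(\<Sum>i<n. F (a i)) = _\<close> by (simp add: F)
  next
    case 2
    then obtain i where "S = {i}" by (auto simp: card_1_singleton_iff)
    then show ?thesis unfolding \<open>_ = real (card S) * (real (card S) - 1)\<close> 1 by simp
  next
    case 3
    let ?m = "real (card S)"
    have "\<bar>F (\<Sum>i<n. a i) - (\<Sum>i<n. F (a i))\<bar> \<le> \<bar>F (\<Sum>i<n. a i)\<bar> + \<bar>\<Sum>i\<in>S. F (a i)\<bar>"
      unfolding 1 by (rule abs_triangle_ineq4)
    also have "\<bar>\<Sum>i\<in>S. F (a i)\<bar> \<le> (\<Sum>i\<in>S. B)"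
      by (rule order_trans[OF sum_abs sum_mono]) (rule F)
    also have "\<bar>F (\<Sum>i<n. a i)\<bar> \<le> B" by (rule F)
    finally have "\<bar>F (\<Sum>i<n. a i) - (\<Sum>i<n. F (a i))\<bar> \<le> B * (1 + ?m)" by (simp add: algebra_simps)
    also have "\<dots> \<le> B * (2 * (?m * (?m - 1)))"
    proof (rule mult_left_mono[OF _ B0])
      have "2 * ?m \<le> ?m * ?m" "?m \<ge> 2" using 3 by (auto intro: mult_right_mono)
      then show "1 + ?m \<le> 2 * (?m * (?m - 1))"
        unfolding right_diff_distrib mult_1_right by linarith
    qed
    finally show ?thesis unfolding 2 by (simp add: mult_ac)
  qed
qed

context branching begin

lemma measurable_root_jump:
  assumes "\<And>y. H y \<in> M \<rightarrow>\<^sub>M R"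
  shows "(\<lambda>\<omega>. H (x + jump \<omega> []) \<omega>) \<in> M \<rightarrow>\<^sub>M R"
  by (rule measurable_compose_countable[where f="\<lambda>z. H (x + z)"]) (use assms in auto)

lemma expectation_root_jump:
  fixes H :: "int ^ 'd \<Rightarrow> 'd outcome \<Rightarrow> real"
  assumes H[measurable]: "\<And>y. H y \<in> borel_measurable M"
    and upd: "\<And>y \<omega> n z z'. H y (fun_upd \<omega> [] (n, z)) = H y (fun_upd \<omega> [] (n, z'))"
    and B: "\<And>y \<omega>. \<bar>H y \<omega>\<bar> \<le> B"
  shows "expectation (\<lambda>\<omega>. H (x + jump \<omega> []) \<omega>) = measure_pmf.expectation \<mu> (\<lambda>z. expectation (H (x + z)))"
proof -
  have int: "integrable M (H y)" for y by (rule integrable_const_bound[of _ B]) (use B in auto)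
  have HB: "0 \<le> H y \<omega> + B" for y \<omega> using B[of y \<omega>] by linarith
  have m: "(\<lambda>\<omega>. H (x + jump \<omega> []) \<omega>) \<in> borel_measurable M" by (rule measurable_root_jump[OF H])
  have intj: "integrable M (\<lambda>\<omega>. H (x + jump \<omega> []) \<omega>)"
    by (rule integrable_const_bound[of _ B]) (use B m in auto)
  have eB: "\<bar>expectation (H y)\<bar> \<le> B" for y
  proof -
    have "norm (expectation (H y)) \<le> expectation (\<lambda>_. B)"
      by (rule norm_integral_le_AE) (use B in auto)
    then show ?thesis by (simp add: prob_space[simplified])
  qed
  have intz: "integrable (measure_pmf \<mu>) (\<lambda>z. expectation (H (x + z)))"
    by (rule measure_pmf.integrable_const_bound[of _ B]) (use eB in auto)
  have "ennreal (expectation (\<lambda>\<omega>. H (x + jump \<omega> []) \<omega> + B)) = (\<integral>\<^sup>+\<omega>. ennreal (H (x + jump \<omega> []) \<omega> + B) \<partial>M)"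
    using HB intj by (intro nn_integral_eq_integral[symmetric]) auto
  also have "\<dots> = (\<integral>\<^sup>+z. \<integral>\<^sup>+\<omega>. ennreal (H (x + z) \<omega> + B) \<partial>M \<partial>measure_pmf \<mu>)"
    by (rule nn_integral_root_jump[where H="\<lambda>y \<omega>. ennreal (H y \<omega> + B)"]) (simp, subst upd, rule refl)
  also have "\<dots> = (\<integral>\<^sup>+z. ennreal (expectation (H (x + z)) + B) \<partial>measure_pmf \<mu>)"
  proof (rule nn_integral_cong)
    fix z
    have "(\<integral>\<^sup>+\<omega>. ennreal (H (x + z) \<omega> + B) \<partial>M) = ennreal (expectation (\<lambda>\<omega>. H (x + z) \<omega> + B))"
      using HB int by (intro nn_integral_eq_integral) auto
    then show "(\<integral>\<^sup>+\<omega>. ennreal (H (x + z) \<omega> + B) \<partial>M) = ennreal (expectation (H (x + z)) + B)"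
      using int by (simp add: prob_space[simplified])
  qed
  also have "\<dots> = ennreal (measure_pmf.expectation \<mu> (\<lambda>z. expectation (H (x + z)) + B))"
  proof (rule nn_integral_eq_integral)
    show "AE z in measure_pmf \<mu>. 0 \<le> expectation (H (x + z)) + B"
    proof (rule AE_I2)
      fix z show "0 \<le> expectation (H (x + z)) + B" using eB[of "x + z"] by linarith
    qed
  qed (use intz in auto)
  finally have "ennreal (expectation (\<lambda>\<omega>. H (x + jump \<omega> []) \<omega>) + B) = ennreal (measure_pmf.expectation \<mu> (\<lambda>z. expectation (H (x + z))) + B)"
    using intj intz by (simp add: prob_space[simplified])
  moreover have "0 \<le> expectation (\<lambda>\<omega>. H (x + jump \<omega> []) \<omega>) + B"
  proof -
    have "0 \<le> expectation (\<lambda>\<omega>. H (x + jump \<omega> []) \<omega> + B)" using HB by (intro integral_nonneg_AE) auto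
    then show ?thesis using intj by (simp add: prob_space[simplified])
  qed
  moreover have "0 \<le> measure_pmf.expectation \<mu> (\<lambda>z. expectation (H (x + z))) + B"
  proof -
    have "0 \<le> expectation (H (x + z)) + B" for z using eB[of "x + z"] by linarith
    then have "0 \<le> measure_pmf.expectation \<mu> (\<lambda>z. expectation (H (x + z)) + B)" by (intro integral_nonneg_AE) auto
    then show ?thesis using intz by simp
  qed
  ultimately show ?thesis by (simp add: ennreal_inj)
qed

lemma branching_sum_real:
  fixes Y :: "'d outcome \<Rightarrow> real"
  assumes Y[measurable]: "Y \<in> borel_measurable M" and B: "\<And>\<omega>. \<bar>Y \<omega>\<bar> \<le> B"
    and mean1: "(\<integral>\<^sup>+n. of_nat n \<partial>measure_pmf p) = 1"
  shows "integrable M (\<lambda>\<omega>. \<Sum>i<offspring \<omega> []. Y (child i \<omega>))"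
    and "expectation (\<lambda>\<omega>. \<Sum>i<offspring \<omega> []. Y (child i \<omega>)) = expectation Y"
proof -
  have nn: "integrable M (\<lambda>\<omega>. \<Sum>i<offspring \<omega> []. W (child i \<omega>)) \<and> expectation (\<lambda>\<omega>. \<Sum>i<offspring \<omega> []. W (child i \<omega>)) = expectation W"
    if W[measurable]: "W \<in> borel_measurable M" and W0: "\<And>\<omega>. 0 \<le> W \<omega>" "\<And>\<omega>. W \<omega> \<le> B'" for W and B' :: real
  proof -
    have m: "(\<lambda>\<omega>. \<Sum>i<offspring \<omega> []. W (child i \<omega>)) \<in> borel_measurable M"
      by (rule measurable_compose_countable[where f="\<lambda>n \<omega>. \<Sum>i<n. W (child i \<omega>)"])
         (auto intro!: borel_measurable_sum measurable_compose[OF measurable_child W])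
    have intW: "integrable M W" by (rule integrable_const_bound[of _ B']) (use W0 in auto)
    have "(\<integral>\<^sup>+\<omega>. ennreal (\<Sum>i<offspring \<omega> []. W (child i \<omega>)) \<partial>M) = (\<integral>\<^sup>+\<omega>. (\<Sum>i<offspring \<omega> []. ennreal (W (child i \<omega>))) \<partial>M)"
      using W0 by (simp add: sum_ennreal)
    also have "\<dots> = (\<integral>\<^sup>+\<omega>. ennreal (W \<omega>) \<partial>M)"
      using branching_sum[of "\<lambda>\<omega>. ennreal (W \<omega>)"] mean1 by simp
    also have "\<dots> = ennreal (expectation W)" using intW W0 by (intro nn_integral_eq_integral) auto
    finally have e: "(\<integral>\<^sup>+\<omega>. ennreal (\<Sum>i<offspring \<omega> []. W (child i \<omega>)) \<partial>M) = ennreal (expectation W)" .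
    have i: "integrable M (\<lambda>\<omega>. \<Sum>i<offspring \<omega> []. W (child i \<omega>))"
      unfolding integrable_iff_bounded using m e W0 by (simp add: sum_nonneg)
    have "ennreal (expectation (\<lambda>\<omega>. \<Sum>i<offspring \<omega> []. W (child i \<omega>))) = ennreal (expectation W)"
      using i W0 unfolding e[symmetric] by (intro nn_integral_eq_integral[symmetric]) (auto intro: sum_nonneg)
    then show ?thesis using i W0 by (auto simp: ennreal_inj integral_nonneg_AE sum_nonneg)
  qed
  have B0: "0 \<le> B" using B[of undefined] by linarith
  have b1: "0 \<le> Y \<omega> + B" "Y \<omega> + B \<le> 2 * B" for \<omega> using B[of \<omega>] by linarith+
  have N1: "integrable M (\<lambda>\<omega>. \<Sum>i<offspring \<omega> []. Y (child i \<omega>) + B) \<and> expectation (\<lambda>\<omega>. \<Sum>i<offspring \<omega> []. Y (child i \<omega>) + B) = expectation (\<lambda>\<omega>. Y \<omega> + B)"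
    by (rule nn[of _ "2 * B"]) (use b1 in auto)
  have N2: "integrable M (\<lambda>\<omega>. \<Sum>i<offspring \<omega> []. B) \<and> expectation (\<lambda>\<omega>. \<Sum>i<offspring \<omega> []. B) = expectation (\<lambda>\<omega>. B)"
    by (rule nn[of "\<lambda>_. B" B]) (use B0 in auto)
  have e: "(\<Sum>i<offspring \<omega> []. Y (child i \<omega>)) = (\<Sum>i<offspring \<omega> []. Y (child i \<omega>) + B) - (\<Sum>i<offspring \<omega> []. B)" for \<omega>
    by (simp add: sum.distrib)
  have intY: "integrable M Y" by (rule integrable_const_bound[of _ B]) (use B in auto)
  show "integrable M (\<lambda>\<omega>. \<Sum>i<offspring \<omega> []. Y (child i \<omega>))"
    unfolding e using N1 N2 by (intro Bochner_Integration.integrable_diff) auto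
  have "expectation (\<lambda>\<omega>. \<Sum>i<offspring \<omega> []. Y (child i \<omega>)) = expectation (\<lambda>\<omega>. Y \<omega> + B) - expectation (\<lambda>\<omega>. B)"
    unfolding e using N1 N2 by (subst Bochner_Integration.integral_diff) auto
  then show "expectation (\<lambda>\<omega>. \<Sum>i<offspring \<omega> []. Y (child i \<omega>)) = expectation Y"
    using intY by (simp add: prob_space[simplified])
qed

end

locale critical_brw = centred_walk \<mu> C + branching p \<mu> for p :: "nat pmf" and \<mu> :: "(int ^ 'd::finite) pmf" and C :: real +
  fixes \<sigma> :: real and K :: "(int ^ 'd) set"
  assumes p1: "pmf p 1 < 1"
    and critical: "(\<lambda>k. real k * pmf p k) sums 1"
    and variance: "(\<lambda>k. (real k - 1)\<^sup>2 * pmf p k) sums \<sigma>\<^sup>2" "\<sigma>\<^sup>2 > 0"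
    and K: "K \<noteq> {}" "finite K"
begin

lemma nn_integral_offspring:
  assumes "(\<lambda>k. f k * pmf p k) sums s" "\<And>k. f k \<ge> 0"
  shows "(\<integral>\<^sup>+n. ennreal (f n) \<partial>measure_pmf p) = ennreal s"
proof -
  have "(\<integral>\<^sup>+n. ennreal (f n) \<partial>measure_pmf p) = (\<Sum>n. ennreal (f n * pmf p n))"
    unfolding nn_integral_measure_pmf nn_integral_count_space_nat
    using assms(2) by (simp add: ennreal_mult mult.commute)
  also have "\<dots> = ennreal (\<Sum>n. f n * pmf p n)"
    using assms by (intro suminf_ennreal2) (auto simp: sums_iff)
  finally show ?thesis using assms by (simp add: sums_iff)
qed

lemma mean_offspring: "(\<integral>\<^sup>+n. of_nat n \<partial>measure_pmf p) = 1"
  using nn_integral_offspring[OF critical] by (simp add: ennreal_of_nat_eq_real_of_nat)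

text \<open>For every natural number \<open>n\<close>, \<open>n * (n - 1) \<le> 2 * (n - 1)\<^sup>2\<close>.\<close>

lemma pairs_offspring: "(\<integral>\<^sup>+n. of_nat (n * (n - 1)) \<partial>measure_pmf p) \<le> ennreal (2 * \<sigma>\<^sup>2)"
proof -
  have "(of_nat (n * (n - 1)) :: ennreal) \<le> ennreal (2 * (real n - 1)\<^sup>2)" for n
  proof -
    have "real (n * (n - 1)) \<le> 2 * (real n - 1)\<^sup>2"
    proof (cases "n \<ge> 2")
      case True
      then have "real n \<le> 2 * (real n - 1)" by simp
      then have "real n * (real n - 1) \<le> 2 * (real n - 1) * (real n - 1)" using True by (intro mult_right_mono) auto
      then show ?thesis using True by (simp add: of_nat_diff power2_eq_square mult.assoc)
    next
      case False
      then have "n = 0 \<or> n = 1" by auto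
      then show ?thesis by auto
    qed
    then show ?thesis by (simp add: ennreal_of_nat_eq_real_of_nat ennreal_leI del: of_nat_mult)
  qed
  then have "(\<integral>\<^sup>+n. of_nat (n * (n - 1)) \<partial>measure_pmf p) \<le> (\<integral>\<^sup>+n. ennreal (2 * (real n - 1)\<^sup>2) \<partial>measure_pmf p)"
    by (intro nn_integral_mono)
  also have "\<dots> = ennreal (2 * \<sigma>\<^sup>2)"
    using sums_mult[OF variance(1), of 2] by (intro nn_integral_offspring) (auto simp: mult.assoc)
  finally show ?thesis .
qed

abbreviation Z :: "int ^ 'd \<Rightarrow> 'd outcome \<Rightarrow> ennreal" where "Z x \<omega> \<equiv> occupation_time x K \<omega>"
abbreviation L :: "int ^ 'd \<Rightarrow> 'd outcome \<Rightarrow> ennreal" where "L x \<omega> \<equiv> num_pioneers x K \<omega>"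

text \<open>The mean number of visits to \<open>K\<close> of a walk with jump law \<open>\<mu>\<close>. The lazy walk spends on
  average two units of time at each visited point, whence the factor one half.\<close>

definition g :: "int ^ 'd \<Rightarrow> real" where "g x = green_sum K x / 2"

lemma g_nonneg: "g x \<ge> 0" using green_sum_nonneg[of K x] by (simp add: g_def)

lemma G_bounded: "\<exists>B\<ge>0. \<forall>x. G x \<le> B"
proof -
  obtain B where B: "B \<ge> 0" "\<And>x. G x \<le> B / N x ^ (CARD('d) - 2)" using G_upper by blast
  have "G x \<le> B" for x
  proof -
    have "N x ^ (CARD('d) - 2) \<ge> 1" using N_ge_1[of x] by (rule one_le_power)
    then have "B / N x ^ (CARD('d) - 2) \<le> B / 1" 
      using B(1) \<open>N x ^ (CARD('d) - 2) \<ge> 1\<close> by (intro divide_left_mono) (auto intro: less_le_trans[OF zero_less_one])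
    then show ?thesis using B(2)[of x] by simp
  qed
  then show ?thesis using B by blast
qed

lemma g_bounded: "\<exists>B\<ge>0. \<forall>x. g x \<le> B"
proof -
  obtain B where B: "B \<ge> 0" "\<And>x. G x \<le> B" using G_bounded by blast
  have "g x \<le> real (card K) * B" for x
  proof -
    have "green_sum K x \<le> (\<Sum>k\<in>K. B)" unfolding green_sum_def by (intro sum_mono B)
    then show ?thesis using green_sum_nonneg[of K x] by (simp add: g_def)
  qed
  then show ?thesis using B by (intro exI[of _ "real (card K) * B"]) auto
qed

lemma integrable_G_pmf: "integrable (measure_pmf Q) (\<lambda>z. G (f z))"
proof -
  obtain B where "B \<ge> 0" "\<And>x. G x \<le> B" using G_bounded by blast
  then show ?thesis by (intro measure_pmf.integrable_const_bound[of _ B]) (auto simp: G_nonneg)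
qed

lemma G_harmonic: "measure_pmf.expectation \<mu> (\<lambda>z. G (k - (x + z))) = G (k - x) - 2 * of_bool (x = k)"
proof -
  let ?f = "\<lambda>z. G (k - (x + z))"
  have "ennreal (measure_pmf.expectation (lazy \<mu>) ?f) = (\<integral>\<^sup>+z. ennreal (?f z) \<partial>measure_pmf (lazy \<mu>))"
    by (intro nn_integral_eq_integral[symmetric] integrable_G_pmf) (auto simp: G_nonneg)
  also have "\<dots> = (\<Sum>n. \<integral>\<^sup>+z. ennreal (h n (k - x - z)) \<partial>measure_pmf (lazy \<mu>))"
    by (simp add: ennreal_G nn_integral_suminf diff_diff_eq)
  also have "\<dots> = (\<Sum>n. ennreal (h (1 + n) (k - x)))"
    by (simp add: ennreal_pmf_bind pmf_map_plus)
  also have "\<dots> = ennreal (\<Sum>n. h (1 + n) (k - x))"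
    by (intro suminf_ennreal2 summable_h_shift pmf_nonneg)
  finally have "measure_pmf.expectation (lazy \<mu>) ?f = (\<Sum>n. h (1 + n) (k - x))"
  proof (subst (asm) ennreal_inj)
    show "0 \<le> measure_pmf.expectation (lazy \<mu>) ?f" by (intro integral_nonneg_AE) (simp add: G_nonneg)
    show "0 \<le> (\<Sum>n. h (1 + n) (k - x))" by (intro suminf_nonneg summable_h_shift pmf_nonneg)
  qed
  also have "\<dots> = G (k - x) - h 0 (k - x)" using G_split[of "k - x" 1] by simp
  also have "h 0 (k - x) = of_bool (x = k)" by auto
  finally have "(?f 0 + measure_pmf.expectation \<mu> ?f) / 2 = G (k - x) - of_bool (x = k)"
    using integral_lazy[OF integrable_G_pmf[of \<mu> "\<lambda>z. k - (x + z)"]] by simp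
  then show ?thesis by simp
qed

lemma g_step: "measure_pmf.expectation \<mu> (\<lambda>z. g (x + z)) = g x - indicator K x"
proof -
  have "measure_pmf.expectation \<mu> (\<lambda>z. g (x + z)) = (\<Sum>k\<in>K. measure_pmf.expectation \<mu> (\<lambda>z. G (k - (x + z)))) / 2"
    by (simp add: g_def green_sum_def Bochner_Integration.integral_sum integrable_G_pmf)
  also have "\<dots> = g x - (\<Sum>k\<in>K. of_bool (x = k))"
    by (simp add: G_harmonic g_def green_sum_def sum_subtractf sum_distrib_left[symmetric] diff_divide_distrib)
  also have "(\<Sum>k\<in>K. of_bool (x = k)) = (indicator K x :: real)"
    using K(2) by (simp add: of_bool_def sum.delta' indicator_def if_distrib[symmetric])
  finally show ?thesis .
qed

lemma g_ge_indicator: "indicator K x \<le> g x"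
proof -
  have "0 \<le> measure_pmf.expectation \<mu> (\<lambda>z. g (x + z))"
    by (intro integral_nonneg_AE) (simp add: g_nonneg)
  then show ?thesis using g_step[of x] by simp
qed

lemma integrable_g: "integrable (measure_pmf Q) (\<lambda>z. g (f z))"
  by (simp add: g_def green_sum_def integrable_G_pmf)

lemma nn_integral_g: "(\<integral>\<^sup>+z. ennreal (g (x + z)) \<partial>measure_pmf \<mu>) = ennreal (g x - indicator K x)"
  unfolding g_step[symmetric] by (intro nn_integral_eq_integral integrable_g) (simp add: g_nonneg)

lemma nn_integral_child_sum:
  fixes H :: "int ^ 'd \<Rightarrow> 'd outcome \<Rightarrow> ennreal"
  assumes H: "\<And>y. H y \<in> borel_measurable M"
    and upd: "\<And>y \<omega> n z z'. H y (fun_upd \<omega> [] (n, z)) = H y (fun_upd \<omega> [] (n, z'))"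
  shows "(\<integral>\<^sup>+\<omega>. (\<Sum>i<offspring \<omega> []. H (x + jump (child i \<omega>) []) (child i \<omega>)) \<partial>M) =
    (\<integral>\<^sup>+z. \<integral>\<^sup>+\<omega>. H (x + z) \<omega> \<partial>M \<partial>measure_pmf \<mu>)"
  using branching_sum[OF measurable_root_jump[where H=H and x=x, OF H]]
    nn_integral_root_jump[where H=H and x=x, OF H upd]
  by (simp add: mean_offspring)

lemma measurable_child_sum:
  fixes H :: "int ^ 'd \<Rightarrow> 'd outcome \<Rightarrow> ennreal"
  assumes H: "\<And>y. H y \<in> borel_measurable M"
  shows "(\<lambda>\<omega>. \<Sum>i<offspring \<omega> []. H (x + jump (child i \<omega>) []) (child i \<omega>)) \<in> borel_measurable M"
  by (rule measurable_compose_countable[where f="\<lambda>n \<omega>. \<Sum>i<n. H (x + jump (child i \<omega>) []) (child i \<omega>)"])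
     (auto intro!: borel_measurable_sum measurable_compose[OF measurable_child measurable_root_jump[OF H]])

lemma truncated_update_root:
  "truncated_occupation n x K (fun_upd \<omega> [] (m, z)) = truncated_occupation n x K (fun_upd \<omega> [] (m, z'))"
  by (cases n) (simp_all add: truncated_occupation_0 truncated_occupation_Suc)

text \<open>The mean number of children being one, the mean of the truncated count satisfies a recursion
  along the walk, and \<open>g\<close> is a supersolution of it by \<open>g_step\<close>.\<close>

lemma mean_occupation_le: "(\<integral>\<^sup>+\<omega>. Z x \<omega> \<partial>M) \<le> ennreal (g x)"
proof -
  have t: "(\<integral>\<^sup>+\<omega>. truncated_occupation n x K \<omega> \<partial>M) \<le> ennreal (g x)" for n x
  proof (induction n arbitrary: x)
    case 0
    have "ennreal (indicator K x) \<le> ennreal (g x)" by (intro ennreal_leI g_ge_indicator)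
    then show ?case by (simp add: truncated_occupation_0 emeasure_space_1[simplified] ennreal_indicator)
  next
    case (Suc n)
    have "(\<integral>\<^sup>+\<omega>. truncated_occupation (Suc n) x K \<omega> \<partial>M) =
      indicator K x + (\<integral>\<^sup>+z. \<integral>\<^sup>+\<omega>. truncated_occupation n (x + z) K \<omega> \<partial>M \<partial>measure_pmf \<mu>)"
      unfolding truncated_occupation_Suc
      by (subst nn_integral_add, simp, rule measurable_child_sum, rule measurable_truncated_occupation,
          subst nn_integral_child_sum)
         (auto intro: truncated_update_root simp: emeasure_space_1[simplified])
    also have "\<dots> \<le> indicator K x + (\<integral>\<^sup>+z. ennreal (g (x + z)) \<partial>measure_pmf \<mu>)"
      by (intro add_left_mono nn_integral_mono Suc)
    also have "\<dots> = ennreal (indicator K x) + ennreal (g x - indicator K x)"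
      by (simp add: nn_integral_g ennreal_indicator)
    also have "\<dots> = ennreal (g x)"
      using g_ge_indicator[of x] by (subst ennreal_plus[symmetric]) auto
    finally show ?case .
  qed
  have "(\<integral>\<^sup>+\<omega>. Z x \<omega> \<partial>M) = (\<integral>\<^sup>+\<omega>. (SUP n. truncated_occupation n x K \<omega>) \<partial>M)"
    by (simp add: SUP_truncated_occupation)
  also have "\<dots> = (SUP n. \<integral>\<^sup>+\<omega>. truncated_occupation n x K \<omega> \<partial>M)"
  proof (rule nn_integral_monotone_convergence_SUP)
    show "incseq (\<lambda>n. truncated_occupation n x K)"
      by (auto simp: incseq_def le_fun_def truncated_occupation_def indicator_def intro!: nn_integral_mono)
  qed (rule measurable_truncated_occupation)
  also have "\<dots> \<le> ennreal (g x)" by (intro SUP_least t)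
  finally show ?thesis .
qed

lemma AE_Z_finite: "AE \<omega> in M. Z x \<omega> \<noteq> \<top>"
proof -
  have "(\<integral>\<^sup>+\<omega>. Z x \<omega> \<partial>M) \<noteq> \<infinity>" using mean_occupation_le[of x] by (auto simp: top_unique)
  from nn_integral_PInf_AE[OF measurable_occupation_time this] show ?thesis by simp
qed

definition q :: "int ^ 'd \<Rightarrow> real" where "q x = prob {\<omega>. Z x \<omega> \<noteq> 0}"

lemma q_nonneg: "q x \<ge> 0" and q_le_1: "q x \<le> 1" by (simp_all add: q_def)

lemma hit_sets [measurable]: "{\<omega>. Z x \<omega> \<noteq> 0} \<in> events"
proof -
  have "{\<omega> \<in> space M. Z x \<omega> \<noteq> 0} \<in> events" by measurable
  then show ?thesis by simp
qed

lemma ennreal_q: "ennreal (q x) = (\<integral>\<^sup>+\<omega>. indicator {\<omega>. Z x \<omega> \<noteq> 0} \<omega> \<partial>M)"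
  by (simp add: q_def emeasure_eq_measure)

lemma q_le_g: "q x \<le> g x"
proof -
  have "ennreal (q x) \<le> (\<integral>\<^sup>+\<omega>. Z x \<omega> \<partial>M)"
    unfolding ennreal_q by (intro nn_integral_mono) (auto simp: indicator_def occupation_time_ge_1)
  also have "\<dots> \<le> ennreal (g x)" by (rule mean_occupation_le)
  finally show ?thesis using g_nonneg by (simp add: ennreal_le_iff)
qed

abbreviation \<Lambda> :: "int ^ 'd \<Rightarrow> 'd outcome \<Rightarrow> real \<times> real" where
  "\<Lambda> x \<omega> \<equiv> (enn2real (L x \<omega>), enn2real (Z x \<omega>))"

definition v :: "(real \<times> real \<Rightarrow> real) \<Rightarrow> int ^ 'd \<Rightarrow> real" where
  "v F x = expectation (\<lambda>\<omega>. F (\<Lambda> x \<omega>))"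

lemma \<Lambda>_measurable [measurable]: "\<Lambda> x \<in> M \<rightarrow>\<^sub>M borel"
  by (intro borel_measurable_Pair borel_measurable_enn2real) auto

lemma \<Lambda>_update_root: "\<Lambda> x (fun_upd \<omega> [] (n, z)) = \<Lambda> x (fun_upd \<omega> [] (n, z'))"
  using num_pioneers_update_root[of x K \<omega> n z z'] occupation_time_update_root[of x K \<omega> n z z'] by simp

lemma \<Lambda>_eq_0: "Z x \<omega> = 0 \<Longrightarrow> \<Lambda> x \<omega> = 0"
  using num_pioneers_le_occupation[of x K \<omega>] by (simp add: zero_prod_def)

lemma v_le_q:
  assumes F: "F \<in> borel_measurable borel" "F 0 = 0" "\<And>a. \<bar>F a\<bar> \<le> B"
  shows "\<bar>v F x\<bar> \<le> B * q x"
proof -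
  have "norm (v F x) \<le> expectation (\<lambda>\<omega>. B * indicator {\<omega>. Z x \<omega> \<noteq> 0} \<omega>)"
    unfolding v_def
  proof (rule norm_integral_le_AE)
    show "(\<lambda>\<omega>. F (\<Lambda> x \<omega>)) \<in> borel_measurable M" by (rule measurable_compose[OF \<Lambda>_measurable F(1)])
    show "AE \<omega> in M. norm (F (\<Lambda> x \<omega>)) \<le> B * indicator {\<omega>. Z x \<omega> \<noteq> 0} \<omega>"
      using F(2,3) \<Lambda>_eq_0[of x] by (intro AE_I2) (auto simp: indicator_def)
    show "integrable M (\<lambda>\<omega>. B * indicator {\<omega>. Z x \<omega> \<noteq> 0} \<omega>)"
      by (intro integrable_mult_right integrable_const_bound[of _ 1] borel_measurable_indicator hit_sets) auto
  qed
  then show ?thesis by (simp add: q_def)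
qed

text \<open>By criticality \<open>P (v F)\<close> is exactly the mean of the sum of \<open>F\<close> over the children, and outside
  \<open>K\<close> the pair of counts is the sum over the children. The defect of additivity comes from
  pairs of children that both have descendants in \<open>K\<close>; given the number of children, their
  subtrees are independent.\<close>

lemma v_one_step:
  assumes F: "F \<in> borel_measurable borel" "F 0 = 0" "\<And>a. \<bar>F a\<bar> \<le> B" and x: "x \<notin> K"
  shows "\<bar>v F x - measure_pmf.expectation \<mu> (\<lambda>z. v F (x + z))\<bar> \<le>
    4 * B * \<sigma>\<^sup>2 * (measure_pmf.expectation \<mu> (\<lambda>z. q (x + z)))\<^sup>2"
proof -
  define \<Lambda>c where "\<Lambda>c = (\<lambda>i \<omega>. \<Lambda> (x + jump (child i \<omega>) []) (child i \<omega>))"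
  define Y where "Y = (\<lambda>\<omega>. F (\<Lambda> (x + jump \<omega> []) \<omega>))"
  define I :: "'d outcome \<Rightarrow> ennreal" where "I = (\<lambda>\<omega>. indicator {\<omega>. Z (x + jump \<omega> []) \<omega> \<noteq> 0} \<omega>)"
  have B0: "B \<ge> 0" using F(3)[of 0] by linarith
  have mF: "(\<lambda>\<omega>. F (\<Lambda> y \<omega>)) \<in> borel_measurable M" for y by (rule measurable_compose[OF \<Lambda>_measurable F(1)])
  have mY: "Y \<in> borel_measurable M" unfolding Y_def by (rule measurable_root_jump[OF mF])
  have Yb: "\<bar>Y \<omega>\<bar> \<le> B" for \<omega> by (simp add: Y_def F)
  have Yc: "Y (child i \<omega>) = F (\<Lambda>c i \<omega>)" for i \<omega> by (simp add: Y_def \<Lambda>c_def)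
  have EY: "expectation Y = measure_pmf.expectation \<mu> (\<lambda>z. v F (x + z))"
    unfolding Y_def v_def
    by (rule expectation_root_jump[where B=B, OF mF arg_cong[where f=F, OF \<Lambda>_update_root] F(3)])
  note S = branching_sum_real[OF mY Yb mean_offspring]
  have iF: "integrable M (\<lambda>\<omega>. F (\<Lambda> x \<omega>))" by (rule integrable_const_bound[of _ B]) (use F mF in auto)
  define D where "D = (\<lambda>\<omega>. F (\<Lambda> x \<omega>) - (\<Sum>i<offspring \<omega> []. Y (child i \<omega>)))"
  have iD: "integrable M D" unfolding D_def using iF S(1) by (rule Bochner_Integration.integrable_diff)
  have ED: "expectation D = v F x - measure_pmf.expectation \<mu> (\<lambda>z. v F (x + z))"
    unfolding D_def using iF S by (simp add: EY v_def)
  have mI: "I \<in> borel_measurable M"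
  proof -
    have "(\<lambda>\<omega>. indicator {\<omega>. Z y \<omega> \<noteq> 0} \<omega> :: ennreal) \<in> borel_measurable M" for y by simp
    from measurable_root_jump[where H="\<lambda>y \<omega>. indicator {\<omega>. Z y \<omega> \<noteq> 0} \<omega>", OF this]
    show ?thesis by (simp add: I_def indicator_def)
  qed
  have EI: "(\<integral>\<^sup>+\<omega>. I \<omega> \<partial>M) = ennreal (measure_pmf.expectation \<mu> (\<lambda>z. q (x + z)))"
  proof -
    have "(\<integral>\<^sup>+\<omega>. I \<omega> \<partial>M) = (\<integral>\<^sup>+\<omega>. indicator {\<omega>. Z (x + jump \<omega> []) \<omega> \<noteq> 0} \<omega> \<partial>M)" by (simp add: I_def)
    also have "\<dots> = (\<integral>\<^sup>+\<omega>. (\<lambda>y \<omega>. indicator {\<omega>. Z y \<omega> \<noteq> 0} \<omega>) (x + jump \<omega> []) \<omega> \<partial>M)"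
      by (intro nn_integral_cong) (simp add: indicator_def)
    also have "\<dots> = (\<integral>\<^sup>+z. \<integral>\<^sup>+\<omega>. indicator {\<omega>. Z (x + z) \<omega> \<noteq> 0} \<omega> \<partial>M \<partial>measure_pmf \<mu>)"
      by (rule nn_integral_root_jump, simp, simp only: indicator_def mem_Collect_eq)
         (subst occupation_time_update_root, rule refl)
    also have "\<dots> = (\<integral>\<^sup>+z. ennreal (q (x + z)) \<partial>measure_pmf \<mu>)" unfolding ennreal_q ..
    also have "\<dots> = ennreal (measure_pmf.expectation \<mu> (\<lambda>z. q (x + z)))"
      by (intro nn_integral_eq_integral measure_pmf.integrable_const_bound[of _ 1]) (auto simp: q_nonneg q_le_1)
    finally show ?thesis .
  qed
  let ?P = "\<lambda>\<omega>. \<Sum>i<offspring \<omega> []. \<Sum>j<offspring \<omega> []. if i = j then 0 else I (child i \<omega>) * I (child j \<omega>)"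
  have AED: "AE \<omega> in M. ennreal \<bar>D \<omega>\<bar> \<le> ennreal (2 * B) * ?P \<omega>"
    using AE_Z_finite[of x]
  proof (rule AE_mp, intro AE_I2 impI)
    fix \<omega> assume fin: "Z x \<omega> \<noteq> \<top>"
    let ?n = "offspring \<omega> []"
    have Zsum: "Z x \<omega> = (\<Sum>i<?n. Z (x + jump (child i \<omega>) []) (child i \<omega>))"
      using x by (subst occupation_time_rec) simp
    have Lsum: "L x \<omega> = (\<Sum>i<?n. L (x + jump (child i \<omega>) []) (child i \<omega>))"
      using x by (subst num_pioneers_rec) simp
    have Zf: "Z (x + jump (child i \<omega>) []) (child i \<omega>) \<noteq> \<top>" if "i < ?n" for i
    proof -
      have "Z (x + jump (child i \<omega>) []) (child i \<omega>) \<le> Z x \<omega>"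
        unfolding Zsum using that by (intro member_le_sum[where f="\<lambda>i. Z (x + jump (child i \<omega>) []) (child i \<omega>)"]) auto
      then show ?thesis using fin by (auto simp: top_unique)
    qed
    have Lf: "L (x + jump (child i \<omega>) []) (child i \<omega>) \<noteq> \<top>" if "i < ?n" for i
      using Zf[OF that] num_pioneers_le_occupation[of "x + jump (child i \<omega>) []" K "child i \<omega>"] by (auto simp: top_unique)
    have "enn2real (Z x \<omega>) = (\<Sum>i<?n. enn2real (Z (x + jump (child i \<omega>) []) (child i \<omega>)))"
      unfolding Zsum using Zf by (subst enn2real_sum) (auto simp: less_top)
    moreover have "enn2real (L x \<omega>) = (\<Sum>i<?n. enn2real (L (x + jump (child i \<omega>) []) (child i \<omega>)))"
      unfolding Lsum using Lf by (subst enn2real_sum) (auto simp: less_top)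
    ultimately have sumL: "\<Lambda> x \<omega> = (\<Sum>i<?n. \<Lambda>c i \<omega>)"
      by (intro prod_eqI) (simp_all add: fst_sum snd_sum \<Lambda>c_def)
    have "\<bar>D \<omega>\<bar> = \<bar>F (\<Sum>i<?n. \<Lambda>c i \<omega>) - (\<Sum>i<?n. F (\<Lambda>c i \<omega>))\<bar>" by (simp add: D_def sumL Yc)
    also have "\<dots> \<le> 2 * B * (\<Sum>i<?n. \<Sum>j<?n. if i = j then 0 else of_bool (\<Lambda>c i \<omega> \<noteq> 0) * of_bool (\<Lambda>c j \<omega> \<noteq> 0))"
      by (rule additive_defect) (rule F)+
    finally have "ennreal \<bar>D \<omega>\<bar> \<le> ennreal (2 * B * (\<Sum>i<?n. \<Sum>j<?n. if i = j then 0 else of_bool (\<Lambda>c i \<omega> \<noteq> 0) * of_bool (\<Lambda>c j \<omega> \<noteq> 0)))"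
      by (rule ennreal_leI)
    also have "\<dots> = ennreal (2 * B) * (\<Sum>i<?n. \<Sum>j<?n. ennreal (if i = j then 0 else of_bool (\<Lambda>c i \<omega> \<noteq> 0) * of_bool (\<Lambda>c j \<omega> \<noteq> 0)))"
    proof -
      have nn: "(0::real) \<le> (if i = j then 0 else of_bool (\<Lambda>c i \<omega> \<noteq> 0) * of_bool (\<Lambda>c j \<omega> \<noteq> 0))" for i j
        by simp
      have "(\<Sum>i<?n. \<Sum>j<?n. ennreal (if i = j then 0 else of_bool (\<Lambda>c i \<omega> \<noteq> 0) * of_bool (\<Lambda>c j \<omega> \<noteq> 0))) =
        ennreal (\<Sum>i<?n. \<Sum>j<?n. if i = j then 0 else of_bool (\<Lambda>c i \<omega> \<noteq> 0) * of_bool (\<Lambda>c j \<omega> \<noteq> 0))"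
        by (simp only: sum_ennreal nn sum_nonneg)
      then show ?thesis using B0 nn by (simp only:) (intro ennreal_mult sum_nonneg, auto)
    qed
    also have "\<dots> \<le> ennreal (2 * B) * ?P \<omega>"
    proof (intro mult_left_mono sum_mono)
      fix i j
      have "\<Lambda>c i \<omega> \<noteq> 0 \<Longrightarrow> I (child i \<omega>) = 1" for i
        using \<Lambda>_eq_0[of "x + jump (child i \<omega>) []" "child i \<omega>"] by (auto simp: I_def \<Lambda>c_def indicator_def)
      then show "ennreal (if i = j then 0 else of_bool (\<Lambda>c i \<omega> \<noteq> 0) * of_bool (\<Lambda>c j \<omega> \<noteq> 0)) \<le> (if i = j then 0 else I (child i \<omega>) * I (child j \<omega>))"
        by auto
    qed simp
    finally show "ennreal \<bar>D \<omega>\<bar> \<le> ennreal (2 * B) * ?P \<omega>" .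
  qed
  have mIc: "(\<lambda>\<omega>. I (child i \<omega>)) \<in> borel_measurable M" for i
    by (rule measurable_compose[OF measurable_child mI])
  have mIJ: "(\<lambda>\<omega>. if i = j then 0 else I (child i \<omega>) * I (child j \<omega>)) \<in> borel_measurable M" for i j
    using mIc by (cases "i = j") auto
  have mP: "?P \<in> borel_measurable M"
    by (rule measurable_compose_countable[where f="\<lambda>n \<omega>. \<Sum>i<n. \<Sum>j<n. if i = j then 0 else I (child i \<omega>) * I (child j \<omega>)"])
       (auto intro!: borel_measurable_sum mIJ)
  have "ennreal \<bar>expectation D\<bar> \<le> (\<integral>\<^sup>+\<omega>. ennreal \<bar>D \<omega>\<bar> \<partial>M)"
    using integral_norm_bound_ennreal[OF iD] by simp
  also have "\<dots> \<le> (\<integral>\<^sup>+\<omega>. ennreal (2 * B) * ?P \<omega> \<partial>M)" by (rule nn_integral_mono_AE[OF AED])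
  also have "\<dots> = ennreal (2 * B) * (\<integral>\<^sup>+\<omega>. ?P \<omega> \<partial>M)" by (rule nn_integral_cmult[OF mP])
  also have "\<dots> \<le> ennreal (2 * B) * (ennreal (2 * \<sigma>\<^sup>2) * (ennreal (measure_pmf.expectation \<mu> (\<lambda>z. q (x + z))))\<^sup>2)"
    unfolding branching_pairs[OF mI] EI by (intro mult_left_mono mult_right_mono pairs_offspring) auto
  also have "\<dots> = ennreal (4 * B * \<sigma>\<^sup>2 * (measure_pmf.expectation \<mu> (\<lambda>z. q (x + z)))\<^sup>2)"
    using B0 by (simp add: ennreal_mult[symmetric] ennreal_power integral_nonneg_AE q_nonneg mult_ac)
  finally have "\<bar>expectation D\<bar> \<le> 4 * B * \<sigma>\<^sup>2 * (measure_pmf.expectation \<mu> (\<lambda>z. q (x + z)))\<^sup>2"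
    using B0 by (subst (asm) ennreal_le_iff) auto
  then show ?thesis by (simp add: ED)
qed

end

section \<open>Asymptotics of functionals\<close>

text \<open>A Bonferroni inequality. The sum runs over ordered pairs, which only weakens it.\<close>

lemma prod_one_minus_bound:
  fixes a :: "nat \<Rightarrow> real"
  assumes "\<And>i. 0 \<le> a i" "\<And>i. a i \<le> 1"
  shows "(\<Prod>i<n. 1 - a i) \<le> 1 - (\<Sum>i<n. a i) + (\<Sum>i<n. \<Sum>j<n. if i = j then 0 else a i * a j)"
proof -
  have lower: "1 - (\<Sum>i<n. a i) \<le> (\<Prod>i<n. 1 - a i)" for n
  proof (induction n)
    case (Suc n)
    have S: "0 \<le> a n * (\<Sum>i<n. a i)" using assms by (intro mult_nonneg_nonneg sum_nonneg) auto
    have "(1 - (\<Sum>i<n. a i)) * (1 - a n) \<le> (\<Prod>i<n. 1 - a i) * (1 - a n)"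
      using Suc assms(2)[of n] by (intro mult_right_mono) auto
    moreover have "(1 - (\<Sum>i<n. a i)) * (1 - a n) = 1 - (\<Sum>i<n. a i) - a n + a n * (\<Sum>i<n. a i)"
      by (simp add: algebra_simps)
    ultimately show ?case using S by simp
  qed simp
  have upper: "(\<Prod>i<n. 1 - a i) \<le> 1 - (\<Sum>i<n. a i) + ((\<Sum>i<n. a i)\<^sup>2 - (\<Sum>i<n. (a i)\<^sup>2))" for n
  proof (induction n)
    case (Suc n)
    let ?S = "\<Sum>i<n. a i" and ?P = "\<Prod>i<n. 1 - a i"
    have "a n * (1 - ?S) \<le> a n * ?P" using lower[of n] assms by (intro mult_left_mono) auto
    then have "?P * (1 - a n) \<le> 1 - ?S + (?S\<^sup>2 - (\<Sum>i<n. (a i)\<^sup>2)) - a n * (1 - ?S)"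
      using Suc by (simp add: algebra_simps)
    also have "\<dots> \<le> 1 - (?S + a n) + ((?S + a n)\<^sup>2 - ((\<Sum>i<n. (a i)\<^sup>2) + (a n)\<^sup>2))"
    proof -
      have "0 \<le> a n * ?S" using assms by (intro mult_nonneg_nonneg sum_nonneg) auto
      then show ?thesis by (simp add: power2_eq_square algebra_simps)
    qed
    finally show ?case by simp
  qed simp
  have "(\<Sum>i<n. \<Sum>j<n. if i = j then 0 else a i * a j) = (\<Sum>i<n. (\<Sum>j<n. a i * a j) - (a i)\<^sup>2)"
  proof (rule sum.cong[OF refl])
    fix i assume i: "i \<in> {..<n}"
    have "(\<Sum>j<n. a i * a j) = (\<Sum>j<n. (if i = j then 0 else a i * a j) + (if j = i then (a i)\<^sup>2 else 0))"
      by (intro sum.cong) (auto simp: power2_eq_square)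
    also have "\<dots> = (\<Sum>j<n. if i = j then 0 else a i * a j) + (a i)\<^sup>2"
      using i by (simp add: sum.distrib)
    finally show "(\<Sum>j<n. if i = j then 0 else a i * a j) = (\<Sum>j<n. a i * a j) - (a i)\<^sup>2" by simp
  qed
  also have "\<dots> = (\<Sum>i<n. a i)\<^sup>2 - (\<Sum>i<n. (a i)\<^sup>2)"
    by (simp add: sum_subtractf sum_product[symmetric] power2_eq_square)
  finally show ?thesis using upper[of n] by simp
qed

context critical_brw begin

abbreviation P :: "(int ^ 'd \<Rightarrow> real) \<Rightarrow> int ^ 'd \<Rightarrow> real" where
  "P f x \<equiv> measure_pmf.expectation \<mu> (\<lambda>z. f (x + z))"

lemma lazy_average:
  assumes "\<And>x. \<bar>f x\<bar> \<le> B"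
  shows "measure_pmf.expectation (lazy \<mu>) (\<lambda>z. f (x + z)) = (f x + P f x) / 2"
  by (subst integral_lazy) (auto intro!: integrable_bounded_pmf[of _ B] assms)

lemma P_nonneg: "(\<And>x. f x \<ge> 0) \<Longrightarrow> P f x \<ge> 0"
  by (intro integral_nonneg_AE) auto

lemma q_bounded: "\<bar>q x\<bar> \<le> 1" using q_nonneg[of x] q_le_1[of x] by simp

lemma Pq_le_g: "P q x \<le> g x"
proof -
  have "P q x \<le> P g x"
    by (rule integral_mono) (auto intro!: integrable_bounded_pmf[of _ 1] q_bounded integrable_g q_le_g)
  also have "\<dots> \<le> g x" unfolding g_step by (simp add: indicator_def)
  finally show ?thesis .
qed

lemma G_0_ge_1: "G 0 \<ge> 1"
proof -
  have "h 0 0 \<le> G 0" unfolding G_def using sum_le_suminf[OF summable_h, of "{0}" 0] by (simp add: pmf_nonneg)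
  then show ?thesis by simp
qed

lemma indicator_le_green_sq_sum: "indicator K y \<le> green_sq_sum K y"
proof (cases "y \<in> K")
  case True
  have "1 \<le> (G (y - y))\<^sup>2" using G_0_ge_1 by simp
  also have "\<dots> \<le> green_sq_sum K y"
    unfolding green_sq_sum_def using K True by (intro member_le_sum[where f="\<lambda>k. (G (k - y))\<^sup>2"]) auto
  finally show ?thesis by (simp add: indicator_def)
qed (simp add: green_sq_sum_nonneg)

lemma g_square_le: "(g x)\<^sup>2 \<le> real (card K) / 4 * green_sq_sum K x"
  using sum_squared_le_sum_of_squares[of "\<lambda>k. G (k - x)" K] by (simp add: g_def green_sum_def green_sq_sum_def power_divide mult.commute)

text \<open>One step of the lazy walk averages \<open>u\<close> to \<open>(u + P u) / 2\<close>, so this is the charge whose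
  potential is \<open>u\<close>.\<close>

definition flux :: "(int ^ 'd \<Rightarrow> real) \<Rightarrow> int ^ 'd \<Rightarrow> real" where "flux u x = (u x - P u x) / 2"

definition charge :: "(int ^ 'd \<Rightarrow> real) \<Rightarrow> real" where
  "charge u = (\<integral>y. flux u y \<partial>count_space UNIV)"

text \<open>Outside \<open>K\<close> the charge is at most of the order of \<open>(P q)\<^sup>2 \<le> g\<^sup>2\<close>, which is a multiple of
  \<open>green_sq_sum\<close>; on \<open>K\<close> it is bounded, and \<open>green_sq_sum\<close> is at least one there.\<close>

lemma charge_limit:
  assumes b: "\<And>x. \<bar>u x\<bar> \<le> B * q x" and off: "\<And>x. x \<notin> K \<Longrightarrow> \<bar>u x - P u x\<bar> \<le> B * (P q x)\<^sup>2"
    and B: "B \<ge> 0"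
  shows "((\<lambda>x. u x / G (- x)) \<longlongrightarrow> charge u) at_inf"
    and "\<And>y. \<bar>flux u y\<bar> \<le> (B + B * real (card K)) * green_sq_sum K y"
proof -
  let ?B = "B + B * real (card K)"
  have B': "?B \<ge> 0" "B \<le> ?B" using B by auto
  have ub: "\<bar>u x\<bar> \<le> B" for x using b[of x] mult_left_mono[OF q_le_1[of x] B] by simp
  have Pub: "\<bar>P u x\<bar> \<le> B" for x
  proof -
    have "norm (P u x) \<le> measure_pmf.expectation \<mu> (\<lambda>z. B)" by (rule norm_integral_le_AE) (use ub in auto)
    then show ?thesis by simp
  qed
  show fl: "\<bar>flux u y\<bar> \<le> ?B * green_sq_sum K y" for y
  proof (cases "y \<in> K")
    case True
    have "\<bar>flux u y\<bar> \<le> B" unfolding flux_def using ub[of y] Pub[of y] by (simp add: abs_le_iff)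
    also have "\<dots> \<le> B * green_sq_sum K y" using indicator_le_green_sq_sum[of y] True mult_left_mono[OF _ B, of 1 "green_sq_sum K y"] by simp
    also have "\<dots> \<le> ?B * green_sq_sum K y" using B' green_sq_sum_nonneg[of K y] by (intro mult_right_mono) auto
    finally show ?thesis .
  next
    case False
    have "\<bar>flux u y\<bar> \<le> B * (P q y)\<^sup>2" using off[OF False] unfolding flux_def
      by (simp add: abs_divide)
    also have "(P q y)\<^sup>2 \<le> (g y)\<^sup>2" using Pq_le_g[of y] P_nonneg[where f=q and x=y, OF q_nonneg] by (intro power_mono) auto
    also note g_square_le[of y]
    also have "real (card K) / 4 * green_sq_sum K y \<le> real (card K) * green_sq_sum K y" using green_sq_sum_nonneg[of K y] by (intro mult_right_mono) auto
    finally have "\<bar>flux u y\<bar> \<le> B * (real (card K) * green_sq_sum K y)" using B by (simp add: mult_left_mono)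
    also have "\<dots> \<le> ?B * green_sq_sum K y" using B green_sq_sum_nonneg[of K y] by (simp add: distrib_right)
    finally show ?thesis .
  qed
  show "((\<lambda>x. u x / G (- x)) \<longlongrightarrow> charge u) at_inf"
    unfolding charge_def
  proof (rule potential_asymptotics[OF K(2), where B="?B"])
    show "u x = flux u x + measure_pmf.expectation (lazy \<mu>) (\<lambda>z. u (x + z))" for x
      unfolding lazy_average[of u B, OF ub] flux_def by (simp add: field_simps)
    show "\<bar>u x\<bar> \<le> ?B" for x using ub[of x] B' by linarith
    show "\<bar>u x\<bar> \<le> ?B * green_sum K x" for x
    proof -
      have "\<bar>u x\<bar> \<le> B * g x" using b[of x] mult_left_mono[OF q_le_g[of x] B] by linarith
      also have "\<dots> \<le> ?B * green_sum K x" using B' green_sum_nonneg[of K x] by (intro mult_mono) (auto simp: g_def)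
      finally show ?thesis .
    qed
  qed (use B' fl in auto)
qed

lemma v_limit:
  assumes F: "F \<in> borel_measurable borel" "F 0 = 0" "\<And>a. \<bar>F a\<bar> \<le> B"
  shows "((\<lambda>x. v F x / G (- x)) \<longlongrightarrow> charge (v F)) at_inf"
proof (rule charge_limit(1)[where B="B + 4 * B * \<sigma>\<^sup>2"])
  have B: "B \<ge> 0" using F(3)[of 0] by linarith
  then show "0 \<le> B + 4 * B * \<sigma>\<^sup>2" by simp
  fix x
  have "\<bar>v F x\<bar> \<le> B * q x" by (rule v_le_q[OF F])
  also have "\<dots> \<le> (B + 4 * B * \<sigma>\<^sup>2) * q x" using B q_nonneg[of x] by (intro mult_right_mono) auto
  finally show "\<bar>v F x\<bar> \<le> (B + 4 * B * \<sigma>\<^sup>2) * q x" .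
  assume "x \<notin> K"
  then have "\<bar>v F x - P (v F) x\<bar> \<le> 4 * B * \<sigma>\<^sup>2 * (P q x)\<^sup>2" by (rule v_one_step[OF F])
  also have "\<dots> \<le> (B + 4 * B * \<sigma>\<^sup>2) * (P q x)\<^sup>2" using B by (intro mult_right_mono) auto
  finally show "\<bar>v F x - P (v F) x\<bar> \<le> (B + 4 * B * \<sigma>\<^sup>2) * (P q x)\<^sup>2" .
qed

subsection \<open>Positivity of the hitting charge\<close>

definition Fhit :: "real \<times> real \<Rightarrow> real" where "Fhit a = of_bool (a \<noteq> 0)"

lemma Fhit: "Fhit \<in> borel_measurable borel" "Fhit 0 = 0" "\<bar>Fhit a\<bar> \<le> 1"
proof -
  have "(indicator (- {0}) :: real \<times> real \<Rightarrow> real) \<in> borel_measurable borel" by simp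
  moreover have "Fhit = indicator (- {0})" by (auto simp: Fhit_def fun_eq_iff indicator_def)
  ultimately show "Fhit \<in> borel_measurable borel" by simp
qed (auto simp: Fhit_def)

lemma AE_\<Lambda>_eq_0: "AE \<omega> in M. \<Lambda> x \<omega> = 0 \<longleftrightarrow> Z x \<omega> = 0"
  using AE_Z_finite[of x]
  by eventually_elim (use \<Lambda>_eq_0 in \<open>auto simp: zero_prod_def enn2real_eq_0_iff\<close>)

lemma v_Fhit: "v Fhit x = q x"
proof -
  have "v Fhit x = expectation (indicator {\<omega>. Z x \<omega> \<noteq> 0})"
    unfolding v_def
  proof (rule integral_cong_AE)
    show "(\<lambda>\<omega>. Fhit (\<Lambda> x \<omega>)) \<in> borel_measurable M" by (rule measurable_compose[OF \<Lambda>_measurable Fhit(1)])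
    show "AE \<omega> in M. Fhit (\<Lambda> x \<omega>) = indicator {\<omega>. Z x \<omega> \<noteq> 0} \<omega>"
      using AE_\<Lambda>_eq_0[of x] by eventually_elim (auto simp: Fhit_def indicator_def)
  qed (intro borel_measurable_indicator hit_sets)
  then show ?thesis by (simp add: q_def)
qed

lemma q_limit: "((\<lambda>x. q x / G (- x)) \<longlongrightarrow> charge q) at_inf"
  using v_limit[OF Fhit] unfolding v_Fhit[abs_def] by simp

text \<open>A minorant of the indicator of a visit. For small \<open>s\<close> the quadratic error in its one-step
  equation is smaller than the gain at the points of \<open>K\<close>, which is of order \<open>s\<close>.\<close>

definition Fexp :: "real \<Rightarrow> real \<times> real \<Rightarrow> real" where "Fexp s a = 1 - exp (- s * \<bar>snd a\<bar>)"

lemma Fexp: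
  assumes "s \<ge> 0"
  shows "Fexp s \<in> borel_measurable borel" "Fexp s 0 = 0" "\<bar>Fexp s a\<bar> \<le> 1" "0 \<le> Fexp s a" "Fexp s a \<le> 1" "Fexp s a \<le> s * \<bar>snd a\<bar>"
proof -
  have "(\<lambda>a::real\<times>real. 1 - exp (- s * \<bar>snd a\<bar>)) \<in> borel_measurable (borel \<Otimes>\<^sub>M borel)" by measurable
  then show "Fexp s \<in> borel_measurable borel" unfolding Fexp_def[abs_def] borel_prod .
  show "Fexp s 0 = 0" by (simp add: Fexp_def)
  show "0 \<le> Fexp s a" "Fexp s a \<le> 1" "\<bar>Fexp s a\<bar> \<le> 1" using assms by (auto simp: Fexp_def abs_le_iff)
  show "Fexp s a \<le> s * \<bar>snd a\<bar>" using exp_ge_add_one_self[of "- s * \<bar>snd a\<bar>"] by (simp add: Fexp_def)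
qed

lemma v_Fexp_le:
  assumes "s \<ge> 0" shows "v (Fexp s) x \<le> s * g x" "0 \<le> v (Fexp s) x" "v (Fexp s) x \<le> 1"
proof -
  have m: "(\<lambda>\<omega>. Fexp s (\<Lambda> x \<omega>)) \<in> borel_measurable M" by (rule measurable_compose[OF \<Lambda>_measurable Fexp(1)[OF assms]])
  have i: "integrable M (\<lambda>\<omega>. Fexp s (\<Lambda> x \<omega>))" by (rule integrable_const_bound[of _ 1]) (use m Fexp[OF assms] in auto)
  show "0 \<le> v (Fexp s) x" unfolding v_def using Fexp[OF assms] by (intro integral_nonneg_AE) auto
  show "v (Fexp s) x \<le> 1"
    using v_le_q[OF Fexp(1-3)[OF assms], of x] q_le_1[of x] by linarith
  have "ennreal (v (Fexp s) x) = (\<integral>\<^sup>+\<omega>. ennreal (Fexp s (\<Lambda> x \<omega>)) \<partial>M)"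
    unfolding v_def using i Fexp[OF assms] by (intro nn_integral_eq_integral[symmetric]) auto
  also have "\<dots> \<le> (\<integral>\<^sup>+\<omega>. ennreal s * Z x \<omega> \<partial>M)"
  proof (rule nn_integral_mono_AE)
    show "AE \<omega> in M. ennreal (Fexp s (\<Lambda> x \<omega>)) \<le> ennreal s * Z x \<omega>"
      using AE_Z_finite[of x]
    proof (rule AE_mp, intro AE_I2 impI)
      fix \<omega> assume f: "Z x \<omega> \<noteq> \<top>"
      have "ennreal (Fexp s (\<Lambda> x \<omega>)) \<le> ennreal (s * enn2real (Z x \<omega>))"
        using Fexp(6)[OF assms, of "\<Lambda> x \<omega>"] by (intro ennreal_leI) simp
      also have "\<dots> = ennreal s * Z x \<omega>" using assms f by (simp add: ennreal_mult less_top)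
      finally show "ennreal (Fexp s (\<Lambda> x \<omega>)) \<le> ennreal s * Z x \<omega>" .
    qed
  qed
  also have "\<dots> = ennreal s * (\<integral>\<^sup>+\<omega>. Z x \<omega> \<partial>M)" by (rule nn_integral_cmult) simp
  also have "\<dots> \<le> ennreal s * ennreal (g x)" by (intro mult_left_mono mean_occupation_le) simp
  also have "\<dots> = ennreal (s * g x)" using assms g_nonneg by (simp add: ennreal_mult)
  finally show "v (Fexp s) x \<le> s * g x" using assms g_nonneg by (subst (asm) ennreal_le_iff) auto
qed

text \<open>The exponential of the occupation time is the product over the children and the root; the
  Bonferroni inequality linearises the product, with the pairs of children as error.\<close>

lemma v_Fexp_one_step:
  assumes s: "s \<ge> 0"
  shows "v (Fexp s) x - P (v (Fexp s)) x \<ge>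
    (1 - exp (- s)) * indicator K x * (1 - P (v (Fexp s)) x) - 2 * \<sigma>\<^sup>2 * (P (v (Fexp s)) x)\<^sup>2"
proof -
  define Y where "Y = (\<lambda>\<omega>. Fexp s (\<Lambda> (x + jump \<omega> []) \<omega>))"
  have mF: "(\<lambda>\<omega>. Fexp s (\<Lambda> y \<omega>)) \<in> borel_measurable M" for y by (rule measurable_compose[OF \<Lambda>_measurable Fexp(1)[OF s]])
  have mY: "Y \<in> borel_measurable M" unfolding Y_def by (rule measurable_root_jump[OF mF])
  have Y01: "0 \<le> Y \<omega>" "Y \<omega> \<le> 1" for \<omega> using Fexp[OF s] by (auto simp: Y_def)
  have Yb: "\<bar>Y \<omega>\<bar> \<le> 1" for \<omega> using Y01[of \<omega>] by simp
  have EY: "expectation Y = P (v (Fexp s)) x"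
    unfolding Y_def v_def
    by (rule expectation_root_jump[where B=1, OF mF arg_cong[where f="Fexp s", OF \<Lambda>_update_root] Fexp(3)[OF s]])
  note S = branching_sum_real[OF mY Yb mean_offspring]
  have iY: "integrable M Y" by (rule integrable_const_bound[of _ 1]) (use mY Yb in auto)
  have iF: "integrable M (\<lambda>\<omega>. Fexp s (\<Lambda> x \<omega>))" by (rule integrable_const_bound[of _ 1]) (use mF Fexp[OF s] in auto)
  let ?S = "\<lambda>\<omega>. \<Sum>i<offspring \<omega> []. Y (child i \<omega>)"
  let ?P = "\<lambda>\<omega>. \<Sum>i<offspring \<omega> []. \<Sum>j<offspring \<omega> []. if i = j then 0 else Y (child i \<omega>) * Y (child j \<omega>)"
  let ?c = "(1 - exp (- s)) * indicator K x"
  have c01: "0 \<le> ?c" "?c \<le> 1" using s by (auto simp: indicator_def)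
  have nn: "(0::real) \<le> (if i = j then 0 else Y (child i \<omega>) * Y (child j \<omega>))" for i j \<omega> using Y01 by simp
  have mYc: "(\<lambda>\<omega>. Y (child i \<omega>)) \<in> borel_measurable M" for i by (rule measurable_compose[OF measurable_child mY])
  have mIJ: "(\<lambda>\<omega>. if i = j then 0 else Y (child i \<omega>) * Y (child j \<omega>)) \<in> borel_measurable M" for i j
    using mYc by (cases "i = j") auto
  have mP: "?P \<in> borel_measurable M"
    by (rule measurable_compose_countable[where f="\<lambda>n \<omega>. \<Sum>i<n. \<Sum>j<n. if i = j then 0 else Y (child i \<omega>) * Y (child j \<omega>)"])
       (auto intro!: borel_measurable_sum mIJ)
  have EP: "(\<integral>\<^sup>+\<omega>. ennreal (?P \<omega>) \<partial>M) \<le> ennreal (2 * \<sigma>\<^sup>2 * (P (v (Fexp s)) x)\<^sup>2)"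
  proof -
    have e: "ennreal (?P \<omega>) = (\<Sum>i<offspring \<omega> []. \<Sum>j<offspring \<omega> []. if i = j then 0 else ennreal (Y (child i \<omega>)) * ennreal (Y (child j \<omega>)))" for \<omega>
    proof -
      have "(if i = j then 0 else ennreal (Y (child i \<omega>)) * ennreal (Y (child j \<omega>))) = ennreal (if i = j then 0 else Y (child i \<omega>) * Y (child j \<omega>))" for i j
        using Y01 by (simp add: ennreal_mult)
      then show ?thesis by (simp only: sum_ennreal nn sum_nonneg)
    qed
    have "(\<integral>\<^sup>+\<omega>. ennreal (?P \<omega>) \<partial>M) = (\<integral>\<^sup>+n. of_nat (n * (n - 1)) \<partial>measure_pmf p) * (\<integral>\<^sup>+\<omega>. ennreal (Y \<omega>) \<partial>M)\<^sup>2"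
      unfolding e by (rule branching_pairs) (use mY in auto)
    also have "(\<integral>\<^sup>+\<omega>. ennreal (Y \<omega>) \<partial>M) = ennreal (P (v (Fexp s)) x)"
      unfolding EY[symmetric] using iY Y01 by (intro nn_integral_eq_integral) auto
    also have "(\<integral>\<^sup>+n. of_nat (n * (n - 1)) \<partial>measure_pmf p) * (ennreal (P (v (Fexp s)) x))\<^sup>2 \<le> ennreal (2 * \<sigma>\<^sup>2) * (ennreal (P (v (Fexp s)) x))\<^sup>2"
      by (intro mult_right_mono pairs_offspring) auto
    also have "\<dots> = ennreal (2 * \<sigma>\<^sup>2 * (P (v (Fexp s)) x)\<^sup>2)"
      using P_nonneg[where f="v (Fexp s)" and x=x, OF v_Fexp_le(2)[OF s]] by (simp add: ennreal_mult ennreal_power)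
    finally show ?thesis .
  qed
  have iP: "integrable M ?P"
    unfolding integrable_iff_bounded
  proof
    have "norm (?P \<omega>) = ?P \<omega>" for \<omega> using nn by (simp only: real_norm_def abs_of_nonneg sum_nonneg)
    then show "(\<integral>\<^sup>+\<omega>. ennreal (norm (?P \<omega>)) \<partial>M) < \<infinity>" using EP by (simp only:) (auto intro: le_less_trans simp: less_top)
  qed (rule mP)
  have P_le: "expectation ?P \<le> 2 * \<sigma>\<^sup>2 * (P (v (Fexp s)) x)\<^sup>2"
  proof -
    have "ennreal (expectation ?P) = (\<integral>\<^sup>+\<omega>. ennreal (?P \<omega>) \<partial>M)"
      using iP nn by (intro nn_integral_eq_integral[symmetric]) (auto intro!: sum_nonneg)
    then have "ennreal (expectation ?P) \<le> ennreal (2 * \<sigma>\<^sup>2 * (P (v (Fexp s)) x)\<^sup>2)" using EP by simp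
    then show ?thesis by (subst (asm) ennreal_le_iff) auto
  qed
  have AEb: "AE \<omega> in M. ?S \<omega> + ?c * (1 - ?S \<omega>) - ?P \<omega> \<le> Fexp s (\<Lambda> x \<omega>)"
    using AE_Z_finite[of x]
  proof (rule AE_mp, intro AE_I2 impI)
    fix \<omega> assume fin: "Z x \<omega> \<noteq> \<top>"
    let ?n = "offspring \<omega> []"
    let ?Z = "\<lambda>i. Z (x + jump (child i \<omega>) []) (child i \<omega>)"
    have Zsum: "Z x \<omega> = indicator K x + (\<Sum>i<?n. ?Z i)" by (subst occupation_time_rec) simp
    have Zf: "?Z i < \<top>" if "i < ?n" for i
    proof -
      have "?Z i \<le> (\<Sum>i<?n. ?Z i)" using that by (intro member_le_sum[where f="?Z"]) auto
      also have "\<dots> \<le> Z x \<omega>" unfolding Zsum by simp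
      finally show ?thesis using fin by (auto simp: top_unique less_top)
    qed
    have sf: "(\<Sum>i<?n. ?Z i) < \<top>" using Zf by simp
    have "enn2real (Z x \<omega>) = indicator K x + (\<Sum>i<?n. enn2real (?Z i))"
    proof -
      have "enn2real (\<Sum>i<?n. ?Z i) = (\<Sum>i<?n. enn2real (?Z i))" using Zf by (subst enn2real_sum) auto
      then show ?thesis unfolding Zsum using sf by (subst enn2real_plus) (auto simp: indicator_def)
    qed
    then have "exp (- s * enn2real (Z x \<omega>)) = exp (- s * indicator K x) * (\<Prod>i<?n. exp (- s * enn2real (?Z i)))"
      by (simp add: distrib_left exp_add exp_diff exp_minus divide_inverse sum_distrib_left exp_sum prod_inversef)
    also have "exp (- s * indicator K x) = 1 - ?c" by (simp add: indicator_def)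
    also have "(\<Prod>i<?n. exp (- s * enn2real (?Z i))) = (\<Prod>i<?n. 1 - Y (child i \<omega>))"
      by (intro prod.cong) (auto simp: Y_def Fexp_def)
    also have "(1 - ?c) * (\<Prod>i<?n. 1 - Y (child i \<omega>)) \<le> (1 - ?c) * (1 - ?S \<omega> + ?P \<omega>)"
      using c01 Y01 by (intro mult_left_mono prod_one_minus_bound) auto
    also have "\<dots> = 1 - ?S \<omega> - ?c * (1 - ?S \<omega>) + (1 - ?c) * ?P \<omega>" by (simp add: algebra_simps)
    also have "(1 - ?c) * ?P \<omega> \<le> 1 * ?P \<omega>" using c01 nn by (intro mult_right_mono sum_nonneg) auto
    finally show "?S \<omega> + ?c * (1 - ?S \<omega>) - ?P \<omega> \<le> Fexp s (\<Lambda> x \<omega>)" by (simp add: Fexp_def)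
  qed
  have "expectation (\<lambda>\<omega>. ?S \<omega> + ?c * (1 - ?S \<omega>) - ?P \<omega>) \<le> v (Fexp s) x"
    unfolding v_def using S(1) iP iF AEb
    by (intro integral_mono_AE Bochner_Integration.integrable_diff Bochner_Integration.integrable_add integrable_mult_right) auto
  also have "expectation (\<lambda>\<omega>. ?S \<omega> + ?c * (1 - ?S \<omega>) - ?P \<omega>) = expectation Y + ?c * (1 - expectation Y) - expectation ?P"
    using S iP by (simp add: prob_space[simplified])
  finally show ?thesis using P_le EY by simp
qed

lemma charge_mono_limit:
  assumes "((\<lambda>x. u x / G (- x)) \<longlongrightarrow> a) at_inf" "((\<lambda>x. w x / G (- x)) \<longlongrightarrow> b) at_inf" "\<And>x. u x \<le> w x"
  shows "a \<le> b"
  by (rule tendsto_le[OF at_inf_neq_bot assms(2,1)])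
     (use assms(3) G_nonneg in \<open>auto intro!: always_eventually divide_right_mono\<close>)

text \<open>The charge of \<open>v (Fexp s)\<close> is at least \<open>s * card K / 8\<close> minus a multiple of \<open>s\<^sup>2\<close>, and that
  of \<open>q\<close> is at least as large, because both charges are limits of quotients by the same
  function.\<close>

lemma charge_q_pos: "charge q > 0"
proof -
  obtain Bg where Bg: "Bg \<ge> 0" "\<And>x. g x \<le> Bg" using g_bounded by blast
  define Q where "Q = real (card K) / 4 * (\<integral>y. green_sq_sum K y \<partial>count_space UNIV)"
  have Q0: "Q \<ge> 0" unfolding Q_def using green_sq_sum_nonneg[of K] by (intro mult_nonneg_nonneg integral_nonneg_AE) auto
  have cK: "real (card K) > 0" using K by (simp add: card_gt_0_iff)
  \<comment> \<open>The first bound makes \<open>P u \<le> 1 / 2\<close>, the second makes the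
    quadratic error at most half of the gain \<open>s * card K / 8\<close>.\<close>
  define s where "s = min (1 / (2 * (Bg + 1))) ((real (card K) / 16) / (\<sigma>\<^sup>2 * Q + 1))"
  have den: "\<sigma>\<^sup>2 * Q + 1 > 0" using Q0 by (simp add: add_nonneg_pos)
  have s0: "s > 0" using Bg cK den by (simp add: s_def)
  have s1: "s * Bg \<le> 1 / 2" "s \<le> 1"
  proof -
    have "s * Bg \<le> 1 / (2 * (Bg + 1)) * Bg" using Bg by (intro mult_right_mono) (auto simp: s_def)
    also have "\<dots> \<le> 1 / 2" using Bg by (simp add: field_simps)
    finally show "s * Bg \<le> 1 / 2" .
    have "s \<le> 1 / (2 * (Bg + 1))" by (simp add: s_def)
    also have "\<dots> \<le> 1" using Bg by (simp add: field_simps)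
    finally show "s \<le> 1" .
  qed
  have s2: "\<sigma>\<^sup>2 * Q * s \<le> real (card K) / 16"
  proof -
    have "\<sigma>\<^sup>2 * Q * s \<le> (\<sigma>\<^sup>2 * Q + 1) * ((real (card K) / 16) / (\<sigma>\<^sup>2 * Q + 1))"
      using Q0 s0 by (intro mult_mono) (auto simp: s_def)
    also have "\<dots> = real (card K) / 16"
      using den by (subst times_divide_eq_right) (rule nonzero_mult_div_cancel_left, simp)
    finally show ?thesis .
  qed
  let ?u = "v (Fexp s)"
  note F = Fexp[OF less_imp_le[OF s0]]
  note ul = v_Fexp_le[OF less_imp_le[OF s0]]
  have Pu: "P ?u x \<le> s * g x" "0 \<le> P ?u x" for x
  proof -
    have "P ?u x \<le> measure_pmf.expectation \<mu> (\<lambda>z. s * g (x + z))"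
      using ul(2,3) by (intro integral_mono integrable_mult_right integrable_g integrable_bounded_pmf[of _ 1] ul(1)) (auto simp: abs_le_iff intro: order_trans[of _ 0])
    also have "\<dots> = s * (g x - indicator K x)" using g_step[of x] by simp
    also have "\<dots> \<le> s * g x" using s0 by (simp add: indicator_def)
    finally show "P ?u x \<le> s * g x" .
    show "0 \<le> P ?u x" by (rule P_nonneg) (rule ul)
  qed
  have B: "(0::real) \<le> 1 + 4 * 1 * \<sigma>\<^sup>2" by simp
  have cl: "((\<lambda>x. ?u x / G (- x)) \<longlongrightarrow> charge ?u) at_inf" by (rule v_limit[OF F(1-3)])
  have flb: "\<bar>flux ?u y\<bar> \<le> ((1 + 4 * 1 * \<sigma>\<^sup>2) + (1 + 4 * 1 * \<sigma>\<^sup>2) * real (card K)) * green_sq_sum K y" for y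
  proof (rule charge_limit(2)[OF _ _ B])
    fix x
    have "\<bar>?u x\<bar> \<le> 1 * q x" by (rule v_le_q[OF F(1-3)])
    also have "\<dots> \<le> (1 + 4 * 1 * \<sigma>\<^sup>2) * q x" using q_nonneg[of x] by (intro mult_right_mono) auto
    finally show "\<bar>?u x\<bar> \<le> (1 + 4 * 1 * \<sigma>\<^sup>2) * q x" .
    assume "x \<notin> K"
    then have "\<bar>?u x - P ?u x\<bar> \<le> 4 * 1 * \<sigma>\<^sup>2 * (P q x)\<^sup>2" by (rule v_one_step[OF F(1-3)])
    also have "\<dots> \<le> (1 + 4 * 1 * \<sigma>\<^sup>2) * (P q x)\<^sup>2" by (intro mult_right_mono) auto
    finally show "\<bar>?u x - P ?u x\<bar> \<le> (1 + 4 * 1 * \<sigma>\<^sup>2) * (P q x)\<^sup>2" .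
  qed
  have iflux: "integrable (count_space UNIV) (flux ?u)"
  proof (rule Bochner_Integration.integrable_bound)
    let ?c = "(1 + 4 * 1 * \<sigma>\<^sup>2) + (1 + 4 * 1 * \<sigma>\<^sup>2) * real (card K)"
    show "integrable (count_space UNIV) (\<lambda>y. ?c * green_sq_sum K y)" by (rule integrable_mult_right[OF integrable_green_sq_sum])
    show "AE y in count_space UNIV. norm (flux ?u y) \<le> norm (?c * green_sq_sum K y)"
    proof (rule AE_I2)
      fix y
      have "norm (flux ?u y) \<le> ?c * green_sq_sum K y" using flb[of y] by simp
      then show "norm (flux ?u y) \<le> norm (?c * green_sq_sum K y)"
        unfolding real_norm_def by (rule order_trans[OF _ abs_ge_self])
    qed
  qed simp
  have lower: "s / 8 * indicator K y - \<sigma>\<^sup>2 * s\<^sup>2 * (real (card K) / 4) * green_sq_sum K y \<le> flux ?u y" for y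
  proof -
    have "1 - exp (- s) \<ge> s / 2"
    proof -
      have "exp (- s) \<le> 1 + (- s) + (- s)\<^sup>2 / 2 * exp 0" using s0 by (intro exp_le_quadratic) auto
      moreover have "s\<^sup>2 \<le> s" using s0 s1(2) by (simp add: power2_eq_square mult_left_le)
      ultimately show ?thesis by simp
    qed
    moreover have "1 - P ?u y \<ge> 1 / 2"
      using Pu(1)[of y] mult_left_mono[OF Bg(2)[of y] less_imp_le[OF s0]] s1(1) by linarith
    ultimately have "(s / 2) * (1 / 2) \<le> (1 - exp (- s)) * (1 - P ?u y)" using s0 by (intro mult_mono) auto
    then have 1: "s / 4 * indicator K y \<le> (1 - exp (- s)) * indicator K y * (1 - P ?u y)"
      by (cases "y \<in> K") auto
    have "(P ?u y)\<^sup>2 \<le> (s * g y)\<^sup>2" using Pu by (intro power_mono) auto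
    also have "\<dots> \<le> s\<^sup>2 * (real (card K) / 4 * green_sq_sum K y)"
      unfolding power_mult_distrib by (intro mult_left_mono g_square_le) auto
    finally have "2 * \<sigma>\<^sup>2 * (P ?u y)\<^sup>2 \<le> 2 * \<sigma>\<^sup>2 * (s\<^sup>2 * (real (card K) / 4 * green_sq_sum K y))"
      by (intro mult_left_mono) auto
    with 1 v_Fexp_one_step[OF less_imp_le[OF s0], of y]
    have "s / 4 * indicator K y - 2 * \<sigma>\<^sup>2 * (s\<^sup>2 * (real (card K) / 4 * green_sq_sum K y)) \<le> ?u y - P ?u y" by linarith
    then show ?thesis unfolding flux_def by (simp add: field_simps)
  qed
  have intK: "integrable (count_space UNIV) (indicator K :: _ \<Rightarrow> real)"
    and IK: "(\<integral>y. indicator K y \<partial>count_space (UNIV :: (int ^ 'd) set)) = real (card K)"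
    using K(2) by (simp_all add: integrable_indicator_iff ennreal_of_nat_eq_real_of_nat)
  have "(\<integral>y. s / 8 * indicator K y - \<sigma>\<^sup>2 * s\<^sup>2 * (real (card K) / 4) * green_sq_sum K y \<partial>count_space UNIV) \<le> charge ?u"
    unfolding charge_def by (intro integral_mono iflux lower Bochner_Integration.integrable_diff integrable_mult_right intK integrable_green_sq_sum)
  also have "(\<integral>y. s / 8 * indicator K y - \<sigma>\<^sup>2 * s\<^sup>2 * (real (card K) / 4) * green_sq_sum K y \<partial>count_space UNIV) =
    s / 8 * real (card K) - \<sigma>\<^sup>2 * s\<^sup>2 * Q"
    using intK integrable_green_sq_sum[of K] IK by (simp add: Q_def)
  finally have "s / 8 * real (card K) - \<sigma>\<^sup>2 * s\<^sup>2 * Q \<le> charge ?u" .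
  moreover have "\<sigma>\<^sup>2 * s\<^sup>2 * Q \<le> s * (real (card K) / 16)"
    using mult_left_mono[OF s2 less_imp_le[OF s0]] by (simp add: power2_eq_square mult_ac)
  moreover have "s * (real (card K) / 16) < s / 8 * real (card K)" using s0 cK by simp
  ultimately have "charge ?u > 0" by linarith
  moreover have "charge ?u \<le> charge q"
  proof (rule charge_mono_limit[OF cl q_limit])
    fix x show "?u x \<le> q x" using v_le_q[OF F(1-3), of x] by linarith
  qed
  ultimately show ?thesis by linarith
qed

end

section \<open>Large occupation times\<close>

lemma prod_of_bool: "finite I \<Longrightarrow> (\<Prod>i\<in>I. of_bool (Q i)) = (of_bool (\<forall>i\<in>I. Q i) :: 'a::{comm_semiring_1})"
  by (induction I rule: finite_induct) auto

context critical_brw begin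

definition large :: "nat \<Rightarrow> int ^ 'd \<Rightarrow> real" where "large m x = prob {\<omega>. Z x \<omega> \<ge> of_nat m}"

lemma large_sets [measurable]: "{\<omega>. Z x \<omega> \<ge> of_nat m} \<in> events"
proof -
  have "{\<omega> \<in> space M. Z x \<omega> \<ge> of_nat m} \<in> events" by measurable
  then show ?thesis by simp
qed

lemma large_bounds: "0 \<le> large m x" "large m x \<le> 1" "\<bar>large m x\<bar> \<le> 1"
  by (simp_all add: large_def)

lemma large_1: "large 1 x = q x"
  unfolding large_def q_def by (intro arg_cong[where f=prob]) (use occupation_time_ge_1[of x K] in auto)

definition \<Phi> :: "real \<Rightarrow> real" where "\<Phi> y = measure_pmf.expectation p (\<lambda>n. y ^ n)"

text \<open>The subtrees of the children are independent, so the probability that all of them lie in the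
  required events is the offspring generating function at the probability for one child.\<close>

lemma small_step:
  fixes H :: "int ^ 'd \<Rightarrow> 'd outcome set"
  assumes H: "\<And>y. H y \<in> events"
    and upd: "\<And>y \<omega> n z z'. fun_upd \<omega> [] (n, z) \<in> H y \<longleftrightarrow> fun_upd \<omega> [] (n, z') \<in> H y"
  shows "prob {\<omega>. \<forall>i<offspring \<omega> []. child i \<omega> \<in> H (x + jump (child i \<omega>) [])} = \<Phi> (P (\<lambda>y. prob (H y)) x)"
    and "{\<omega>. \<forall>i<offspring \<omega> []. child i \<omega> \<in> H (x + jump (child i \<omega>) [])} \<in> events"
proof -
  let ?Y = "\<lambda>\<omega>. of_bool (\<omega> \<in> H (x + jump \<omega> [])) :: ennreal"
  let ?A = "{\<omega>. \<forall>i<offspring \<omega> []. child i \<omega> \<in> H (x + jump (child i \<omega>) [])}"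
  have mH: "(\<lambda>\<omega>. of_bool (\<omega> \<in> H y) :: ennreal) \<in> borel_measurable M" for y
    using borel_measurable_indicator[OF H[of y]] by (simp add: indicator_def[abs_def])
  have mY: "?Y \<in> borel_measurable M"
    by (rule measurable_root_jump[where H="\<lambda>y \<omega>. of_bool (\<omega> \<in> H y)", OF mH])
  have EY: "(\<integral>\<^sup>+\<omega>. ?Y \<omega> \<partial>M) = ennreal (P (\<lambda>y. prob (H y)) x)"
  proof -
    have "(\<integral>\<^sup>+\<omega>. ?Y \<omega> \<partial>M) = (\<integral>\<^sup>+z. \<integral>\<^sup>+\<omega>. of_bool (\<omega> \<in> H (x + z)) \<partial>M \<partial>measure_pmf \<mu>)"
      by (rule nn_integral_root_jump[where H="\<lambda>y \<omega>. of_bool (\<omega> \<in> H y)", OF mH]) (rule arg_cong[where f=of_bool], rule upd)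
    also have "\<dots> = (\<integral>\<^sup>+z. ennreal (prob (H (x + z))) \<partial>measure_pmf \<mu>)"
    proof (rule nn_integral_cong)
      fix z
      have "(\<integral>\<^sup>+\<omega>. of_bool (\<omega> \<in> H (x + z)) \<partial>M) = (\<integral>\<^sup>+\<omega>. indicator (H (x + z)) \<omega> \<partial>M)"
        by (simp add: indicator_def)
      then show "(\<integral>\<^sup>+\<omega>. of_bool (\<omega> \<in> H (x + z)) \<partial>M) = ennreal (prob (H (x + z)))"
        using H by (simp add: emeasure_eq_measure)
    qed
    also have "\<dots> = ennreal (P (\<lambda>y. prob (H y)) x)"
      by (intro nn_integral_eq_integral measure_pmf.integrable_const_bound[of _ 1]) auto
    finally show ?thesis .
  qed
  have mYc: "(\<lambda>\<omega>. ?Y (child i \<omega>)) \<in> borel_measurable M" for i by (rule measurable_compose[OF measurable_child mY])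
  have e: "(\<Prod>i<offspring \<omega> []. ?Y (child i \<omega>)) = indicator ?A \<omega>" for \<omega>
    by (subst prod_of_bool) (auto simp: indicator_def)
  have "(\<lambda>\<omega>. \<Prod>i<offspring \<omega> []. ?Y (child i \<omega>)) \<in> borel_measurable M"
    by (rule measurable_compose_countable[where f="\<lambda>n \<omega>. \<Prod>i<n. ?Y (child i \<omega>)"])
       (auto intro!: borel_measurable_prod_ennreal mYc)
  then have "(indicator ?A :: _ \<Rightarrow> ennreal) \<in> borel_measurable M" unfolding e by simp
  then show A: "?A \<in> events" by (simp add: borel_measurable_indicator_iff)
  have P0: "0 \<le> P (\<lambda>y. prob (H y)) x" "P (\<lambda>y. prob (H y)) x \<le> 1"
    by (auto intro!: P_nonneg measure_pmf.integral_le_const measure_pmf.integrable_const_bound[of _ 1])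
  have "ennreal (prob ?A) = (\<integral>\<^sup>+\<omega>. (\<Prod>i<offspring \<omega> []. ?Y (child i \<omega>)) \<partial>M)"
    unfolding e using A by (simp add: emeasure_eq_measure)
  also have "\<dots> = (\<integral>\<^sup>+n. (ennreal (P (\<lambda>y. prob (H y)) x)) ^ n \<partial>measure_pmf p)"
    unfolding branching_power[OF mY] EY ..
  also have "\<dots> = (\<integral>\<^sup>+n. ennreal ((P (\<lambda>y. prob (H y)) x) ^ n) \<partial>measure_pmf p)"
    using P0 by (simp add: ennreal_power)
  also have "\<dots> = ennreal (\<Phi> (P (\<lambda>y. prob (H y)) x))"
    unfolding \<Phi>_def using P0
    by (intro nn_integral_eq_integral measure_pmf.integrable_const_bound[of _ 1]) (auto simp: power_le_one)
  finally show "prob ?A = \<Phi> (P (\<lambda>y. prob (H y)) x)"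
    using P0 by (subst (asm) ennreal_inj) (auto simp: \<Phi>_def intro!: integral_nonneg_AE)
qed

lemma prob_compl_large: "prob {\<omega>. Z x \<omega> < of_nat m} = 1 - large m x"
proof -
  have "{\<omega>. Z x \<omega> < of_nat m} = space M - {\<omega>. Z x \<omega> \<ge> of_nat m}" by auto
  then show ?thesis unfolding large_def by (simp only: prob_compl[OF large_sets])
qed

lemma small_sets: "{\<omega>. Z x \<omega> < of_nat m} \<in> events"
proof -
  have "{\<omega> \<in> space M. Z x \<omega> < of_nat m} \<in> events" by measurable
  then show ?thesis by simp
qed

lemma P_one_minus:
  assumes "\<And>x. \<bar>f x\<bar> \<le> B" shows "P (\<lambda>y. 1 - f y) x = 1 - P f x"
  by (subst Bochner_Integration.integral_diff) (auto intro!: integrable_bounded_pmf[of _ B] assms)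

text \<open>If fewer than \<open>m\<close> visits are made in total, the same is true below every child. For \<open>m = 1\<close>
  and a starting point outside \<open>K\<close> the converse holds as well.\<close>

lemma large_step: "1 - large m x \<le> \<Phi> (1 - P (large m) x)"
  and q_step: "x \<notin> K \<Longrightarrow> 1 - q x = \<Phi> (1 - P q x)"
proof -
  let ?A = "\<lambda>m. {\<omega>. \<forall>i<offspring \<omega> []. child i \<omega> \<in> {\<omega>'. Z (x + jump (child i \<omega>) []) \<omega>' < of_nat m}}"
  have upd: "fun_upd \<omega> [] (n, z) \<in> {\<omega>. Z y \<omega> < of_nat m} \<longleftrightarrow> fun_upd \<omega> [] (n, z') \<in> {\<omega>. Z y \<omega> < of_nat m}" for y \<omega> n z z' m
    unfolding mem_Collect_eq by (subst occupation_time_update_root) (rule refl)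
  note st = small_step[where H="\<lambda>y. {\<omega>. Z y \<omega> < of_nat m}" and x=x for m, OF small_sets upd]
  have eq: "prob (?A m) = \<Phi> (1 - P (large m) x)" for m
    unfolding st(1) prob_compl_large by (subst P_one_minus[where f="large m", OF large_bounds(3)]) (rule refl)
  have "1 - large m x = prob {\<omega>. Z x \<omega> < of_nat m}" by (simp only: prob_compl_large)
  also have "\<dots> \<le> prob (?A m)"
  proof (rule finite_measure_mono[OF _ st(2)])
    show "{\<omega>. Z x \<omega> < of_nat m} \<subseteq> ?A m"
    proof safe
      fix \<omega> i assume a: "Z x \<omega> < of_nat m" and i: "i < offspring \<omega> []"
      have "Z (x + jump (child i \<omega>) []) (child i \<omega>) \<le> (\<Sum>i<offspring \<omega> []. Z (x + jump (child i \<omega>) []) (child i \<omega>))"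
        using i by (intro member_le_sum[where f="\<lambda>i. Z (x + jump (child i \<omega>) []) (child i \<omega>)"]) auto
      also have "\<dots> \<le> Z x \<omega>" by (subst (2) occupation_time_rec) simp
      finally show "Z (x + jump (child i \<omega>) []) (child i \<omega>) < of_nat m" using a by simp
    qed
  qed
  finally show "1 - large m x \<le> \<Phi> (1 - P (large m) x)" unfolding eq .
  show "1 - q x = \<Phi> (1 - P q x)" if x: "x \<notin> K"
  proof -
    have "{\<omega>. Z x \<omega> < of_nat 1} = ?A 1"
    proof (rule set_eqI)
      fix \<omega>
      have lt: "Z y \<omega>' < of_nat 1 \<longleftrightarrow> Z y \<omega>' = 0" for y \<omega>'
        using occupation_time_ge_1[of y K \<omega>'] by (auto simp: not_le[symmetric])
      have "Z x \<omega> = 0 \<longleftrightarrow> (\<forall>i<offspring \<omega> []. Z (x + jump (child i \<omega>) []) (child i \<omega>) = 0)"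
        using x by (subst occupation_time_rec) auto
      then show "\<omega> \<in> {\<omega>. Z x \<omega> < of_nat 1} \<longleftrightarrow> \<omega> \<in> ?A 1" by (simp only: mem_Collect_eq lt)
    qed
    then have "1 - large 1 x = \<Phi> (1 - P (large 1) x)" using eq[of 1] prob_compl_large[of x 1] by simp
    then show ?thesis unfolding large_1 .
  qed
qed

lemma integrable_power: "0 \<le> y \<Longrightarrow> y \<le> 1 \<Longrightarrow> integrable (measure_pmf p) (\<lambda>n. (y::real) ^ n)"
  by (intro measure_pmf.integrable_const_bound[of _ 1]) (auto simp: power_le_one)

lemma mean_offspring_real: "integrable (measure_pmf p) real" "measure_pmf.expectation p real = 1"
proof -
  have e: "(\<integral>\<^sup>+n. ennreal (real n) \<partial>measure_pmf p) = 1"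
    using mean_offspring by (simp add: ennreal_of_nat_eq_real_of_nat)
  show i: "integrable (measure_pmf p) real" unfolding integrable_iff_bounded using e by simp
  have "ennreal (measure_pmf.expectation p real) = ennreal 1"
    using e by (subst nn_integral_eq_integral[symmetric]) (use i in auto)
  then show "measure_pmf.expectation p real = 1" by (subst (asm) ennreal_inj) (auto intro!: integral_nonneg_AE)
qed

lemma \<Phi>_lipschitz:
  assumes "0 \<le> a" "a \<le> b" "b \<le> 1" shows "\<Phi> b - \<Phi> a \<le> b - a"
proof -
  have pt: "b ^ n - a ^ n \<le> real n * (b - a)" for n
  proof (induction n)
    case (Suc n)
    have "b ^ Suc n - a ^ Suc n = b * (b ^ n - a ^ n) + (b - a) * a ^ n" by (simp add: algebra_simps)
    also have "\<dots> \<le> 1 * (real n * (b - a)) + (b - a) * 1"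
      using Suc assms by (intro add_mono mult_mono power_le_one) (auto simp: power_mono)
    finally show ?case by (simp add: algebra_simps)
  qed simp
  have "\<Phi> b - \<Phi> a = measure_pmf.expectation p (\<lambda>n. b ^ n - a ^ n)"
    unfolding \<Phi>_def using assms by (subst Bochner_Integration.integral_diff) (auto intro!: integrable_power)
  also have "\<dots> \<le> measure_pmf.expectation p (\<lambda>n. real n * (b - a))"
    using assms pt mean_offspring_real by (intro integral_mono Bochner_Integration.integrable_diff integrable_power) auto
  also have "\<dots> = b - a" using mean_offspring_real by simp
  finally show ?thesis .
qed

lemma \<Phi>_mono:
  assumes "0 \<le> a" "a \<le> b" "b \<le> 1" shows "\<Phi> a \<le> \<Phi> b"
  unfolding \<Phi>_def using assms by (intro integral_mono integrable_power power_mono) auto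

lemma \<Phi>_convex:
  assumes e: "0 \<le> e" "e \<le> 1" and s: "0 \<le> s" "s \<le> 1"
  shows "\<Phi> (1 - e * s) \<le> (1 - e) + e * \<Phi> (1 - s)"
proof -
  have es: "0 \<le> 1 - e * s" "1 - e * s \<le> 1" using assms mult_le_one[of e s] by auto
  have pt: "(1 - e * s) ^ n \<le> (1 - e) + e * (1 - s) ^ n" for n
  proof (induction n)
    case (Suc n)
    have w: "(1 - s) ^ n \<le> 1" using s by (intro power_le_one) auto
    have "(1 - e * s) ^ Suc n \<le> (1 - e * s) * ((1 - e) + e * (1 - s) ^ n)"
      using Suc es by (simp add: mult_left_mono)
    also have "\<dots> = (1 - e) + e * (1 - s) ^ Suc n - e * s * (1 - e) * (1 - (1 - s) ^ n)"
      by (simp add: algebra_simps)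
    also have "\<dots> \<le> (1 - e) + e * (1 - s) ^ Suc n"
      using e s w by (simp add: mult_nonneg_nonneg)
    finally show ?case .
  qed simp
  have "\<Phi> (1 - e * s) \<le> measure_pmf.expectation p (\<lambda>n. (1 - e) + e * (1 - s) ^ n)"
    unfolding \<Phi>_def using pt es s by (intro integral_mono integrable_power Bochner_Integration.integrable_add integrable_mult_right) auto
  also have "\<dots> = (1 - e) + e * \<Phi> (1 - s)" unfolding \<Phi>_def using s by (simp add: integrable_power)
  finally show ?thesis .
qed

lemma P_le_1: "(\<And>x. 0 \<le> f x) \<Longrightarrow> (\<And>x. f x \<le> 1) \<Longrightarrow> P f x \<le> 1"
  by (intro measure_pmf.integral_le_const measure_pmf.integrable_const_bound[of _ 1]) auto

text \<open>Let \<open>D\<close> be the positive part of \<open>e * q - large m\<close>. It vanishes on \<open>K\<close>. Outside \<open>K\<close> the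
  recursions for \<open>q\<close> and \<open>large m\<close>, the convexity of \<open>\<Phi>\<close>, and the Lipschitz constant one of
  \<open>\<Phi>\<close>, which reflects criticality, give \<open>D \<le> P D\<close>. So \<open>D\<close> is subharmonic and dominated by the
  potential of \<open>K\<close>, whose averages over many steps vanish; hence \<open>D = 0\<close>.\<close>

lemma large_ge_multiple_of_q:
  assumes e: "0 \<le> e" "e \<le> 1" and onK: "\<And>k. k \<in> K \<Longrightarrow> e \<le> large m k"
  shows "e * q x \<le> large m x"
proof -
  define D where "D = (\<lambda>x. max 0 (e * q x - large m x))"
  have eq: "0 \<le> e * q x" "e * q x \<le> q x" "e * q x \<le> e" for x
    using e q_nonneg[of x] q_le_1[of x] by (auto simp: mult_left_le_one_le mult_left_le)
  have D0: "0 \<le> D x" "D x \<le> q x" "\<bar>D x\<bar> \<le> 1" for x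
    using eq[of x] large_bounds[of m x] q_le_1[of x] q_nonneg[of x] by (auto simp: D_def)
  have sub: "D x \<le> P D x" for x
  proof (cases "x \<in> K")
    case True
    then have "D x = 0" using onK[OF True] eq(3)[of x] by (simp add: D_def)
    then show ?thesis using P_nonneg[where f=D and x=x, OF D0(1)] by simp
  next
    case False
    have Pq: "0 \<le> P q x" "P q x \<le> 1" using P_nonneg[where f=q and x=x, OF q_nonneg] P_le_1[where f=q and x=x, OF q_nonneg q_le_1] .
    have Pl: "0 \<le> P (large m) x" "P (large m) x \<le> 1"
      using P_nonneg[where f="large m" and x=x, OF large_bounds(1)] P_le_1[where f="large m" and x=x, OF large_bounds(1,2)] .
    have ePq: "0 \<le> e * P q x" "e * P q x \<le> 1" using e Pq mult_le_one[of e "P q x"] by auto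
    have "e * q x - large m x \<le> e * (1 - \<Phi> (1 - P q x)) - 1 + \<Phi> (1 - P (large m) x)"
    proof -
      have qx: "q x = 1 - \<Phi> (1 - P q x)" using q_step[OF False] by linarith
      have "e * q x = e * (1 - \<Phi> (1 - P q x))" by (subst qx) (rule refl)
      then show ?thesis using large_step[of m x] by linarith
    qed
    also have "\<dots> \<le> \<Phi> (1 - P (large m) x) - \<Phi> (1 - e * P q x)"
      using \<Phi>_convex[OF e Pq] by (simp add: algebra_simps)
    also have "\<dots> \<le> max 0 (e * P q x - P (large m) x)"
    proof (cases "P (large m) x \<le> e * P q x")
      case True
      then show ?thesis using \<Phi>_lipschitz[of "1 - e * P q x" "1 - P (large m) x"] ePq Pl by simp
    next
      case False
      then show ?thesis using \<Phi>_mono[of "1 - P (large m) x" "1 - e * P q x"] ePq Pl by simp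
    qed
    also have "e * P q x - P (large m) x = P (\<lambda>y. e * q y - large m y) x"
      by (subst Bochner_Integration.integral_diff)
         (auto intro!: integrable_mult_right integrable_bounded_pmf[of _ 1] q_bounded large_bounds)
    also have "\<dots> \<le> P D x"
    proof (rule integral_mono)
      show "integrable (measure_pmf \<mu>) (\<lambda>z. e * q (x + z) - large m (x + z))"
        by (intro Bochner_Integration.integrable_diff integrable_mult_right integrable_bounded_pmf[of _ 1] q_bounded large_bounds)
      show "integrable (measure_pmf \<mu>) (\<lambda>z. D (x + z))" by (rule integrable_bounded_pmf[of _ 1]) (rule D0)
    qed (simp add: D_def)
    finally show ?thesis using P_nonneg[where f=D and x=x, OF D0(1)] by (simp add: D_def)
  qed
  have subA: "D x \<le> A n D x" for n x
  proof (induction n arbitrary: x)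
    case (Suc n)
    have "D x \<le> measure_pmf.expectation (lazy \<mu>) (\<lambda>z. D (x + z))"
      unfolding lazy_average[of D 1, OF D0(3)] using sub[of x] by simp
    also have "\<dots> \<le> measure_pmf.expectation (lazy \<mu>) (\<lambda>z. A n D (x + z))"
    proof (rule integral_mono)
      show "integrable (measure_pmf (lazy \<mu>)) (\<lambda>z. D (x + z))" by (rule integrable_bounded_pmf[of _ 1]) (rule D0)
      show "integrable (measure_pmf (lazy \<mu>)) (\<lambda>z. A n D (x + z))"
        by (rule integrable_bounded_pmf[of _ 1], rule A_bounded) (rule D0)
    qed (rule Suc)
    also have "\<dots> = A (Suc n) D x" by (rule A_Suc[symmetric]) (rule D0(3))
    finally show ?case .
  qed simp
  have "(\<lambda>n. A n D x) \<longlonglongrightarrow> 0"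
  proof (rule A_green_sum_vanishes[OF K(2), where B="1/2"])
    fix x show "\<bar>D x\<bar> \<le> 1 / 2 * green_sum K x" using D0[of x] q_le_g[of x] by (simp add: g_def)
  qed simp
  then have "D x \<le> 0" by (rule LIMSEQ_le_const) (use subA in auto)
  then show ?thesis by (simp add: D_def)
qed

text \<open>If the first two children exist and have \<open>m\<close> visits each in their subtrees, there are
  \<open>2 * m\<close> visits in total.\<close>

lemma two_children: "measure_pmf.prob p {n. 2 \<le> n} * (P (large m) x)\<^sup>2 \<le> large (2 * m) x"
  and first_child: "measure_pmf.prob p {n. 1 \<le> n} * P q x \<le> q x"
proof -
  let ?Y = "\<lambda>m \<omega>. indicator {\<omega>. Z (x + jump \<omega> []) \<omega> \<ge> of_nat m} \<omega> :: ennreal"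
  have mY: "?Y m \<in> borel_measurable M" for m
  proof -
    have "(\<lambda>\<omega>. indicator {\<omega>. Z y \<omega> \<ge> of_nat m} \<omega> :: ennreal) \<in> borel_measurable M" for y by simp
    from measurable_root_jump[where H="\<lambda>y \<omega>. indicator {\<omega>. Z y \<omega> \<ge> of_nat m} \<omega>" and x=x, OF this]
    show ?thesis by (simp add: indicator_def)
  qed
  have EY: "(\<integral>\<^sup>+\<omega>. ?Y m \<omega> \<partial>M) = ennreal (P (large m) x)" for m
  proof -
    have "(\<integral>\<^sup>+\<omega>. ?Y m \<omega> \<partial>M) = (\<integral>\<^sup>+\<omega>. (\<lambda>y \<omega>. indicator {\<omega>. Z y \<omega> \<ge> of_nat m} \<omega>) (x + jump \<omega> []) \<omega> \<partial>M)"
      by (intro nn_integral_cong) (simp add: indicator_def)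
    also have "\<dots> = (\<integral>\<^sup>+z. \<integral>\<^sup>+\<omega>. indicator {\<omega>. Z (x + z) \<omega> \<ge> of_nat m} \<omega> \<partial>M \<partial>measure_pmf \<mu>)"
      by (rule nn_integral_root_jump, simp, simp only: indicator_def mem_Collect_eq)
         (subst occupation_time_update_root, rule refl)
    also have "\<dots> = (\<integral>\<^sup>+z. ennreal (large m (x + z)) \<partial>measure_pmf \<mu>)"
      by (simp add: large_def emeasure_eq_measure)
    also have "\<dots> = ennreal (P (large m) x)"
      by (intro nn_integral_eq_integral integrable_bounded_pmf[of _ 1]) (auto simp: large_bounds)
    finally show ?thesis .
  qed
  have Pl: "0 \<le> P (large m) x" for m by (rule P_nonneg) (rule large_bounds)
  have EN: "(\<integral>\<^sup>+n. indicator A n \<partial>measure_pmf p) = ennreal (measure_pmf.prob p A)" for A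
    by (simp add: measure_pmf.emeasure_eq_measure)
  have le: "Z x \<omega> \<ge> (\<Sum>i\<in>J. Z (x + jump (child i \<omega>) []) (child i \<omega>))" if "J \<subseteq> {..<offspring \<omega> []}" for J \<omega>
  proof -
    have "(\<Sum>i\<in>J. Z (x + jump (child i \<omega>) []) (child i \<omega>)) \<le> (\<Sum>i<offspring \<omega> []. Z (x + jump (child i \<omega>) []) (child i \<omega>))"
      using that by (intro sum_mono2) auto
    also have "\<dots> \<le> Z x \<omega>" by (subst (2) occupation_time_rec) simp
    finally show ?thesis .
  qed
  have "ennreal (measure_pmf.prob p {n. 2 \<le> n}) * (ennreal (P (large m) x) * ennreal (P (large m) x)) =
    (\<integral>\<^sup>+\<omega>. indicator {n. 2 \<le> n} (offspring \<omega> []) * (\<Prod>i\<in>{0, 1}. ?Y m (child i \<omega>)) \<partial>M)"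
    using branching_product[of "{0, 1}" "\<lambda>_. ?Y m" "indicator {n. 2 \<le> n}"] mY EY by (simp add: EN)
  also have "\<dots> \<le> (\<integral>\<^sup>+\<omega>. indicator {\<omega>. Z x \<omega> \<ge> of_nat (2 * m)} \<omega> \<partial>M)"
  proof (rule nn_integral_mono)
    fix \<omega>
    show "indicator {n. 2 \<le> n} (offspring \<omega> []) * (\<Prod>i\<in>{0, 1}. ?Y m (child i \<omega>)) \<le> (indicator {\<omega>. Z x \<omega> \<ge> of_nat (2 * m)} \<omega> :: ennreal)"
    proof (cases "2 \<le> offspring \<omega> [] \<and> (\<forall>i\<in>{0, 1}. Z (x + jump (child i \<omega>) []) (child i \<omega>) \<ge> of_nat m)")
      case True
      have "(of_nat (2 * m) :: ennreal) = of_nat m + of_nat m" by (simp flip: of_nat_add add: mult_2)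
      also have "\<dots> \<le> (\<Sum>i\<in>{0, 1}. Z (x + jump (child i \<omega>) []) (child i \<omega>))"
        using True by (auto intro!: add_mono)
      also have "\<dots> \<le> Z x \<omega>" using True by (intro le) auto
      finally show ?thesis by (simp add: indicator_def)
    next
      case False
      then show ?thesis by (auto simp: indicator_def)
    qed
  qed
  also have "\<dots> = ennreal (large (2 * m) x)"
    using large_sets[of "2 * m" x] by (simp add: large_def emeasure_eq_measure del: of_nat_mult)
  finally show "measure_pmf.prob p {n. 2 \<le> n} * (P (large m) x)\<^sup>2 \<le> large (2 * m) x"
    using Pl large_bounds by (simp add: ennreal_mult[symmetric] power2_eq_square)
  have "ennreal (measure_pmf.prob p {n. 1 \<le> n}) * ennreal (P (large 1) x) =
    (\<integral>\<^sup>+\<omega>. indicator {n. 1 \<le> n} (offspring \<omega> []) * (\<Prod>i\<in>{0}. ?Y 1 (child i \<omega>)) \<partial>M)"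
    using branching_product[of "{0}" "\<lambda>_. ?Y 1" "indicator {n. 1 \<le> n}"] mY[of 1] EY[of 1] by (simp add: EN)
  also have "\<dots> \<le> (\<integral>\<^sup>+\<omega>. indicator {\<omega>. Z x \<omega> \<ge> of_nat 1} \<omega> \<partial>M)"
  proof (rule nn_integral_mono)
    fix \<omega>
    show "indicator {n. 1 \<le> n} (offspring \<omega> []) * (\<Prod>i\<in>{0}. ?Y 1 (child i \<omega>)) \<le> (indicator {\<omega>. Z x \<omega> \<ge> of_nat 1} \<omega> :: ennreal)"
    proof (cases "1 \<le> offspring \<omega> [] \<and> Z (x + jump (child 0 \<omega>) []) (child 0 \<omega>) \<ge> of_nat 1")
      case True
      then have "(of_nat 1 :: ennreal) \<le> (\<Sum>i\<in>{0}. Z (x + jump (child i \<omega>) []) (child i \<omega>))" by simp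
      also have "\<dots> \<le> Z x \<omega>" using True by (intro le) auto
      finally show ?thesis by (simp add: indicator_def)
    next
      case False
      then show ?thesis by (auto simp: indicator_def)
    qed
  qed
  also have "\<dots> = ennreal (large 1 x)"
    using large_sets[of 1 x] by (simp add: large_def emeasure_eq_measure)
  finally have "measure_pmf.prob p {n. 1 \<le> n} * P (large 1) x \<le> large 1 x"
    using Pl[of 1] large_bounds by (simp add: ennreal_mult[symmetric])
  then show "measure_pmf.prob p {n. 1 \<le> n} * P q x \<le> q x" unfolding large_1 .
qed

text \<open>Otherwise the mean number of children would be the probability of having exactly one child.\<close>

lemma prob_two_children: "measure_pmf.prob p {n. 2 \<le> n} > 0"
proof (rule ccontr)
  assume "\<not> measure_pmf.prob p {n. 2 \<le> n} > 0"
  then have "measure_pmf.prob p {n. 2 \<le> n} = 0" using measure_nonneg[of p "{n. 2 \<le> n}"] by linarith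
  then have z: "pmf p n = 0" if "n \<ge> 2" for n
    using that measure_pmf.finite_measure_mono[of "{n}" "{n. 2 \<le> n}" p] pmf_nonneg[of p n] by (simp add: measure_pmf_single)
  have "(\<lambda>k. real k * pmf p k) sums (\<Sum>k\<in>{1}. real k * pmf p k)"
  proof (rule sums_finite)
    fix k :: nat assume "k \<notin> {1}"
    then have "k = 0 \<or> 2 \<le> k" by auto
    then show "real k * pmf p k = 0" using z by auto
  qed simp
  then have "pmf p 1 = 1" using sums_unique2[OF critical] by simp
  then show False using p1 by simp
qed

lemma q_on_K: "x \<in> K \<Longrightarrow> q x = 1"
proof -
  assume x: "x \<in> K"
  have "{\<omega>. Z x \<omega> \<noteq> 0} = UNIV" using x by (subst occupation_time_rec) auto
  then show ?thesis using prob_space by (simp add: q_def)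
qed

text \<open>The zeros of \<open>q\<close> are preserved by the steps of the lazy walk. As \<open>G\<close> is positive everywhere,
  the walk can reach \<open>K\<close>, where \<open>q = 1\<close>.\<close>

lemma q_pos: "q x > 0"
proof (rule ccontr)
  assume "\<not> q x > 0"
  then have q0: "q x = 0" using q_nonneg[of x] by linarith
  have p1: "measure_pmf.prob p {n. 1 \<le> n} > 0"
  proof -
    have "measure_pmf.prob p {n. 2 \<le> n} \<le> measure_pmf.prob p {n. 1 \<le> n}"
      by (intro measure_pmf.finite_measure_mono) auto
    then show ?thesis using prob_two_children by linarith
  qed
  have step: "\<forall>z\<in>set_pmf (lazy \<mu>). q (y + z) = 0" if "q y = 0" for y
  proof -
    have "P q y \<le> 0" using first_child[of y] that p1 by (simp add: mult_le_0_iff)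
    then have "measure_pmf.expectation (lazy \<mu>) (\<lambda>z. q (y + z)) = 0"
      unfolding lazy_average[of q 1, OF q_bounded] using that P_nonneg[where f=q and x=y, OF q_nonneg] by simp
    then have "AE z in measure_pmf (lazy \<mu>). q (y + z) = 0"
      by (subst (asm) integral_nonneg_eq_0_iff_AE) (auto intro!: integrable_bounded_pmf[of _ 1] q_bounded simp: q_nonneg)
    then show ?thesis by (simp add: AE_measure_pmf_iff)
  qed
  have all: "q y = 0 \<Longrightarrow> \<forall>z\<in>set_pmf (conv_pow (lazy \<mu>) n). q (y + z) = 0" for n y
  proof (induction n arbitrary: y)
    case (Suc n)
    show ?case
    proof
      fix w assume "w \<in> set_pmf (conv_pow (lazy \<mu>) (Suc n))"
      then obtain z z' where w: "z \<in> set_pmf (lazy \<mu>)" "z' \<in> set_pmf (conv_pow (lazy \<mu>) n)" "w = z + z'" by auto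
      then show "q (y + w) = 0" using Suc.IH[of "y + z"] step[OF Suc.prems] by (auto simp: add.assoc)
    qed
  qed simp
  obtain k where k: "k \<in> K" using K by auto
  have "\<exists>n. h n (k - x) > 0"
  proof (rule ccontr)
    assume "\<not> (\<exists>n. h n (k - x) > 0)"
    then have "h n (k - x) = 0" for n using pmf_nonneg[of "conv_pow (lazy \<mu>) n" "k - x"] by (auto simp: not_less intro: antisym)
    then have "G (k - x) = 0" by (simp add: G_def del: conv_pow.simps)
    then show False using G_pos[of "k - x"] by simp
  qed
  then obtain n where "h n (k - x) > 0" by blast
  then have "k - x \<in> set_pmf (conv_pow (lazy \<mu>) n)" by (simp add: set_pmf_iff)
  then have "q (x + (k - x)) = 0" using all[OF q0] by blast
  then show False using q_on_K[OF k] by simp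
qed

lemma large_pos: "large (2 ^ j) x > 0"
proof (induction j arbitrary: x)
  case 0 then show ?case using q_pos[of x] large_1[of x] by simp
next
  case (Suc j)
  have "P (large (2 ^ j)) x > 0"
  proof (rule ccontr)
    assume "\<not> P (large (2 ^ j)) x > 0"
    then have "P (large (2 ^ j)) x = 0" using P_nonneg[where f="large (2 ^ j)" and x=x, OF large_bounds(1)] by linarith
    then have "AE z in measure_pmf \<mu>. large (2 ^ j) (x + z) = 0"
      by (subst (asm) integral_nonneg_eq_0_iff_AE) (auto intro!: integrable_bounded_pmf[of _ 1] large_bounds)
    moreover obtain z where "z \<in> set_pmf \<mu>" using set_pmf_not_empty[of \<mu>] by blast
    ultimately show False using Suc[of "x + z"] by (auto simp: AE_measure_pmf_iff)
  qed
  then have "0 < measure_pmf.prob p {n. 2 \<le> n} * (P (large (2 ^ j)) x)\<^sup>2" using prob_two_children by simp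
  also have "\<dots> \<le> large (2 * 2 ^ j) x" by (rule two_children)
  finally show ?case by simp
qed

text \<open>On the finite set \<open>K\<close> the positive probabilities \<open>large (2 ^ j)\<close> have a positive minimum.\<close>

lemma large_ge_q: "\<exists>e>0. \<forall>x. e * q x \<le> large (2 ^ j) x"
proof -
  define e where "e = Min (large (2 ^ j) ` K)"
  have fin: "finite (large (2 ^ j) ` K)" "large (2 ^ j) ` K \<noteq> {}" using K by auto
  have e0: "e > 0" unfolding e_def using fin large_pos by (simp add: Min_gr_iff)
  have le: "e \<le> large (2 ^ j) k" if "k \<in> K" for k unfolding e_def using fin that by (intro Min_le) auto
  have e1: "e \<le> 1" using le large_bounds(2) K by (meson ex_in_conv order_trans)
  show ?thesis using large_ge_multiple_of_q[OF less_imp_le[OF e0] e1 le] e0 by blast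
qed

end

section \<open>The limit law\<close>

context critical_brw begin

text \<open>Changing the value at zero to zero makes the preceding results applicable, and it does not
  change conditional means given a visit.\<close>

definition on_hit :: "(real \<times> real \<Rightarrow> real) \<Rightarrow> real \<times> real \<Rightarrow> real" where "on_hit F a = F a * Fhit a"

lemma on_hit:
  assumes "F \<in> borel_measurable borel" "\<And>a. \<bar>F a\<bar> \<le> B"
  shows "on_hit F \<in> borel_measurable borel" "on_hit F 0 = 0" "\<bar>on_hit F a\<bar> \<le> B"
proof -
  show "on_hit F \<in> borel_measurable borel" unfolding on_hit_def[abs_def] using assms(1) Fhit(1) by (rule borel_measurable_times)
  show "on_hit F 0 = 0" by (simp add: on_hit_def Fhit)
  show "\<bar>on_hit F a\<bar> \<le> B" using assms(2)[of a] order_trans[OF abs_ge_zero assms(2)] by (auto simp: on_hit_def Fhit_def)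
qed

definition cond_limit :: "(real \<times> real \<Rightarrow> real) \<Rightarrow> real" where "cond_limit F = charge (v (on_hit F)) / charge q"

lemma cond_limit_tendsto:
  assumes "F \<in> borel_measurable borel" "\<And>a. \<bar>F a\<bar> \<le> B"
  shows "((\<lambda>x. v (on_hit F) x / q x) \<longlongrightarrow> cond_limit F) at_inf"
proof -
  have "((\<lambda>x. (v (on_hit F) x / G (- x)) / (q x / G (- x))) \<longlongrightarrow> cond_limit F) at_inf"
    unfolding cond_limit_def using charge_q_pos by (intro tendsto_divide v_limit[OF on_hit[OF assms]] q_limit) auto
  moreover have "(v (on_hit F) x / G (- x)) / (q x / G (- x)) = v (on_hit F) x / q x" for x
    using G_pos[of "- x"] by simp
  ultimately show ?thesis by (simp only:)
qed

lemma conditioned_integral: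
  assumes "F \<in> borel_measurable borel"
  shows "(\<integral>\<omega>. F (\<Lambda> x \<omega>) \<partial>brw_conditioned p \<mu> x K) = v (on_hit F) x / q x"
proof -
  let ?S = "{\<omega>. Z x \<omega> \<noteq> 0}"
  have mF: "(\<lambda>\<omega>. F (\<Lambda> x \<omega>)) \<in> borel_measurable M" by (rule measurable_compose[OF \<Lambda>_measurable assms])
  have mcF: "(\<lambda>\<omega>. on_hit F (\<Lambda> x \<omega>)) \<in> borel_measurable M"
  proof -
    have "on_hit F \<in> borel_measurable borel" unfolding on_hit_def[abs_def] using assms Fhit(1) by (rule borel_measurable_times)
    then show ?thesis by (rule measurable_compose[OF \<Lambda>_measurable])
  qed
  have S: "{\<omega> \<in> space M. Z x \<omega> \<ge> 1} = ?S" using occupation_time_ge_1[of x K] by auto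
  have d: "indicator ?S \<omega> / emeasure M ?S = ennreal (indicator ?S \<omega> / q x)" for \<omega>
    unfolding emeasure_eq_measure using q_pos[of x]
    by (simp add: q_def[symmetric] indicator_def divide_ennreal flip: ennreal_1)
  have "brw_conditioned p \<mu> x K = density M (\<lambda>\<omega>. ennreal (indicator ?S \<omega> / q x))"
    unfolding brw_conditioned_def S uniform_measure_def d ..
  then have "(\<integral>\<omega>. F (\<Lambda> x \<omega>) \<partial>brw_conditioned p \<mu> x K) = (\<integral>\<omega>. (indicator ?S \<omega> / q x) *\<^sub>R F (\<Lambda> x \<omega>) \<partial>M)"
    using mF hit_sets[of x] q_nonneg[of x] by (simp only:) (intro integral_density, auto)
  also have "\<dots> = (\<integral>\<omega>. on_hit F (\<Lambda> x \<omega>) / q x \<partial>M)"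
  proof (rule integral_cong_AE)
    show "(\<lambda>\<omega>. (indicator ?S \<omega> / q x) *\<^sub>R F (\<Lambda> x \<omega>)) \<in> borel_measurable M"
      using mF hit_sets[of x] by (intro borel_measurable_scaleR borel_measurable_divide borel_measurable_indicator) auto
    show "(\<lambda>\<omega>. on_hit F (\<Lambda> x \<omega>) / q x) \<in> borel_measurable M" using mcF by simp
    show "AE \<omega> in M. (indicator ?S \<omega> / q x) *\<^sub>R F (\<Lambda> x \<omega>) = on_hit F (\<Lambda> x \<omega>) / q x"
      using AE_\<Lambda>_eq_0[of x] by eventually_elim (auto simp: on_hit_def Fhit_def indicator_def)
  qed
  also have "\<dots> = v (on_hit F) x / q x" by (simp add: v_def)
  finally show ?thesis .
qed

lemma integrable_on_hit:
  assumes "F \<in> borel_measurable borel" "\<And>a. \<bar>F a\<bar> \<le> B"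
  shows "integrable M (\<lambda>\<omega>. on_hit F (\<Lambda> x \<omega>))"
  by (rule integrable_const_bound[of _ B])
     (use on_hit[OF assms] measurable_compose[OF \<Lambda>_measurable on_hit(1)[OF assms]] in auto)

lemma cond_limit_add_sum:
  assumes F: "F \<in> borel_measurable borel" "\<And>a. \<bar>F a\<bar> \<le> B"
    and R: "R \<in> borel_measurable borel" "\<And>a. \<bar>R a\<bar> \<le> B"
    and H: "\<And>i. i \<in> I \<Longrightarrow> H i \<in> borel_measurable borel" "\<And>i a. i \<in> I \<Longrightarrow> \<bar>H i a\<bar> \<le> 1" and I: "finite I"
    and e: "\<And>a. F a = R a + (\<Sum>i\<in>I. c i * H i a)"
  shows "cond_limit F = cond_limit R + (\<Sum>i\<in>I. c i * cond_limit (H i))"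
proof (rule tendsto_unique[OF at_inf_neq_bot cond_limit_tendsto[OF F]])
  have "v (on_hit F) x = v (on_hit R) x + (\<Sum>i\<in>I. c i * v (on_hit (H i)) x)" for x
  proof -
    have "on_hit F a = on_hit R a + (\<Sum>i\<in>I. c i * on_hit (H i) a)" for a
      unfolding on_hit_def e by (simp add: distrib_right sum_distrib_right mult.assoc)
    then have "v (on_hit F) x = expectation (\<lambda>\<omega>. on_hit R (\<Lambda> x \<omega>) + (\<Sum>i\<in>I. c i * on_hit (H i) (\<Lambda> x \<omega>)))"
      unfolding v_def by (simp only:)
    also have "\<dots> = v (on_hit R) x + (\<Sum>i\<in>I. c i * v (on_hit (H i)) x)"
      unfolding v_def
      by (subst Bochner_Integration.integral_add, rule integrable_on_hit[OF R],
          rule Bochner_Integration.integrable_sum, rule integrable_mult_right, rule integrable_on_hit[OF H], assumption, assumption,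
          subst Bochner_Integration.integral_sum, rule integrable_mult_right, rule integrable_on_hit[OF H], assumption, assumption, simp)
    finally show ?thesis .
  qed
  then have "v (on_hit F) x / q x = v (on_hit R) x / q x + (\<Sum>i\<in>I. c i * (v (on_hit (H i)) x / q x))" for x
    by (simp add: add_divide_distrib sum_divide_distrib)
  moreover have "((\<lambda>x. v (on_hit R) x / q x + (\<Sum>i\<in>I. c i * (v (on_hit (H i)) x / q x))) \<longlongrightarrow> cond_limit R + (\<Sum>i\<in>I. c i * cond_limit (H i))) at_inf"
    by (intro tendsto_intros cond_limit_tendsto[OF R] cond_limit_tendsto[OF H]) auto
  ultimately show "((\<lambda>x. v (on_hit F) x / q x) \<longlongrightarrow> cond_limit R + (\<Sum>i\<in>I. c i * cond_limit (H i))) at_inf" by simp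
qed

lemma cond_limit_nonneg:
  assumes "F \<in> borel_measurable borel" "\<And>a. \<bar>F a\<bar> \<le> B" "\<And>a. F a \<ge> 0"
  shows "cond_limit F \<ge> 0"
proof (rule tendsto_lowerbound[OF cond_limit_tendsto[OF assms(1,2)] _ at_inf_neq_bot])
  have "v (on_hit F) x \<ge> 0" for x unfolding v_def on_hit_def Fhit_def using assms(3) by (intro integral_nonneg_AE) auto
  then show "\<forall>\<^sub>F x in at_inf. 0 \<le> v (on_hit F) x / q x" using q_nonneg by (intro always_eventually) auto
qed

lemma cond_limit_1: "cond_limit (\<lambda>_. 1) = 1"
proof -
  have "on_hit (\<lambda>_. 1) = Fhit" by (auto simp: on_hit_def)
  then show ?thesis using charge_q_pos by (simp add: cond_limit_def v_Fhit[abs_def])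
qed

definition \<kappa> :: real where "\<kappa> = real (card K) / (2 * charge q)"

lemma g_over_q_limit: "((\<lambda>x. g x / q x) \<longlongrightarrow> \<kappa>) at_inf"
proof -
  have "((\<lambda>x. ((\<Sum>k\<in>K. G (k - x) / G (- x)) / 2) / (q x / G (- x))) \<longlongrightarrow> ((\<Sum>k\<in>K. 1) / 2) / charge q) at_inf"
    using charge_q_pos by (intro tendsto_divide tendsto_sum G_ratio' q_limit tendsto_const) auto
  moreover have "((\<Sum>k\<in>K. G (k - x) / G (- x)) / 2) / (q x / G (- x)) = g x / q x" for x
    using G_pos[of "- x"] by (simp add: g_def green_sum_def sum_divide_distrib[symmetric])
  ultimately show ?thesis by (simp add: \<kappa>_def)
qed

text \<open>Markov's inequality: given a visit the mean occupation time is at most \<open>g x / q x\<close>, which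
  tends to \<open>\<kappa>\<close>.\<close>

lemma cond_limit_tight:
  assumes F: "F \<in> borel_measurable borel" "\<And>a. \<bar>F a\<bar> \<le> B" and m: "m \<ge> 1"
    and small: "\<And>x \<omega>. Z x \<omega> \<le> of_nat m \<Longrightarrow> F (\<Lambda> x \<omega>) = 0"
  shows "\<bar>cond_limit F\<bar> \<le> B * \<kappa> / real m"
proof -
  have B0: "B \<ge> 0" using order_trans[OF abs_ge_zero F(2)] .
  have "\<bar>v (on_hit F) x\<bar> \<le> B * g x / real m" for x
  proof -
    have "ennreal \<bar>v (on_hit F) x\<bar> \<le> (\<integral>\<^sup>+\<omega>. ennreal \<bar>on_hit F (\<Lambda> x \<omega>)\<bar> \<partial>M)"
      unfolding v_def using integral_norm_bound_ennreal[OF integrable_on_hit[OF F]] by simp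
    also have "\<dots> \<le> (\<integral>\<^sup>+\<omega>. ennreal (B / real m) * Z x \<omega> \<partial>M)"
    proof (rule nn_integral_mono)
      fix \<omega>
      show "ennreal \<bar>on_hit F (\<Lambda> x \<omega>)\<bar> \<le> ennreal (B / real m) * Z x \<omega>"
      proof (cases "Z x \<omega> \<le> of_nat m")
        case True
        then show ?thesis using small by (simp add: on_hit_def)
      next
        case False
        have "ennreal \<bar>on_hit F (\<Lambda> x \<omega>)\<bar> \<le> ennreal B" by (intro ennreal_leI on_hit(3)[OF F])
        also have "\<dots> = ennreal (B / real m) * ennreal (real m)" using m B0 by (simp flip: ennreal_mult)
        also have "\<dots> \<le> ennreal (B / real m) * Z x \<omega>"
          using False by (intro mult_left_mono) (auto simp: ennreal_of_nat_eq_real_of_nat)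
        finally show ?thesis .
      qed
    qed
    also have "\<dots> = ennreal (B / real m) * (\<integral>\<^sup>+\<omega>. Z x \<omega> \<partial>M)" by (rule nn_integral_cmult) simp
    also have "\<dots> \<le> ennreal (B / real m) * ennreal (g x)" by (intro mult_left_mono mean_occupation_le) simp
    also have "\<dots> = ennreal (B * g x / real m)" using B0 g_nonneg by (simp flip: ennreal_mult)
    finally show ?thesis using B0 g_nonneg by (subst (asm) ennreal_le_iff) auto
  qed
  then have le: "\<bar>v (on_hit F) x / q x\<bar> \<le> (B / real m) * (g x / q x)" for x
    using q_pos[of x] divide_right_mono[of "\<bar>v (on_hit F) x\<bar>" "B * g x / real m" "q x"] by (simp add: abs_divide)
  have "((\<lambda>x. (B / real m) * (g x / q x)) \<longlongrightarrow> (B / real m) * \<kappa>) at_inf"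
    by (intro tendsto_mult tendsto_const g_over_q_limit)
  from tendsto_le[OF at_inf_neq_bot this tendsto_rabs[OF cond_limit_tendsto[OF F]]]
  show ?thesis using le by simp
qed

definition as_reals :: "nat \<times> nat \<Rightarrow> real \<times> real" where "as_reals a = (real (fst a), real (snd a))"

lemma as_reals_inj: "as_reals a = as_reals b \<longleftrightarrow> a = b"
  by (cases a, cases b) (auto simp: as_reals_def)

definition grid :: "nat \<Rightarrow> (nat \<times> nat) set" where "grid m = {..m} \<times> {..m}"

lemma \<Lambda>_in_grid:
  assumes "Z x \<omega> \<le> of_nat m" shows "\<Lambda> x \<omega> \<in> as_reals ` grid m"
proof -
  have Lm: "L x \<omega> \<le> of_nat m" using assms num_pioneers_le_occupation[of x K \<omega>] by (rule order_trans[rotated])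
  obtain b where b: "Z x \<omega> = of_nat b"
    using assms by (cases rule: occupation_time_cases[of x K \<omega>]) (auto simp: top_unique)
  obtain a where a: "L x \<omega> = of_nat a"
    using Lm by (cases rule: num_pioneers_cases[of x K \<omega>]) (auto simp: top_unique)
  have "b \<le> m" "a \<le> m" using assms Lm a b by auto
  then have "(a, b) \<in> grid m" "\<Lambda> x \<omega> = as_reals (a, b)" using a b
    by (auto simp: grid_def as_reals_def ennreal_of_nat_eq_real_of_nat)
  then show ?thesis by blast
qed

definition limit_mass :: "nat \<times> nat \<Rightarrow> real" where "limit_mass a = cond_limit (indicator {as_reals a})"

lemma indicator_facts: "(indicator {b :: real \<times> real} :: _ \<Rightarrow> real) \<in> borel_measurable borel" "\<bar>indicator {b} a :: real\<bar> \<le> 1"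
  by (auto simp: indicator_def)

lemma limit_mass_nonneg: "limit_mass a \<ge> 0"
  unfolding limit_mass_def by (rule cond_limit_nonneg[OF indicator_facts]) simp

lemma finite_grid: "finite (grid m)" by (simp add: grid_def)

text \<open>As a limit of means the functional is additive. Tightness controls the part of \<open>F\<close>
  outside the finite grid, so that the values on single points determine it.\<close>

lemma cond_limit_grid:
  assumes F: "F \<in> borel_measurable borel" "\<And>a. \<bar>F a\<bar> \<le> B" and m: "m \<ge> 1"
  shows "\<bar>cond_limit F - (\<Sum>a\<in>grid m. F (as_reals a) * limit_mass a)\<bar> \<le> B * \<kappa> / real m"
proof -
  define R where "R = (\<lambda>b. indicator (- as_reals ` grid m) b * F b)"
  have fin: "finite (as_reals ` grid m)" using finite_grid by simp
  then have "- as_reals ` grid m \<in> sets borel" by (auto intro!: borel_open finite_imp_closed)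
  then have Rm: "R \<in> borel_measurable borel" unfolding R_def by (intro borel_measurable_times F borel_measurable_indicator)
  have Rb: "\<bar>R b\<bar> \<le> B" for b using F(2)[of b] order_trans[OF abs_ge_zero F(2)] by (auto simp: R_def indicator_def)
  have dec: "F b = R b + (\<Sum>a\<in>grid m. F (as_reals a) * indicator {as_reals a} b)" for b
  proof (cases "b \<in> as_reals ` grid m")
    case True
    then obtain a where a: "a \<in> grid m" "b = as_reals a" by blast
    have "(\<Sum>a'\<in>grid m. F (as_reals a') * indicator {as_reals a'} b) = (\<Sum>a'\<in>grid m. if a' = a then F b else 0)"
      using a by (intro sum.cong) (auto simp: indicator_def as_reals_inj)
    then show ?thesis using a True finite_grid by (simp add: R_def)
  next
    case False
    then have "(\<Sum>a\<in>grid m. F (as_reals a) * indicator {as_reals a} b) = 0" by (intro sum.neutral) (auto simp: indicator_def)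
    then show ?thesis using False by (simp add: R_def)
  qed
  have "cond_limit F = cond_limit R + (\<Sum>a\<in>grid m. F (as_reals a) * limit_mass a)"
    unfolding limit_mass_def by (rule cond_limit_add_sum[OF F Rm Rb indicator_facts finite_grid dec])
  moreover have "\<bar>cond_limit R\<bar> \<le> B * \<kappa> / real m"
    by (rule cond_limit_tight[OF Rm Rb m]) (use \<Lambda>_in_grid in \<open>auto simp: R_def indicator_def\<close>)
  ultimately show ?thesis by simp
qed

lemma limit_mass_sum_bounds:
  assumes "m \<ge> 1" shows "1 - \<kappa> / real m \<le> (\<Sum>a\<in>grid m. limit_mass a)"
  using cond_limit_grid[of "\<lambda>_. 1" 1 m] assms by (simp add: cond_limit_1)

lemma limit_mass_sum_le_1: "(\<Sum>a\<in>grid m. limit_mass a) \<le> 1"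
proof -
  define R where "R = (indicator (- as_reals ` grid m) :: real \<times> real \<Rightarrow> real)"
  have fin: "finite (as_reals ` grid m)" using finite_grid by simp
  then have "- as_reals ` grid m \<in> sets borel" by (auto intro!: borel_open finite_imp_closed)
  then have R: "R \<in> borel_measurable borel" "\<And>b. \<bar>R b\<bar> \<le> 1" "\<And>b. R b \<ge> 0" by (auto simp: R_def indicator_def)
  have dec: "(\<lambda>_. 1) b = R b + (\<Sum>a\<in>grid m. 1 * indicator {as_reals a} b)" for b :: "real \<times> real"
  proof (cases "b \<in> as_reals ` grid m")
    case True
    then obtain a where a: "a \<in> grid m" "b = as_reals a" by blast
    have "(\<Sum>a'\<in>grid m. 1 * indicator {as_reals a'} b) = (\<Sum>a'\<in>grid m. if a' = a then 1 else 0 :: real)"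
      using a by (intro sum.cong) (auto simp: indicator_def as_reals_inj)
    then show ?thesis using a True finite_grid by (simp add: R_def)
  next
    case False
    then have "(\<Sum>a\<in>grid m. 1 * indicator {as_reals a} b) = (0::real)" by (intro sum.neutral) (auto simp: indicator_def)
    then show ?thesis using False by (simp add: R_def)
  qed
  have "cond_limit (\<lambda>_. 1) = cond_limit R + (\<Sum>a\<in>grid m. 1 * cond_limit (indicator {as_reals a}))"
    by (rule cond_limit_add_sum[where B=1, OF _ _ R(1,2) indicator_facts finite_grid dec]) auto
  then show ?thesis using cond_limit_nonneg[OF R] by (simp add: cond_limit_1 limit_mass_def)
qed

text \<open>The masses of the grids exceed \<open>1 - \<kappa> / m\<close>.\<close>

lemma limit_mass_total: "(\<integral>\<^sup>+a. ennreal (limit_mass a) \<partial>count_space UNIV) = 1"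
proof -
  have grid_mono: "grid m \<subseteq> grid m'" if "m \<le> m'" for m m' using that by (auto simp: grid_def)
  have "(\<integral>\<^sup>+a. ennreal (limit_mass a) \<partial>count_space UNIV) = (\<integral>\<^sup>+a. (SUP m. ennreal (limit_mass a) * indicator (grid m) a) \<partial>count_space UNIV)"
  proof (rule nn_integral_cong)
    fix a :: "nat \<times> nat"
    show "ennreal (limit_mass a) = (SUP m. ennreal (limit_mass a) * indicator (grid m) a)"
    proof (rule antisym)
      have "a \<in> grid (max (fst a) (snd a))" by (cases a) (auto simp: grid_def)
      then show "ennreal (limit_mass a) \<le> (SUP m. ennreal (limit_mass a) * indicator (grid m) a)"
        by (intro SUP_upper2[of "max (fst a) (snd a)"]) auto
      show "(SUP m. ennreal (limit_mass a) * indicator (grid m) a) \<le> ennreal (limit_mass a)"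
        by (rule SUP_least) (auto simp: indicator_def)
    qed
  qed
  also have "\<dots> = (SUP m. \<integral>\<^sup>+a. ennreal (limit_mass a) * indicator (grid m) a \<partial>count_space UNIV)"
    by (intro nn_integral_monotone_convergence_SUP)
       (use grid_mono in \<open>auto simp: incseq_def le_fun_def indicator_def\<close>)
  also have "\<dots> = (SUP m. ennreal (\<Sum>a\<in>grid m. limit_mass a))"
  proof (rule SUP_cong[OF refl])
    fix m
    have "(\<integral>\<^sup>+a. ennreal (limit_mass a) * indicator (grid m) a \<partial>count_space UNIV) = (\<integral>\<^sup>+a. ennreal (limit_mass a) \<partial>count_space (grid m))"
      by (subst nn_integral_count_space_indicator) auto
    also have "\<dots> = ennreal (\<Sum>a\<in>grid m. limit_mass a)"
      using finite_grid by (simp add: nn_integral_count_space_finite sum_ennreal limit_mass_nonneg)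
    finally show "(\<integral>\<^sup>+a. ennreal (limit_mass a) * indicator (grid m) a \<partial>count_space UNIV) = ennreal (\<Sum>a\<in>grid m. limit_mass a)" .
  qed
  also have "\<dots> = 1"
  proof (rule antisym)
    show "(SUP m. ennreal (\<Sum>a\<in>grid m. limit_mass a)) \<le> 1"
      by (rule SUP_least) (use limit_mass_sum_le_1 in simp)
    have "(\<lambda>m. 1 - \<kappa> / real m) \<longlonglongrightarrow> 1 - 0"
      by (intro tendsto_diff tendsto_const tendsto_divide_0[OF tendsto_const] filterlim_at_top_imp_at_infinity filterlim_real_sequentially)
    then have "(\<lambda>m. ennreal (1 - \<kappa> / real m)) \<longlonglongrightarrow> ennreal 1" by (intro tendsto_ennrealI) simp
    moreover have "ennreal (1 - \<kappa> / real m) \<le> (SUP m. ennreal (\<Sum>a\<in>grid m. limit_mass a))" if "m \<ge> 1" for m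
      using limit_mass_sum_bounds[OF that] by (intro SUP_upper2[of m] ennreal_leI) auto
    ultimately have "ennreal 1 \<le> (SUP m. ennreal (\<Sum>a\<in>grid m. limit_mass a))"
      by (intro LIMSEQ_le_const2) auto
    then show "1 \<le> (SUP m. ennreal (\<Sum>a\<in>grid m. limit_mass a))" by simp
  qed
  finally show ?thesis .
qed

definition limit_pmf :: "(nat \<times> nat) pmf" where "limit_pmf = embed_pmf limit_mass"

lemma pmf_limit_pmf: "pmf limit_pmf a = limit_mass a"
  unfolding limit_pmf_def by (rule pmf_embed_pmf[OF limit_mass_nonneg limit_mass_total])

lemma cond_limit_eq_integral:
  assumes F: "F \<in> borel_measurable borel" "\<And>a. \<bar>F a\<bar> \<le> B"
  shows "cond_limit F = measure_pmf.expectation limit_pmf (\<lambda>a. F (as_reals a))"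
proof -
  let ?I = "measure_pmf.expectation limit_pmf (\<lambda>a. F (as_reals a))"
  have B0: "B \<ge> 0" using order_trans[OF abs_ge_zero F(2)] .
  have le: "\<bar>cond_limit F - ?I\<bar> \<le> 2 * B * \<kappa> / real m" if m: "m \<ge> 1" for m
  proof -
    let ?s = "\<Sum>a\<in>grid m. F (as_reals a) * limit_mass a"
    have i: "integrable (measure_pmf limit_pmf) (\<lambda>a. indicator S a * F (as_reals a))" for S
      by (rule measure_pmf.integrable_const_bound[of _ B]) (use F(2) B0 in \<open>auto simp: indicator_def\<close>)
    have "?I = measure_pmf.expectation limit_pmf (\<lambda>a. indicator (grid m) a * F (as_reals a) + indicator (- grid m) a * F (as_reals a))"
      by (intro Bochner_Integration.integral_cong) (auto simp: indicator_def)
    also have "\<dots> = measure_pmf.expectation limit_pmf (\<lambda>a. indicator (grid m) a * F (as_reals a)) + measure_pmf.expectation limit_pmf (\<lambda>a. indicator (- grid m) a * F (as_reals a))"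
      by (rule Bochner_Integration.integral_add[OF i i])
    also have "measure_pmf.expectation limit_pmf (\<lambda>a. indicator (grid m) a * F (as_reals a)) = ?s"
      by (subst integral_measure_pmf[of "grid m"]) (auto simp: finite_grid indicator_def pmf_limit_pmf mult.commute)
    finally have "\<bar>?I - ?s\<bar> = norm (measure_pmf.expectation limit_pmf (\<lambda>a. indicator (- grid m) a * F (as_reals a)))" by simp
    also have "\<dots> \<le> measure_pmf.expectation limit_pmf (\<lambda>a. B * indicator (- grid m) a)"
    proof (rule norm_integral_le_AE)
      show "integrable (measure_pmf limit_pmf) (\<lambda>a. B * indicator (- grid m) a)"
        by (intro integrable_mult_right measure_pmf.integrable_const_bound[of _ 1]) auto
    qed (use F(2) B0 in \<open>auto simp: indicator_def\<close>)
    also have "\<dots> = B * measure_pmf.prob limit_pmf (- grid m)" by simp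
    also have "measure_pmf.prob limit_pmf (- grid m) = 1 - (\<Sum>a\<in>grid m. limit_mass a)"
      using measure_pmf.prob_compl[of "grid m" limit_pmf] finite_grid
      by (simp add: measure_measure_pmf_finite pmf_limit_pmf Compl_eq_Diff_UNIV)
    also have "B * (1 - (\<Sum>a\<in>grid m. limit_mass a)) \<le> B * (\<kappa> / real m)"
      using limit_mass_sum_bounds[OF m] B0 by (intro mult_left_mono) auto
    finally show ?thesis using cond_limit_grid[OF F m] by (simp add: abs_le_iff)
  qed
  have "(\<lambda>m. 2 * B * \<kappa> / real m) \<longlonglongrightarrow> 0"
    by (intro tendsto_divide_0[OF tendsto_const] filterlim_at_top_imp_at_infinity filterlim_real_sequentially)
  then have "\<bar>cond_limit F - ?I\<bar> \<le> 0" by (rule LIMSEQ_le_const) (use le in auto)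
  then show ?thesis by simp
qed

text \<open>If the limit were a constant \<open>c\<close>, it would give no mass to occupation times of at least
  \<open>2 ^ j > snd c\<close>, in contradiction to \<open>large_ge_q\<close>.\<close>

lemma limit_nondegenerate:
  "nondegenerate (measure_pmf (map_pmf as_reals limit_pmf)) (\<lambda>\<omega>. (fst \<omega>, snd \<omega>))"
  unfolding nondegenerate_def
proof
  assume "\<exists>c. AE \<omega> in measure_pmf (map_pmf as_reals limit_pmf). (fst \<omega>, snd \<omega>) = c"
  then obtain c where c: "\<And>a. a \<in> set_pmf limit_pmf \<Longrightarrow> as_reals a = c" by (auto simp: AE_measure_pmf_iff)
  obtain j where j: "snd c < 2 ^ j" using real_arch_pow[of 2 "snd c"] by auto
  let ?F = "\<lambda>a :: real \<times> real. of_bool (2 ^ j \<le> snd a) :: real"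
  have "(\<lambda>a :: real \<times> real. of_bool (2 ^ j \<le> snd a) :: real) \<in> borel_measurable (borel \<Otimes>\<^sub>M borel)" by measurable
  then have F: "?F \<in> borel_measurable borel" "\<And>a. \<bar>?F a\<bar> \<le> 1" unfolding borel_prod by auto
  have "measure_pmf.expectation limit_pmf (\<lambda>a. ?F (as_reals a)) = measure_pmf.expectation limit_pmf (\<lambda>a. 0)"
    using c j by (intro integral_cong_AE) (auto simp: AE_measure_pmf_iff)
  then have 0: "cond_limit ?F = 0" using cond_limit_eq_integral[OF F] by simp
  obtain e where e: "e > 0" "\<And>x. e * q x \<le> large (2 ^ j) x" using large_ge_q by blast
  have "v (on_hit ?F) x = large (2 ^ j) x" for x
  proof -
    have "v (on_hit ?F) x = expectation (indicator {\<omega>. Z x \<omega> \<ge> of_nat (2 ^ j)})"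
      unfolding v_def
    proof (rule integral_cong_AE)
      show "(\<lambda>\<omega>. on_hit ?F (\<Lambda> x \<omega>)) \<in> borel_measurable M" by (rule measurable_compose[OF \<Lambda>_measurable on_hit(1)[OF F]])
      show "AE \<omega> in M. on_hit ?F (\<Lambda> x \<omega>) = indicator {\<omega>. Z x \<omega> \<ge> of_nat (2 ^ j)} \<omega>"
        using AE_Z_finite[of x]
      proof eventually_elim
        case (elim \<omega>)
        then obtain b where b: "Z x \<omega> = of_nat b" by (cases rule: occupation_time_cases[of x K \<omega>]) auto
        have "\<Lambda> x \<omega> \<noteq> 0" if "2 ^ j \<le> b"
        proof -
          have "0 < b" by (rule less_le_trans[OF _ that]) simp
          then show ?thesis using b by (auto simp: zero_prod_def ennreal_of_nat_eq_real_of_nat)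
        qed
        moreover have "(2 ^ j \<le> real b) = (2 ^ j \<le> b)" by (metis of_nat_le_iff of_nat_numeral of_nat_power)
        moreover have "(of_nat (2 ^ j) \<le> (of_nat b :: ennreal)) = (2 ^ j \<le> b)" by (rule of_nat_le_iff)
        ultimately show ?case unfolding on_hit_def Fhit_def indicator_def mem_Collect_eq b
          by (auto simp: ennreal_of_nat_eq_real_of_nat simp del: of_nat_power of_nat_numeral)
      qed
    qed (intro borel_measurable_indicator large_sets)
    then show ?thesis by (simp add: large_def)
  qed
  then have "e \<le> v (on_hit ?F) x / q x" for x using e(2)[of x] q_pos[of x] by (simp add: field_simps)
  then have "e \<le> cond_limit ?F"
    by (intro tendsto_lowerbound[OF cond_limit_tendsto[OF F] _ at_inf_neq_bot] always_eventually) auto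
  then show False using 0 e(1) by simp
qed

theorem conditioned_law_converges:
  "converges_in_law (\<lambda>x. brw_conditioned p \<mu> x K) \<Lambda> at_inf
     (measure_pmf (map_pmf as_reals limit_pmf)) (\<lambda>\<omega>. (fst \<omega>, snd \<omega>))"
  unfolding converges_in_law_def
proof (intro allI impI)
  fix f :: "real \<times> real \<Rightarrow> real" assume f: "continuous_on UNIV f \<and> bounded (range f)"
  then obtain B where B: "\<And>a. \<bar>f a\<bar> \<le> B" by (auto simp: bounded_iff)
  have m: "f \<in> borel_measurable borel" using f by (intro borel_measurable_continuous_onI) auto
  have "((\<lambda>x. v (on_hit f) x / q x) \<longlongrightarrow> cond_limit f) at_inf" by (rule cond_limit_tendsto[OF m B])
  then show "((\<lambda>x. \<integral>\<omega>. f (\<Lambda> x \<omega>) \<partial>brw_conditioned p \<mu> x K) \<longlongrightarrow> (\<integral>\<omega>. f (fst \<omega>, snd \<omega>) \<partial>measure_pmf (map_pmf as_reals limit_pmf))) at_inf"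
    using cond_limit_eq_integral[OF m B] by (simp add: conditioned_integral[OF m])
qed

end

theorem theorem1p3:
  fixes p :: "nat pmf" and \<mu> :: "(int ^ 'd::finite) pmf"
    and \<sigma> C :: real and K :: "(int ^ 'd) set"
  assumes dim: "CARD('d) \<ge> 5"
    and p1: "pmf p 1 < 1"
    and critical: "(\<lambda>k. real k * pmf p k) sums 1"
    and variance: "(\<lambda>k. (real k - 1)\<^sup>2 * pmf p k) sums \<sigma>\<^sup>2" "\<sigma>\<^sup>2 > 0"
    and mean: "integrable (measure_pmf \<mu>) vec_of_int" "mean_vec \<mu> = 0"
    and cov: "positive_definite (covariance_matrix \<mu>)"
    and aperiodic: "\<And>H. add_subgroup H \<Longrightarrow> set_pmf \<mu> \<subseteq> H \<Longrightarrow> H = UNIV"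
    and C: "C > 0"
    and tail: "\<And>r::real. r \<ge> 1 \<Longrightarrow>
      measure_pmf.prob \<mu> {x. norm (vec_of_int x) > r} < C / r ^ CARD('d)"
    and K: "K \<noteq> {}" "finite K"
  shows "\<exists>(\<Omega> :: (real \<times> real) measure) (Y :: real \<times> real \<Rightarrow> real) (Z :: real \<times> real \<Rightarrow> real).
    prob_space \<Omega> \<and> Y \<in> borel_measurable \<Omega> \<and> Z \<in> borel_measurable \<Omega> \<and>
    nondegenerate \<Omega> (\<lambda>\<omega>. (Y \<omega>, Z \<omega>)) \<and>
    converges_in_law
      (\<lambda>x. brw_conditioned p \<mu> x K)
      (\<lambda>x \<omega>. (enn2real (num_pioneers x K \<omega>), enn2real (occupation_time x K \<omega>)))
      (filtercomap (\<lambda>x. norm (vec_of_int x)) at_top)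
      \<Omega> (\<lambda>\<omega>. (Y \<omega>, Z \<omega>))"
proof -
  interpret critical_brw p \<mu> C \<sigma> K
    by unfold_locales (fact dim mean cov C p1 critical variance K | rule aperiodic tail; assumption)+
  show ?thesis
    using limit_nondegenerate conditioned_law_converges[unfolded at_inf_def]
    by (intro exI[of _ "measure_pmf (map_pmf as_reals limit_pmf)"] exI[of _ fst] exI[of _ snd] conjI)
       (auto intro: prob_space_measure_pmf)
qed

end
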